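(* Assume that $M_1,M_2$ are closed manifolds, and let one source warp $\ell_1=L$ be fixed, where $L>0$ is smooth and $P$-periodic on $\mathbb R$. 1. There are local families of unit-speed harmonic reconstructions with $\ell_1=L$, smoothly parametrized by nonempty open subsets of $\mathbb R^2$, with $P$-periodic magnitudes and $P$-periodic reconstructed source metrics, in which the members whose profiles close on finite covers are dense. 2. There is a sequence of closed doubly spiral unit-speed harmonic reconstructions (each with $P$-periodic magnitudes and source warps, with $\ell_1=L$, and with profile closing on a finite cover) whose source warps are uniformly positive (bounded below by a positive constant independent of the member of the sequence), such that one target magnitude tends to zero and the least closing multiplier tends to infinity along the sequence. 3. There exist nondegenerate closed members $(\mu_*,\delta_*,x_* )$ for $L$, with phase return $2\pi\rho$, $\rho\in\mathbb Q^2$, which persist with the same phase return under small positive periodic perturbations of the prescribed warp: given $r\ge2$ and $0<\alpha<1$, for every positive $P$-periodic $\widetilde L$ sufficiently close to $L$ in $C^{r,\alpha}_{\rm per}$ there is a nearby datum $(\mu,\delta,x)$ giving a reconstruction with $\ell_1=\widetilde L$ and the same phase increments $2\pi\rho$.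
   Context: Setting. For $i=1,2$, $(M_i,g_i)$ is a Riemannian manifold of dimension $k_i>0$, and $f_i:(M_i,g_i)\to\mathbb S^{2n_i+1}\subset\mathbb C^{n_i+1}$ (unit round sphere) is an eigenmap: $\Delta f_i=-d_if_i$ with $d_i=|df_i|^2>0$ constant. Reconstruction. Given $c\in\mathbb R$, $\varepsilon>0$, $\sigma\in\{\pm1\}$ and a smooth $a:\mathbb R\to(0,1)$ with $R:=1-a^2-(a')^2>0$ (admissible), set $Q=1+(c^2-1)a^2$, $b=\sqrt{1-a^2}$, $F=\sqrt{\varepsilon Q/(a^2R)}$, $T=\frac1{a^2Q}-\frac{a+a''}{aR}$; let $(\ell_1,\ell_2)$ be the unique positive pair with $\ell_1^{k_1}\ell_2^{k_2}=F$, $d_2/\ell_2^2-d_1/\ell_1^2=T$; and choose phases with $s_1'=\sigma\sqrt\varepsilon/(Fa^2)$, $s_2'=\sigma c\sqrt\varepsilon/(Fb^2)$. The map $G=(ae^{is_1}f_1,be^{is_2}f_2)$ is then harmonic from $(\mathbb R\times M_1\times M_2,\ dt^2+\ell_1^2g_1+\ell_2^2g_2)$ to $\mathbb S^{2n_1+2n_2+3}$, and its profile curve $\gamma=(ae^{is_1},be^{is_2})\subset\mathbb S^3$ has unit speed. The functions $a,b$ are the (target) magnitudes. It is doubly spiral if both phases rotate ($c\ne0$). Closure. If $a$ is $P$-periodic, so are the warps and phase velocities; the phase increments (phase return) are $\Delta_i=\int_0^Ps_i'\,dt$. The profile closes on a finite cover if it is $mP$-periodic for some integer $m\ge1$, equivalently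 $m(\Delta_1,\Delta_2)\in(2\pi\mathbb Z)^2$; the least such $m$ is the least closing multiplier. In that case $G$ descends to a harmonic map from the closed manifold $(\mathbb R/mP\mathbb Z)\times M_1\times M_2$. Nondegenerate closed data. Put $k=k_2$, $\rho_L=d_1/L^2$, $w_L=L^{2k_1/k}$. For $\mu,\delta>0$ and positive $P$-periodic $x$, put $q_\delta=x^2+\delta-\delta^2x^2$, $r_\delta=1-\delta(x^2+x'^2)>0$, and consider the magnitude equation $$x''=\frac{r_\delta}{xq_\delta}-x-r_\delta x\Bigl[\mu w_L\Bigl(\frac{x^2r_\delta}{q_\delta}\Bigr)^{1/k}-\rho_L\Bigr].$$ Its solutions give reconstructions with $\ell_1=L$, $c=\delta^{-1}$, $\varepsilon=\delta^2(d_2/\mu)^k$, $\sigma=1$, $a=\sqrt\delta\,x$; write $(D_1,D_2)$ for their phase increments over $[0,P]$. Let $\mathcal R(L,\mu,\delta,x)$ be the difference of the two sides. A datum $(\mu_*,\delta_*,x_* )$ with $\delta_*>0$ and $\mathcal R=0$ is closed if $(D_1,D_2)=2\pi\rho$ with $\rho\in\mathbb Q^2$, and nondegenerate if the linearization $D_x\mathcal R$ is invertible $C^{2,\alpha}_{\rm per}\to C^{0,\alpha}_{\rm per}$ and, along the local solution branch $x=X(\mu,\delta)$ it defines, the $(\mu,\delta)$-derivative of $(D_1,D_2)$ is invertible there. *)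

theory Defs
  imports "HOL-Analysis.Analysis"
begin

section \<open>Differentiability classes\<close>

text \<open>On an open set of a Euclidean space this is the usual class of n times continuously
  differentiable maps: all iterated directional derivatives of order at most n exist, are
  differentiable if of order less than n, and are continuous.\<close>

primrec Ck_on :: "nat \<Rightarrow> ('a::real_normed_vector \<Rightarrow> 'b::real_normed_vector) \<Rightarrow> 'a set \<Rightarrow> bool" where
  "Ck_on 0 f S \<longleftrightarrow> continuous_on S f"
| "Ck_on (Suc n) f S \<longleftrightarrow>
     f differentiable_on S \<and> (\<forall>v. Ck_on n (\<lambda>x. frechet_derivative f (at x) v) S)"

definition smooth_on :: "('a::real_normed_vector \<Rightarrow> 'b::real_normed_vector) \<Rightarrow> 'a set \<Rightarrow> bool" where
  "smooth_on f S \<longleftrightarrow> (\<forall>n. Ck_on n f S)"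

definition periodic :: "real \<Rightarrow> (real \<Rightarrow> 'a) \<Rightarrow> bool" where
  "periodic P f \<longleftrightarrow> (\<forall>t. f (t + P) = f t)"


section \<open>Riemannian manifolds in local coordinates\<close>

text \<open>A chart carries its domain, its coordinate map and the coordinate expression of the metric.
  The latter is a bilinear form on the model space, depending on a point of the coordinate image.
  The manifold is the whole type of points; its dimension is that of the model space.\<close>

type_synonym 'e field_of_forms = "'e \<Rightarrow> 'e \<Rightarrow> 'e \<Rightarrow> real"

record ('m, 'e) rchart =
  cdom :: "'m set"
  cmap :: "'m \<Rightarrow> 'e"
  cmet :: "'e field_of_forms"

definition cimg :: "('m, 'e) rchart \<Rightarrow> 'e set" where
  "cimg C = cmap C ` cdom C"

definition cpar :: "('m, 'e) rchart \<Rightarrow> 'e \<Rightarrow> 'm" where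
  "cpar C = inv_into (cdom C) (cmap C)"

definition riemannian_chart :: "('m::topological_space, 'e::euclidean_space) rchart \<Rightarrow> bool" where
  "riemannian_chart C \<longleftrightarrow>
     open (cdom C) \<and> open (cimg C) \<and>
     homeomorphism (cdom C) (cimg C) (cmap C) (cpar C) \<and>
     (\<forall>p\<in>cimg C. bilinear (cmet C p)
        \<and> (\<forall>u v. cmet C p u v = cmet C p v u)
        \<and> (\<forall>u. u \<noteq> 0 \<longrightarrow> cmet C p u u > 0)) \<and>
     (\<forall>u v. smooth_on (\<lambda>p. cmet C p u v) (cimg C))"

definition compatible_charts ::
  "('m::topological_space, 'e::euclidean_space) rchart \<Rightarrow> ('m, 'e) rchart \<Rightarrow> bool" where
  "compatible_charts C C' \<longleftrightarrow>
     (let \<tau> = cmap C' \<circ> cpar C; S = cmap C ` (cdom C \<inter> cdom C') in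
      smooth_on \<tau> S \<and>
      (\<forall>p\<in>S. \<forall>u v. cmet C p u v =
         cmet C' (\<tau> p) (frechet_derivative \<tau> (at p) u) (frechet_derivative \<tau> (at p) v)))"

definition riemannian_atlas ::
  "('m::{t2_space, second_countable_topology}, 'e::euclidean_space) rchart set \<Rightarrow> bool" where
  "riemannian_atlas A \<longleftrightarrow>
     (\<Union>C\<in>A. cdom C) = UNIV \<and>
     (\<forall>C\<in>A. riemannian_chart C) \<and>
     (\<forall>C\<in>A. \<forall>C'\<in>A. compatible_charts C C')"

text \<open>The vector that represents a linear form with respect to the metric at a point.\<close>

definition riesz :: "('e \<Rightarrow> 'e \<Rightarrow> real) \<Rightarrow> ('e \<Rightarrow> real) \<Rightarrow> 'e" where
  "riesz B \<omega> = (THE w. \<forall>z. B w z = \<omega> z)"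

text \<open>Since \<open>riesz (g p) (inner i)\<close> has the components \<open>g\<^sup>i\<^sup>j\<close>, a sum over i in \<open>Basis\<close> of
  \<open>h i (riesz (g p) (inner i))\<close> is the metric trace of h.\<close>

definition sharp :: "'e::euclidean_space field_of_forms \<Rightarrow> 'e \<Rightarrow> 'e \<Rightarrow> 'e" where
  "sharp g p i = riesz (g p) (\<lambda>z. i \<bullet> z)"

definition christoffel :: "'e::euclidean_space field_of_forms \<Rightarrow> 'e \<Rightarrow> 'e \<Rightarrow> 'e \<Rightarrow> 'e" where
  "christoffel g p u v = riesz (g p) (\<lambda>z.
     (frechet_derivative (\<lambda>q. g q v z) (at p) u
      + frechet_derivative (\<lambda>q. g q u z) (at p) v
      - frechet_derivative (\<lambda>q. g q u v) (at p) z) / 2)"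

definition covariant_hessian ::
  "'e::euclidean_space field_of_forms \<Rightarrow> ('e \<Rightarrow> 'v::real_inner) \<Rightarrow> 'e \<Rightarrow> 'e \<Rightarrow> 'e \<Rightarrow> 'v" where
  "covariant_hessian g F p u v =
     frechet_derivative (\<lambda>q. frechet_derivative F (at q) u) (at p) v
     - frechet_derivative F (at p) (christoffel g p u v)"

definition laplacian ::
  "'e::euclidean_space field_of_forms \<Rightarrow> ('e \<Rightarrow> 'v::real_inner) \<Rightarrow> 'e \<Rightarrow> 'v" where
  "laplacian g F p = (\<Sum>i\<in>Basis. covariant_hessian g F p i (sharp g p i))"

definition differential_norm2 ::
  "'e::euclidean_space field_of_forms \<Rightarrow> ('e \<Rightarrow> 'v::real_inner) \<Rightarrow> 'e \<Rightarrow> real" where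
  "differential_norm2 g F p =
     (\<Sum>i\<in>Basis. frechet_derivative F (at p) i \<bullet> frechet_derivative F (at p) (sharp g p i))"

definition eigenmap ::
  "('m, 'e::euclidean_space) rchart set \<Rightarrow> ('m \<Rightarrow> 'v::real_inner) \<Rightarrow> real \<Rightarrow> bool" where
  "eigenmap A f d \<longleftrightarrow>
     d > 0 \<and> (\<forall>x. norm (f x) = 1) \<and>
     (\<forall>C\<in>A. smooth_on (f \<circ> cpar C) (cimg C) \<and>
        (\<forall>p\<in>cimg C. laplacian (cmet C) (f \<circ> cpar C) p = - d *\<^sub>R f (cpar C p) \<and>
                     differential_norm2 (cmet C) (f \<circ> cpar C) p = d))"

text \<open>The second fundamental form of the unit sphere is \<open>II(X,Y) = - (X \<bullet> Y) G\<close> at the point G, so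
  the tension field of a map G into the unit sphere is its Laplacian minus the trace of
  \<open>II(dG,dG)\<close>.\<close>

definition sphere_tension ::
  "'e::euclidean_space field_of_forms \<Rightarrow> ('e \<Rightarrow> 'v::real_inner) \<Rightarrow> 'e \<Rightarrow> 'v" where
  "sphere_tension g F p = laplacian g F p + differential_norm2 g F p *\<^sub>R F p"

definition harmonic_into_sphere ::
  "('m, 'e::euclidean_space) rchart set \<Rightarrow> ('m \<Rightarrow> 'v::real_inner) \<Rightarrow> bool" where
  "harmonic_into_sphere A G \<longleftrightarrow>
     (\<forall>x. norm (G x) = 1) \<and>
     (\<forall>C\<in>A. Ck_on 2 (G \<circ> cpar C) (cimg C) \<and>
        (\<forall>p\<in>cimg C. sphere_tension (cmet C) (G \<circ> cpar C) p = 0))"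

text \<open>The atlas of the product of the real line with two manifolds, with the metric
  \<open>dt\<^sup>2 + \<ell>\<^sub>1(t)\<^sup>2 g\<^sub>1 + \<ell>\<^sub>2(t)\<^sup>2 g\<^sub>2\<close>.\<close>

definition warped_chart ::
  "(real \<Rightarrow> real) \<Rightarrow> (real \<Rightarrow> real) \<Rightarrow> ('m1, 'e1) rchart \<Rightarrow> ('m2, 'e2) rchart
   \<Rightarrow> (real \<times> 'm1 \<times> 'm2, real \<times> 'e1 \<times> 'e2) rchart" where
  "warped_chart l1 l2 C1 C2 = \<lparr>
     cdom = UNIV \<times> cdom C1 \<times> cdom C2,
     cmap = (\<lambda>(t, x, y). (t, cmap C1 x, cmap C2 y)),
     cmet = (\<lambda>(t, p, q) (\<tau>, u, v) (\<tau>', u', v').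
        \<tau> * \<tau>' + (l1 t)\<^sup>2 * cmet C1 p u u' + (l2 t)\<^sup>2 * cmet C2 q v v') \<rparr>"

definition warped_atlas ::
  "(real \<Rightarrow> real) \<Rightarrow> (real \<Rightarrow> real) \<Rightarrow> ('m1, 'e1) rchart set \<Rightarrow> ('m2, 'e2) rchart set
   \<Rightarrow> (real \<times> 'm1 \<times> 'm2, real \<times> 'e1 \<times> 'e2) rchart set" where
  "warped_atlas l1 l2 A1 A2 = {warped_chart l1 l2 C1 C2 | C1 C2. C1 \<in> A1 \<and> C2 \<in> A2}"


section \<open>Reconstructions\<close>

definition Q_fun :: "real \<Rightarrow> (real \<Rightarrow> real) \<Rightarrow> real \<Rightarrow> real" where
  "Q_fun c a t = 1 + (c\<^sup>2 - 1) * (a t)\<^sup>2"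

definition R_fun :: "(real \<Rightarrow> real) \<Rightarrow> real \<Rightarrow> real" where
  "R_fun a t = 1 - (a t)\<^sup>2 - (deriv a t)\<^sup>2"

definition co_magnitude :: "(real \<Rightarrow> real) \<Rightarrow> real \<Rightarrow> real" where
  "co_magnitude a t = sqrt (1 - (a t)\<^sup>2)"

definition F_fun :: "real \<Rightarrow> real \<Rightarrow> (real \<Rightarrow> real) \<Rightarrow> real \<Rightarrow> real" where
  "F_fun c \<epsilon> a t = sqrt (\<epsilon> * Q_fun c a t / ((a t)\<^sup>2 * R_fun a t))"

definition T_fun :: "real \<Rightarrow> (real \<Rightarrow> real) \<Rightarrow> real \<Rightarrow> real" where
  "T_fun c a t =
     1 / ((a t)\<^sup>2 * Q_fun c a t) - (a t + deriv (deriv a) t) / (a t * R_fun a t)"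

definition phase_rate1 :: "real \<Rightarrow> real \<Rightarrow> real \<Rightarrow> (real \<Rightarrow> real) \<Rightarrow> real \<Rightarrow> real" where
  "phase_rate1 c \<epsilon> \<sigma> a t = \<sigma> * sqrt \<epsilon> / (F_fun c \<epsilon> a t * (a t)\<^sup>2)"

definition phase_rate2 :: "real \<Rightarrow> real \<Rightarrow> real \<Rightarrow> (real \<Rightarrow> real) \<Rightarrow> real \<Rightarrow> real" where
  "phase_rate2 c \<epsilon> \<sigma> a t = \<sigma> * c * sqrt \<epsilon> / (F_fun c \<epsilon> a t * (co_magnitude a t)\<^sup>2)"

definition phase_increments ::
  "real \<Rightarrow> real \<Rightarrow> real \<Rightarrow> real \<Rightarrow> (real \<Rightarrow> real) \<Rightarrow> real \<times> real" where
  "phase_increments P c \<epsilon> \<sigma> a =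
     (integral {0..P} (phase_rate1 c \<epsilon> \<sigma> a), integral {0..P} (phase_rate2 c \<epsilon> \<sigma> a))"

record recon =
  par_c :: real
  par_eps :: real
  par_sig :: real
  mag :: "real \<Rightarrow> real"
  warp1 :: "real \<Rightarrow> real"
  warp2 :: "real \<Rightarrow> real"
  phase1 :: "real \<Rightarrow> real"
  phase2 :: "real \<Rightarrow> real"

text \<open>Only twice continuous differentiability of the magnitude is built in, because a warp of finite
  regularity only allows a magnitude of finite regularity; smoothness is stated separately where
  it holds. The two equations for the warps have at most one positive solution.\<close>

definition is_reconstruction :: "nat \<Rightarrow> nat \<Rightarrow> real \<Rightarrow> real \<Rightarrow> recon \<Rightarrow> bool" where
  "is_reconstruction k1 k2 d1 d2 D \<longleftrightarrow>
     par_eps D > 0 \<and> par_sig D \<in> {- 1, 1} \<and>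
     Ck_on 2 (mag D) UNIV \<and>
     (\<forall>t. 0 < mag D t \<and> mag D t < 1 \<and> R_fun (mag D) t > 0) \<and>
     (\<forall>t. warp1 D t > 0 \<and> warp2 D t > 0 \<and>
          warp1 D t ^ k1 * warp2 D t ^ k2 = F_fun (par_c D) (par_eps D) (mag D) t \<and>
          d2 / (warp2 D t)\<^sup>2 - d1 / (warp1 D t)\<^sup>2 = T_fun (par_c D) (mag D) t) \<and>
     (\<forall>t. (phase1 D has_real_derivative
             phase_rate1 (par_c D) (par_eps D) (par_sig D) (mag D) t) (at t) \<and>
          (phase2 D has_real_derivative
             phase_rate2 (par_c D) (par_eps D) (par_sig D) (mag D) t) (at t))"

definition profile :: "recon \<Rightarrow> real \<Rightarrow> complex \<times> complex" where
  "profile D t =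
     (of_real (mag D t) * cis (phase1 D t),
      of_real (co_magnitude (mag D) t) * cis (phase2 D t))"

definition unit_speed :: "recon \<Rightarrow> bool" where
  "unit_speed D \<longleftrightarrow>
     (\<forall>t. \<exists>v. (profile D has_vector_derivative v) (at t) \<and> norm v = 1)"

text \<open>The product norm on the target is the Euclidean one, so the target sphere is the unit sphere
  of the product.\<close>

definition recon_map ::
  "recon \<Rightarrow> ('m1 \<Rightarrow> complex ^ 'n1) \<Rightarrow> ('m2 \<Rightarrow> complex ^ 'n2)
   \<Rightarrow> real \<times> 'm1 \<times> 'm2 \<Rightarrow> (complex ^ 'n1) \<times> (complex ^ 'n2)" where
  "recon_map D f1 f2 =
     (\<lambda>(t, x, y). (fst (profile D t) *s f1 x, snd (profile D t) *s f2 y))"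

definition harmonic_reconstruction ::
  "('m1, 'e1::euclidean_space) rchart set \<Rightarrow> ('m2, 'e2::euclidean_space) rchart set
   \<Rightarrow> ('m1 \<Rightarrow> complex ^ 'n1) \<Rightarrow> ('m2 \<Rightarrow> complex ^ 'n2) \<Rightarrow> real \<Rightarrow> real \<Rightarrow> recon \<Rightarrow> bool" where
  "harmonic_reconstruction A1 A2 f1 f2 d1 d2 D \<longleftrightarrow>
     is_reconstruction DIM('e1) DIM('e2) d1 d2 D \<and> unit_speed D \<and>
     harmonic_into_sphere (warped_atlas (warp1 D) (warp2 D) A1 A2) (recon_map D f1 f2)"

definition doubly_spiral :: "recon \<Rightarrow> bool" where
  "doubly_spiral D \<longleftrightarrow> par_c D \<noteq> 0"

definition P_periodic_data :: "real \<Rightarrow> recon \<Rightarrow> bool" where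
  "P_periodic_data P D \<longleftrightarrow>
     periodic P (mag D) \<and> periodic P (co_magnitude (mag D)) \<and>
     periodic P (warp1 D) \<and> periodic P (warp2 D)"

definition closing_multiplier :: "real \<Rightarrow> recon \<Rightarrow> nat \<Rightarrow> bool" where
  "closing_multiplier P D m \<longleftrightarrow> m \<ge> 1 \<and> periodic (of_nat m * P) (profile D)"

definition profile_closes :: "real \<Rightarrow> recon \<Rightarrow> bool" where
  "profile_closes P D \<longleftrightarrow> (\<exists>m. closing_multiplier P D m)"

definition least_closing_multiplier :: "real \<Rightarrow> recon \<Rightarrow> nat" where
  "least_closing_multiplier P D = (LEAST m. closing_multiplier P D m)"


section \<open>Periodic Hoelder spaces\<close>

text \<open>For periodic functions, the supremum over the line of the Hoelder quotients agrees with the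
  one over the circle.\<close>

definition holder_quotients :: "real \<Rightarrow> (real \<Rightarrow> real) \<Rightarrow> real set" where
  "holder_quotients \<alpha> f = {\<bar>f s - f t\<bar> / \<bar>s - t\<bar> powr \<alpha> | s t. s \<noteq> t}"

definition holder_per :: "real \<Rightarrow> nat \<Rightarrow> real \<Rightarrow> (real \<Rightarrow> real) set" where
  "holder_per P r \<alpha> =
     {f. periodic P f \<and> Ck_on r f UNIV \<and> bdd_above (holder_quotients \<alpha> ((deriv ^^ r) f))}"

definition holder_norm :: "nat \<Rightarrow> real \<Rightarrow> (real \<Rightarrow> real) \<Rightarrow> real" where
  "holder_norm r \<alpha> f =
     (\<Sum>j\<le>r. SUP t. \<bar>(deriv ^^ j) f t\<bar>) + Sup (holder_quotients \<alpha> ((deriv ^^ r) f))"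


section \<open>The magnitude equation and nondegenerate closed data\<close>

definition q_fun :: "real \<Rightarrow> (real \<Rightarrow> real) \<Rightarrow> real \<Rightarrow> real" where
  "q_fun \<delta> x t = (x t)\<^sup>2 + \<delta> - \<delta>\<^sup>2 * (x t)\<^sup>2"

definition r_fun :: "real \<Rightarrow> (real \<Rightarrow> real) \<Rightarrow> real \<Rightarrow> real" where
  "r_fun \<delta> x t = 1 - \<delta> * ((x t)\<^sup>2 + (deriv x t)\<^sup>2)"

definition magnitude_residual ::
  "nat \<Rightarrow> nat \<Rightarrow> real \<Rightarrow> (real \<Rightarrow> real) \<Rightarrow> real \<Rightarrow> real \<Rightarrow> (real \<Rightarrow> real) \<Rightarrow> real \<Rightarrow> real" where
  "magnitude_residual k1 k2 d1 L \<mu> \<delta> x t =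
     (let q = q_fun \<delta> x t; r = r_fun \<delta> x t;
          w = L t powr (2 * real k1 / real k2); \<rho> = d1 / (L t)\<^sup>2 in
      deriv (deriv x) t -
      (r / (x t * q) - x t
       - r * x t * (\<mu> * w * ((x t)\<^sup>2 * r / q) powr (1 / real k2) - \<rho>)))"

definition magnitude_datum ::
  "nat \<Rightarrow> nat \<Rightarrow> real \<Rightarrow> real \<Rightarrow> (real \<Rightarrow> real) \<Rightarrow> real \<Rightarrow> real \<Rightarrow> (real \<Rightarrow> real) \<Rightarrow> bool" where
  "magnitude_datum k1 k2 d1 P L \<mu> \<delta> x \<longleftrightarrow>
     \<mu> > 0 \<and> \<delta> > 0 \<and> periodic P x \<and> Ck_on 2 x UNIV \<and>
     (\<forall>t. x t > 0 \<and> r_fun \<delta> x t > 0) \<and>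
     (\<forall>t. magnitude_residual k1 k2 d1 L \<mu> \<delta> x t = 0)"

definition datum_eps :: "nat \<Rightarrow> real \<Rightarrow> real \<Rightarrow> real \<Rightarrow> real" where
  "datum_eps k2 d2 \<mu> \<delta> = \<delta>\<^sup>2 * (d2 / \<mu>) ^ k2"

definition datum_mag :: "real \<Rightarrow> (real \<Rightarrow> real) \<Rightarrow> real \<Rightarrow> real" where
  "datum_mag \<delta> x t = sqrt \<delta> * x t"

definition datum_return ::
  "nat \<Rightarrow> real \<Rightarrow> real \<Rightarrow> real \<Rightarrow> real \<Rightarrow> (real \<Rightarrow> real) \<Rightarrow> real \<times> real" where
  "datum_return k2 d2 P \<mu> \<delta> x =
     phase_increments P (1 / \<delta>) (datum_eps k2 d2 \<mu> \<delta>) 1 (datum_mag \<delta> x)"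

definition realizes_datum ::
  "nat \<Rightarrow> real \<Rightarrow> (real \<Rightarrow> real) \<Rightarrow> real \<Rightarrow> real \<Rightarrow> (real \<Rightarrow> real) \<Rightarrow> recon \<Rightarrow> bool" where
  "realizes_datum k2 d2 L \<mu> \<delta> x D \<longleftrightarrow>
     warp1 D = L \<and> par_c D = 1 / \<delta> \<and> par_eps D = datum_eps k2 d2 \<mu> \<delta> \<and>
     par_sig D = 1 \<and> mag D = datum_mag \<delta> x"

text \<open>The operator A is the Frechet derivative at x, in the direction of the function variable, of
  the residual as a map between the periodic Hoelder spaces of orders 2 and 0.\<close>

definition residual_derivative ::
  "nat \<Rightarrow> nat \<Rightarrow> real \<Rightarrow> real \<Rightarrow> real \<Rightarrow> (real \<Rightarrow> real) \<Rightarrow> real \<Rightarrow> real \<Rightarrow> (real \<Rightarrow> real)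
   \<Rightarrow> ((real \<Rightarrow> real) \<Rightarrow> (real \<Rightarrow> real)) \<Rightarrow> bool" where
  "residual_derivative k1 k2 d1 P \<alpha> L \<mu> \<delta> x A \<longleftrightarrow>
     (\<forall>h\<in>holder_per P 2 \<alpha>. A h \<in> holder_per P 0 \<alpha>) \<and>
     (\<forall>h\<in>holder_per P 2 \<alpha>. \<forall>h'\<in>holder_per P 2 \<alpha>. \<forall>s s'.
        A (\<lambda>t. s * h t + s' * h' t) = (\<lambda>t. s * A h t + s' * A h' t)) \<and>
     (\<exists>K. \<forall>h\<in>holder_per P 2 \<alpha>. holder_norm 0 \<alpha> (A h) \<le> K * holder_norm 2 \<alpha> h) \<and>
     (\<forall>e>0. \<exists>\<theta>>0. \<forall>h\<in>holder_per P 2 \<alpha>. holder_norm 2 \<alpha> h < \<theta> \<longrightarrow>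
        (let rem = (\<lambda>t. magnitude_residual k1 k2 d1 L \<mu> \<delta> (\<lambda>s. x s + h s) t
                        - magnitude_residual k1 k2 d1 L \<mu> \<delta> x t - A h t) in
         rem \<in> holder_per P 0 \<alpha> \<and> holder_norm 0 \<alpha> rem \<le> e * holder_norm 2 \<alpha> h))"

definition linearization_invertible ::
  "nat \<Rightarrow> nat \<Rightarrow> real \<Rightarrow> real \<Rightarrow> real \<Rightarrow> (real \<Rightarrow> real) \<Rightarrow> real \<Rightarrow> real \<Rightarrow> (real \<Rightarrow> real) \<Rightarrow> bool" where
  "linearization_invertible k1 k2 d1 P \<alpha> L \<mu> \<delta> x \<longleftrightarrow>
     (\<exists>A. residual_derivative k1 k2 d1 P \<alpha> L \<mu> \<delta> x A \<and>
          bij_betw A (holder_per P 2 \<alpha>) (holder_per P 0 \<alpha>) \<and>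
          (\<exists>K. \<forall>h\<in>holder_per P 2 \<alpha>. holder_norm 2 \<alpha> h \<le> K * holder_norm 0 \<alpha> (A h)))"

text \<open>The branch given by the implicit function theorem: near the base point, its values are the only
  solutions close to x, and they depend continuously on the parameters.\<close>

definition local_branch ::
  "nat \<Rightarrow> nat \<Rightarrow> real \<Rightarrow> real \<Rightarrow> real \<Rightarrow> (real \<Rightarrow> real) \<Rightarrow> real \<Rightarrow> real \<Rightarrow> (real \<Rightarrow> real)
   \<Rightarrow> (real \<times> real) set \<Rightarrow> (real \<times> real \<Rightarrow> real \<Rightarrow> real) \<Rightarrow> bool" where
  "local_branch k1 k2 d1 P \<alpha> L \<mu> \<delta> x U X \<longleftrightarrow>
     open U \<and> (\<mu>, \<delta>) \<in> U \<and> X (\<mu>, \<delta>) = x \<and>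
     (\<exists>\<eta>>0. \<forall>p\<in>U. \<forall>y\<in>holder_per P 2 \<alpha>. holder_norm 2 \<alpha> (\<lambda>t. y t - x t) < \<eta> \<longrightarrow>
        (magnitude_datum k1 k2 d1 P L (fst p) (snd p) y \<longleftrightarrow> y = X p)) \<and>
     (\<forall>p\<in>U. X p \<in> holder_per P 2 \<alpha> \<and> magnitude_datum k1 k2 d1 P L (fst p) (snd p) (X p)) \<and>
     (\<forall>p\<in>U. ((\<lambda>p'. holder_norm 2 \<alpha> (\<lambda>t. X p' t - X p t)) \<longlongrightarrow> 0) (at p))"

definition nondegenerate_datum ::
  "nat \<Rightarrow> nat \<Rightarrow> real \<Rightarrow> real \<Rightarrow> real \<Rightarrow> real \<Rightarrow> (real \<Rightarrow> real) \<Rightarrow> real \<Rightarrow> real \<Rightarrow> (real \<Rightarrow> real) \<Rightarrow> bool" where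
  "nondegenerate_datum k1 k2 d1 d2 P \<alpha> L \<mu> \<delta> x \<longleftrightarrow>
     magnitude_datum k1 k2 d1 P L \<mu> \<delta> x \<and> x \<in> holder_per P 2 \<alpha> \<and>
     linearization_invertible k1 k2 d1 P \<alpha> L \<mu> \<delta> x \<and>
     (\<exists>U X J. local_branch k1 k2 d1 P \<alpha> L \<mu> \<delta> x U X \<and>
        ((\<lambda>p. datum_return k2 d2 P (fst p) (snd p) (X p)) has_derivative J) (at (\<mu>, \<delta>)) \<and>
        bij J)"

definition has_phase_return ::
  "nat \<Rightarrow> real \<Rightarrow> real \<Rightarrow> real \<Rightarrow> real \<Rightarrow> (real \<Rightarrow> real) \<Rightarrow> real \<Rightarrow> real \<Rightarrow> bool" where
  "has_phase_return k2 d2 P \<mu> \<delta> x \<rho>1 \<rho>2 \<longleftrightarrow>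
     datum_return k2 d2 P \<mu> \<delta> x = (2 * pi * \<rho>1, 2 * pi * \<rho>2)"

end

theory Submission
  imports Defs
begin

text \<open>At \<open>\<delta> = 0\<close> the magnitude equation becomes the Ermakov equation \<open>x'' + (\<mu> w + 1 - \<rho>) x = x\<^sup>-\<^sup>3\<close>.
  For large \<open>\<mu>\<close> the WKB expansion gives a periodic approximate solution, near which the linearized
  operator is close to an operator \<open>h'' + a h\<close> with an explicit fundamental system; choosing \<open>\<mu>\<close> among
  suitable discrete values makes this system antiperiodic, so that the operator has an explicit
  inverse G on periodic functions. Writing \<open>x = G g\<close> turns the magnitude equation into a fixed point
  equation for g with contraction factor 1/2, uniformly for the parameters near \<open>(\<mu>\<^sub>0, 0)\<close> and for
  the warps close to L. This gives a locally unique branch of solutions that is smooth in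
  \<open>(\<mu>, \<delta>)\<close>, and the same contraction inverts the linearization in the Hoelder spaces.

  At \<open>(\<mu>\<^sub>0, 0)\<close> the second phase increment is P for every \<open>\<mu>\<close>, the first one is strictly increasing in
  \<open>\<mu>\<close> and the second one is strictly decreasing in \<open>\<delta>\<close>. Hence the phase return is a local
  diffeomorphism near this point, and parameters with rational phase return are dense. Letting
  \<open>\<delta>\<close> tend to 0 makes the magnitude \<open>\<surd>\<delta> x\<close> collapse while the warps stay bounded below, and
  the denominators of the rational returns may be taken as large as desired.

  The map is harmonic because the Laplacian of the warped product reduces the tension field to
  two ordinary differential equations for the profile, which the equations for the warps solve.\<close>

section \<open>Calculus of continuously differentiable maps\<close>

text \<open>The obstacle is resonance. Linearizing \<open>x^-3\<close> at the leading amplitude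
  \<open>(\<mu> w)^(-1/4)\<close> adds \<open>3 \<mu> w\<close> to \<open>\<mu> w\<close>, so the
  linearized operator oscillates at twice the WKB frequency. Antiperiodicity puts its phase midway
  between two resonances, where the periodic inverse has sup norm of order
  \<open>e = \<mu>^(-1/2)\<close>. The error in the coefficient stays bounded as e tends to 0, so
  its product with the inverse becomes small: this is where the contraction comes from. With
  \<open>g = h'' + a h\<close> as the unknown, both h and h' are bounded operators of a continuous
  function, so the dependence of the equation on x' costs no derivative. Differentiating the fixed
  point equation in the parameters gives an equation of the same form with the same Lipschitz
  constants, so smoothness follows by induction. The signs of the derivatives of the phase return
  come from exact integral identities for periodic solutions, not from the WKB expansion. At
  \<open>\<delta> = 0\<close> the second increment does not depend on \<mu>, so the Jacobian is
  triangular there and its two diagonal signs decide.\<close>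

abbreviation (input) fderiv :: "('a::real_normed_vector \<Rightarrow> 'b::real_normed_vector) \<Rightarrow> 'a \<Rightarrow> 'a \<Rightarrow> 'b" where
  "fderiv f x \<equiv> frechet_derivative f (at x)"

type_synonym jet = "real \<times> real \<times> real \<times> real \<times> real"

lemmas real_vector_derivative = has_real_derivative_iff_has_vector_derivative

lemma Ck_on_cong:
  assumes "open S" "\<And>x. x \<in> S \<Longrightarrow> f x = g x"
  shows "Ck_on n f S \<longleftrightarrow> Ck_on n g S"
  using assms(2)
proof (induction n arbitrary: f g)
  case 0
  then show ?case by (simp cong: continuous_on_cong)
next
  case (Suc n)
  have ev: "eventually (\<lambda>y. f y = g y) (nhds x)" if "x \<in> S" for x
    using that assms(1) Suc.prems eventually_nhds by blast
  have hd: "(f has_derivative F) (at x) \<longleftrightarrow> (g has_derivative F) (at x)" if "x \<in> S" for x F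
    using that assms(1) Suc.prems
    by (metis has_derivative_transform_within_open)
  have fd: "fderiv f x = fderiv g x" if "x \<in> S" for x
    using hd[OF that] by (simp add: frechet_derivative_def)
  have "f differentiable_on S \<longleftrightarrow> g differentiable_on S"
    using assms(1) hd by (auto simp: differentiable_on_eq_differentiable_at differentiable_def)
  moreover have "Ck_on n (\<lambda>x. fderiv f x v) S
      \<longleftrightarrow> Ck_on n (\<lambda>x. fderiv g x v) S" for v
    by (rule Suc.IH) (simp add: fd)
  ultimately show ?case by simp
qed

lemma Ck_on_SucI:
  assumes "open S" "\<And>x. x \<in> S \<Longrightarrow> (f has_derivative f' x) (at x)"
    and "\<And>v. Ck_on n (\<lambda>x. f' x v) S"
  shows "Ck_on (Suc n) f S"
proof -
  have fd: "fderiv f x = f' x" if "x \<in> S" for x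
    using assms(2)[OF that] frechet_derivative_at by metis
  have "Ck_on n (\<lambda>x. fderiv f x v) S" for v
    using assms(3) by (subst Ck_on_cong[OF assms(1)]) (auto simp: fd)
  moreover have "f differentiable_on S"
    using assms(1,2) by (auto simp: differentiable_on_eq_differentiable_at differentiable_def)
  ultimately show ?thesis by simp
qed

lemma Ck_on_Suc_has_derivative:
  assumes "open S" "Ck_on (Suc n) f S" "x \<in> S"
  shows "(f has_derivative fderiv f x) (at x)"
  using assms by (simp add: differentiable_on_eq_differentiable_at frechet_derivative_works)

lemma Ck_on_SucD: "Ck_on (Suc n) f S \<Longrightarrow> Ck_on n (\<lambda>x. fderiv f x v) S"
  by simp

lemma Ck_on_continuous: "Ck_on n f S \<Longrightarrow> continuous_on S f"
  by (cases n) (auto simp: differentiable_imp_continuous_on)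

lemma Ck_on_Suc_imp: "Ck_on (Suc n) f S \<Longrightarrow> Ck_on n f S"
proof (induction n arbitrary: f)
  case 0
  then have "continuous_on S f" by (intro Ck_on_continuous)
  then show ?case by simp
next
  case (Suc n)
  have "f differentiable_on S" using Suc.prems by simp
  moreover have "Ck_on n (\<lambda>x. fderiv f x v) S" for v
    using Suc.IH[OF Ck_on_SucD[OF Suc.prems]] .
  ultimately show ?case by (simp only: Ck_on.simps simp_thms)
qed

lemma Ck_on_mono: "m \<le> n \<Longrightarrow> Ck_on n f S \<Longrightarrow> Ck_on m f S"
proof (induction n rule: dec_induct)
  case (step n)
  then show ?case using Ck_on_Suc_imp by blast
qed auto

lemma Ck_on_subset: "Ck_on n f S \<Longrightarrow> T \<subseteq> S \<Longrightarrow> Ck_on n f T"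
  by (induction n arbitrary: f) (auto intro: continuous_on_subset differentiable_on_subset)

lemma Ck_on_const: "Ck_on n (\<lambda>x. c) S"
proof (induction n arbitrary: c)
  case (Suc n)
  have "fderiv (\<lambda>x. c) x = (\<lambda>v. 0)" for x :: 'a
    using frechet_derivative_at has_derivative_const by metis
  then show ?case using Suc[of 0] by simp
qed auto

lemma Ck_on_linear_compose:
  assumes "bounded_linear T" "open S" "Ck_on n f S"
  shows "Ck_on n (\<lambda>x. T (f x)) S"
  using assms(3)
proof (induction n arbitrary: f)
  case 0
  then show ?case
    using assms(1) by (auto intro: bounded_linear.continuous_on)
next
  case (Suc n)
  show ?case
  proof (rule Ck_on_SucI[OF assms(2)])
    show "((\<lambda>x. T (f x)) has_derivative (\<lambda>v. T (fderiv f x v))) (at x)"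
      if "x \<in> S" for x
      using bounded_linear.has_derivative[OF assms(1) Ck_on_Suc_has_derivative[OF assms(2) Suc.prems that]] .
    show "Ck_on n (\<lambda>x. T (fderiv f x v)) S" for v
      using Suc.IH[OF Ck_on_SucD[OF Suc.prems]] .
  qed
qed

lemma Ck_on_linear:
  assumes "bounded_linear T" "open S"
  shows "Ck_on n T S"
proof (cases n)
  case 0
  then show ?thesis using assms linear_continuous_on by auto
next
  case (Suc m)
  show ?thesis unfolding Suc
    by (rule Ck_on_SucI[OF assms(2) bounded_linear_imp_has_derivative[OF assms(1)] Ck_on_const])
qed

lemma Ck_on_add:
  assumes "open S" "Ck_on n f S" "Ck_on n g S"
  shows "Ck_on n (\<lambda>x. f x + g x) S"
  using assms(2,3)
proof (induction n arbitrary: f g)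
  case 0
  then show ?case by (auto intro: continuous_intros)
next
  case (Suc n)
  show ?case
  proof (rule Ck_on_SucI[OF assms(1)])
    show "((\<lambda>x. f x + g x) has_derivative
        (\<lambda>v. fderiv f x v + fderiv g x v)) (at x)"
      if "x \<in> S" for x
      by (rule has_derivative_add[OF Ck_on_Suc_has_derivative[OF assms(1) Suc.prems(1) that]
        Ck_on_Suc_has_derivative[OF assms(1) Suc.prems(2) that]])
    show "Ck_on n (\<lambda>x. fderiv f x v + fderiv g x v) S" for v
      by (rule Suc.IH[OF Ck_on_SucD[OF Suc.prems(1)] Ck_on_SucD[OF Suc.prems(2)]])
  qed
qed

lemma Ck_on_sum:
  assumes "open S" "\<And>i. i \<in> I \<Longrightarrow> Ck_on n (f i) S"
  shows "Ck_on n (\<lambda>x. \<Sum>i\<in>I. f i x) S"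
  using assms(2)
  by (induction I rule: infinite_finite_induct) (auto intro: Ck_on_const Ck_on_add assms(1))

lemma Ck_on_bilinear:
  assumes "bounded_bilinear B" "open S" "Ck_on n f S" "Ck_on n g S"
  shows "Ck_on n (\<lambda>x. B (f x) (g x)) S"
  using assms(3,4)
proof (induction n arbitrary: f g)
  case 0
  then show ?case using bounded_bilinear.continuous_on[OF assms(1)] by auto
next
  case (Suc n)
  show ?case
  proof (rule Ck_on_SucI[OF assms(2)])
    show "((\<lambda>x. B (f x) (g x)) has_derivative
        (\<lambda>v. B (f x) (fderiv g x v) + B (fderiv f x v) (g x))) (at x)"
      if "x \<in> S" for x
      by (rule bounded_bilinear.FDERIV[OF assms(1) Ck_on_Suc_has_derivative[OF assms(2) Suc.prems(1) that]
        Ck_on_Suc_has_derivative[OF assms(2) Suc.prems(2) that]])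
    show "Ck_on n (\<lambda>x. B (f x) (fderiv g x v)
        + B (fderiv f x v) (g x)) S" for v
      by (rule Ck_on_add[OF assms(2) Suc.IH[OF Ck_on_Suc_imp[OF Suc.prems(1)] Ck_on_SucD[OF Suc.prems(2)]]
          Suc.IH[OF Ck_on_SucD[OF Suc.prems(1)] Ck_on_Suc_imp[OF Suc.prems(2)]]])
  qed
qed

lemma Ck_on_minus: "open S \<Longrightarrow> Ck_on n f S \<Longrightarrow> Ck_on n (\<lambda>x. - f x) S"
  using Ck_on_linear_compose[OF bounded_linear_minus[OF bounded_linear_ident]] .

lemma Ck_on_diff:
  "open S \<Longrightarrow> Ck_on n f S \<Longrightarrow> Ck_on n g S \<Longrightarrow> Ck_on n (\<lambda>x. f x - g x) S"
  using Ck_on_add[of S n f "\<lambda>x. - g x"] Ck_on_minus by auto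

lemma Ck_on_mult:
  fixes f g :: "'a::real_normed_vector \<Rightarrow> 'b::real_normed_algebra"
  shows "open S \<Longrightarrow> Ck_on n f S \<Longrightarrow> Ck_on n g S \<Longrightarrow> Ck_on n (\<lambda>x. f x * g x) S"
  using Ck_on_bilinear[OF bounded_bilinear_mult] .

lemma Ck_on_scaleR:
  "open S \<Longrightarrow> Ck_on n f S \<Longrightarrow> Ck_on n g S \<Longrightarrow> Ck_on n (\<lambda>x. f x *\<^sub>R g x) S"
  using Ck_on_bilinear[OF bounded_bilinear_scaleR] .

lemma Ck_on_power:
  fixes f :: "'a::real_normed_vector \<Rightarrow> 'b::real_normed_algebra_1"
  shows "open S \<Longrightarrow> Ck_on n f S \<Longrightarrow> Ck_on n (\<lambda>x. f x ^ m) S"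
  by (induction m) (auto intro: Ck_on_const Ck_on_mult)

lemma Ck_on_fst: "open S \<Longrightarrow> Ck_on n f S \<Longrightarrow> Ck_on n (\<lambda>x. fst (f x)) S"
  using Ck_on_linear_compose[OF bounded_linear_fst] .

lemma Ck_on_snd: "open S \<Longrightarrow> Ck_on n f S \<Longrightarrow> Ck_on n (\<lambda>x. snd (f x)) S"
  using Ck_on_linear_compose[OF bounded_linear_snd] .

lemma Ck_on_ident: "open S \<Longrightarrow> Ck_on n (\<lambda>x. x) S"
  using Ck_on_linear[OF bounded_linear_ident] .

lemma Ck_on_Pair:
  assumes "open S" "Ck_on n f S" "Ck_on n g S"
  shows "Ck_on n (\<lambda>x. (f x, g x)) S"
proof -
  have "bounded_linear (\<lambda>u::'b. (u, 0::'c))" "bounded_linear (\<lambda>u::'c. (0::'b, u))"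
    by (auto intro!: bounded_linear_Pair bounded_linear_ident bounded_linear_zero)
  then have "Ck_on n (\<lambda>x. (f x, 0::'c) + (0::'b, g x)) S"
    using assms by (intro Ck_on_add Ck_on_linear_compose[where T="\<lambda>u. (u, 0)"]
      Ck_on_linear_compose[where T="\<lambda>u. (0, u)"]) auto
  then show ?thesis by simp
qed

lemma linear_euclidean_expand:
  fixes T :: "'a::euclidean_space \<Rightarrow> 'b::real_vector"
  assumes "linear T"
  shows "T w = (\<Sum>i\<in>Basis. (w \<bullet> i) *\<^sub>R T i)"
proof -
  have "T w = T (\<Sum>i\<in>Basis. (w \<bullet> i) *\<^sub>R i)" by (simp only: euclidean_representation)
  also have "\<dots> = (\<Sum>i\<in>Basis. (w \<bullet> i) *\<^sub>R T i)" 
    unfolding linear_sum[OF assms] linear_cmul[OF assms] by (rule refl)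
  finally show ?thesis .
qed

text \<open>The chain rule evaluates the derivative of g in a direction that moves with x. Expanding
  that direction in \<open>Basis\<close> leaves directional derivatives of g in fixed directions, to
  which the induction hypothesis applies.\<close>

lemma Ck_on_compose:
  fixes f :: "'a::real_normed_vector \<Rightarrow> 'b::euclidean_space"
  assumes "open S" "open T" "f ` S \<subseteq> T" "Ck_on n g T" "Ck_on n f S"
  shows "Ck_on n (\<lambda>x. g (f x)) S"
  using assms(4,5)
proof (induction n arbitrary: g)
  case 0
  then show ?case using assms(3) by (auto intro: continuous_on_compose2)
next
  case (Suc n)
  have fx: "f x \<in> T" if "x \<in> S" for x using that assms(3) by auto
  show ?case
  proof (rule Ck_on_SucI[OF assms(1)])
    show "((\<lambda>x. g (f x)) has_derivative
        (\<lambda>v. \<Sum>i\<in>Basis. (fderiv f x v \<bullet> i) *\<^sub>R fderiv g (f x) i)) (at x)"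
      if "x \<in> S" for x
    proof -
      have g: "(g has_derivative fderiv g (f x)) (at (f x))"
        using Ck_on_Suc_has_derivative[OF assms(2) Suc.prems(1) fx[OF that]] .
      have "((\<lambda>x. g (f x)) has_derivative
          (\<lambda>v. fderiv g (f x) (fderiv f x v))) (at x)"
        using has_derivative_compose[OF Ck_on_Suc_has_derivative[OF assms(1) Suc.prems(2) that] g] .
      moreover have "(\<lambda>v. fderiv g (f x) (fderiv f x v))
          = (\<lambda>v. \<Sum>i\<in>Basis. (fderiv f x v \<bullet> i) *\<^sub>R fderiv g (f x) i)"
        using linear_euclidean_expand[OF has_derivative_linear[OF g]] by metis
      ultimately show ?thesis by metis
    qed
    have "Ck_on n (\<lambda>x. fderiv g (f x) i) S" for i
      using Suc.IH[OF Ck_on_SucD[OF Suc.prems(1)]] Ck_on_Suc_imp[OF Suc.prems(2)] .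
    then show "Ck_on n (\<lambda>x. \<Sum>i\<in>Basis. (fderiv f x v \<bullet> i) *\<^sub>R
        fderiv g (f x) i) S" for v
      using Ck_on_SucD[OF Suc.prems(2)]
      by (intro Ck_on_sum Ck_on_scaleR assms(1) Ck_on_linear_compose[OF bounded_linear_inner_left])
  qed
qed

lemma Ck_on_Suc_real:
  fixes f :: "real \<Rightarrow> 'b::real_normed_vector"
  assumes "open S" "\<And>x. x \<in> S \<Longrightarrow> (f has_vector_derivative f' x) (at x)" "Ck_on n f' S"
  shows "Ck_on (Suc n) f S"
proof (rule Ck_on_SucI[OF assms(1)])
  show "(f has_derivative (\<lambda>v. v *\<^sub>R f' x)) (at x)" if "x \<in> S" for x
    using assms(2)[OF that] by (simp add: has_vector_derivative_def)
  show "Ck_on n (\<lambda>x. v *\<^sub>R f' x) S" for v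
    by (intro Ck_on_scaleR Ck_on_const assms)
qed

lemma Ck_on_SucI_DERIV:
  fixes f :: "real \<Rightarrow> real"
  assumes "open S" "\<And>x. x \<in> S \<Longrightarrow> (f has_real_derivative f' x) (at x)" "Ck_on n f' S"
  shows "Ck_on (Suc n) f S"
  using Ck_on_Suc_real[of S f f' n] assms by (simp add: real_vector_derivative)

lemma Ck_on_Suc_DERIV:
  fixes f :: "real \<Rightarrow> real"
  assumes "open S" "Ck_on (Suc n) f S"
  shows "\<And>x. x \<in> S \<Longrightarrow> (f has_real_derivative deriv f x) (at x)" "Ck_on n (deriv f) S"
proof -
  show *: "(f has_real_derivative deriv f x) (at x)" if "x \<in> S" for x
    using Ck_on_Suc_has_derivative[OF assms that] DERIV_imp_deriv has_real_derivative by metis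
  have "fderiv f x 1 = deriv f x" if "x \<in> S" for x
    using *[OF that] frechet_derivative_at[of f] unfolding has_field_derivative_def by (metis mult.right_neutral)
  then show "Ck_on n (deriv f) S"
    using Ck_on_SucD[OF assms(2), of 1] by (subst Ck_on_cong[OF assms(1)]) auto
qed

lemma Ck_on_inverse_real: "Ck_on n (inverse :: real \<Rightarrow> real) (- {0})"
proof (induction n)
  case 0
  then show ?case by (auto intro!: continuous_intros)
next
  case (Suc n)
  show ?case
    by (rule Ck_on_SucI_DERIV[where f'="\<lambda>x. - (inverse x * inverse x)"])
      (auto intro!: derivative_eq_intros Ck_on_minus Ck_on_mult Suc simp: power2_eq_square)
qed

lemma Ck_on_powr_real: "Ck_on n (\<lambda>x::real. x powr a) {0<..}"
proof (induction n arbitrary: a)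
  case 0
  then show ?case by (auto intro!: continuous_intros)
next
  case (Suc n)
  show ?case
    by (rule Ck_on_SucI_DERIV[where f'="\<lambda>x. a * x powr (a - 1)"])
      (auto intro!: derivative_eq_intros Ck_on_mult Ck_on_const Suc)
qed

lemma Ck_on_sin_cos_real: "Ck_on n (sin :: real \<Rightarrow> real) UNIV \<and> Ck_on n (cos :: real \<Rightarrow> real) UNIV"
proof (induction n)
  case 0
  then show ?case by (auto intro!: continuous_intros)
next
  case (Suc n)
  have "Ck_on (Suc n) (sin :: real \<Rightarrow> real) UNIV"
    by (rule Ck_on_SucI_DERIV[where f'=cos]) (use Suc in \<open>auto intro!: derivative_eq_intros\<close>)
  moreover have "Ck_on (Suc n) (cos :: real \<Rightarrow> real) UNIV"
    by (rule Ck_on_SucI_DERIV[where f'="\<lambda>x. - sin x"])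
      (use Suc in \<open>auto intro!: derivative_eq_intros Ck_on_minus\<close>)
  ultimately show ?case by blast
qed

lemma Ck_on_inverse:
  fixes f :: "'a::real_normed_vector \<Rightarrow> real"
  assumes "open S" "Ck_on n f S" "\<And>x. x \<in> S \<Longrightarrow> f x \<noteq> 0"
  shows "Ck_on n (\<lambda>x. inverse (f x)) S"
  by (rule Ck_on_compose[where g=inverse, OF assms(1) _ _ Ck_on_inverse_real assms(2)]) (use assms(3) in auto)

lemma Ck_on_divide:
  fixes f g :: "'a::real_normed_vector \<Rightarrow> real"
  assumes "open S" "Ck_on n f S" "Ck_on n g S" "\<And>x. x \<in> S \<Longrightarrow> g x \<noteq> 0"
  shows "Ck_on n (\<lambda>x. f x / g x) S"
  unfolding divide_inverse by (intro Ck_on_mult Ck_on_inverse assms)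

lemma Ck_on_powr:
  fixes f :: "'a::real_normed_vector \<Rightarrow> real"
  assumes "open S" "Ck_on n f S" "\<And>x. x \<in> S \<Longrightarrow> f x > 0"
  shows "Ck_on n (\<lambda>x. f x powr a) S"
  by (rule Ck_on_compose[where g="\<lambda>x. x powr a", OF assms(1) _ _ Ck_on_powr_real assms(2)]) (use assms(3) in auto)

lemma Ck_on_sqrt:
  fixes f :: "'a::real_normed_vector \<Rightarrow> real"
  assumes "open S" "Ck_on n f S" "\<And>x. x \<in> S \<Longrightarrow> f x > 0"
  shows "Ck_on n (\<lambda>x. sqrt (f x)) S"
  using Ck_on_powr[OF assms, of "1/2"] assms(3) 
  by (subst Ck_on_cong[where g="\<lambda>x. f x powr (1/2)", OF assms(1)]) (auto simp: powr_half_sqrt less_imp_le)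

lemma Ck_on_sin:
  fixes f :: "'a::real_normed_vector \<Rightarrow> real"
  shows "open S \<Longrightarrow> Ck_on n f S \<Longrightarrow> Ck_on n (\<lambda>x. sin (f x)) S"
  by (rule Ck_on_compose[where g=sin and T=UNIV]) (auto simp: Ck_on_sin_cos_real)

lemma Ck_on_cos:
  fixes f :: "'a::real_normed_vector \<Rightarrow> real"
  shows "open S \<Longrightarrow> Ck_on n f S \<Longrightarrow> Ck_on n (\<lambda>x. cos (f x)) S"
  by (rule Ck_on_compose[where g=cos and T=UNIV]) (auto simp: Ck_on_sin_cos_real)

lemma Ck_on_of_real:
  fixes f :: "'a::real_normed_vector \<Rightarrow> real"
  shows "open S \<Longrightarrow> Ck_on n f S \<Longrightarrow> Ck_on n (\<lambda>x. complex_of_real (f x)) S"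
  using Ck_on_linear_compose[OF bounded_linear_of_real] .

lemma Ck_on_cis:
  fixes f :: "'a::real_normed_vector \<Rightarrow> real"
  assumes "open S" "Ck_on n f S"
  shows "Ck_on n (\<lambda>x. cis (f x)) S"
proof -
  have "Ck_on n (\<lambda>x. of_real (cos (f x)) + \<i> * of_real (sin (f x))) S"
    by (intro Ck_on_add Ck_on_mult Ck_on_const Ck_on_of_real Ck_on_cos Ck_on_sin assms)
  moreover have "cis y = of_real (cos y) + \<i> * of_real (sin y)" for y
    by (simp add: complex_eq_iff)
  ultimately show ?thesis by simp
qed

lemmas Ck_intros = Ck_on_const Ck_on_add Ck_on_diff Ck_on_minus Ck_on_mult Ck_on_power
  Ck_on_fst Ck_on_snd Ck_on_ident Ck_on_Pair Ck_on_divide Ck_on_inverse Ck_on_powr Ck_on_sqrt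
  Ck_on_sin Ck_on_cos

text \<open>\<open>Ck_on\<close> speaks of one direction at a time. In finite dimension, continuity
  in every fixed direction amounts to continuity of the derivative in operator norm, which the
  uniform estimates below rely on.\<close>

lemma Ck_on_Suc_blinfun:
  fixes f :: "'a::euclidean_space \<Rightarrow> 'b::real_normed_vector"
  assumes "open S" "Ck_on (Suc n) f S"
  obtains F where "\<And>x. x \<in> S \<Longrightarrow> (f has_derivative blinfun_apply (F x)) (at x)"
    and "\<And>x. x \<in> S \<Longrightarrow> blinfun_apply (F x) = fderiv f x"
    and "continuous_on S F"
proof
  define F where "F x = (if x \<in> S then Blinfun (fderiv f x) else 0)" for x
  show *: "blinfun_apply (F x) = fderiv f x" if "x \<in> S" for x
    using Ck_on_Suc_has_derivative[OF assms that] that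
    by (simp add: F_def bounded_linear_Blinfun_apply has_derivative_bounded_linear)
  show "(f has_derivative blinfun_apply (F x)) (at x)" if "x \<in> S" for x
    using *[OF that] Ck_on_Suc_has_derivative[OF assms that] by simp
  have "continuous_on S (\<lambda>x. blinfun_apply (F x) i)" for i
    using Ck_on_continuous[OF Ck_on_SucD[OF assms(2), of i]] * by (simp cong: continuous_on_cong)
  then show "continuous_on S F"
    using assms(1) by (intro continuous_at_imp_continuous_on ballI continuous_blinfun_componentwiseI1)
      (auto simp: continuous_on_eq_continuous_at)
qed

text \<open>Uniform continuity on K alone would not do, because the second point is only close to K.
  A closed neighbourhood of K inside W is still compact, and uniform continuity is applied
  there.\<close>

lemma uniform_near_compact:
  fixes f :: "'a::heine_borel \<Rightarrow> 'b::metric_space"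
  assumes "open W" "continuous_on W f" "compact K" "K \<subseteq> W" "e > 0"
  shows "\<exists>d>0. \<forall>z\<in>K. \<forall>z'. dist z z' < d \<longrightarrow> z' \<in> W \<and> dist (f z') (f z) < e"
proof (cases "K = {}")
  case False
  obtain r where r: "r > 0" "{x. infdist x K \<le> r} \<subseteq> W"
    using compact_in_open_separated[OF False assms(3,1,4)] by blast
  have "compact {x. infdist x K \<le> r}"
    using False assms(3) r(1) by (intro compact_infdist_le)
  then have "uniformly_continuous_on {x. infdist x K \<le> r} f"
    using r(2) assms(2) continuous_on_subset by (intro compact_uniformly_continuous) auto
  then obtain d where d: "d > 0"
    "\<And>x x'. infdist x K \<le> r \<Longrightarrow> infdist x' K \<le> r \<Longrightarrow> dist x' x < d \<Longrightarrow> dist (f x') (f x) < e"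
    using assms(5) unfolding uniformly_continuous_on_def by (metis mem_Collect_eq)
  show ?thesis
  proof (intro exI[of _ "min d r"] conjI ballI allI impI)
    show "0 < min d r" using r d by auto
  next
    fix z z' assume z: "z \<in> K" "dist z z' < min d r"
    have i: "infdist z' K \<le> r"
      using infdist_le[OF z(1), of z'] z(2) by (auto simp: dist_commute)
    show "z' \<in> W" using i r by auto
    show "dist (f z') (f z) < e"
      using d(2)[of z z'] i z r(1) by (auto simp: dist_commute)
  qed
qed (auto intro: exI[of _ 1])

lemma Ck_on_uniform_differentiable:
  fixes f :: "'a::euclidean_space \<Rightarrow> 'b::real_normed_vector"
  assumes "open W" "Ck_on (Suc n) f W" "compact K" "K \<subseteq> W" "e > 0"
  shows "\<exists>d>0. \<forall>z\<in>K. \<forall>h. norm h < d \<longrightarrow> z + h \<in> W \<and>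
     norm (f (z + h) - f z - fderiv f z h) \<le> e * norm h"
proof -
  obtain F where F: "\<And>x. x \<in> W \<Longrightarrow> (f has_derivative blinfun_apply (F x)) (at x)"
     "\<And>x. x \<in> W \<Longrightarrow> blinfun_apply (F x) = fderiv f x" "continuous_on W F"
    using Ck_on_Suc_blinfun[OF assms(1,2)] by blast
  obtain d where d: "d > 0"
    "\<And>z z'. z \<in> K \<Longrightarrow> dist z z' < d \<Longrightarrow> z' \<in> W \<and> dist (F z') (F z) < e"
    using uniform_near_compact[OF assms(1) F(3) assms(3-5)] by blast
  show ?thesis
  proof (intro exI[of _ d] conjI ballI allI impI d(1))
    fix z h :: 'a assume z: "z \<in> K" and h: "norm h < d"
    show "z + h \<in> W" using d(2)[OF z, of "z + h"] h by (simp add: dist_norm)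
    have b: "x \<in> W" "norm (F x - F z) \<le> e" if "x \<in> ball z d" for x
      using d(2)[OF z, of x] that by (auto simp: dist_norm)
    have "norm (f (z + h) - f z - blinfun_apply (F z) (z + h - z)) \<le> norm (z + h - z) * e"
    proof (rule differentiable_bound_linearization[where S="ball z d"])
      show "z + t *\<^sub>R (z + h - z) \<in> ball z d" if "t \<in> {0..1}" for t
      proof -
        have "\<bar>t\<bar> * norm h \<le> norm h" using that by (simp add: mult_left_le_one_le)
        then show ?thesis using h by (simp add: dist_norm)
      qed
      show "(f has_derivative blinfun_apply (F x)) (at x within ball z d)" if "x \<in> ball z d" for x
        using F(1)[OF b(1)[OF that]] has_derivative_at_withinI by blast
      show "onorm (blinfun_apply (F x) - blinfun_apply (F z)) \<le> e" if "x \<in> ball z d" for x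
        using b(2)[OF that] by (simp add: norm_blinfun.rep_eq minus_blinfun.rep_eq fun_diff_def)
    qed (use d in auto)
    then show "norm (f (z + h) - f z - fderiv f z h) \<le> e * norm h"
      using F(2)[of z] z assms(4) by (auto simp: mult.commute)
  qed
qed

lemma Ck_on_derivative_bounded:
  fixes f :: "'a::euclidean_space \<Rightarrow> 'b::real_normed_vector"
  assumes "open W" "Ck_on (Suc n) f W" "compact K" "K \<subseteq> W"
  shows "\<exists>C>0. \<forall>z\<in>K. \<forall>h. norm (fderiv f z h) \<le> C * norm h"
proof -
  obtain F where F: "\<And>x. x \<in> W \<Longrightarrow> (f has_derivative blinfun_apply (F x)) (at x)"
     "\<And>x. x \<in> W \<Longrightarrow> blinfun_apply (F x) = fderiv f x" "continuous_on W F"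
    using Ck_on_Suc_blinfun[OF assms(1,2)] by blast
  have "bounded (F ` K)"
    using F(3) assms(3,4) continuous_on_subset compact_continuous_image compact_imp_bounded by metis
  then obtain C where C: "C > 0" "\<And>z. z \<in> K \<Longrightarrow> norm (F z) \<le> C"
    unfolding bounded_pos by auto
  have "norm (fderiv f z h) \<le> C * norm h" if "z \<in> K" for z h
    using norm_blinfun[of "F z" h] C(2)[OF that] F(2)[of z] that assms(4)
    by (smt (verit, ccfv_SIG) mult_right_mono norm_ge_zero subsetD)
  then show ?thesis using C(1) by blast
qed

lemma Ck_on_uniform_Lipschitz:
  fixes f :: "'a::euclidean_space \<Rightarrow> 'b::real_normed_vector"
  assumes "open W" "Ck_on (Suc n) f W" "compact K" "K \<subseteq> W"
  shows "\<exists>C>0. \<exists>d>0. \<forall>z\<in>K. \<forall>h. norm h < d \<longrightarrow> z + h \<in> W \<and> norm (f (z + h) - f z) \<le> C * norm h"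
proof -
  obtain d where d: "d > 0" "\<And>z h. z \<in> K \<Longrightarrow> norm h < d \<Longrightarrow> z + h \<in> W \<and>
     norm (f (z + h) - f z - fderiv f z h) \<le> 1 * norm h"
    using Ck_on_uniform_differentiable[OF assms, of 1] by auto
  obtain C where C: "C > 0" "\<And>z h. z \<in> K \<Longrightarrow> norm (fderiv f z h) \<le> C * norm h"
    using Ck_on_derivative_bounded[OF assms] by blast
  have "z + h \<in> W \<and> norm (f (z + h) - f z) \<le> (C + 1) * norm h" if "z \<in> K" "norm h < d" for z h
    using d(2)[OF that] C(2)[OF that(1), of h]
      norm_triangle_ineq[of "f (z + h) - f z - fderiv f z h" "fderiv f z h"]
    by (auto simp: algebra_simps)
  then show ?thesis using C(1) d(1) by (intro exI[of _ "C + 1"] conjI exI[of _ d]) auto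
qed

section \<open>Integrals depending on parameters\<close>

lemma has_derivative_integral_param:
  fixes H :: "'a::euclidean_space \<times> real \<Rightarrow> real"
  assumes "open T" "Ck_on (Suc n) H (T \<times> UNIV)" "z \<in> T"
  shows "((\<lambda>z. integral {a..b} (\<lambda>\<sigma>. H (z, \<sigma>))) has_derivative
     (\<lambda>v. integral {a..b} (\<lambda>\<sigma>. fderiv H (z, \<sigma>) (v, 0)))) (at z)"
proof -
  note z = assms(3)
  have oT: "open (T \<times> (UNIV::real set))" using assms(1) by (simp add: open_Times)
  obtain F where F: "\<And>x. x \<in> T \<times> UNIV \<Longrightarrow> (H has_derivative blinfun_apply (F x)) (at x)"
     "\<And>x. x \<in> T \<times> UNIV \<Longrightarrow> blinfun_apply (F x) = fderiv H x" "continuous_on (T \<times> UNIV) F"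
    using Ck_on_Suc_blinfun[OF oT assms(2)] by blast
  \<comment> \<open>Composition with the inclusion of the first factor turns the full derivative of
    H into the partial derivative that the Leibniz rule expects, as a continuous family of bounded
    operators.\<close>
  define J where "J = (Blinfun (\<lambda>v. (v, 0::real)) :: 'a \<Rightarrow>\<^sub>L ('a \<times> real))"
  have J: "blinfun_apply J v = (v, 0)" for v
    unfolding J_def by (subst bounded_linear_Blinfun_apply)
      (auto intro!: bounded_linear_Pair bounded_linear_ident bounded_linear_zero)
  have cH: "continuous_on (T \<times> UNIV) H" using Ck_on_continuous[OF assms(2)] .
  obtain d where d: "d > 0" "ball z d \<subseteq> T" using z assms(1) openE by blast
  have cG: "continuous_on (ball z d \<times> cbox a b) (\<lambda>(z, \<sigma>). F (z, \<sigma>) o\<^sub>L J)"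
    using d by (auto simp: case_prod_unfold intro!: bounded_bilinear.continuous_on[OF bounded_bilinear_blinfun_compose]
       continuous_on_subset[OF F(3)] continuous_intros)
  have "((\<lambda>z. integral (cbox a b) (\<lambda>\<sigma>. H (z, \<sigma>))) has_derivative
      integral (cbox a b) (\<lambda>\<sigma>. F (z, \<sigma>) o\<^sub>L J)) (at z within ball z d)"
  proof (rule leibniz_rule[where U="ball z d"])
    fix x \<sigma> assume x: "x \<in> ball z d"
    have "(H has_derivative blinfun_apply (F (x, \<sigma>))) (at (x, \<sigma>))" using x d F(1) by blast
    moreover have "((\<lambda>x. (x, \<sigma>)) has_derivative (\<lambda>v. (v, 0))) (at x within ball z d)"
      by (auto intro!: derivative_eq_intros)
    ultimately have "((\<lambda>x. H (x, \<sigma>)) has_derivative (\<lambda>v. blinfun_apply (F (x, \<sigma>)) (v, 0))) (at x within ball z d)"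
      using has_derivative_compose by blast
    then show "((\<lambda>x. H (x, \<sigma>)) has_derivative blinfun_apply (F (x, \<sigma>) o\<^sub>L J)) (at x within ball z d)"
      by (rule has_derivative_eq_rhs) (simp add: fun_eq_iff J)
  next
    fix x assume x: "x \<in> ball z d"
    have "continuous_on (cbox a b) (\<lambda>\<sigma>. H (x, \<sigma>))"
      using x d by (intro continuous_on_compose2[OF cH]) (auto intro!: continuous_intros)
    then show "(\<lambda>\<sigma>. H (x, \<sigma>)) integrable_on cbox a b" by (rule integrable_continuous)
  qed (use d cG in auto)
  moreover have "blinfun_apply (integral (cbox a b) (\<lambda>\<sigma>. F (z, \<sigma>) o\<^sub>L J)) v
      = integral {a..b} (\<lambda>\<sigma>. fderiv H (z, \<sigma>) (v, 0))" for v
  proof -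
    have "continuous_on (cbox a b) (\<lambda>\<sigma>. F (z, \<sigma>) o\<^sub>L J)"
      using z by (auto intro!: bounded_bilinear.continuous_on[OF bounded_bilinear_blinfun_compose]
        continuous_on_compose2[OF F(3)] continuous_intros)
    then have "blinfun_apply (integral (cbox a b) (\<lambda>\<sigma>. F (z, \<sigma>) o\<^sub>L J)) v
       = integral (cbox a b) (\<lambda>\<sigma>. blinfun_apply (F (z, \<sigma>) o\<^sub>L J) v)"
      by (intro blinfun_apply_integral integrable_continuous)
    then show ?thesis using F(2) z by (simp add: J)
  qed
  ultimately show ?thesis
      using d(1) at_within_open[of z "ball z d"] by (simp add: fun_eq_iff has_derivative_eq_rhs)
qed

lemma Ck_on_integral:
  fixes H :: "'a::euclidean_space \<times> real \<Rightarrow> real"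
  assumes "open T" "Ck_on n H (T \<times> UNIV)"
  shows "Ck_on n (\<lambda>z. integral {a..b} (\<lambda>\<sigma>. H (z, \<sigma>))) T"
  using assms(2)
proof (induction n arbitrary: H)
  case 0
  have "continuous_on (T \<times> cbox a b) H"
    using 0 by (auto intro: continuous_on_subset)
  then show ?case
    using integral_continuous_on_param[of T a b "\<lambda>z \<sigma>. H (z, \<sigma>)"] by (simp add: case_prod_unfold)
next
  case (Suc n)
  show ?case
    by (rule Ck_on_SucI[OF assms(1) has_derivative_integral_param[OF assms(1) Suc.prems]
        Suc.IH[OF Ck_on_SucD[OF Suc.prems]]])
qed

section \<open>Periodic functions on the line\<close>

lemma periodic_of_int:
  assumes "periodic P f"
  shows "f (t + of_int m * P) = f t"
proof -
  have nat: "f (t + of_nat n * P) = f t" for n t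
  proof (induction n arbitrary: t)
    case (Suc n)
    have "f (t + of_nat (Suc n) * P) = f ((t + of_nat n * P) + P)" by (simp add: algebra_simps)
    then show ?case using Suc assms unfolding periodic_def by metis
  qed simp
  show ?thesis
  proof (cases m rule: int_cases2)
    case (nonneg n)
    then show ?thesis using nat by simp
  next
    case (nonpos n)
    then show ?thesis using nat[of "t - of_nat n * P" n] by simp
  qed
qed

lemma periodic_shift_into:
  fixes t P :: real
  assumes "P > 0"
  obtains m :: int where "t + of_int m * P \<in> {0..P}"
proof
  have "of_int \<lfloor>t / P\<rfloor> * P \<le> t" "t < (of_int \<lfloor>t / P\<rfloor> + 1) * P"
    using assms floor_divide_lower floor_divide_upper by blast+
  then show "t + of_int (- \<lfloor>t / P\<rfloor>) * P \<in> {0..P}" by (auto simp: algebra_simps)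
qed

lemma periodic_all:
  assumes "P > 0" "periodic P f" "\<And>t. t \<in> {0..P} \<Longrightarrow> A (f t)"
  shows "A (f t)"
  using periodic_shift_into[OF assms(1), of t] periodic_of_int[OF assms(2)] assms(3) by metis

lemma periodic_image:
  assumes "P > 0" "periodic P f"
  shows "range f = f ` {0..P}"
  using periodic_all[OF assms, of "\<lambda>y. y \<in> f ` {0..P}"] by auto

lemma periodic_compact_range:
  fixes f :: "real \<Rightarrow> 'a::topological_space"
  assumes "P > 0" "periodic P f" "continuous_on UNIV f"
  shows "compact (range f)"
  unfolding periodic_image[OF assms(1,2)]
  using assms(3) continuous_on_subset by (intro compact_continuous_image) auto

lemma periodic_bounded:
  fixes f :: "real \<Rightarrow> real"
  assumes "P > 0" "periodic P f" "continuous_on UNIV f"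
  obtains B where "B > 0" "\<And>t. \<bar>f t\<bar> \<le> B"
  using compact_imp_bounded[OF periodic_compact_range[OF assms]] unfolding bounded_pos by auto

lemma periodic_pos_lower:
  fixes f :: "real \<Rightarrow> real"
  assumes "P > 0" "periodic P f" "continuous_on UNIV f" "\<And>t. f t > 0"
  obtains b where "b > 0" "\<And>t. b \<le> f t"
proof -
  obtain y where "y \<in> range f" "\<And>z. z \<in> range f \<Longrightarrow> y \<le> z"
    using compact_attains_inf[OF periodic_compact_range[OF assms(1-3)]] by auto
  then show ?thesis using that[of y] assms(4) by auto
qed

lemma periodic_deriv:
  fixes f :: "real \<Rightarrow> real"
  assumes "periodic P f" "\<And>t. (f has_real_derivative f' t) (at t)"
  shows "periodic P f'"
  unfolding periodic_def
proof
  fix t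
  have "((\<lambda>t. f (t + P)) has_real_derivative f' (t + P)) (at t)"
    using assms(2)[of "t + P"] DERIV_shift by blast
  moreover have "(\<lambda>t. f (t + P)) = f" using assms(1) by (auto simp: periodic_def)
  ultimately show "f' (t + P) = f' t" using assms(2) DERIV_unique by metis
qed

lemma ex_antiderivative:
  fixes f :: "real \<Rightarrow> real"
  assumes "continuous_on UNIV f"
  obtains F where "\<And>t. (F has_real_derivative f t) (at t)"
  using einterval_antiderivative[of "-\<infinity>" "\<infinity>" f] assms
  by (auto simp: continuous_on_eq_continuous_at real_vector_derivative)

lemma integral_shift_back:
  fixes F :: "real \<Rightarrow> real"
  assumes "\<And>t. (F has_real_derivative f t) (at t)" "P \<ge> 0"
  shows "integral {0..P} (\<lambda>\<sigma>. f (t - \<sigma>)) = F t - F (t - P)"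
proof -
  have "((\<lambda>\<sigma>. - F (t - \<sigma>)) has_real_derivative f (t - \<sigma>)) (at \<sigma>)" for \<sigma>
    by (auto intro!: derivative_eq_intros DERIV_chain2[OF assms(1)])
  then have "((\<lambda>\<sigma>. f (t - \<sigma>)) has_integral (- F (t - P) - (- F (t - 0)))) {0..P}"
    using assms(2) by (intro fundamental_theorem_of_calculus)
      (auto simp: real_vector_derivative intro: has_vector_derivative_at_within)
  then show ?thesis by (simp add: integral_unique)
qed

section \<open>The periodic inverse of an antiperiodic operator\<close>

text \<open>A second order operator \<open>h \<mapsto> h'' + a h\<close> all of whose solutions are \<open>P\<close>-antiperiodic; its
  inverse on periodic functions is \<open>g \<mapsto> G g\<close>, and \<open>H g\<close> is the derivative of \<open>G g\<close>.\<close>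

locale antiperiodic_operator =
  fixes P :: real and u1 u2 v1 v2 a :: "real \<Rightarrow> real" and m m' :: real
  assumes P_pos: "P > 0"
    and du1: "\<And>t. (u1 has_real_derivative v1 t) (at t)"
    and du2: "\<And>t. (u2 has_real_derivative v2 t) (at t)"
    and dv1: "\<And>t. (v1 has_real_derivative - a t * u1 t) (at t)"
    and dv2: "\<And>t. (v2 has_real_derivative - a t * u2 t) (at t)"
    and anti: "\<And>t. u1 (t + P) = - u1 t" "\<And>t. u2 (t + P) = - u2 t"
    and wronskian: "\<And>t. u1 t * v2 t - v1 t * u2 t = 2"
    and smooth_u: "\<And>n. Ck_on n u1 UNIV" "\<And>n. Ck_on n u2 UNIV"
    and smooth_v: "\<And>n. Ck_on n v1 UNIV" "\<And>n. Ck_on n v2 UNIV"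
    and smooth_a: "\<And>n. Ck_on n a UNIV"
    and periodic_a: "periodic P a"
    and m: "\<And>t. \<bar>u1 t\<bar> \<le> m" "\<And>t. \<bar>u2 t\<bar> \<le> m" 
    and m': "\<And>t. \<bar>v1 t\<bar> \<le> m'" "\<And>t. \<bar>v2 t\<bar> \<le> m'"
begin

definition contper :: "(real \<Rightarrow> real) \<Rightarrow> bool" where
  "contper g \<longleftrightarrow> continuous_on UNIV g \<and> periodic P g"

text \<open>The integral of \<open>u * g\<close> over the window from \<open>t - P\<close> to t.
  Writing it over the fixed interval makes its joint regularity in t and in parameters an instance
  of \<open>Ck_on_integral\<close>.\<close>

definition cmean :: "(real \<Rightarrow> real) \<Rightarrow> (real \<Rightarrow> real) \<Rightarrow> real \<Rightarrow> real" where
  "cmean u g t = integral {0..P} (\<lambda>\<sigma>. u (t - \<sigma>) * g (t - \<sigma>))"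

text \<open>Variation of constants. The 4 is the Wronskian 2 times the factor 2 by which
  antiperiodicity doubles the derivative of \<open>cmean\<close>.\<close>

definition G :: "(real \<Rightarrow> real) \<Rightarrow> real \<Rightarrow> real" where
  "G g t = (u2 t * cmean u1 g t - u1 t * cmean u2 g t) / 4"

definition H :: "(real \<Rightarrow> real) \<Rightarrow> real \<Rightarrow> real" where
  "H g t = (v2 t * cmean u1 g t - v1 t * cmean u2 g t) / 4"

text \<open>Sup norm bounds for \<open>G\<close> and \<open>H\<close>: two products, each at most
  \<open>m * (P * m)\<close> or \<open>m' * (P * m)\<close>, divided by 4. All contraction constants
  are measured against these two numbers.\<close>

definition M1 :: real where "M1 = P * m\<^sup>2 / 2"
definition M2 :: real where "M2 = P * m * m' / 2"

lemma contperD: "contper g \<Longrightarrow> continuous_on S g" "contper g \<Longrightarrow> periodic P g"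
  by (auto simp: contper_def intro: continuous_on_subset)

lemma anti_v: "v1 (t + P) = - v1 t" "v2 (t + P) = - v2 t"
proof -
  have "(w has_real_derivative w' t) (at t) \<Longrightarrow> (w has_real_derivative w' (t + P)) (at (t + P))
    \<Longrightarrow> (\<And>t. w (t + P) = - w t) \<Longrightarrow> w' (t + P) = - w' t" for w w' :: "real \<Rightarrow> real"
  proof -
    assume d: "(w has_real_derivative w' t) (at t)" "(w has_real_derivative w' (t + P)) (at (t + P))"
      and e: "\<And>t. w (t + P) = - w t"
    have "((\<lambda>t. w (t + P)) has_real_derivative w' (t + P)) (at t)"
      using d(2) DERIV_shift by blast
    moreover have "((\<lambda>t. - w t) has_real_derivative - w' t) (at t)"
      using d(1) by (rule DERIV_minus)
    ultimately show ?thesis unfolding e using DERIV_unique by blast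
  qed
  then show "v1 (t + P) = - v1 t" "v2 (t + P) = - v2 t" using du1 du2 anti by blast+
qed

lemma cont_u: "continuous_on S u1" "continuous_on S u2"
  using Ck_on_continuous[OF smooth_u(1)] Ck_on_continuous[OF smooth_u(2)]
    continuous_on_subset by blast+

lemma cmean_integrable:
  assumes "u = u1 \<or> u = u2" "contper g"
  shows "(\<lambda>\<sigma>. u (t - \<sigma>) * g (t - \<sigma>)) integrable_on {0..P}"
proof (rule integrable_continuous_real)
  have "continuous_on UNIV u" "continuous_on UNIV g" using assms cont_u contperD by auto
  then show "continuous_on {0..P} (\<lambda>\<sigma>. u (t - \<sigma>) * g (t - \<sigma>))"
    by (auto intro!: continuous_intros elim!: continuous_on_compose2)
qed

text \<open>At the rear end of the window u has changed sign while g has not, so the two boundary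
  terms add instead of cancelling.\<close>

lemma cmean_deriv:
  assumes "u = u1 \<or> u = u2" "contper g"
  shows "(cmean u g has_real_derivative 2 * u t * g t) (at t)"
proof -
  have "continuous_on UNIV (\<lambda>t. u t * g t)"
    using assms cont_u contperD by (auto intro!: continuous_intros)
  then obtain F where F: "\<And>t. (F has_real_derivative u t * g t) (at t)"
    using ex_antiderivative by blast
  have "cmean u g = (\<lambda>t. F t - F (t - P))"
    using integral_shift_back[OF F, of P] P_pos by (auto simp: cmean_def)
  moreover have "((\<lambda>t. F t - F (t - P)) has_real_derivative u t * g t - u (t - P) * g (t - P)) (at t)"
    by (auto intro!: derivative_eq_intros F DERIV_chain2[OF F])
  moreover have "u (t - P) = - u t" using assms(1) anti[of "t - P"] by auto
  moreover have "g (t - P) = g t"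
    using contperD(2)[OF assms(2)] by (metis diff_add_cancel periodic_def)
  ultimately show ?thesis by (simp add: algebra_simps)
qed

lemma G_deriv: "contper g \<Longrightarrow> (G g has_real_derivative H g t) (at t)"
  unfolding G_def[abs_def]
  by (auto intro!: derivative_eq_intros du1 du2 cmean_deriv simp: H_def field_simps)

lemma H_deriv:
  assumes "contper g"
  shows "(H g has_real_derivative g t - a t * G g t) (at t)"
proof -
  have "(H g has_real_derivative
     ((- a t * u2 t * cmean u1 g t + 2 * u1 t * g t * v2 t) -
      (- a t * u1 t * cmean u2 g t + 2 * u2 t * g t * v1 t)) / 4) (at t)"
    unfolding H_def[abs_def]
    by (auto intro!: derivative_eq_intros dv1 dv2 cmean_deriv assms)
  moreover have "((- a t * u2 t * cmean u1 g t + 2 * u1 t * g t * v2 t) -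
      (- a t * u1 t * cmean u2 g t + 2 * u2 t * g t * v1 t)) / 4
      = (u1 t * v2 t - v1 t * u2 t) * g t / 2 - a t * G g t"
    by (simp add: G_def field_simps)
  ultimately show ?thesis by (simp only: wronskian) (simp add: field_simps)
qed

lemma periodic_cmean:
  assumes "u = u1 \<or> u = u2" "contper g"
  shows "cmean u g (t + P) = - cmean u g t"
proof -
  have "u (t + P - \<sigma>) * g (t + P - \<sigma>) = - (u (t - \<sigma>) * g (t - \<sigma>))" for \<sigma>
    using assms(1) anti[of "t - \<sigma>"] contperD(2)[OF assms(2), unfolded periodic_def, rule_format, of "t - \<sigma>"]
    by (auto simp: algebra_simps)
  then show ?thesis by (simp add: cmean_def)
qed

lemma periodic_GH: "contper g \<Longrightarrow> periodic P (G g)" "contper g \<Longrightarrow> periodic P (H g)"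
  by (auto simp: periodic_def G_def H_def periodic_cmean anti anti_v)

lemma contper_GH: "contper g \<Longrightarrow> contper (G g)" "contper g \<Longrightarrow> contper (H g)"
  by (auto simp: contper_def periodic_GH intro!: continuous_at_imp_continuous_on
    DERIV_isCont[OF G_deriv] DERIV_isCont[OF H_deriv])

lemma m_nonneg: "m \<ge> 0" "m' \<ge> 0"
  using m(1)[of 0] m'(1)[of 0] by auto

lemma M_nonneg: "M1 \<ge> 0" "M2 \<ge> 0"
  using m_nonneg P_pos by (auto simp: M1_def M2_def)

lemma cmean_bound:
  assumes "u = u1 \<or> u = u2" "contper g" "\<And>t. \<bar>g t\<bar> \<le> B"
  shows "\<bar>cmean u g t\<bar> \<le> P * m * B"
proof -
  have "norm (integral {0..P} (\<lambda>\<sigma>. u (t - \<sigma>) * g (t - \<sigma>))) \<le> integral {0..P} (\<lambda>\<sigma>. m * B)"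
  proof (rule integral_norm_bound_integral[OF cmean_integrable[OF assms(1,2)]])
    show "norm (u (t - \<sigma>) * g (t - \<sigma>)) \<le> m * B" for \<sigma>
      using assms(1) m assms(3)[of "t - \<sigma>"] m_nonneg by (auto simp: abs_mult intro!: mult_mono)
  qed auto
  then show ?thesis using P_pos by (simp add: cmean_def algebra_simps)
qed

lemma GH_bound:
  assumes "contper g" "\<And>t. \<bar>g t\<bar> \<le> B"
  shows "\<bar>G g t\<bar> \<le> M1 * B" "\<bar>H g t\<bar> \<le> M2 * B"
proof -
  have c: "\<bar>cmean u1 g t\<bar> \<le> P * m * B" "\<bar>cmean u2 g t\<bar> \<le> P * m * B"
    using cmean_bound assms by auto
  have *: "\<bar>(x * c1 - y * c2) / 4\<bar> \<le> k * (P * m * B) / 2"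
    if "\<bar>x\<bar> \<le> k" "\<bar>y\<bar> \<le> k" "\<bar>c1\<bar> \<le> P * m * B" "\<bar>c2\<bar> \<le> P * m * B" for x y c1 c2 k :: real
  proof -
    have "\<bar>x * c1\<bar> \<le> k * (P * m * B)" "\<bar>y * c2\<bar> \<le> k * (P * m * B)"
      using that by (auto simp: abs_mult intro!: mult_mono)
    then show ?thesis by (simp add: abs_le_iff)
  qed
  show "\<bar>G g t\<bar> \<le> M1 * B" using *[OF m(2) m(1) c] by (simp add: G_def M1_def power2_eq_square algebra_simps)
  show "\<bar>H g t\<bar> \<le> M2 * B" using *[OF m'(2) m'(1) c] by (simp add: H_def M2_def power2_eq_square algebra_simps)
qed

lemma contper_lin: "contper g \<Longrightarrow> contper h \<Longrightarrow> contper (\<lambda>t. \<alpha> * g t + \<beta> * h t)"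
  by (auto simp: contper_def periodic_def intro!: continuous_intros)

lemma contper_diff: "contper g \<Longrightarrow> contper h \<Longrightarrow> contper (\<lambda>t. g t - h t)"
  by (auto simp: contper_def periodic_def intro!: continuous_intros)

lemma cmean_lin:
  assumes "u = u1 \<or> u = u2" "contper g" "contper h"
  shows "cmean u (\<lambda>t. \<alpha> * g t + \<beta> * h t) t = \<alpha> * cmean u g t + \<beta> * cmean u h t"
proof -
  have "integral {0..P} (\<lambda>\<sigma>. \<alpha> * (u (t - \<sigma>) * g (t - \<sigma>)) + \<beta> * (u (t - \<sigma>) * h (t - \<sigma>)))
    = \<alpha> * cmean u g t + \<beta> * cmean u h t"
    using integrable_cmul[OF cmean_integrable[OF assms(1,2)], where c=\<alpha>]
      integrable_cmul[OF cmean_integrable[OF assms(1,3)], where c=\<beta>]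
    by (subst integral_add) (auto simp: cmean_def)
  then show ?thesis by (simp add: cmean_def algebra_simps)
qed

lemma GH_lin:
  assumes "contper g" "contper h"
  shows "G (\<lambda>t. \<alpha> * g t + \<beta> * h t) t = \<alpha> * G g t + \<beta> * G h t"
    and "H (\<lambda>t. \<alpha> * g t + \<beta> * h t) t = \<alpha> * H g t + \<beta> * H h t"
  by (simp_all add: G_def H_def cmean_lin assms field_simps)

lemma GH_diff:
  assumes "contper g" "contper h"
  shows "G (\<lambda>t. g t - h t) t = G g t - G h t" "H (\<lambda>t. g t - h t) t = H g t - H h t"
  using GH_lin[OF assms, of 1 "-1"] by simp_all

text \<open>The Wronskian of a periodic solution with an antiperiodic one is constant and changes
  sign after a period, so it vanishes. Vanishing against both members of a fundamental system forces
  the solution to be zero.\<close>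

lemma homogeneous_zero:
  assumes y: "\<And>t. (y has_real_derivative z t) (at t)"
    and z: "\<And>t. (z has_real_derivative - a t * y t) (at t)"
    and per: "periodic P y" "periodic P z"
  shows "y t = 0" "z t = 0"
proof -
  have W: "y t * v t - z t * u t = 0"
    if u: "\<And>t. (u has_real_derivative v t) (at t)" "\<And>t. (v has_real_derivative - a t * u t) (at t)"
      "\<And>t. u (t + P) = - u t" "\<And>t. v (t + P) = - v t" for u v
  proof -
    have "((\<lambda>t. y t * v t - z t * u t) has_real_derivative 0) (at t)" for t
      by (auto intro!: derivative_eq_intros y z u simp: algebra_simps)
    then have "y (t + P) * v (t + P) - z (t + P) * u (t + P) = y t * v t - z t * u t"
      using DERIV_isconst_all by blast
    then show ?thesis using u(3,4) per by (simp add: periodic_def mult.commute)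
  qed
  have w: "y t * v1 t = z t * u1 t" "y t * v2 t = z t * u2 t"
    using W[OF du1 dv1 anti(1) anti_v(1)] W[OF du2 dv2 anti(2) anti_v(2)] by auto
  have "2 * y t = (u1 t * v2 t - v1 t * u2 t) * y t" by (simp only: wronskian)
  also have "\<dots> = u1 t * (y t * v2 t) - u2 t * (y t * v1 t)" by (simp add: algebra_simps)
  finally show "y t = 0" using w by simp
  have "2 * z t = (u1 t * v2 t - v1 t * u2 t) * z t" by (simp only: wronskian)
  also have "\<dots> = v2 t * (z t * u1 t) - v1 t * (z t * u2 t)" by (simp add: algebra_simps)
  finally show "z t = 0" using w[symmetric] by simp
qed

lemma G_unique:
  assumes y: "\<And>t. (y has_real_derivative z t) (at t)"
    and z: "\<And>t. (z has_real_derivative g t - a t * y t) (at t)"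
    and per: "periodic P y" and g: "contper g"
  shows "y = G g" "z = H g"
proof -
  have pz: "periodic P z" using periodic_deriv[OF per y] .
  have "y t - G g t = 0 \<and> z t - H g t = 0" for t
  proof (rule conjI)
    have 1: "((\<lambda>t. y t - G g t) has_real_derivative z t - H g t) (at t)" for t
      by (intro DERIV_diff y G_deriv g)
    have 2: "((\<lambda>t. z t - H g t) has_real_derivative - a t * (y t - G g t)) (at t)" for t
      by (rule DERIV_cong[OF DERIV_diff[OF z H_deriv[OF g]]]) (simp add: algebra_simps)
    have 3: "periodic P (\<lambda>t. y t - G g t)" "periodic P (\<lambda>t. z t - H g t)"
      using per pz periodic_GH[OF g] by (auto simp: periodic_def)
    show "y t - G g t = 0" using homogeneous_zero(1)[OF 1 2 3] .
    show "z t - H g t = 0" using homogeneous_zero(2)[OF 1 2 3] .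
  qed
  then show "y = G g" "z = H g" by (auto simp: fun_eq_iff)
qed

lemma Ck_on_GH:
  fixes g :: "'p::euclidean_space \<times> real \<Rightarrow> real"
  assumes "open S" "Ck_on n g (S \<times> UNIV)"
  shows "Ck_on n (\<lambda>z. G (\<lambda>t. g (fst z, t)) (snd z)) (S \<times> UNIV)"
    and "Ck_on n (\<lambda>z. H (\<lambda>t. g (fst z, t)) (snd z)) (S \<times> UNIV)"
proof -
  have oS: "open (S \<times> (UNIV::real set))" "open ((S \<times> (UNIV::real set)) \<times> (UNIV::real set))"
    using assms(1) by (auto simp: open_Times)
  have cm: "Ck_on n (\<lambda>z. cmean u (\<lambda>t. g (fst z, t)) (snd z)) (S \<times> UNIV)"
    if u: "Ck_on n u UNIV" for u
    unfolding cmean_def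
  proof (rule Ck_on_integral[OF oS(1), where H="\<lambda>w. u (snd (fst w) - snd w) * g (fst (fst w), snd (fst w) - snd w)", simplified])
    show "Ck_on n (\<lambda>w. u (snd (fst w) - snd w) * g (fst (fst w), snd (fst w) - snd w)) ((S \<times> UNIV) \<times> UNIV)"
      by (intro Ck_on_mult oS(2) Ck_on_compose[OF oS(2) open_UNIV _ u] Ck_on_compose[OF oS(2) oS(1) _ assms(2)] Ck_intros)
        auto
  qed
  have c: "Ck_on n (\<lambda>z. w (snd z)) (S \<times> UNIV)" if "Ck_on n w UNIV" for w :: "real \<Rightarrow> real"
    by (intro Ck_on_compose[OF oS(1) open_UNIV _ that] Ck_intros oS(1)) auto
  show "Ck_on n (\<lambda>z. G (\<lambda>t. g (fst z, t)) (snd z)) (S \<times> UNIV)"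
    unfolding G_def by (intro Ck_intros oS(1) cm c smooth_u smooth_v) auto
  show "Ck_on n (\<lambda>z. H (\<lambda>t. g (fst z, t)) (snd z)) (S \<times> UNIV)"
    unfolding H_def by (intro Ck_intros oS(1) cm c smooth_u smooth_v) auto
qed

section \<open>The contraction and the dependence of its fixed point on parameters\<close>

lemma contper_sup:
  assumes "contper f"
  obtains B where "\<And>t. \<bar>f t\<bar> \<le> B" "\<And>c. (\<And>t. \<bar>f t\<bar> \<le> c) \<Longrightarrow> B \<le> c" "B \<ge> 0"
proof (rule that)
  obtain b where b: "\<And>t. \<bar>f t\<bar> \<le> b"
    using periodic_bounded[OF P_pos] assms unfolding contper_def by metis
  have bdd: "bdd_above (range (\<lambda>t. \<bar>f t\<bar>))"
    unfolding bdd_above_def using b by (intro exI[of _ b]) auto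
  show *: "\<bar>f t\<bar> \<le> (SUP t. \<bar>f t\<bar>)" for t using bdd by (intro cSUP_upper) auto
  show "(SUP t. \<bar>f t\<bar>) \<le> c" if "\<And>t. \<bar>f t\<bar> \<le> c" for c using that by (intro cSUP_least) auto
  show "(SUP t. \<bar>f t\<bar>) \<ge> 0" using *[of 0] by linarith
qed

lemma GH_zero: "contper (\<lambda>_. 0)" "G (\<lambda>_. 0) t = 0" "H (\<lambda>_. 0) t = 0"
  by (simp_all add: contper_def periodic_def G_def H_def cmean_def)

text \<open>With contraction factor 1/2, the sup distance B from an exact to an approximate fixed
  point satisfies \<open>B \<le> B / 2 + e\<close>. Uniqueness is the case \<open>e = 0\<close>;
  continuity in parameters and in the warp is obtained by reading e as the effect of the
  change.\<close>

lemma fixed_point_stable: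
  assumes g: "contper g" "\<And>t. (G g t, H g t) \<in> W t" "\<And>t. g t = N t (G g t) (H g t)"
    and h: "contper h" "\<And>t. (G h t, H h t) \<in> W t" "\<And>t. \<bar>N t (G h t) (H h t) - h t\<bar> \<le> e"
    and lip: "\<And>t x y x' y'. (x, y) \<in> W t \<Longrightarrow> (x', y') \<in> W t \<Longrightarrow>
        \<bar>N t x y - N t x' y'\<bar> \<le> \<alpha> * \<bar>x - x'\<bar> + \<beta> * \<bar>y - y'\<bar>"
    and ab: "\<alpha> \<ge> 0" "\<beta> \<ge> 0" "\<alpha> * M1 + \<beta> * M2 \<le> 1/2"
  shows "\<bar>g t - h t\<bar> \<le> 2 * e"
proof -
  obtain B where B: "\<And>t. \<bar>g t - h t\<bar> \<le> B" "\<And>c. (\<And>t. \<bar>g t - h t\<bar> \<le> c) \<Longrightarrow> B \<le> c" "B \<ge> 0"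
    using contper_sup[OF contper_diff[OF g(1) h(1)]] by blast
  have b: "\<bar>G g t - G h t\<bar> \<le> M1 * B" "\<bar>H g t - H h t\<bar> \<le> M2 * B" for t
    using GH_bound[OF contper_diff[OF g(1) h(1)] B(1)] GH_diff[OF g(1) h(1)] by auto
  have "\<bar>g t - h t\<bar> \<le> B / 2 + e" for t
  proof -
    have "\<bar>g t - h t\<bar> \<le> \<bar>N t (G g t) (H g t) - N t (G h t) (H h t)\<bar> + e"
      using g(3)[of t] h(3)[of t] by linarith
    also have "\<dots> \<le> \<alpha> * \<bar>G g t - G h t\<bar> + \<beta> * \<bar>H g t - H h t\<bar> + e"
      using lip[OF g(2) h(2)] by simp
    also have "\<dots> \<le> \<alpha> * (M1 * B) + \<beta> * (M2 * B) + e"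
      using b ab by (intro add_mono mult_left_mono) auto
    also have "\<dots> = (\<alpha> * M1 + \<beta> * M2) * B + e" by (simp add: algebra_simps)
    also have "\<dots> \<le> 1/2 * B + e" using ab B(3) by (intro add_right_mono mult_right_mono) auto
    finally show ?thesis by simp
  qed
  then have "B \<le> B / 2 + e" by (rule B(2))
  then show ?thesis using B(1)[of t] by linarith
qed

text \<open>The R-ball around \<open>ga\<close> is invariant because the contraction contributes at
  most \<open>R / 2\<close> and the defect of the centre at most \<open>R / 2\<close>. The sets
  \<open>W t\<close> are the regions on which N is under control.\<close>

lemma fixed_point_exists:
  assumes ga: "contper ga" "R \<ge> 0"
    and W: "\<And>g t. contper g \<Longrightarrow> (\<And>t. \<bar>g t - ga t\<bar> \<le> R) \<Longrightarrow> (G g t, H g t) \<in> W t"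
    and N: "\<And>g. contper g \<Longrightarrow> (\<And>t. \<bar>g t - ga t\<bar> \<le> R) \<Longrightarrow> contper (\<lambda>t. N t (G g t) (H g t))"
    and lip: "\<And>t x y x' y'. (x, y) \<in> W t \<Longrightarrow> (x', y') \<in> W t \<Longrightarrow>
        \<bar>N t x y - N t x' y'\<bar> \<le> \<alpha> * \<bar>x - x'\<bar> + \<beta> * \<bar>y - y'\<bar>"
    and ab: "\<alpha> \<ge> 0" "\<beta> \<ge> 0" "\<alpha> * M1 + \<beta> * M2 \<le> 1/2"
    and defect: "\<And>t. \<bar>N t (G ga t) (H ga t) - ga t\<bar> \<le> R / 2"
  shows "\<exists>g. contper g \<and> (\<forall>t. \<bar>g t - ga t\<bar> \<le> R) \<and> (\<forall>t. g t = N t (G g t) (H g t))"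
proof -
  have bc: "apply_bcontfun (Bcontfun g) = g" if "contper g" for g
  proof -
    obtain B where "\<And>t. \<bar>g t\<bar> \<le> B" using contper_sup[OF \<open>contper g\<close>] by metis
    then have "g \<in> bcontfun" using contperD(1)[OF that] by (intro bcontfun_normI) auto
    then show ?thesis by (rule Bcontfun_inverse)
  qed
  \<comment> \<open>Periodicity and the distance bound survive pointwise limits, so D is closed in
    the complete space of bounded continuous functions.\<close>
  define D where "D = {w :: real \<Rightarrow>\<^sub>C real. (\<forall>t. w (t + P) = w t) \<and> (\<forall>t. \<bar>w t - ga t\<bar> \<le> R)}"
  define \<Psi> where "\<Psi> w = Bcontfun (\<lambda>t. N t (G (apply_bcontfun w) t) (H (apply_bcontfun w) t))" for w
  have Dc: "contper (apply_bcontfun w)" "\<And>t. \<bar>w t - ga t\<bar> \<le> R" if "w \<in> D" for w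
    using that by (auto simp: D_def contper_def periodic_def)
  have \<Psi>: "apply_bcontfun (\<Psi> w) t = N t (G (apply_bcontfun w) t) (H (apply_bcontfun w) t)" if "w \<in> D" for w t
    using bc[OF N[OF Dc[OF that]]] by (simp add: \<Psi>_def)
  have contr: "dist (\<Psi> w) (\<Psi> w') \<le> 1/2 * dist w w'" if "w \<in> D" "w' \<in> D" for w w'
  proof (rule dist_bound)
    fix t
    let ?d = "dist w w'"
    have b: "\<bar>apply_bcontfun w t - apply_bcontfun w' t\<bar> \<le> ?d" for t
      using dist_bounded[of w t w'] by (simp add: dist_real_def)
    have gb: "\<bar>G (apply_bcontfun w) t - G (apply_bcontfun w') t\<bar> \<le> M1 * ?d"
       "\<bar>H (apply_bcontfun w) t - H (apply_bcontfun w') t\<bar> \<le> M2 * ?d"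
      using GH_bound[OF contper_diff[OF Dc(1)[OF that(1)] Dc(1)[OF that(2)]] b]
        GH_diff[OF Dc(1)[OF that(1)] Dc(1)[OF that(2)]] by auto
    have "dist (\<Psi> w t) (\<Psi> w' t) \<le> \<alpha> * \<bar>G (apply_bcontfun w) t - G (apply_bcontfun w') t\<bar>
        + \<beta> * \<bar>H (apply_bcontfun w) t - H (apply_bcontfun w') t\<bar>"
      unfolding \<Psi>[OF that(1)] \<Psi>[OF that(2)] dist_real_def
      by (rule lip[OF W[OF Dc[OF that(1)]] W[OF Dc[OF that(2)]]])
    also have "\<dots> \<le> \<alpha> * (M1 * ?d) + \<beta> * (M2 * ?d)"
      using gb ab by (intro add_mono mult_left_mono) auto
    also have "\<dots> = (\<alpha> * M1 + \<beta> * M2) * ?d" by (simp add: algebra_simps)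
    also have "\<dots> \<le> 1/2 * ?d" using ab by (intro mult_right_mono) auto
    finally show "dist (\<Psi> w t) (\<Psi> w' t) \<le> 1/2 * ?d" .
  qed
  have gaD: "Bcontfun ga \<in> D"
    using ga contperD(2)[OF ga(1)] by (auto simp: D_def bc periodic_def)
  have "\<exists>!w\<in>D. \<Psi> w = w"
  proof (rule Banach_fix[where c="1/2"])
    show "complete D"
    proof (rule completeI)
      fix f assume f: "\<forall>n. f n \<in> D" "Cauchy f"
      then obtain l where l: "f \<longlonglongrightarrow> l" using Cauchy_convergent convergent_def by blast
      have pt: "(\<lambda>n. f n t) \<longlonglongrightarrow> l t" for t
      proof (rule tendsto_dist_iff[THEN iffD2], rule Lim_null_comparison)
        show "\<forall>\<^sub>F n in sequentially. norm (dist (f n t) (l t)) \<le> dist (f n) l"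
          using dist_bounded by (auto intro!: always_eventually)
        show "(\<lambda>n. dist (f n) l) \<longlonglongrightarrow> 0" using l tendsto_dist_iff by blast
      qed
      have "l (t + P) = l t" for t
        using pt[of "t + P"] pt[of t] f(1) LIMSEQ_unique by (auto simp: D_def)
      moreover have "\<bar>l t - ga t\<bar> \<le> R" for t
      proof (rule LIMSEQ_le_const2)
        show "(\<lambda>n. \<bar>f n t - ga t\<bar>) \<longlonglongrightarrow> \<bar>l t - ga t\<bar>" by (intro tendsto_intros pt)
        show "\<exists>N. \<forall>n\<ge>N. \<bar>f n t - ga t\<bar> \<le> R" using f(1) by (auto simp: D_def)
      qed
      ultimately show "\<exists>l\<in>D. f \<longlonglongrightarrow> l" using l by (auto simp: D_def)
    qed
    show "\<Psi> ` D \<subseteq> D"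
    proof
      fix x assume "x \<in> \<Psi> ` D"
      then obtain w where w: "w \<in> D" "x = \<Psi> w" by auto
      have b: "\<bar>apply_bcontfun w t - ga t\<bar> \<le> R" for t using Dc(2)[OF w(1)] .
      have gb: "\<bar>G (apply_bcontfun w) t - G ga t\<bar> \<le> M1 * R" "\<bar>H (apply_bcontfun w) t - H ga t\<bar> \<le> M2 * R" for t
        using GH_bound[OF contper_diff[OF Dc(1)[OF w(1)] ga(1)] b] GH_diff[OF Dc(1)[OF w(1)] ga(1)] by auto
      have "\<bar>x t - ga t\<bar> \<le> R" for t
      proof -
        have Wa: "(G ga t, H ga t) \<in> W t" using W[OF ga(1)] ga(2) by simp
        have "\<bar>x t - N t (G ga t) (H ga t)\<bar> \<le> \<alpha> * \<bar>G (apply_bcontfun w) t - G ga t\<bar>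
            + \<beta> * \<bar>H (apply_bcontfun w) t - H ga t\<bar>"
          unfolding w(2) \<Psi>[OF w(1)] by (rule lip[OF W[OF Dc[OF w(1)]] Wa])
        also have "\<dots> \<le> \<alpha> * (M1 * R) + \<beta> * (M2 * R)"
          using gb ab by (intro add_mono mult_left_mono) auto
        also have "\<dots> = (\<alpha> * M1 + \<beta> * M2) * R" by (simp add: algebra_simps)
        also have "\<dots> \<le> 1/2 * R" using ab ga(2) by (intro mult_right_mono) auto
        finally show ?thesis using defect[of t] by linarith
      qed
      moreover have "x (t + P) = x t" for t
        using contperD(2)[OF N[OF Dc[OF w(1)]]] \<Psi>[OF w(1)] w(2) by (simp add: periodic_def)
      ultimately show "x \<in> D" by (simp add: D_def)
    qed
  qed (use gaD contr in auto)
  then obtain w where w: "w \<in> D" "\<Psi> w = w" by blast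
  then show ?thesis using Dc[OF w(1)] \<Psi>[OF w(1)] by metis
qed

lemma contper_bound_all:
  assumes "contper f" "\<And>t. t \<in> {0..P} \<Longrightarrow> \<bar>f t\<bar> \<le> e"
  shows "\<bar>f t\<bar> \<le> e"
  using periodic_all[OF P_pos contperD(2)[OF assms(1)], of "\<lambda>y. \<bar>y\<bar> \<le> e"] assms(2) by auto

text \<open>The fixed point at \<open>p0\<close> is an approximate fixed point for every nearby p.
  Its defect is small uniformly over one period by compactness, and periodicity extends this to the
  line; stability then gives closeness uniformly in t.\<close>

lemma family_continuous:
  fixes g :: "'p::euclidean_space \<times> real \<Rightarrow> real" and N :: "real \<times> real \<times> real \<times> 'p \<Rightarrow> real"
  assumes S: "open S" and Om: "open \<Omega>" and N: "continuous_on \<Omega> N"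
    and per: "\<And>t x y p. (t, x, y, p) \<in> \<Omega> \<Longrightarrow> (t + P, x, y, p) \<in> \<Omega> \<and> N (t + P, x, y, p) = N (t, x, y, p)"
    and W: "\<And>t x y p. p \<in> S \<Longrightarrow> (x, y) \<in> W t \<Longrightarrow> (t, x, y, p) \<in> \<Omega>"
    and lip: "\<And>p t x y x' y'. p \<in> S \<Longrightarrow> (x, y) \<in> W t \<Longrightarrow> (x', y') \<in> W t \<Longrightarrow>
        \<bar>N (t, x, y, p) - N (t, x', y', p)\<bar> \<le> \<alpha> * \<bar>x - x'\<bar> + \<beta> * \<bar>y - y'\<bar>"
    and ab: "\<alpha> \<ge> 0" "\<beta> \<ge> 0" "\<alpha> * M1 + \<beta> * M2 \<le> 1/2"
    and g: "\<And>p. p \<in> S \<Longrightarrow> contper (\<lambda>t. g (p, t))"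
      "\<And>p t. p \<in> S \<Longrightarrow> (G (\<lambda>t. g (p, t)) t, H (\<lambda>t. g (p, t)) t) \<in> W t"
      "\<And>p t. p \<in> S \<Longrightarrow> g (p, t) = N (t, G (\<lambda>t. g (p, t)) t, H (\<lambda>t. g (p, t)) t, p)"
  shows "continuous_on (S \<times> UNIV) g"
proof (rule continuous_at_imp_continuous_on, rule ballI)
  fix z assume "z \<in> S \<times> (UNIV :: real set)"
  then obtain p0 t0 where z: "z = (p0, t0)" "p0 \<in> S" by auto
  let ?x = "G (\<lambda>t. g (p0, t))" and ?y = "H (\<lambda>t. g (p0, t))"
  have cxy: "continuous_on UNIV ?x" "continuous_on UNIV ?y"
    using contper_GH[OF g(1)[OF z(2)]] contperD by auto
  have pxy: "?x (t + P) = ?x t" "?y (t + P) = ?y t" for t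
    using periodic_GH[OF g(1)[OF z(2)]] by (auto simp: periodic_def)
  have cN: "continuous_on (S \<times> UNIV) (\<lambda>(p, t). N (t, ?x t, ?y t, p))"
    unfolding case_prod_unfold using W g(2)[OF z(2)]
    by (intro continuous_on_compose2[OF N] continuous_on_Pair continuous_on_snd continuous_on_fst
        continuous_on_id continuous_on_compose2[OF cxy(1)] continuous_on_compose2[OF cxy(2)]) auto
  have near: "\<exists>d>0. \<forall>p\<in>S. dist p p0 < d \<longrightarrow> (\<forall>t. \<bar>g (p, t) - g (p0, t)\<bar> \<le> 2 * e)" if e: "e > 0" for e
  proof -
    obtain X0 where X0: "p0 \<in> X0" "open X0"
      "\<forall>p\<in>X0 \<inter> S. \<forall>t\<in>{0..P}. dist (N (t, ?x t, ?y t, p)) (N (t, ?x t, ?y t, p0)) \<le> e"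
    proof (rule continuous_on_prod_compactE[OF continuous_on_subset[OF cN] compact_Icc[of 0 P] z(2) e])
      show "S \<times> {0..P} \<subseteq> S \<times> UNIV" by auto
    qed auto
    obtain d where d: "d > 0" "ball p0 d \<subseteq> X0" using X0 openE by blast
    have "\<bar>g (p, t) - g (p0, t)\<bar> \<le> 2 * e" if p: "p \<in> S" "dist p p0 < d" for p t
    proof (rule fixed_point_stable[where g="\<lambda>t. g (p, t)" and h="\<lambda>t. g (p0, t)"
        and N="\<lambda>t x y. N (t, x, y, p)" and W=W and \<alpha>=\<alpha> and \<beta>=\<beta>,
        OF g(1)[OF p(1)] g(2)[OF p(1)] g(3)[OF p(1)] g(1)[OF z(2)] g(2)[OF z(2)] _ lip[OF p(1)] ab])
      fix t
      let ?f = "\<lambda>t. N (t, ?x t, ?y t, p) - g (p0, t)"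
      have "contper (\<lambda>t. N (t, ?x t, ?y t, p))"
        unfolding contper_def
      proof
        have "continuous_on UNIV (\<lambda>t. (\<lambda>(p, t). N (t, ?x t, ?y t, p)) (p, t))"
          by (rule continuous_on_compose2[OF cN]) (use p in \<open>auto intro!: continuous_intros\<close>)
        then show "continuous_on UNIV (\<lambda>t. N (t, ?x t, ?y t, p))" by simp
        show "periodic P (\<lambda>t. N (t, ?x t, ?y t, p))"
          using pxy per W[OF p(1) g(2)[OF z(2)]] by (auto simp: periodic_def)
      qed
      then have "contper ?f" using g(1)[OF z(2)] by (rule contper_diff)
      moreover have "\<bar>?f t\<bar> \<le> e" if "t \<in> {0..P}" for t
      proof -
        have "p \<in> X0" using p(2) d(2) by (auto simp: dist_commute)
        then show ?thesis using X0(3) p(1) that g(3)[OF z(2), of t] by (auto simp: dist_real_def)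
      qed
      ultimately show "\<bar>?f t\<bar> \<le> e" by (rule contper_bound_all)
    qed
    then show ?thesis using d(1) by auto
  qed
  show "isCont g z"
    unfolding continuous_at_eps_delta z(1)
  proof (intro allI impI)
    fix e :: real assume e: "e > 0"
    obtain d where d: "d > 0" "\<And>p t. p \<in> S \<Longrightarrow> dist p p0 < d \<Longrightarrow> \<bar>g (p, t) - g (p0, t)\<bar> \<le> 2 * (e / 8)"
      using near[of "e / 8"] e by auto
    obtain d2 where d2: "d2 > 0" "ball p0 d2 \<subseteq> S" using S z(2) openE by blast
    have "isCont (\<lambda>t. g (p0, t)) t0"
      using contperD(1)[OF g(1)[OF z(2)], of UNIV] by (simp add: continuous_on_eq_continuous_at)
    then obtain d3 where d3: "d3 > 0" "\<And>t. dist t t0 < d3 \<Longrightarrow> \<bar>g (p0, t) - g (p0, t0)\<bar> < e / 2"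
      unfolding continuous_at_eps_delta using e by (metis dist_real_def half_gt_zero)
    show "\<exists>d>0. \<forall>x'. dist x' (p0, t0) < d \<longrightarrow> dist (g x') (g (p0, t0)) < e"
    proof (intro exI[of _ "min d (min d2 d3)"] conjI allI impI)
      fix x' :: "'p \<times> real" assume x': "dist x' (p0, t0) < min d (min d2 d3)"
      obtain p t where pt: "x' = (p, t)" by (cases x')
      have "dist p p0 < min d (min d2 d3)" "dist t t0 < min d (min d2 d3)"
        using x' dist_fst_le[of x' "(p0, t0)"] dist_snd_le[of x' "(p0, t0)"] by (auto simp: pt)
      then have "\<bar>g (p, t) - g (p0, t)\<bar> \<le> 2 * (e / 8)" "\<bar>g (p0, t) - g (p0, t0)\<bar> < e / 2"
        using d(2)[of p t] d3(2)[of t] d2(2) by (auto simp: dist_commute subset_iff)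
      then show "dist (g x') (g (p0, t0)) < e" unfolding pt dist_real_def using e by linarith
    qed (use d d2 d3 in auto)
  qed
qed

lemma shift_derivative:
  fixes N :: "real \<times> 'q::real_normed_vector \<Rightarrow> real"
  assumes "open \<Omega>" "\<And>t q. (t, q) \<in> \<Omega> \<Longrightarrow> (t + P, q) \<in> \<Omega> \<and> N (t + P, q) = N (t, q)"
    and "Ck_on (Suc n) N \<Omega>" "(t, q) \<in> \<Omega>"
  shows "fderiv N (t + P, q) = fderiv N (t, q)"
proof -
  have "(N has_derivative fderiv N (t + P, q)) (at ((t, q) + (P, 0)))"
    using Ck_on_Suc_has_derivative[OF assms(1,3)] assms(2)[OF assms(4)] by simp
  moreover have "((\<lambda>z. z + (P, 0)) has_derivative (\<lambda>v. v)) (at (t, q))"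
    by (auto intro!: derivative_eq_intros)
  ultimately have "((\<lambda>z. N (z + (P, 0))) has_derivative fderiv N (t + P, q)) (at (t, q))"
    using has_derivative_compose by blast
  then have "(N has_derivative fderiv N (t + P, q)) (at (t, q))"
    by (rule has_derivative_transform_within_open[OF _ assms(1,4)]) (use assms(2) in auto)
  then show ?thesis using frechet_derivative_at by blast
qed

text \<open>This turns the Lipschitz hypothesis into a bound on partial derivatives with the same
  constants, so the linearized fixed point equation contracts exactly as well as the nonlinear
  one.\<close>

lemma lipschitz_imp_derivative_bound:
  fixes N :: "real \<times> real \<times> real \<times> 'p::euclidean_space \<Rightarrow> real"
  assumes "open W" "(x, y) \<in> W" "(N has_derivative DN) (at (t, x, y, p))"
    and lip: "\<And>x y x' y'. (x, y) \<in> W \<Longrightarrow> (x', y') \<in> W \<Longrightarrow>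
        \<bar>N (t, x, y, p) - N (t, x', y', p)\<bar> \<le> \<alpha> * \<bar>x - x'\<bar> + \<beta> * \<bar>y - y'\<bar>"
  shows "\<bar>DN (0, h, k, 0)\<bar> \<le> \<alpha> * \<bar>h\<bar> + \<beta> * \<bar>k\<bar>"
proof -
  have "((\<lambda>s. (t, x + s * h, y + s * k, p)) has_derivative (\<lambda>s. (0, s * h, s * k, 0))) (at 0)"
    by (auto intro!: derivative_eq_intros)
  then have "((\<lambda>s. N (t, x + s * h, y + s * k, p)) has_derivative (\<lambda>s. DN (0, s * h, s * k, 0))) (at 0)"
    by (rule has_derivative_compose) (use assms(3) in simp)
  moreover have "DN (0, s * h, s * k, 0) = DN (0, h, k, 0) * s" for s :: real
    using linear_cmul[OF has_derivative_linear[OF assms(3)], of s "(0, h, k, 0)"] by simp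
  ultimately have "((\<lambda>s. N (t, x + s * h, y + s * k, p)) has_real_derivative DN (0, h, k, 0)) (at 0)"
    by (simp add: has_field_derivative_def)
  then have lim: "((\<lambda>s. (N (t, x + s * h, y + s * k, p) - N (t, x, y, p)) / s) \<longlongrightarrow> DN (0, h, k, 0)) (at 0)"
    unfolding DERIV_def by simp
  have "((\<lambda>s. (x + s * h, y + s * k)) \<longlongrightarrow> (x + 0 * h, y + 0 * k)) (at (0::real))"
    by (intro tendsto_intros)
  then have "\<forall>\<^sub>F s in at (0::real). (x + s * h, y + s * k) \<in> W"
    using topological_tendstoD assms(1,2) by fastforce
  moreover have "\<forall>\<^sub>F s in at (0::real). s \<noteq> 0" by (simp add: eventually_at_filter)
  ultimately have "\<forall>\<^sub>F s in at (0::real). \<bar>(N (t, x + s * h, y + s * k, p) - N (t, x, y, p)) / s\<bar> \<le> \<alpha> * \<bar>h\<bar> + \<beta> * \<bar>k\<bar>"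
  proof eventually_elim
    case (elim s)
    have "\<bar>N (t, x + s * h, y + s * k, p) - N (t, x, y, p)\<bar> \<le> \<bar>s\<bar> * (\<alpha> * \<bar>h\<bar> + \<beta> * \<bar>k\<bar>)"
      using lip[OF elim(1) assms(2)] by (simp add: abs_mult algebra_simps)
    then show ?case using elim(2) by (simp add: divide_le_eq mult.commute)
  qed
  moreover have "((\<lambda>s. \<bar>(N (t, x + s * h, y + s * k, p) - N (t, x, y, p)) / s\<bar>) \<longlongrightarrow> \<bar>DN (0, h, k, 0)\<bar>) (at 0)"
    using lim by (rule tendsto_rabs)
  ultimately show ?thesis
    by (intro tendsto_upperbound[where F="at (0::real)"]) auto
qed

text \<open>The derivative of the fixed point in a direction v solves the linearized fixed point
  equation, which is again of the form treated here, with the same \<alpha> and \<beta> and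
  coefficients one order less regular. The hypotheses are chained implications so that the induction
  can vary \<open>N\<close>, its domain, \<open>W\<close> and \<open>g\<close>.\<close>

lemma family_Ck_on:
  fixes g :: "'p::euclidean_space \<times> real \<Rightarrow> real" and N :: "real \<times> real \<times> real \<times> 'p \<Rightarrow> real"
  assumes S: "open S" and ab: "\<alpha> \<ge> 0" "\<beta> \<ge> 0" "\<alpha> * M1 + \<beta> * M2 \<le> 1/2"
  shows "open \<Omega> \<Longrightarrow> Ck_on n N \<Omega> \<Longrightarrow> (\<And>t. open (W t)) \<Longrightarrow>
    (\<And>t x y p. (t, x, y, p) \<in> \<Omega> \<Longrightarrow> (t + P, x, y, p) \<in> \<Omega> \<and> N (t + P, x, y, p) = N (t, x, y, p)) \<Longrightarrow>
    (\<And>t x y p. p \<in> S \<Longrightarrow> (x, y) \<in> W t \<Longrightarrow> (t, x, y, p) \<in> \<Omega>) \<Longrightarrow>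
    (\<And>p t x y x' y'. p \<in> S \<Longrightarrow> (x, y) \<in> W t \<Longrightarrow> (x', y') \<in> W t \<Longrightarrow>
        \<bar>N (t, x, y, p) - N (t, x', y', p)\<bar> \<le> \<alpha> * \<bar>x - x'\<bar> + \<beta> * \<bar>y - y'\<bar>) \<Longrightarrow>
    (\<And>p. p \<in> S \<Longrightarrow> contper (\<lambda>t. g (p, t))) \<Longrightarrow>
    (\<And>p t. p \<in> S \<Longrightarrow> (G (\<lambda>t. g (p, t)) t, H (\<lambda>t. g (p, t)) t) \<in> W t) \<Longrightarrow>
    (\<And>p t. p \<in> S \<Longrightarrow> g (p, t) = N (t, G (\<lambda>t. g (p, t)) t, H (\<lambda>t. g (p, t)) t, p)) \<Longrightarrow>
    Ck_on n g (S \<times> UNIV)"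
proof (induction n arbitrary: N \<Omega> W g)
  case 0
  show ?case unfolding Ck_on.simps
    by (rule family_continuous[OF S 0(1) 0(2)[unfolded Ck_on.simps] 0(4) 0(5) 0(6) ab 0(7) 0(8) 0(9)])
next
  case (Suc n)
  note Om = Suc.prems(1) and N = Suc.prems(2) and oW = Suc.prems(3) and per = Suc.prems(4)
    and W = Suc.prems(5) and lip = Suc.prems(6) and g = Suc.prems(7-9)
  \<comment> \<open>Regularity of order n comes first: it makes the coefficients of the linearized
    equation, taken along the solution, of class n.\<close>
  have Ckg: "Ck_on n g (S \<times> UNIV)"
    by (rule Suc.IH[OF Om Ck_on_Suc_imp[OF N] oW per W lip g])
  have oS: "open (S \<times> (UNIV :: real set))" using S by (simp add: open_Times)
  define x where "x p = G (\<lambda>t. g (p, t))" for p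
  define y where "y p = H (\<lambda>t. g (p, t))" for p
  define D where "D p t = fderiv N (t, x p t, y p t, p)" for p t
  have xiOm: "(t, x p t, y p t, p) \<in> \<Omega>" if "p \<in> S" for p t
    using W[OF that g(2)[OF that]] by (simp add: x_def y_def)
  have Dd: "(N has_derivative D p t) (at (t, x p t, y p t, p))" if "p \<in> S" for p t
    unfolding D_def by (rule Ck_on_Suc_has_derivative[OF Om N xiOm[OF that]])
  have Nx: "N (t, x p t, y p t, p) = g (p, t)" if "p \<in> S" for p t
    unfolding x_def y_def by (rule g(3)[OF that, symmetric])
  have Dlin: "linear (D p t)" if "p \<in> S" for p t
    using has_derivative_linear[OF Dd[OF that]] .
  define A where "A p t = D p t (0, 1, 0, 0)" for p t
  define B where "B p t = D p t (0, 0, 1, 0)" for p t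
  define T where "T p t = D p t (1, 0, 0, 0)" for p t
  define E where "E v p t = D p t (0, 0, 0, v)" for v p t
  note coef_defs = A_def B_def T_def E_def
  have Dexp: "D p t (\<tau>, h, k, v) = \<tau> * T p t + h * A p t + k * B p t + E v p t" if "p \<in> S" for p t \<tau> h k v
  proof -
    have "(\<tau>, h, k, v) = \<tau> *\<^sub>R (1, 0, 0, 0) + h *\<^sub>R (0, 1, 0, 0) + k *\<^sub>R (0, 0, 1, 0) + (0, 0, 0, v)" by simp
    then show ?thesis by (simp only: linear_add[OF Dlin[OF that]] linear_cmul[OF Dlin[OF that]] real_scaleR_def coef_defs)
  qed
  have Dbound: "\<bar>D p t (0, h, k, 0)\<bar> \<le> \<alpha> * \<bar>h\<bar> + \<beta> * \<bar>k\<bar>" if "p \<in> S" for p t h k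
    by (rule lipschitz_imp_derivative_bound[OF oW[of t] g(2)[OF that] Dd[OF that, unfolded x_def y_def] lip[OF that]])
  have xp: "x p (t + P) = x p t" "y p (t + P) = y p t" if "p \<in> S" for p t
    using periodic_GH[OF g(1)[OF that]] by (auto simp: x_def y_def periodic_def)
  have Dper: "D p (t + P) = D p t" if "p \<in> S" for p t
    unfolding D_def xp[OF that]
    by (rule shift_derivative[OF Om _ N xiOm[OF that]]) (use per in auto)
  have Ckx: "Ck_on n (\<lambda>z. x (fst z) (snd z)) (S \<times> UNIV)" "Ck_on n (\<lambda>z. y (fst z) (snd z)) (S \<times> UNIV)"
    unfolding x_def y_def using Ck_on_GH[OF S Ckg] by auto
  have CkD: "Ck_on n (\<lambda>z. D (fst z) (snd z) w) (S \<times> UNIV)" for w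
    unfolding D_def
    by (rule Ck_on_compose[OF oS Om _ Ck_on_SucD[OF N]])
      (auto intro!: Ck_on_Pair Ckx Ck_on_fst Ck_on_snd Ck_on_ident oS xiOm)
  have contD: "contper (\<lambda>t. D p t w)" if "p \<in> S" for p w
  proof -
    have "continuous_on UNIV (\<lambda>t. D (fst (p, t)) (snd (p, t)) w)"
      by (rule continuous_on_compose2[OF Ck_on_continuous[OF CkD]])
        (use that in \<open>auto intro!: continuous_intros\<close>)
    then show ?thesis using Dper[OF that] by (simp add: contper_def periodic_def)
  qed
  have lipD: "\<bar>(D p t (0, h, k, v) + r) - (D p t (0, h', k', v) + r)\<bar> \<le> \<alpha> * \<bar>h - h'\<bar> + \<beta> * \<bar>k - k'\<bar>"
    if "p \<in> S" for p t h k h' k' v r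
  proof -
    have "D p t (0, h, k, v) - D p t (0, h', k', v) = D p t (0, h - h', k - k', 0)"
      using linear_diff[OF Dlin[OF that], of t "(0, h, k, v)" "(0, h', k', v)"] by simp
    then show ?thesis using Dbound[OF that, of t "h - h'" "k - k'"] by simp
  qed
  have contD3: "contper (\<lambda>t. D p t (0, G h t, H h t, v))" if "p \<in> S" "contper h" for p h v
  proof -
    have "contper (\<lambda>t. G h t * A p t + H h t * B p t + E v p t)"
      unfolding coef_defs using contD[OF that(1)] contper_GH[OF that(2)]
      by (auto simp: contper_def periodic_def intro!: continuous_intros)
    then show ?thesis using that by (simp add: Dexp)
  qed
  have ex_gd: "\<exists>h. contper h \<and> (\<forall>t. h t = D p t (0, G h t, H h t, v))" if p: "p \<in> S" for p v
  proof -
    obtain b where b: "\<And>t. \<bar>D p t (0, 0, 0, v)\<bar> \<le> b" "b \<ge> 0"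
      using contper_sup[OF contD[OF p]] by metis
    note z = GH_zero(1) and G0 = GH_zero(2,3)
    have "\<exists>h. contper h \<and> (\<forall>t. \<bar>h t - 0\<bar> \<le> 2 * b) \<and> (\<forall>t. h t = (D p t (0, G h t, H h t, v) + 0))"
      by (rule fixed_point_exists[where N="\<lambda>t h k. D p t (0, h, k, v) + 0" and W="\<lambda>t. UNIV", OF z _ _ _ _ ab])
        (use b lipD[OF p] contD3[OF p] in \<open>auto simp: G0\<close>)
    then show ?thesis by auto
  qed
  \<comment> \<open>The candidate for the derivative in direction v. The differential at p is
    assembled from these functions only after their linearity in v has been proved.\<close>
  define gd where "gd v p = (SOME h. contper h \<and> (\<forall>t. h t = D p t (0, G h t, H h t, v)))" for v p
  have gd: "contper (gd v p)" "gd v p t = D p t (0, G (gd v p) t, H (gd v p) t, v)" if "p \<in> S" for p v t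
    using someI_ex[OF ex_gd[OF that, of v]] unfolding gd_def by blast+
  have lin_stable: "\<bar>h t\<bar> \<le> 2 * e"
    if p: "p \<in> S" and h: "contper h" "\<And>t. h t = D p t (0, G h t, H h t, 0) + r t" and r: "\<And>t. \<bar>r t\<bar> \<le> e" for p h r e t
  proof -
    note z = GH_zero(1) and G0 = GH_zero(2,3)
    have D0: "D p t (0, 0, 0, 0) = 0" for t
      using linear_0[OF Dlin[OF p]] unfolding zero_prod_def .
    have "\<bar>h t - 0\<bar> \<le> 2 * e"
      by (rule fixed_point_stable[where g=h and h="\<lambda>t. 0" and N="\<lambda>t h k. D p t (0, h, k, 0) + r t" and W="\<lambda>t. UNIV", OF h(1) _ h(2) z _ _ _ ab])
        (use r lipD[OF p] in \<open>auto simp: G0 D0\<close>)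
    then show ?thesis by simp
  qed
  have Ckgd: "Ck_on n (\<lambda>z. gd v (fst z) (snd z)) (S \<times> UNIV)" for v
  \<comment> \<open>The linearized equation is affine on the whole plane, so W is everything and the
    only restriction left is \<open>p \<in> S\<close>.\<close>
  proof (rule Suc.IH[where \<Omega>="UNIV \<times> UNIV \<times> UNIV \<times> S" and W="\<lambda>t. UNIV" and
        N="\<lambda>z. D (snd (snd (snd z))) (fst z) (0, fst (snd z), fst (snd (snd z)), v)"])
    show oT: "open ((UNIV::real set) \<times> (UNIV::real set) \<times> (UNIV::real set) \<times> S)"
      using S by (simp add: open_Times)
    have c: "Ck_on n (\<lambda>z. D (snd (snd (snd z))) (fst z) w) ((UNIV::real set) \<times> (UNIV::real set) \<times> (UNIV::real set) \<times> S)" for w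
      by (rule Ck_on_compose[OF oT oS _ CkD[of w], where f="\<lambda>z. (snd (snd (snd z)), fst z)", simplified])
        (auto intro!: Ck_intros oT)
    have "Ck_on n (\<lambda>z. fst (snd z) * A (snd (snd (snd z))) (fst z)
      + fst (snd (snd z)) * B (snd (snd (snd z))) (fst z)
      + E v (snd (snd (snd z))) (fst z)) (UNIV \<times> UNIV \<times> UNIV \<times> S)"
      unfolding coef_defs by (intro Ck_on_add Ck_on_mult c oT Ck_on_fst Ck_on_snd Ck_on_ident)
    then show "Ck_on n (\<lambda>z. D (snd (snd (snd z))) (fst z) (0, fst (snd z), fst (snd (snd z)), v)) (UNIV \<times> UNIV \<times> UNIV \<times> S)"
      by (subst Ck_on_cong[OF oT]) (auto simp: Dexp)
    fix p t h k h' k'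
    assume p: "p \<in> S"
    show "\<bar>D (snd (snd (snd (t, h, k, p)))) (fst (t, h, k, p)) (0, fst (snd (t, h, k, p)), fst (snd (snd (t, h, k, p))), v)
      - D (snd (snd (snd (t, h', k', p)))) (fst (t, h', k', p)) (0, fst (snd (t, h', k', p)), fst (snd (snd (t, h', k', p))), v)\<bar>
      \<le> \<alpha> * \<bar>h - h'\<bar> + \<beta> * \<bar>k - k'\<bar>"
      using lipD[OF p, of t h k v 0 h' k'] by simp
  next
    fix p t assume p: "p \<in> S"
    show "contper (\<lambda>t. gd v (fst (p, t)) (snd (p, t)))" using gd(1)[OF p] by simp
    show "gd v (fst (p, t)) (snd (p, t)) = D (snd (snd (snd (t, G (\<lambda>t. gd v (fst (p, t)) (snd (p, t))) t,
        H (\<lambda>t. gd v (fst (p, t)) (snd (p, t))) t, p)))) (fst (t, G (\<lambda>t. gd v (fst (p, t)) (snd (p, t))) t,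
        H (\<lambda>t. gd v (fst (p, t)) (snd (p, t))) t, p)) (0, fst (snd (t, G (\<lambda>t. gd v (fst (p, t)) (snd (p, t))) t,
        H (\<lambda>t. gd v (fst (p, t)) (snd (p, t))) t, p)), fst (snd (snd (t, G (\<lambda>t. gd v (fst (p, t)) (snd (p, t))) t,
        H (\<lambda>t. gd v (fst (p, t)) (snd (p, t))) t, p))), v)"
      unfolding fst_conv snd_conv by (rule gd(2)[OF p])
  qed (auto simp: Dper)
  \<comment> \<open>The time derivative needs no new equation: the chain rule uses
    \<open>G' = H\<close> and \<open>H' = g - a G\<close>, both already expressed through g.\<close>
  define gt where "gt p t = D p t (1, y p t, g (p, t) - a t * x p t, 0)" for p t
  have g_t: "((\<lambda>t. g (p, t)) has_real_derivative gt p t) (at t)" if p: "p \<in> S" for p t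
  proof -
    have "((\<lambda>t. (t, x p t, y p t, p)) has_derivative (\<lambda>s. (s, y p t * s, (g (p, t) - a t * x p t) * s, 0))) (at t)"
      using G_deriv[OF g(1)[OF p], of t] H_deriv[OF g(1)[OF p], of t] unfolding has_field_derivative_def x_def y_def
      by (intro has_derivative_Pair has_derivative_ident has_derivative_const)
    then have "((\<lambda>t. N (t, x p t, y p t, p)) has_derivative
        (\<lambda>s. D p t (s, y p t * s, (g (p, t) - a t * x p t) * s, 0))) (at t)"
      by (rule has_derivative_compose) (rule Dd[OF p])
    moreover have "D p t (s, y p t * s, (g (p, t) - a t * x p t) * s, 0) = gt p t * s" for s
      using linear_cmul[OF Dlin[OF p], of t s "(1, y p t, g (p, t) - a t * x p t, 0)"]
      by (simp add: gt_def algebra_simps)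
    moreover have "(\<lambda>t. N (t, x p t, y p t, p)) = (\<lambda>t. g (p, t))"
      unfolding x_def y_def by (rule ext) (rule g(3)[OF p, symmetric])
    ultimately show ?thesis by (simp add: has_field_derivative_def)
  qed
  have Ckgt: "Ck_on n (\<lambda>z. gt (fst z) (snd z)) (S \<times> UNIV)"
  proof -
    have "Ck_on n (\<lambda>z. a (snd z)) (S \<times> UNIV)"
      by (rule Ck_on_compose[OF oS open_UNIV _ smooth_a]) (auto intro!: Ck_intros oS)
    then have "Ck_on n (\<lambda>z. T (fst z) (snd z) + y (fst z) (snd z) * A (fst z) (snd z)
      + (g z - a (snd z) * x (fst z) (snd z)) * B (fst z) (snd z)
      + E 0 (fst z) (snd z)) (S \<times> UNIV)"
      unfolding coef_defs by (intro Ck_on_add Ck_on_mult Ck_on_diff CkD Ckx Ckg oS)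
    then show ?thesis
      by (subst Ck_on_cong[OF oS]) (auto simp: gt_def Dexp)
  qed
  have g_p: "((\<lambda>p. g (p, t)) has_derivative (\<lambda>v. gd v p t)) (at p)" if p: "p \<in> S" for p t
  proof -
    have lin_gd: "linear (\<lambda>v. gd v p t)" for t
    proof (rule linearI)
      \<comment> \<open>The defect of linearity solves the homogeneous linearized equation with
        remainder 0, so stability makes it vanish.\<close>
      have comb: "gd (v + c *\<^sub>R w) p t = gd v p t + c * gd w p t" for v w c
      proof -
        let ?h = "\<lambda>t. 1 * gd (v + c *\<^sub>R w) p t + (- 1) * (1 * gd v p t + c * gd w p t)"
        have h: "contper (\<lambda>t. 1 * gd v p t + c * gd w p t)" "contper ?h"
          using gd(1)[OF p] contper_lin by blast+
        have "\<bar>?h t\<bar> \<le> 2 * 0"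
        proof (rule lin_stable[OF p h(2), where r="\<lambda>t. 0"])
          fix t
          have E: "E (v + c *\<^sub>R w) p t = E v p t + c * E w p t"
            using linear_add[OF Dlin[OF p], of t "(0, 0, 0, v)" "c *\<^sub>R (0, 0, 0, w)"]
              linear_cmul[OF Dlin[OF p], of t c "(0, 0, 0, w)"] by (simp add: E_def)
          have E0: "E 0 p t = 0"
            using linear_0[OF Dlin[OF p], of t] unfolding E_def zero_prod_def .
          have "gd u p t = G (gd u p) t * A p t + H (gd u p) t * B p t + E u p t" for u
            using gd(2)[OF p, of u t] by (simp add: Dexp[OF p])
          note this[of v] this[of w] this[of "v + c *\<^sub>R w"]
          then show "?h t = D p t (0, G ?h t, H ?h t, 0) + 0"
            unfolding GH_lin[OF gd(1)[OF p] h(1)] GH_lin[OF gd(1)[OF p] gd(1)[OF p]] Dexp[OF p] E0 E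
            by (simp add: algebra_simps E)
        qed simp
        then show ?thesis by simp
      qed
      show "gd (v + w) p t = gd v p t + gd w p t" for v w using comb[of v 1 w] by simp
      have "gd 0 p t = 0" using comb[of 0 "-1" 0] by simp
      then show "gd (c *\<^sub>R w) p t = c *\<^sub>R gd w p t" for c w using comb[of 0 c w] by simp
    qed
    define K where "K = (\<lambda>t. (t, x p t, y p t, p)) ` {0..P}"
    have cxy: "continuous_on UNIV (x p)" "continuous_on UNIV (y p)"
      using contper_GH[OF g(1)[OF p]] contperD by (auto simp: x_def y_def)
    have K: "compact K" "K \<subseteq> \<Omega>"
      unfolding K_def using xiOm[OF p] continuous_on_subset[OF cxy(1)] continuous_on_subset[OF cxy(2)]
      by (auto intro!: compact_continuous_image continuous_intros)
    have xiK: "(t, x p t, y p t, p) \<in> K" if "t \<in> {0..P}" for t using that by (auto simp: K_def)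
    obtain C d where C: "C > 0" "d > 0"
      "\<And>z h. z \<in> K \<Longrightarrow> norm h < d \<Longrightarrow> z + h \<in> \<Omega> \<and> norm (N (z + h) - N z) \<le> C * norm h"
      using Ck_on_uniform_Lipschitz[OF Om N K] by blast
    obtain dS where dS: "dS > 0" "ball p dS \<subseteq> S" using S p openE by blast
    \<comment> \<open>The increment of the full jet caused by moving p by v has norm at most
      \<open>Q * norm v\<close>; the three summands account for x, y and p.\<close>
    define Q where "Q = M1 * (2 * C) + M2 * (2 * C) + 1"
    have Q: "Q \<ge> 1" using M_nonneg C by (simp add: Q_def)
    have near: "\<bar>g (p + v, t) - g (p, t)\<bar> \<le> 2 * (C * norm v)"
      if v: "norm v < d" "norm v < dS" for v t
    proof -
      have pv: "p + v \<in> S" using v dS by (auto simp: dist_norm subset_iff)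
      have c: "contper (\<lambda>t. N (t, x p t, y p t, p + v) - g (p, t))"
      proof (rule contper_diff[OF _ g(1)[OF p]])
        have "continuous_on UNIV (\<lambda>t. N (t, x p t, y p t, p + v))"
          by (rule continuous_on_compose2[OF Ck_on_continuous[OF N]])
            (use W[OF pv] g(2)[OF p] cxy in \<open>auto intro!: continuous_intros simp: x_def y_def\<close>)
        then show "contper (\<lambda>t. N (t, x p t, y p t, p + v))"
          using per W[OF pv] g(2)[OF p] xp[OF p] by (auto simp: contper_def periodic_def x_def y_def)
      qed
      have "\<bar>N (t, x p t, y p t, p + v) - g (p, t)\<bar> \<le> C * norm v" for t
      proof (rule contper_bound_all[OF c])
        fix t assume "t \<in> {0..P}"
        then show "\<bar>N (t, x p t, y p t, p + v) - g (p, t)\<bar> \<le> C * norm v"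
          using C(3)[OF xiK, of t "(0, 0, 0, v)"] v(1) Nx[OF p, of t] by simp
      qed
      then show ?thesis
        by (intro fixed_point_stable[where g="\<lambda>t. g (p + v, t)" and h="\<lambda>t. g (p, t)"
          and N="\<lambda>t x y. N (t, x, y, p + v)" and W=W, OF g(1)[OF pv] g(2)[OF pv] g(3)[OF pv]
            g(1)[OF p] g(2)[OF p] _ lip[OF pv] ab]) (auto simp: x_def y_def)
    qed
    show ?thesis unfolding has_derivative_at_alt
    proof (intro conjI allI impI)
      show "bounded_linear (\<lambda>v. gd v p t)" using lin_gd linear_conv_bounded_linear by blast
      fix e :: real assume e: "e > 0"
      define e' where "e' = e / (2 * Q)"
      have e': "e' > 0" "2 * (e' * Q) = e" using e Q by (auto simp: e'_def)
      obtain d2 where d2: "d2 > 0" "\<And>z h. z \<in> K \<Longrightarrow> norm h < d2 \<Longrightarrow> z + h \<in> \<Omega> \<and>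
          norm (N (z + h) - N z - fderiv N z h) \<le> e' * norm h"
        using Ck_on_uniform_differentiable[OF Om N K e'(1)] by blast
      show "\<exists>d>0. \<forall>q. norm (q - p) < d \<longrightarrow> norm (g (q, t) - g (p, t) - gd (q - p) p t) \<le> e * norm (q - p)"
      proof (intro exI[of _ "min d (min dS (d2 / Q))"] conjI allI impI)
        show "min d (min dS (d2 / Q)) > 0" using C dS d2 Q by auto
        fix q assume q: "norm (q - p) < min d (min dS (d2 / Q))"
        define v where "v = q - p"
        have qv: "q = p + v" and v: "norm v < d" "norm v < dS" "Q * norm v < d2"
          using q Q by (auto simp: v_def field_simps)
        have pv: "p + v \<in> S" using v dS by (auto simp: dist_norm subset_iff)
        have b: "\<bar>x (p + v) t - x p t\<bar> \<le> M1 * (2 * (C * norm v))" "\<bar>y (p + v) t - y p t\<bar> \<le> M2 * (2 * (C * norm v))" for t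
          using GH_bound[OF contper_diff[OF g(1)[OF pv] g(1)[OF p]] near[OF v(1,2)], of t]
            GH_diff[OF g(1)[OF pv] g(1)[OF p], of t] by (auto simp: x_def y_def)
        define h where "h t = (0::real, x (p + v) t - x p t, y (p + v) t - y p t, v)" for t
        have nh: "norm (h t) \<le> Q * norm v" for t
        proof -
          have "norm (h t) \<le> norm (0::real) + (norm (x (p + v) t - x p t) + (norm (y (p + v) t - y p t) + norm v))"
            unfolding h_def by (intro order_trans[OF norm_Pair_le] add_mono order_refl)
          then show ?thesis using b[of t] by (simp add: Q_def algebra_simps)
        qed
        let ?\<Delta> = "\<lambda>t. (g (p + v, t) - g (p, t)) - gd v p t"
        have c\<Delta>: "contper ?\<Delta>" using g(1)[OF pv] g(1)[OF p] gd(1)[OF p] by (intro contper_diff)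
        \<comment> \<open>The error \<open>?\<Delta>\<close> of the candidate derivative solves the
          homogeneous linearized equation up to \<open>?r\<close>, and \<open>?r\<close> is the
          first order Taylor remainder of N along the solution, hence uniformly small relative to
          v.\<close>
        let ?r = "\<lambda>t. ?\<Delta> t - D p t (0, G ?\<Delta> t, H ?\<Delta> t, 0)"
        have "\<bar>?\<Delta> t\<bar> \<le> 2 * (e' * Q * norm v)"
        proof (rule lin_stable[where r="?r", OF p c\<Delta>])
          show "\<bar>?r t\<bar> \<le> e' * Q * norm v" for t
          proof (rule contper_bound_all[where f="?r"])
            show "contper ?r" using c\<Delta> contD3[OF p c\<Delta>] by (rule contper_diff)
            fix t assume t: "t \<in> {0..P}"
            have "G ?\<Delta> t = (x (p + v) t - x p t) - G (gd v p) t" "H ?\<Delta> t = (y (p + v) t - y p t) - H (gd v p) t"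
              unfolding x_def y_def
                GH_diff[OF g(1)[OF pv] g(1)[OF p], symmetric]
              by (rule GH_diff[OF contper_diff[OF g(1)[OF pv] g(1)[OF p]] gd(1)[OF p, of v]])+
            then have "(0, G ?\<Delta> t, H ?\<Delta> t, 0) = h t - (0, G (gd v p) t, H (gd v p) t, v)"
              by (simp add: h_def)
            then have "D p t (0, G ?\<Delta> t, H ?\<Delta> t, 0) = D p t (h t - (0, G (gd v p) t, H (gd v p) t, v))"
              by (rule arg_cong)
            also have "\<dots> = D p t (h t) - D p t (0, G (gd v p) t, H (gd v p) t, v)"
              by (rule linear_diff[OF Dlin[OF p]])
            also have "D p t (0, G (gd v p) t, H (gd v p) t, v) = gd v p t"
              by (rule gd(2)[OF p, symmetric])
            finally have "D p t (0, G ?\<Delta> t, H ?\<Delta> t, 0) = D p t (h t) - gd v p t" .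
            moreover have "N ((t, x p t, y p t, p) + h t) = g (p + v, t)" "N (t, x p t, y p t, p) = g (p, t)"
              using Nx[OF pv, of t] Nx[OF p, of t] by (simp_all add: h_def)
            ultimately have "\<bar>?r t\<bar> = norm (N ((t, x p t, y p t, p) + h t) - N (t, x p t, y p t, p) - D p t (h t))"
              by simp
            also have "\<dots> \<le> e' * norm (h t)"
              using d2(2)[OF xiK[OF t], of "h t"] nh[of t] v(3) unfolding D_def by fastforce
            also have "\<dots> \<le> e' * (Q * norm v)" using nh e'(1) by (intro mult_left_mono) auto
            finally show "\<bar>?r t\<bar> \<le> e' * Q * norm v" by (simp add: algebra_simps)
          qed
        qed simp
        also have "2 * (e' * Q * norm v) = e * norm v" using e'(2) by (simp add: algebra_simps)
        finally show "norm (g (q, t) - g (p, t) - gd (q - p) p t) \<le> e * norm (q - p)"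
          using qv by simp
      qed
    qed
  qed
  show ?case
  proof (rule Ck_on_SucI[OF oS])
    fix z assume "z \<in> S \<times> (UNIV :: real set)"
    then obtain p t where z: "z = (p, t)" "p \<in> S" by auto
    have "isCont (\<lambda>z. gt (fst z) (snd z)) (p, t)"
      using Ck_on_continuous[OF Ckgt] oS z(2) by (simp add: continuous_on_eq_continuous_at)
    then have cgt: "isCont (\<lambda>z. blinfun_scaleR_left (gt (fst z) (snd z)) :: real \<Rightarrow>\<^sub>L real) (p, t)"
      by (rule bounded_linear.isCont[OF bounded_linear_blinfun_scaleR_left])
    \<comment> \<open>Total differentiability follows from the two partial ones once the partial
      derivative in t is continuous jointly; that is why the regularity of \<open>gt\<close> was
      established.\<close>
    have "((\<lambda>(p, t). g (p, t)) has_derivative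
       (\<lambda>(v, \<tau>). gd v p t + blinfun_apply (blinfun_scaleR_left (gt p t)) \<tau>)) (at (p, t) within S \<times> UNIV)"
    proof (rule has_derivative_partialsI)
      show "((\<lambda>p. g (p, t)) has_derivative (\<lambda>v. gd v p t)) (at p within S)"
        using g_p[OF z(2)] has_derivative_at_withinI by blast
      show "((\<lambda>t. g (p, t)) has_derivative blinfun_apply (blinfun_scaleR_left (gt p t))) (at t within UNIV)"
        if "p \<in> S" for p t
        using g_t[OF that] by (simp add: has_field_derivative_def mult.commute[of _ "gt p t"])
      show "continuous (at (p, t) within S \<times> UNIV) (\<lambda>(p, t). blinfun_scaleR_left (gt p t))"
        using cgt by (simp add: case_prod_unfold continuous_at_imp_continuous_at_within)
    qed auto
    then show "(g has_derivative (\<lambda>w. gd (fst w) (fst z) (snd z) + snd w * gt (fst z) (snd z))) (at z)" 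
      using at_within_open[OF _ oS, of z] z by (simp add: case_prod_unfold)
  next
    show "Ck_on n (\<lambda>z. gd (fst w) (fst z) (snd z) + snd w * gt (fst z) (snd z)) (S \<times> UNIV)" for w
      by (intro Ck_on_add Ck_on_mult Ck_on_const Ckgd Ckgt oS)
  qed
qed
end

section \<open>Approximate solutions by fast oscillation\<close>

lemma Ck_on_all_DERIV:
  fixes f :: "real \<Rightarrow> real"
  assumes "\<And>n. Ck_on n f UNIV"
  shows "(f has_real_derivative deriv f t) (at t)" "Ck_on n (deriv f) UNIV"
  using Ck_on_Suc_DERIV[OF open_UNIV assms] by auto

text \<open>After clearing the denominator the remainder is \<open>z^2\<close> times a factor of
  size at most 8, and \<open>8 / (7/8)^3 < 12\<close>.\<close>

lemma inverse_cube_remainder: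
  fixes z :: real
  assumes "\<bar>z\<bar> \<le> 1/8"
  shows "\<bar>1 / (1 - z) ^ 3 - 1 - 3 * z\<bar> \<le> 12 * z\<^sup>2"
proof -
  have p: "1 - z \<ge> 7/8" using assms by auto
  have p3: "(1 - z) ^ 3 \<ge> (7/8) ^ 3" using p by (intro power_mono) auto
  have "1 / (1 - z) ^ 3 - 1 - 3 * z = z\<^sup>2 * (6 - 8 * z + 3 * z\<^sup>2) / (1 - z) ^ 3"
  proof -
    have nz: "(1 - z) ^ 3 \<noteq> 0" using p by simp
    have "1 - (1 + 3 * z) * (1 - z) ^ 3 = z\<^sup>2 * (6 - 8 * z + 3 * z\<^sup>2)"
      by (simp add: power2_eq_square power3_eq_cube algebra_simps)
    then show ?thesis using nz by (simp add: field_simps)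
  qed
  moreover have "\<bar>6 - 8 * z + 3 * z\<^sup>2\<bar> \<le> 8"
  proof -
    have "z\<^sup>2 \<le> (1/8)\<^sup>2" using assms by (intro abs_le_square_iff[THEN iffD1]) auto
    then show ?thesis using assms by (simp add: abs_le_iff power2_eq_square)
  qed
  moreover have "8 / (1 - z) ^ 3 \<le> 12"
  proof -
    have "8 / (1 - z) ^ 3 \<le> 8 / (7/8) ^ 3" using p3 by (intro divide_left_mono) (use p in \<open>auto intro!: mult_pos_pos\<close>)
    then show ?thesis by (simp add: power3_eq_cube)
  qed
  ultimately show ?thesis
  proof -
    assume a: "1 / (1 - z) ^ 3 - 1 - 3 * z = z\<^sup>2 * (6 - 8 * z + 3 * z\<^sup>2) / (1 - z) ^ 3"
      and b: "\<bar>6 - 8 * z + 3 * z\<^sup>2\<bar> \<le> 8" and c: "8 / (1 - z) ^ 3 \<le> 12"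
    have pos: "(1 - z) ^ 3 > 0" using p by (intro zero_less_power) auto
    have "\<bar>1 / (1 - z) ^ 3 - 1 - 3 * z\<bar> = z\<^sup>2 * (\<bar>6 - 8 * z + 3 * z\<^sup>2\<bar> / (1 - z) ^ 3)"
      unfolding a using pos by (simp add: abs_mult)
    also have "\<dots> \<le> z\<^sup>2 * (8 / (1 - z) ^ 3)"
      using b pos by (intro mult_left_mono divide_right_mono) auto
    also have "\<dots> \<le> z\<^sup>2 * 12" using c by (intro mult_left_mono) auto
    finally show ?thesis by simp
  qed
qed

lemma inverse_fourth_remainder:
  fixes u :: real
  assumes "\<bar>u - 1\<bar> \<le> 1/8"
  shows "\<bar>1 - 1 / u ^ 4\<bar> \<le> 10 * \<bar>u - 1\<bar>"
proof -
  have u: "7/8 \<le> u" "u \<le> 9/8" using assms unfolding abs_le_iff by linarith+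
  have u4: "(7/8) ^ 4 \<le> u ^ 4" using u by (intro power_mono) auto
  have pos: "u ^ 4 > 0" using u by (intro zero_less_power) auto
  have q: "u ^ 3 + u\<^sup>2 + u + 1 \<le> (9/8) ^ 3 + (9/8)\<^sup>2 + 9/8 + 1" "0 \<le> u ^ 3 + u\<^sup>2 + u + 1"
  proof -
    have "u ^ 3 \<le> (9/8) ^ 3" "u\<^sup>2 \<le> (9/8)\<^sup>2" using u by (auto intro!: power_mono)
    then show "u ^ 3 + u\<^sup>2 + u + 1 \<le> (9/8) ^ 3 + (9/8)\<^sup>2 + 9/8 + 1" using u by linarith
    show "0 \<le> u ^ 3 + u\<^sup>2 + u + 1" using u by (intro add_nonneg_nonneg) auto
  qed
  have "1 - 1 / u ^ 4 = (u - 1) * (u ^ 3 + u\<^sup>2 + u + 1) / u ^ 4"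
    using u by (simp add: field_simps power2_eq_square power3_eq_cube power4_eq_xxxx)
  then have "\<bar>1 - 1 / u ^ 4\<bar> = \<bar>u - 1\<bar> * ((u ^ 3 + u\<^sup>2 + u + 1) / u ^ 4)"
    using pos q by (simp add: abs_mult)
  also have "\<dots> \<le> \<bar>u - 1\<bar> * (((9/8) ^ 3 + (9/8)\<^sup>2 + 9/8 + 1) / (7/8) ^ 4)"
    using q u4 pos by (intro mult_left_mono frac_le) auto
  also have "\<dots> \<le> \<bar>u - 1\<bar> * 10"
    by (intro mult_left_mono) (auto simp: power2_eq_square power3_eq_cube power4_eq_xxxx)
  finally show ?thesis by simp
qed

lemma periodic_compose: "periodic P f \<Longrightarrow> periodic P (\<lambda>t. h (f t))"
  by (simp add: periodic_def)

text \<open>Fast oscillation: for large \<open>\<mu>\<close> the Ermakov equation \<open>x'' + (\<mu> w + c) x = x\<^sup>-\<^sup>3\<close> has the approximate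
  solution \<open>x\<^sub>a\<close> given by the WKB expansion, and its linearization is close to \<open>h'' + a h\<close>
  with the explicit fundamental system \<open>\<psi> cos (2 \<sigma> / e)\<close>, \<open>\<psi> sin (2 \<sigma> / e)\<close>, where \<open>\<psi> = w\<^sup>-\<^sup>1\<^sup>/\<^sup>4\<close> and \<open>\<mu> = e\<^sup>-\<^sup>2\<close>. The discrete values
  of \<open>\<mu>\<close> used here are those for which this system is antiperiodic.\<close>

lemma ermakov_approximate_solution:
  fixes w c :: "real \<Rightarrow> real" and P \<mu>1 :: real
  assumes P: "P > 0" and w: "\<And>n. Ck_on n w UNIV" "periodic P w" "\<And>t. w t > 0"
    and c: "\<And>n. Ck_on n c UNIV" "periodic P c"
  obtains \<mu> u1 u2 v1 v2 a m m' xa ya R where "\<mu> \<ge> \<mu>1" "\<mu> > 0"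
    and "antiperiodic_operator P u1 u2 v1 v2 a m m'"
    and "\<And>n. Ck_on n xa UNIV" "periodic P xa" "\<And>t. (xa has_real_derivative ya t) (at t)"
    and "R > 0" "m > 0" "m' > 0"
    and "\<And>t x. \<bar>x - xa t\<bar> \<le> antiperiodic_operator.M1 P m * R \<Longrightarrow>
        x > 0 \<and> \<bar>a t - 3 / x ^ 4 - (\<mu> * w t + c t)\<bar> * antiperiodic_operator.M1 P m \<le> 1/4"
    and "\<And>t. \<bar>1 / xa t ^ 3 - (\<mu> * w t + c t) * xa t - deriv ya t\<bar> \<le> R / 4"
proof -
  define \<psi> where "\<psi> t = w t powr (-1/4)" for t
  define \<psi>1 where "\<psi>1 = deriv \<psi>"
  define \<psi>2 where "\<psi>2 = deriv \<psi>1"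
  have C\<psi>: "Ck_on n \<psi> UNIV" for n unfolding \<psi>_def by (intro Ck_on_powr w) auto
  have d\<psi>: "(\<psi> has_real_derivative \<psi>1 t) (at t)" and C\<psi>1: "Ck_on n \<psi>1 UNIV" for n t
    using Ck_on_all_DERIV[OF C\<psi>] by (auto simp: \<psi>1_def)
  have d\<psi>1: "(\<psi>1 has_real_derivative \<psi>2 t) (at t)" and C\<psi>2: "Ck_on n \<psi>2 UNIV" for n t
    using Ck_on_all_DERIV[OF C\<psi>1] by (auto simp: \<psi>2_def)
  have \<psi>pos: "\<psi> t > 0" for t using w(3)[of t] by (simp add: \<psi>_def)
  have w\<psi>: "w t = 1 / \<psi> t ^ 4" for t
  proof -
    have "\<psi> t ^ 4 = w t powr (-1)"
      using w(3)[of t] by (simp add: \<psi>_def powr_power)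
    then show ?thesis using w(3)[of t] by (simp add: powr_minus_divide)
  qed
  have per\<psi>: "periodic P \<psi>" unfolding \<psi>_def using w(2) by (rule periodic_compose)
  have per\<psi>1: "periodic P \<psi>1" using periodic_deriv[OF per\<psi> d\<psi>] .
  have per\<psi>2: "periodic P \<psi>2" using periodic_deriv[OF per\<psi>1 d\<psi>1] .
  \<comment> \<open>Insert \<open>x = f \<psi> (1 - z)\<close>. The leading terms cancel and
    \<open>x^-3 - \<mu> w x\<close> becomes \<open>4 z / (f \<psi>)^3\<close> to first order;
    balancing this with \<open>x'' + c x\<close> at leading order gives
    \<open>z = e^2 K / 4\<close>.\<close>
  define K where "K t = c t * \<psi> t ^ 4 + \<psi> t ^ 3 * \<psi>2 t" for t
  have CK: "Ck_on n K UNIV" for n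
    unfolding K_def by (intro Ck_intros C\<psi> C\<psi>2 c) auto
  have perK: "periodic P K" using per\<psi> per\<psi>2 c(2) by (simp add: K_def periodic_def)
  define Y where "Y t = \<psi> t * K t" for t
  define Y1 where "Y1 = deriv Y"
  define Y2 where "Y2 = deriv Y1"
  have CY: "Ck_on n Y UNIV" for n unfolding Y_def by (intro Ck_intros C\<psi> CK) auto
  have dY: "(Y has_real_derivative Y1 t) (at t)" and CY1: "Ck_on n Y1 UNIV" for n t
    using Ck_on_all_DERIV[OF CY] by (auto simp: Y1_def)
  have dY1: "(Y1 has_real_derivative Y2 t) (at t)" and CY2: "Ck_on n Y2 UNIV" for n t
    using Ck_on_all_DERIV[OF CY1] by (auto simp: Y2_def)
  have perY: "periodic P Y" using per\<psi> perK by (simp add: Y_def periodic_def)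
  have perY1: "periodic P Y1" using periodic_deriv[OF perY dY] .
  have perY2: "periodic P Y2" using periodic_deriv[OF perY1 dY1] .
  have cont: "continuous_on UNIV f" if "\<And>n. Ck_on n f UNIV" for f :: "real \<Rightarrow> real"
    using Ck_on_continuous[OF that[of 0]] .
  obtain p where p: "p > 0" "\<And>t. p \<le> \<psi> t"
    using periodic_pos_lower[OF P per\<psi> cont[OF C\<psi>] \<psi>pos] by blast
  obtain q where q: "q > 0" "\<And>t. \<bar>\<psi> t\<bar> \<le> q"
    using periodic_bounded[OF P per\<psi> cont[OF C\<psi>]] by blast
  obtain \<kappa> where \<kappa>: "\<kappa> > 0" "\<And>t. \<bar>K t\<bar> \<le> \<kappa>"
    using periodic_bounded[OF P perK cont[OF CK]] by blast
  have "periodic P (\<lambda>t. Y2 t / 4 + c t * Y t / 4)"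
    using perY2 perY c(2) by (simp add: periodic_def)
  moreover have "continuous_on UNIV (\<lambda>t. Y2 t / 4 + c t * Y t / 4)"
    using cont[OF CY2] cont[OF CY] cont[OF c(1)] by (intro continuous_intros) auto
  ultimately obtain c1 where c1: "c1 > 0" "\<And>t. \<bar>Y2 t / 4 + c t * Y t / 4\<bar> \<le> c1"
    using periodic_bounded[OF P] by blast
  obtain s1 where s1: "s1 > 0" "\<And>t. \<bar>\<psi>1 t\<bar> \<le> s1"
    using periodic_bounded[OF P per\<psi>1 cont[OF C\<psi>1]] by blast
  have "continuous_on UNIV (\<lambda>t. 1 / (\<psi> t)\<^sup>2)"
    using cont[OF C\<psi>] \<psi>pos by (intro continuous_intros) (auto simp: less_imp_neq[symmetric])
  then obtain \<sigma> where \<sigma>: "\<And>t. (\<sigma> has_real_derivative 1 / (\<psi> t)\<^sup>2) (at t)"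
    using ex_antiderivative by blast
  have C\<sigma>: "Ck_on n \<sigma> UNIV" for n
  proof -
    have "Ck_on (Suc n) \<sigma> UNIV"
      by (rule Ck_on_SucI_DERIV[OF open_UNIV \<sigma>])
        (auto intro!: Ck_intros C\<psi> simp: less_imp_neq[OF \<psi>pos, symmetric])
    then show ?thesis by (rule Ck_on_Suc_imp)
  qed
  define S1 where "S1 = \<sigma> P - \<sigma> 0"
  have \<sigma>P: "\<sigma> (t + P) = \<sigma> t + S1" for t
  proof -
    have "((\<lambda>t. \<sigma> (t + P) - \<sigma> t) has_real_derivative 0) (at t)" for t
    proof -
      have "((\<lambda>t. \<sigma> (t + P)) has_real_derivative 1 / (\<psi> t)\<^sup>2) (at t)"
        using \<sigma>[of "t + P"] per\<psi> DERIV_shift[of \<sigma> _ t P] by (simp add: periodic_def)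
      from DERIV_diff[OF this \<sigma>[of t]] show ?thesis by simp
    qed
    then have "\<sigma> (t + P) - \<sigma> t = \<sigma> (0 + P) - \<sigma> 0" using DERIV_isconst_all by blast
    then show ?thesis by (simp add: S1_def)
  qed
  have S1pos: "S1 > 0"
    unfolding S1_def using DERIV_pos_imp_increasing[of 0 P \<sigma>] P \<sigma> \<psi>pos
    by (metis diff_gt_0_iff_gt less_numeral_extra(1) zero_less_divide_iff zero_less_power)
  \<comment> \<open>The phase \<open>2 * \<sigma> / e\<close> grows by \<open>2 * S1 / e\<close>
    over a period. For \<open>e = ee N\<close> this is an odd multiple of \<open>pi\<close>, and
    \<open>ee N\<close> tends to 0.\<close>
  define ee where "ee N = 2 * S1 / ((2 * real N + 1) * pi)" for N
  define c0 where "c0 = 1 + \<kappa> / 4"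
  define r5 where "r5 = 1 / (\<bar>\<mu>1\<bar> + 1)"
  have r5: "r5 > 0" by (simp add: r5_def add_nonneg_pos)
  \<comment> \<open>In order, the thresholds give \<open>e^2 \<le> e\<close>, keep the relative
    deviation u within 1/8 of 1, bound the contraction factor by 1/4, bound the defect by
    \<open>R / 4\<close>, and force \<open>\<mu> \<ge> \<mu>1\<close>.\<close>
  define \<eta> where "\<eta> = Min {1, 1 / (8 * c0), (1/4) / ((30 * c0 + \<kappa>) / p ^ 4 * (P * q\<^sup>2 / 2)),
      (p / (2 * P * q\<^sup>2)) / (c1 + 12 * (\<kappa> / 4)\<^sup>2 / p ^ 3), r5}"
  have c0: "c0 > 0" using \<kappa> by (simp add: c0_def)
  have \<eta>: "\<eta> > 0" 
    unfolding \<eta>_def using c0 p q P \<kappa> c1 r5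
    by (auto intro!: divide_pos_pos mult_pos_pos add_pos_pos)
  obtain N :: nat where "2 * S1 / (\<eta> * pi) < real N" using reals_Archimedean2 by blast
  then have "2 * S1 < real N * (\<eta> * pi)" using \<eta> by (simp add: divide_less_eq)
  also have "\<dots> \<le> \<eta> * ((2 * real N + 1) * pi)" using \<eta> by (simp add: algebra_simps)
  finally have N: "ee N < \<eta>" by (simp add: ee_def divide_less_eq add_pos_pos)
  define e where "e = ee N"
  have e: "e > 0" unfolding e_def ee_def using S1pos by (auto intro!: divide_pos_pos mult_pos_pos)
  have "e < \<eta>" using N by (simp add: e_def)
  then have e1: "e < 1" and e2: "e < 1 / (8 * c0)" and e3: "e < (1/4) / ((30 * c0 + \<kappa>) / p ^ 4 * (P * q\<^sup>2 / 2))"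
    and e4: "e < (p / (2 * P * q\<^sup>2)) / (c1 + 12 * (\<kappa> / 4)\<^sup>2 / p ^ 3)" and e5: "e < r5"
    unfolding \<eta>_def by auto
  have eS: "2 * S1 / e = (2 * real N + 1) * pi" using S1pos by (simp add: e_def ee_def)
  define \<mu> where "\<mu> = 1 / e\<^sup>2"
  \<comment> \<open>\<open>f = \<mu>^(-1/4)\<close> is the scale of the leading amplitude
    \<open>f \<psi>\<close>. The same factor in \<open>u1\<close> and \<open>u2\<close> makes their
    Wronskian \<open>f^2 * 2 / e = 2\<close>.\<close>
  define f where "f = sqrt e"
  have f: "f > 0" "f\<^sup>2 = e" "f * f = e" "f ^ 4 = e\<^sup>2" using e by (auto simp: f_def power4_eq_xxxx power2_eq_square)
  define u1 where "u1 t = f * \<psi> t * cos (2 * \<sigma> t / e)" for t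
  define u2 where "u2 t = f * \<psi> t * sin (2 * \<sigma> t / e)" for t
  define v1 where "v1 t = f * \<psi>1 t * cos (2 * \<sigma> t / e) - 2 / (f * \<psi> t) * sin (2 * \<sigma> t / e)" for t
  define v2 where "v2 t = f * \<psi>1 t * sin (2 * \<sigma> t / e) + 2 / (f * \<psi> t) * cos (2 * \<sigma> t / e)" for t
  \<comment> \<open>Because the derivative of \<sigma> is \<open>\<psi>^-2\<close>, the first order
    terms in the second derivative of \<psi> times a cosine or sine cancel. The term \<psi>''/\<psi>
    in a then makes \<open>u1\<close> and \<open>u2\<close> exact solutions; a differs from the true
    linearized coefficient only by a bounded amount.\<close>
  define a where "a t = 4 / (e\<^sup>2 * \<psi> t ^ 4) - \<psi>2 t / \<psi> t" for t
  define m where "m = f * q"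
  define m' where "m' = f * s1 + 2 / (f * p)"
  note nz = less_imp_neq[OF \<psi>pos, symmetric] less_imp_neq[OF f(1), symmetric] less_imp_neq[OF e, symmetric]
  have d\<sigma>: "((\<lambda>t. 2 * \<sigma> t / e) has_real_derivative 2 / (e * (\<psi> t)\<^sup>2)) (at t)" for t
    by (rule DERIV_cong[OF DERIV_cdivide[OF DERIV_cmult[OF \<sigma>]]]) (simp add: field_simps)
  have op: "antiperiodic_operator P u1 u2 v1 v2 a m m'"
  proof
    show "P > 0" by (rule P)
    have ef: "e = f * f" using f(3) by simp
    have d2: "((\<lambda>t. 2 / (f * \<psi> t)) has_real_derivative - 2 * \<psi>1 t / (f * (\<psi> t)\<^sup>2)) (at t)" for t
      by (rule DERIV_cong[OF DERIV_divide[OF DERIV_const DERIV_cmult[OF d\<psi>]]])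
        (simp_all add: nz power2_eq_square field_simps)
    note dcos = DERIV_chain2[OF DERIV_cos d\<sigma>] and dsin = DERIV_chain2[OF DERIV_sin d\<sigma>]
    show "(u1 has_real_derivative v1 t) (at t)" for t
      unfolding u1_def[abs_def] v1_def
      by (rule DERIV_cong[OF DERIV_mult[OF DERIV_cmult[OF d\<psi>] dcos]])
        (simp add: nz(1,2) ef power2_eq_square divide_simps)
    show "(u2 has_real_derivative v2 t) (at t)" for t
      unfolding u2_def[abs_def] v2_def
      by (rule DERIV_cong[OF DERIV_mult[OF DERIV_cmult[OF d\<psi>] dsin]])
        (simp add: nz(1,2) ef power2_eq_square divide_simps)
    show "(v1 has_real_derivative - a t * u1 t) (at t)" for t
      unfolding v1_def[abs_def] u1_def a_def
      by (rule DERIV_cong[OF DERIV_diff[OF DERIV_mult[OF DERIV_cmult[OF d\<psi>1] dcos] DERIV_mult[OF d2 dsin]]])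
        (simp add: nz(1,2) ef power2_eq_square power4_eq_xxxx divide_simps, simp add: algebra_simps)
    show "(v2 has_real_derivative - a t * u2 t) (at t)" for t
      unfolding v2_def[abs_def] u2_def a_def
      by (rule DERIV_cong[OF DERIV_add[OF DERIV_mult[OF DERIV_cmult[OF d\<psi>1] dsin] DERIV_mult[OF d2 dcos]]])
        (simp add: nz(1,2) ef power2_eq_square power4_eq_xxxx divide_simps, simp add: algebra_simps)
    have arg: "2 * \<sigma> (t + P) / e = 2 * \<sigma> t / e + (2 * real N + 1) * pi" for t
      using eS by (simp add: \<sigma>P add_divide_distrib distrib_left)
    have tr: "cos (x + (2 * real N + 1) * pi) = - cos x" "sin (x + (2 * real N + 1) * pi) = - sin x" for x
    proof -
      have eq: "x + (2 * real N + 1) * pi = (x + pi) + real N * (2 * pi)" by (simp add: algebra_simps)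
      have "cos ((x + pi) + real N * (2 * pi)) = - cos x" "sin ((x + pi) + real N * (2 * pi)) = - sin x"
        using cos.plus_of_nat[of "x + pi" N] sin.plus_of_nat[of "x + pi" N] by simp_all
      then show "cos (x + (2 * real N + 1) * pi) = - cos x" "sin (x + (2 * real N + 1) * pi) = - sin x"
        unfolding eq .
    qed
    show "u1 (t + P) = - u1 t" "u2 (t + P) = - u2 t" for t
      using per\<psi> unfolding u1_def u2_def arg tr by (auto simp: periodic_def)
    show "u1 t * v2 t - v1 t * u2 t = 2" for t
    proof -
      have "f * \<psi> t * C * (f * \<psi>1 t * S + 2 / (f * \<psi> t) * C)
          - (f * \<psi>1 t * C - 2 / (f * \<psi> t) * S) * (f * \<psi> t * S) = 2 * (C\<^sup>2 + S\<^sup>2)" for C S :: real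
        using nz(1)[of t] nz(2) by (simp add: field_simps power2_eq_square)
      note this[of "cos (2 * \<sigma> t / e)" "sin (2 * \<sigma> t / e)"]
      also have "2 * ((cos (2 * \<sigma> t / e))\<^sup>2 + (sin (2 * \<sigma> t / e))\<^sup>2) = 2" by (simp only: sin_cos_squared_add2)
      finally show ?thesis unfolding u1_def v1_def u2_def v2_def .
    qed
    have Carg: "Ck_on n (\<lambda>t. 2 * \<sigma> t / e) UNIV" for n
      by (intro Ck_intros C\<sigma>) (use e in auto)
    show "Ck_on n u1 UNIV" "Ck_on n u2 UNIV" "Ck_on n v1 UNIV" "Ck_on n v2 UNIV" "Ck_on n a UNIV" for n
      unfolding u1_def[abs_def] u2_def[abs_def] v1_def[abs_def] v2_def[abs_def] a_def[abs_def]
      by (intro Ck_intros Carg C\<psi> C\<psi>1 C\<psi>2; simp add: nz)+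
    show "periodic P a" using per\<psi> per\<psi>2 by (simp add: a_def periodic_def)
    have b: "\<bar>f * \<psi> t * y\<bar> \<le> f * q" if "\<bar>y\<bar> \<le> 1" for t y
    proof -
      have "\<bar>f * \<psi> t * y\<bar> = f * \<bar>\<psi> t\<bar> * \<bar>y\<bar>" using f by (simp add: abs_mult)
      also have "\<dots> \<le> f * q * 1" using that q f by (intro mult_mono) auto
      finally show ?thesis by simp
    qed
    show "\<bar>u1 t\<bar> \<le> m" "\<bar>u2 t\<bar> \<le> m" for t unfolding u1_def u2_def m_def by (rule b, simp)+
    have b1: "\<bar>f * \<psi>1 t * y\<bar> \<le> f * s1" "\<bar>2 / (f * \<psi> t) * y\<bar> \<le> 2 / (f * p)" if "\<bar>y\<bar> \<le> 1" for t y
    proof -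
      have "\<bar>f * \<psi>1 t * y\<bar> = f * \<bar>\<psi>1 t\<bar> * \<bar>y\<bar>" using f by (simp add: abs_mult)
      also have "\<dots> \<le> f * s1 * 1" using that s1 f by (intro mult_mono) auto
      finally show "\<bar>f * \<psi>1 t * y\<bar> \<le> f * s1" by simp
      have "\<bar>2 / (f * \<psi> t) * y\<bar> = 2 / (f * \<psi> t) * \<bar>y\<bar>" using f \<psi>pos[of t] by (simp add: abs_mult)
      also have "\<dots> \<le> 2 / (f * p) * 1"
        using that p f \<psi>pos[of t] by (intro mult_mono divide_left_mono mult_pos_pos) auto
      finally show "\<bar>2 / (f * \<psi> t) * y\<bar> \<le> 2 / (f * p)" by simp
    qed
    show "\<bar>v1 t\<bar> \<le> m'" for t
      using b1(1)[OF abs_cos_le_one[of "2 * \<sigma> t / e"], of t] b1(2)[OF abs_sin_le_one[of "2 * \<sigma> t / e"], of t]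
      unfolding v1_def m'_def by linarith
    show "\<bar>v2 t\<bar> \<le> m'" for t
      using b1(1)[OF abs_sin_le_one[of "2 * \<sigma> t / e"], of t] b1(2)[OF abs_cos_le_one[of "2 * \<sigma> t / e"], of t]
      unfolding v2_def m'_def by linarith
  qed
  have M1: "antiperiodic_operator.M1 P m = P * e * q\<^sup>2 / 2"
    unfolding antiperiodic_operator.M1_def[OF op] using f(2) by (simp add: m_def power_mult_distrib)
  \<comment> \<open>Chosen so that \<open>M1 * R = f e^2 p\<close>: the tube allows a relative
    deviation \<open>e^2\<close> from the amplitude \<open>f \<psi>\<close>, the order of the WKB
    correction itself. R has order \<open>f e\<close>, while the defect has order
    \<open>f e^2\<close>.\<close>
  define R where "R = 2 * f * e * p / (P * q\<^sup>2)"
  have R: "R > 0" unfolding R_def using f e p P q by (auto intro!: divide_pos_pos mult_pos_pos)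
  have M1R: "P * e * q\<^sup>2 / 2 * R = f * e\<^sup>2 * p" unfolding R_def using P q by (simp add: field_simps power2_eq_square)
  define xa where "xa t = f * (\<psi> t - e\<^sup>2 / 4 * Y t)" for t
  define ya where "ya t = f * (\<psi>1 t - e\<^sup>2 / 4 * Y1 t)" for t
  have dxa: "(xa has_real_derivative ya t) (at t)" for t
    unfolding xa_def[abs_def] ya_def by (auto intro!: derivative_eq_intros d\<psi> dY)
  have dya: "(ya has_real_derivative f * (\<psi>2 t - e\<^sup>2 / 4 * Y2 t)) (at t)" for t
    unfolding ya_def[abs_def] by (auto intro!: derivative_eq_intros d\<psi>1 dY1)
  have ee': "e\<^sup>2 \<le> e" using e e1 by (simp add: power2_eq_square)
  have z8: "\<bar>e\<^sup>2 * K t / 4\<bar> \<le> e\<^sup>2 * (\<kappa> / 4)" for t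
    using \<kappa>(2)[of t] by (simp add: abs_mult mult_left_mono)
  have ec0: "e\<^sup>2 * c0 \<le> 1/8"
  proof -
    have "e\<^sup>2 * c0 \<le> e * c0" using ee' c0 by (intro mult_right_mono) auto
    also have "\<dots> \<le> 1/8" using e2 c0 by (simp add: field_simps)
    finally show ?thesis .
  qed
  have lip: "x > 0 \<and> \<bar>a t - 3 / x ^ 4 - (\<mu> * w t + c t)\<bar> * (P * e * q\<^sup>2 / 2) \<le> 1/4"
    if x: "\<bar>x - xa t\<bar> \<le> f * e\<^sup>2 * p" for x t
  proof -
    \<comment> \<open>In the normalized variable u the tube and the WKB correction each move u away
      from 1 by at most a multiple of \<open>e^2\<close>; \<open>c0 = 1 + \<kappa> / 4\<close> adds
      the two.\<close>
    define u where "u = x / (f * \<psi> t)"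
    have xu: "x = f * \<psi> t * u" using f \<psi>pos[of t] by (simp add: u_def)
    have "x - xa t = f * \<psi> t * (u - (1 - e\<^sup>2 * K t / 4))"
      unfolding xu xa_def Y_def by (simp add: algebra_simps)
    then have "f * \<psi> t * \<bar>u - (1 - e\<^sup>2 * K t / 4)\<bar> \<le> f * e\<^sup>2 * p"
      using x f(1) \<psi>pos[of t] by (simp add: abs_mult)
    also have "\<dots> \<le> f * e\<^sup>2 * \<psi> t" using p f by (intro mult_left_mono) auto
    finally have "\<bar>u - (1 - e\<^sup>2 * K t / 4)\<bar> \<le> e\<^sup>2" using f(1) \<psi>pos[of t] by simp
    then have u1: "\<bar>u - 1\<bar> \<le> e\<^sup>2 * c0"
      using z8[of t] by (simp add: c0_def algebra_simps abs_le_iff)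
    then have u8: "\<bar>u - 1\<bar> \<le> 1/8" using ec0 by linarith
    then have upos: "u > 0" by linarith
    have xpos: "x > 0" unfolding xu using f \<psi>pos upos by simp
    \<comment> \<open>The leading terms \<open>4 / (e^2 \<psi>^4)\<close> cancel. What is left has
      numerator of order \<open>e^2\<close>, hence is bounded independently of e, and the factor M1
      supplies the small factor e.\<close>
    have "a t - 3 / x ^ 4 - (\<mu> * w t + c t) = (3 * (1 - 1 / u ^ 4) - e\<^sup>2 * K t) / (e\<^sup>2 * \<psi> t ^ 4)"
    proof -
      have "x ^ 4 = e\<^sup>2 * \<psi> t ^ 4 * u ^ 4" unfolding xu by (simp add: power_mult_distrib f(4))
      moreover have "e\<^sup>2 * K t / (e\<^sup>2 * \<psi> t ^ 4) = c t + \<psi>2 t / \<psi> t"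
        using nz(1)[of t] nz(3) by (simp add: K_def field_simps power4_eq_xxxx power3_eq_cube)
      moreover have "3 * (1 - 1 / u ^ 4) / (e\<^sup>2 * \<psi> t ^ 4) = 3 / (e\<^sup>2 * \<psi> t ^ 4) - 3 / (e\<^sup>2 * \<psi> t ^ 4 * u ^ 4)"
        by (simp add: right_diff_distrib diff_divide_distrib)
      moreover have "4 / (e\<^sup>2 * \<psi> t ^ 4) = 3 / (e\<^sup>2 * \<psi> t ^ 4) + 1 / e\<^sup>2 * (1 / \<psi> t ^ 4)"
        by (simp add: add_divide_distrib[symmetric])
      ultimately show ?thesis
        unfolding a_def \<mu>_def w\<psi> by (simp add: diff_divide_distrib)
    qed
    moreover have "\<bar>3 * (1 - 1 / u ^ 4) - e\<^sup>2 * K t\<bar> \<le> e\<^sup>2 * (30 * c0 + \<kappa>)"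
    proof -
      have "\<bar>1 - 1 / u ^ 4\<bar> \<le> 10 * (e\<^sup>2 * c0)" 
        using order_trans[OF inverse_fourth_remainder[OF u8] mult_left_mono[OF u1, of 10]] by simp
      moreover have "\<bar>e\<^sup>2 * K t\<bar> \<le> e\<^sup>2 * \<kappa>" using z8[of t] by simp
      ultimately show ?thesis by (simp add: abs_le_iff algebra_simps)
    qed
    ultimately have "\<bar>a t - 3 / x ^ 4 - (\<mu> * w t + c t)\<bar> \<le> e\<^sup>2 * (30 * c0 + \<kappa>) / (e\<^sup>2 * \<psi> t ^ 4)"
      using e \<psi>pos[of t] by (simp only: abs_divide) (intro frac_le, auto)
    also have "\<dots> = (30 * c0 + \<kappa>) / \<psi> t ^ 4" using e by simp
    also have "\<dots> \<le> (30 * c0 + \<kappa>) / p ^ 4"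
      using p \<psi>pos c0 \<kappa> by (intro divide_left_mono power_mono mult_pos_pos zero_less_power) (auto simp: less_imp_le)
    finally have "\<bar>a t - 3 / x ^ 4 - (\<mu> * w t + c t)\<bar> * (P * e * q\<^sup>2 / 2) \<le> (30 * c0 + \<kappa>) / p ^ 4 * (P * e * q\<^sup>2 / 2)"
      using P e by (intro mult_right_mono) auto
    also have "\<dots> = e * ((30 * c0 + \<kappa>) / p ^ 4 * (P * q\<^sup>2 / 2))" by simp
    also have "\<dots> \<le> 1/4"
    proof -
      have z: "(30 * c0 + \<kappa>) / p ^ 4 * (P * q\<^sup>2 / 2) > 0"
        using c0 \<kappa> p P q by (intro mult_pos_pos divide_pos_pos add_pos_pos) auto
      show ?thesis using e3 unfolding pos_less_divide_eq[OF z] by (rule less_imp_le)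
    qed
    finally show ?thesis using xpos by blast
  qed
  have defect: "\<bar>1 / xa t ^ 3 - (\<mu> * w t + c t) * xa t - deriv ya t\<bar> \<le> R / 4" for t
  proof -
    define z where "z = e\<^sup>2 * K t / 4"
    have zb: "\<bar>z\<bar> \<le> e\<^sup>2 * (\<kappa> / 4)" using z8[of t] by (simp add: z_def)
    also have "\<dots> \<le> e\<^sup>2 * c0" by (intro mult_left_mono) (auto simp: c0_def)
    finally have z18: "\<bar>z\<bar> \<le> 1/8" using ec0 by linarith
    have xz: "xa t = f * \<psi> t * (1 - z)" by (simp add: xa_def Y_def z_def algebra_simps)
    have dd: "deriv ya t = f * (\<psi>2 t - e\<^sup>2 / 4 * Y2 t)" using dya DERIV_imp_deriv by blast
    \<comment> \<open>K was chosen so that the terms without a power of e inside the bracket cancel.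
      The cubic remainder is of order \<open>z^2 = O(e^4)\<close>, so after division by
      \<open>e^2\<close> everything inside the bracket is of order \<open>e^2\<close>.\<close>
    have "1 / xa t ^ 3 - (\<mu> * w t + c t) * xa t - deriv ya t
       = f * (e\<^sup>2 * (Y2 t / 4 + c t * Y t / 4) + (1 / (1 - z) ^ 3 - 1 - 3 * z) / (e\<^sup>2 * \<psi> t ^ 3))"
    proof -
      have K': "\<psi>2 t = (K t - c t * \<psi> t ^ 4) / \<psi> t ^ 3" using nz by (simp add: K_def)
      have K4: "K t = 4 * z / e\<^sup>2" using nz by (simp add: z_def)
      have i3: "1 / xa t ^ 3 = f * (1 / (1 - z) ^ 3) / (e\<^sup>2 * \<psi> t ^ 3)"
        unfolding xz f(4)[symmetric] power_mult_distrib using nz(2) by (simp add: power4_eq_xxxx power3_eq_cube)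
      have id: "f * i / (e\<^sup>2 * y ^ 3) - (1 / e\<^sup>2 * (1 / y ^ 4) + c') * (f * y * (1 - z))
          - f * ((4 * z / e\<^sup>2 - c' * y ^ 4) / y ^ 3 - e\<^sup>2 / 4 * Y2')
        = f * (e\<^sup>2 * (Y2' / 4 + c' * (y * (4 * z / e\<^sup>2)) / 4) + (i - 1 - 3 * z) / (e\<^sup>2 * y ^ 3))"
        if "y \<noteq> 0" for i y c' Y2' :: real
        using that nz(3) by (simp add: divide_simps power4_eq_xxxx power3_eq_cube power2_eq_square)
          (simp add: algebra_simps)
      show ?thesis unfolding i3 dd unfolding xz \<mu>_def w\<psi> K' Y_def K4 by (rule id[OF nz(1)])
    qed
    also have "\<bar>\<dots>\<bar> \<le> f * (e\<^sup>2 * c1 + 12 * z\<^sup>2 / (e\<^sup>2 * p ^ 3))"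
    proof -
      have "\<bar>e\<^sup>2 * (Y2 t / 4 + c t * Y t / 4)\<bar> \<le> e\<^sup>2 * c1"
        using c1(2)[of t] by (simp add: abs_mult mult_left_mono)
      moreover have "\<bar>(1 / (1 - z) ^ 3 - 1 - 3 * z) / (e\<^sup>2 * \<psi> t ^ 3)\<bar> \<le> 12 * z\<^sup>2 / (e\<^sup>2 * p ^ 3)"
      proof -
        have "\<bar>(1 / (1 - z) ^ 3 - 1 - 3 * z) / (e\<^sup>2 * \<psi> t ^ 3)\<bar> = \<bar>1 / (1 - z) ^ 3 - 1 - 3 * z\<bar> / (e\<^sup>2 * \<psi> t ^ 3)"
          using e \<psi>pos[of t] by simp
        also have "\<dots> \<le> 12 * z\<^sup>2 / (e\<^sup>2 * p ^ 3)"
          using inverse_cube_remainder[OF z18] e p \<psi>pos[of t]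
          by (intro frac_le mult_left_mono power_mono mult_pos_pos zero_less_power) auto
        finally show ?thesis .
      qed
      ultimately have "\<bar>e\<^sup>2 * (Y2 t / 4 + c t * Y t / 4) + (1 / (1 - z) ^ 3 - 1 - 3 * z) / (e\<^sup>2 * \<psi> t ^ 3)\<bar>
          \<le> e\<^sup>2 * c1 + 12 * z\<^sup>2 / (e\<^sup>2 * p ^ 3)"
        by (intro order_trans[OF abs_triangle_ineq add_mono])
      then show ?thesis using f(1) unfolding abs_mult[of f] by (intro mult_mono) auto
    qed
    also have "\<dots> \<le> f * (e\<^sup>2 * c1 + 12 * (e\<^sup>2 * (\<kappa> / 4))\<^sup>2 / (e\<^sup>2 * p ^ 3))"
    proof -
      have "z\<^sup>2 \<le> (e\<^sup>2 * (\<kappa> / 4))\<^sup>2" using zb by (intro abs_le_square_iff[THEN iffD1]) auto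
      then show ?thesis using f e p by (intro mult_left_mono add_left_mono divide_right_mono) auto
    qed
    also have "\<dots> = f * e * (e * (c1 + 12 * (\<kappa> / 4)\<^sup>2 / p ^ 3))"
      using e by (simp add: field_simps power2_eq_square)
    also have "\<dots> \<le> f * e * (p / (2 * P * q\<^sup>2))"
    proof -
      have z: "c1 + 12 * (\<kappa> / 4)\<^sup>2 / p ^ 3 > 0" using c1 \<kappa> p by (intro add_pos_pos divide_pos_pos) auto
      show ?thesis using e4 f e unfolding pos_less_divide_eq[OF z] by (intro mult_left_mono) auto
    qed
    also have "\<dots> = R / 4" by (simp add: R_def mult.commute mult.left_commute)
    finally show ?thesis .
  qed
  show thesis
  proof (rule that[OF _ _ op _ _ dxa R])
    show "\<mu> > 0" using e by (simp add: \<mu>_def)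
    have "\<bar>\<mu>1\<bar> + 1 < 1 / e" using e5 e by (simp add: r5_def field_simps)
    also have "1 / e \<le> 1 / e\<^sup>2" using ee' e by (intro divide_left_mono) auto
    finally show "\<mu> \<ge> \<mu>1" by (simp add: \<mu>_def)
    show "Ck_on n xa UNIV" for n unfolding xa_def[abs_def] by (intro Ck_intros C\<psi> CY) auto
    show "periodic P xa" using per\<psi> perY by (simp add: xa_def periodic_def)
    show "m > 0" "m' > 0" using f q s1 p by (auto simp: m_def m'_def intro!: add_pos_pos)
    show "x > 0 \<and> \<bar>a t - 3 / x ^ 4 - (\<mu> * w t + c t)\<bar> * antiperiodic_operator.M1 P m \<le> 1/4"
      if "\<bar>x - xa t\<bar> \<le> antiperiodic_operator.M1 P m * R" for t x
      unfolding M1 using lip that unfolding M1 M1R by blast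
    show "\<bar>1 / xa t ^ 3 - (\<mu> * w t + c t) * xa t - deriv ya t\<bar> \<le> R / 4" for t by (rule defect)
  qed
qed

section \<open>The branch of solutions of the magnitude equation\<close>

definition rhs_q :: "jet \<Rightarrow> real" where
  "rhs_q z = (case z of (l, x, y, \<mu>, \<delta>) \<Rightarrow> x\<^sup>2 + \<delta> - \<delta>\<^sup>2 * x\<^sup>2)"

definition rhs_r :: "jet \<Rightarrow> real" where
  "rhs_r z = (case z of (l, x, y, \<mu>, \<delta>) \<Rightarrow> 1 - \<delta> * (x\<^sup>2 + y\<^sup>2))"

definition rhs_dom :: "(jet) set" where
  "rhs_dom = {z. 0 < fst z \<and> 0 < fst (snd z) \<and> 0 < rhs_q z \<and> 0 < rhs_r z}"

text \<open>The right-hand side of the magnitude equation, as a function of \<open>(l, x, x', \<mu>, \<delta>)\<close>, is smooth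
  across \<open>\<delta> = 0\<close>, so negative values of \<open>\<delta>\<close> are allowed in the construction of the branch.\<close>

definition rhs :: "nat \<Rightarrow> nat \<Rightarrow> real \<Rightarrow> jet \<Rightarrow> real" where
  "rhs k1 k2 d1 z = (case z of (l, x, y, \<mu>, \<delta>) \<Rightarrow>
     rhs_r z / (x * rhs_q z) - x - rhs_r z * x * (\<mu> * l powr (2 * real k1 / real k2)
       * (x\<^sup>2 * rhs_r z / rhs_q z) powr (1 / real k2) - d1 / l\<^sup>2))"

lemma Ck_on_rhs_q: "open S \<Longrightarrow> Ck_on n rhs_q S"
  unfolding rhs_q_def[abs_def] case_prod_unfold by (intro Ck_intros)

lemma Ck_on_rhs_r: "open S \<Longrightarrow> Ck_on n rhs_r S"
  unfolding rhs_r_def[abs_def] case_prod_unfold by (intro Ck_intros)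

lemma open_rhs_dom: "open rhs_dom"
proof -
  have c: "continuous_on UNIV rhs_q" "continuous_on UNIV rhs_r"
    using Ck_on_continuous[OF Ck_on_rhs_q[OF open_UNIV]] Ck_on_continuous[OF Ck_on_rhs_r[OF open_UNIV]]
    by auto
  show ?thesis unfolding rhs_dom_def
    by (intro open_Collect_conj open_Collect_less c continuous_intros)
qed

lemma Ck_on_rhs: "Ck_on n (rhs k1 k2 d1) rhs_dom"
  unfolding rhs_def[abs_def] case_prod_unfold
  by (intro Ck_intros open_rhs_dom Ck_on_rhs_q Ck_on_rhs_r) (auto simp: rhs_dom_def)

lemma residual_rhs:
  "magnitude_residual k1 k2 d1 L \<mu> \<delta> x t
    = deriv (deriv x) t - rhs k1 k2 d1 (L t, x t, deriv x t, \<mu>, \<delta>)"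
  by (simp add: magnitude_residual_def rhs_def rhs_q_def rhs_r_def q_fun_def r_fun_def Let_def)

locale warp_data =
  fixes k1 k2 :: nat and d1 d2 P :: real and L :: "real \<Rightarrow> real"
  assumes k2_pos: "k2 > 0" and d1_pos: "d1 > 0" and d2_pos: "d2 > 0" and period_pos: "P > 0"
    and L_smooth: "\<And>n. Ck_on n L UNIV" and L_periodic: "periodic P L" and L_pos: "\<And>t. L t > 0"

text \<open>The bounds hold on a tube around the approximate solution \<open>xa\<close>, uniformly for warp values within
  \<open>d0\<close> of L; this is what makes the branch available for perturbed warps.\<close>

locale magnitude_branch = warp_data k1 k2 d1 d2 P L + antiperiodic_operator P u1 u2 v1 v2 a m m'
  for k1 k2 :: nat and d1 d2 P :: real and L u1 u2 v1 v2 a :: "real \<Rightarrow> real" and m m' :: real +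
  fixes xa ya :: "real \<Rightarrow> real" and R \<mu>0 d0 \<alpha>0 \<beta>0 :: real
  assumes m_pos: "m > 0" "m' > 0" and R_pos: "R > 0" and d0_pos: "d0 > 0" and \<mu>0: "\<mu>0 > d0"
    and ab0: "\<alpha>0 \<ge> 0" "\<beta>0 \<ge> 0" "\<alpha>0 * M1 + \<beta>0 * M2 \<le> 1/2"
    and xa_smooth: "\<And>n. Ck_on n xa UNIV" and xa_periodic: "periodic P xa"
    and xa_deriv: "\<And>t. (xa has_real_derivative ya t) (at t)"
    and tube_dom: "\<And>t l x y p. \<bar>l - L t\<bar> < d0 \<Longrightarrow> \<bar>x - xa t\<bar> < M1 * R \<Longrightarrow> \<bar>y - ya t\<bar> < M2 * R \<Longrightarrow>
        dist p (\<mu>0, 0) < d0 \<Longrightarrow> (l, x, y, p) \<in> rhs_dom"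
    and tube_lip: "\<And>t l x y x' y' p. \<bar>l - L t\<bar> < d0 \<Longrightarrow> \<bar>x - xa t\<bar> < M1 * R \<Longrightarrow> \<bar>y - ya t\<bar> < M2 * R \<Longrightarrow>
        \<bar>x' - xa t\<bar> < M1 * R \<Longrightarrow> \<bar>y' - ya t\<bar> < M2 * R \<Longrightarrow> dist p (\<mu>0, 0) < d0 \<Longrightarrow>
        \<bar>(a t * x + rhs k1 k2 d1 (l, x, y, p)) - (a t * x' + rhs k1 k2 d1 (l, x', y', p))\<bar>
          \<le> \<alpha>0 * \<bar>x - x'\<bar> + \<beta>0 * \<bar>y - y'\<bar>"
    and tube_defect: "\<And>t l p. \<bar>l - L t\<bar> < d0 \<Longrightarrow> dist p (\<mu>0, 0) < d0 \<Longrightarrow>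
        \<bar>rhs k1 k2 d1 (l, xa t, ya t, p) - deriv ya t\<bar> \<le> 3 * R / 8"
    and elliptic: "\<And>t. \<mu>0 * L t powr (2 * real k1 / real k2) > d1 / (L t)\<^sup>2"

lemma rhs_at_zero:
  assumes "x > 0"
  shows "rhs k1 k2 d1 (l, x, y, \<mu>, 0)
    = 1 / x ^ 3 - (\<mu> * l powr (2 * real k1 / real k2) + (1 - d1 / l\<^sup>2)) * x"
  using assms by (simp add: rhs_def rhs_q_def rhs_r_def field_simps power2_eq_square power3_eq_cube)

lemma rhs_dom_at_zero: "l > 0 \<Longrightarrow> x > 0 \<Longrightarrow> (l, x, y, \<mu>, 0) \<in> rhs_dom"
  by (simp add: rhs_dom_def rhs_q_def rhs_r_def)

text \<open>The x-derivative is what the coefficient a has to compensate. Since at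
  \<open>\<delta> = 0\<close> the right-hand side does not involve x', the constant \<beta>0 only
  has to absorb the perturbation of the warp and of the parameters.\<close>

lemma rhs_derivative_at_zero:
  assumes "l > 0" "x > 0"
  shows "fderiv (rhs k1 k2 d1) (l, x, y, \<mu>, 0) (0, 1, 0, 0)
      = - 3 / x ^ 4 - (\<mu> * l powr (2 * real k1 / real k2) + (1 - d1 / l\<^sup>2))"
    and "fderiv (rhs k1 k2 d1) (l, x, y, \<mu>, 0) (0, 0, 1, 0) = 0"
proof -
  let ?D = "fderiv (rhs k1 k2 d1) (l, x, y, \<mu>, 0)"
  have D: "(rhs k1 k2 d1 has_derivative ?D) (at (l, x, y, \<mu>, 0))"
    by (rule Ck_on_Suc_has_derivative[OF open_rhs_dom Ck_on_rhs[of "Suc 0"] rhs_dom_at_zero[OF assms]])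
  have lin: "linear ?D" using D by (rule has_derivative_linear)
  have c1: "((\<lambda>s. (l, s, y, \<mu>, 0::real)) has_derivative (\<lambda>h. (0, h, 0, 0, 0))) (at x)"
    by (auto intro!: derivative_eq_intros simp: zero_prod_def)
  have "((\<lambda>s. rhs k1 k2 d1 (l, s, y, \<mu>, 0)) has_derivative (\<lambda>h. ?D (0, h, 0, 0, 0))) (at x)"
    by (rule has_derivative_compose[OF c1 D])
  moreover have "?D (0, h, 0, 0, 0) = ?D (0, 1, 0, 0) * h" for h
    using linear_cmul[OF lin, of h "(0, 1, 0, 0)"] by (simp add: zero_prod_def)
  ultimately have "((\<lambda>s. rhs k1 k2 d1 (l, s, y, \<mu>, 0)) has_real_derivative ?D (0, 1, 0, 0)) (at x)"
    by (simp add: has_field_derivative_def)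
  moreover have "((\<lambda>s. rhs k1 k2 d1 (l, s, y, \<mu>, 0)) has_real_derivative
      - 3 / x ^ 4 - (\<mu> * l powr (2 * real k1 / real k2) + (1 - d1 / l\<^sup>2))) (at x)"
  proof (rule has_field_derivative_transform_within_open[where S="{0<..}"])
    show "((\<lambda>x. 1 / x ^ 3 - (\<mu> * l powr (2 * real k1 / real k2) + (1 - d1 / l\<^sup>2)) * x) has_real_derivative
       - 3 / x ^ 4 - (\<mu> * l powr (2 * real k1 / real k2) + (1 - d1 / l\<^sup>2))) (at x)"
      using assms by (auto intro!: derivative_eq_intros simp: field_simps power2_eq_square power3_eq_cube power4_eq_xxxx)
  qed (use assms rhs_at_zero in auto)
  ultimately show "?D (0, 1, 0, 0) = - 3 / x ^ 4 - (\<mu> * l powr (2 * real k1 / real k2) + (1 - d1 / l\<^sup>2))"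
    by (rule DERIV_unique)
  have c2: "((\<lambda>s. (l, x, s, \<mu>, 0::real)) has_derivative (\<lambda>h. (0, 0, h, 0, 0))) (at y)"
    by (auto intro!: derivative_eq_intros simp: zero_prod_def)
  have "((\<lambda>s. rhs k1 k2 d1 (l, x, s, \<mu>, 0)) has_derivative (\<lambda>h. ?D (0, 0, h, 0, 0))) (at y)"
    by (rule has_derivative_compose[OF c2 D])
  moreover have "((\<lambda>s. rhs k1 k2 d1 (l, x, s, \<mu>, 0)) has_derivative (\<lambda>h. 0)) (at y)"
    using assms by (simp add: rhs_at_zero)
  ultimately have "(\<lambda>h. ?D (0, 0, h, 0, 0)) = (\<lambda>h. 0)" by (rule has_derivative_unique)
  from fun_cong[OF this, of 1] show "?D (0, 0, 1, 0) = 0" by (simp add: zero_prod_def)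
qed

text \<open>All estimates hold at the warp L and at \<open>(\<mu>, 0)\<close>. The closed tube over
  one period is compact, so they survive, with slightly worse constants, for nearby warp values and
  parameters.\<close>

lemma (in warp_data) ex_magnitude_branch:
  "\<exists>u1 u2 v1 v2 a m m' xa ya R \<mu>0 d0 \<alpha>0 \<beta>0.
    magnitude_branch k1 k2 d1 d2 P L u1 u2 v1 v2 a m m' xa ya R \<mu>0 d0 \<alpha>0 \<beta>0"
proof -
  define w where "w t = L t powr (2 * real k1 / real k2)" for t
  define c where "c t = 1 - d1 / (L t)\<^sup>2" for t
  have Lnz: "L t \<noteq> 0" for t using L_pos[of t] by simp
  have Cw: "Ck_on n w UNIV" for n unfolding w_def[abs_def] by (intro Ck_intros L_smooth) (auto simp: L_pos)
  have Cc: "Ck_on n c UNIV" for n unfolding c_def[abs_def] by (intro Ck_intros L_smooth) (auto simp: Lnz)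
  have wpos: "w t > 0" for t using L_pos[of t] by (simp add: w_def)
  have per: "periodic P w" "periodic P c" using L_periodic by (auto simp: w_def c_def periodic_def)
  \<comment> \<open>\<open>\<mu>1\<close> bounds \<open>d1 / (L^2 w)\<close>; asking for
    \<open>\<mu> \<ge> \<mu>1 + 1\<close> yields the strict inequality \<open>elliptic\<close>,
    which later decides the sign of the derivative in \<delta>.\<close>
  have "periodic P (\<lambda>t. d1 / (L t)\<^sup>2 / w t)" using L_periodic per by (auto simp: periodic_def)
  moreover have "continuous_on UNIV (\<lambda>t. d1 / (L t)\<^sup>2 / w t)"
    using Ck_on_continuous[OF L_smooth[of 0]] Ck_on_continuous[OF Cw[of 0]]
    by (intro continuous_intros) (auto simp: Lnz less_imp_neq[OF wpos, symmetric])
  ultimately obtain \<mu>1 where \<mu>1: "\<And>t. \<bar>d1 / (L t)\<^sup>2 / w t\<bar> \<le> \<mu>1" using periodic_bounded[OF period_pos] by blast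
  obtain \<mu> u1 u2 v1 v2 a m m' xa ya R where mu: "\<mu> \<ge> \<mu>1 + 1" "\<mu> > 0"
    and op: "antiperiodic_operator P u1 u2 v1 v2 a m m'"
    and xa: "\<And>n. Ck_on n xa UNIV" "periodic P xa" "\<And>t. (xa has_real_derivative ya t) (at t)"
    and Rm: "R > 0" "m > 0" "m' > 0"
    and lip: "\<And>t x. \<bar>x - xa t\<bar> \<le> antiperiodic_operator.M1 P m * R \<Longrightarrow>
        x > 0 \<and> \<bar>a t - 3 / x ^ 4 - (\<mu> * w t + c t)\<bar> * antiperiodic_operator.M1 P m \<le> 1/4"
    and defect: "\<And>t. \<bar>1 / xa t ^ 3 - (\<mu> * w t + c t) * xa t - deriv ya t\<bar> \<le> R / 4"
    using ermakov_approximate_solution[OF period_pos Cw per(1) wpos Cc per(2), of "\<mu>1 + 1"] by blast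
  interpret antiperiodic_operator P u1 u2 v1 v2 a m m' by (rule op)
  have M: "M1 > 0" "M2 > 0" using Rm period_pos by (auto simp: M1_def M2_def intro!: divide_pos_pos mult_pos_pos)
  have ya: "ya = deriv xa" using xa(3) DERIV_imp_deriv by (metis ext)
  have Cya: "Ck_on n ya UNIV" for n unfolding ya by (rule Ck_on_all_DERIV(2)[OF xa(1)])
  have perya: "periodic P ya" using periodic_deriv[OF xa(2,3)] .
  define emb where "emb = (\<lambda>(t, h, k). (L t, xa t + h, ya t + k, \<mu>, 0::real))"
  define K where "K = emb ` ({0..P} \<times> {- (M1 * R)..M1 * R} \<times> {- (M2 * R)..M2 * R})"
  have "continuous_on UNIV emb"
    unfolding emb_def case_prod_unfold
    by (intro continuous_intros continuous_on_compose2[OF Ck_on_continuous[OF L_smooth[of 0]]]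
      continuous_on_compose2[OF Ck_on_continuous[OF xa(1)[of 0]]]
      continuous_on_compose2[OF Ck_on_continuous[OF Cya[of 0]]]) auto
  then have cK: "compact K"
    unfolding K_def by (intro compact_continuous_image compact_Times compact_Icc) (auto intro: continuous_on_subset)
  have inK: "(L t, x, y, \<mu>, 0) \<in> K" if "\<bar>x - xa t\<bar> \<le> M1 * R" "\<bar>y - ya t\<bar> \<le> M2 * R" for t x y
  proof -
    obtain j :: int where j: "t + of_int j * P \<in> {0..P}" using periodic_shift_into[OF period_pos] by blast
    have "(L t, x, y, \<mu>, 0) = emb (t + of_int j * P, x - xa t, y - ya t)"
      by (simp add: emb_def periodic_of_int[OF L_periodic] periodic_of_int[OF xa(2)] periodic_of_int[OF perya])
    then show ?thesis using j that unfolding K_def abs_le_iff by (intro image_eqI) auto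
  qed
  have Kdom: "K \<subseteq> rhs_dom"
  proof
    fix z assume "z \<in> K"
    then obtain t h k where z: "z = (L t, xa t + h, ya t + k, \<mu>, 0)" "\<bar>h\<bar> \<le> M1 * R"
      by (auto simp: K_def emb_def abs_le_iff)
    then show "z \<in> rhs_dom" using lip[of "xa t + h" t] L_pos by (auto intro: rhs_dom_at_zero)
  qed
  let ?F = "rhs k1 k2 d1"
  let ?F1 = "\<lambda>z. fderiv ?F z (0, 1, 0, 0)"
  let ?F2 = "\<lambda>z. fderiv ?F z (0, 0, 1, 0)"
  have cF: "continuous_on rhs_dom ?F" using Ck_on_continuous[OF Ck_on_rhs[of 0]] .
  have cF12: "continuous_on rhs_dom ?F1" "continuous_on rhs_dom ?F2"
    using Ck_on_continuous[OF Ck_on_SucD[OF Ck_on_rhs[of "Suc 0"]]] by auto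
  \<comment> \<open>The tolerances fill the available budget: the defect becomes
    \<open>R/4 + R/8 = 3R/8\<close>, and the contraction factor
    \<open>1/4 + 1/16 + 1/8 = 7/16\<close>, below 1/2.\<close>
  obtain e1 where e1: "e1 > 0" "\<And>z z'. z \<in> K \<Longrightarrow> dist z z' < e1 \<Longrightarrow> z' \<in> rhs_dom \<and> dist (?F z') (?F z) < R / 8"
    using uniform_near_compact[OF open_rhs_dom cF cK Kdom, of "R / 8"] Rm by auto
  obtain e2 where e2: "e2 > 0" "\<And>z z'. z \<in> K \<Longrightarrow> dist z z' < e2 \<Longrightarrow> z' \<in> rhs_dom \<and> dist (?F1 z') (?F1 z) < 1 / (16 * M1)"
    using uniform_near_compact[OF open_rhs_dom cF12(1) cK Kdom, of "1 / (16 * M1)"] M by auto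
  obtain e3 where e3: "e3 > 0" "\<And>z z'. z \<in> K \<Longrightarrow> dist z z' < e3 \<Longrightarrow> z' \<in> rhs_dom \<and> dist (?F2 z') (?F2 z) < 1 / (8 * M2)"
    using uniform_near_compact[OF open_rhs_dom cF12(2) cK Kdom, of "1 / (8 * M2)"] M by auto
  \<comment> \<open>Halves, because warp value and parameter may each move by \<open>d0\<close> and
    the distances add up. The bound \<open>\<mu> / 2\<close> keeps the first parameter positive on
    the whole disc.\<close>
  define d0 where "d0 = Min {e1 / 2, e2 / 2, e3 / 2, \<mu> / 2}"
  have d0: "d0 > 0" "2 * d0 \<le> e1" "2 * d0 \<le> e2" "2 * d0 \<le> e3" "d0 < \<mu>"
    using e1 e2 e3 mu by (auto simp: d0_def)
  have close: "dist (L t, x, y, \<mu>, 0) (l, x, y, p) < 2 * d0" if "\<bar>l - L t\<bar> < d0" "dist p (\<mu>, 0) < d0" for t l x y :: real and p :: "real \<times> real"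
  proof -
    have "dist (L t, x, y, \<mu>, 0) (l, x, y, p) \<le> \<bar>L t - l\<bar> + dist (\<mu>, 0) p"
      using norm_Pair_le[of "L t - l" "(x, y, (\<mu>, 0)) - (x, y, p)"]
        norm_Pair_le[of "x - x" "(y, (\<mu>, 0)) - (y, p)"] norm_Pair_le[of "y - y" "(\<mu>, 0) - p"]
      by (simp add: dist_norm)
    then show ?thesis using that by (simp add: dist_commute abs_minus_commute)
  qed
  have "magnitude_branch k1 k2 d1 d2 P L u1 u2 v1 v2 a m m' xa ya R \<mu> d0 (5 / (16 * M1)) (1 / (8 * M2))"
  proof unfold_locales
    show "m > 0" "m' > 0" "R > 0" "d0 > 0" "d0 < \<mu>" using Rm d0 by auto
    show "0 \<le> 5 / (16 * M1)" "0 \<le> 1 / (8 * M2)" using M by auto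
    show "5 / (16 * M1) * M1 + 1 / (8 * M2) * M2 \<le> 1/2" using M by (simp add: field_simps)
    show "Ck_on n xa UNIV" "periodic P xa" "(xa has_real_derivative ya t) (at t)" for n t using xa by auto
    show "d1 / (L t)\<^sup>2 < \<mu> * L t powr (2 * real k1 / real k2)" for t
    proof -
      have "d1 / (L t)\<^sup>2 / w t < \<mu>" using \<mu>1[of t] mu(1) by linarith
      then show ?thesis using wpos[of t] by (simp add: divide_less_eq w_def mult.commute mult.left_commute)
    qed
    show "(l, x, y, p) \<in> rhs_dom"
      if "\<bar>l - L t\<bar> < d0" "\<bar>x - xa t\<bar> < M1 * R" "\<bar>y - ya t\<bar> < M2 * R" "dist p (\<mu>, 0) < d0" for t l x y p
      using e1(2)[OF inK, of x t y "(l, x, y, p)"] close[OF that(1,4), of x y] d0(2) that(2,3) by auto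
    show "\<bar>?F (l, xa t, ya t, p) - deriv ya t\<bar> \<le> 3 * R / 8"
      if "\<bar>l - L t\<bar> < d0" "dist p (\<mu>, 0) < d0" for t l p
    proof -
      have "(L t, xa t, ya t, \<mu>, 0) \<in> K" using inK[of "xa t" t "ya t"] M Rm by simp
      then have "\<bar>?F (l, xa t, ya t, p) - ?F (L t, xa t, ya t, \<mu>, 0)\<bar> < R / 8"
        using e1(2) close[OF that, of "xa t" "ya t"] d0(2) by (auto simp: dist_real_def)
      moreover have "xa t > 0" using lip[of "xa t" t] M Rm by simp
      moreover have "\<bar>A - C\<bar> \<le> 3 * R / 8" if "\<bar>A - B\<bar> < R / 8" "\<bar>B - C\<bar> \<le> R / 4" for A B C :: real
        using that by linarith
      ultimately show ?thesis using defect[of t] rhs_at_zero[of "xa t" k1 k2 d1 "L t" "ya t" \<mu>] by (simp add: w_def c_def)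
    qed
    fix t l x y x' y' :: real and p :: "real \<times> real"
    assume h: "\<bar>l - L t\<bar> < d0" "\<bar>x - xa t\<bar> < M1 * R" "\<bar>y - ya t\<bar> < M2 * R"
      "\<bar>x' - xa t\<bar> < M1 * R" "\<bar>y' - ya t\<bar> < M2 * R" "dist p (\<mu>, 0) < d0"
    \<comment> \<open>Mean value theorem along the segment between the two points, which stays in
      the tube because the tube at time t is a box.\<close>
    define \<phi> where "\<phi> s = a t * (x' + s * (x - x')) + ?F (l, x' + s * (x - x'), y' + s * (y - y'), p)" for s
    have der: "\<exists>D. (\<phi> has_real_derivative D) (at s) \<and> \<bar>D\<bar> \<le> 5 / (16 * M1) * \<bar>x - x'\<bar> + 1 / (8 * M2) * \<bar>y - y'\<bar>"
      if s: "0 \<le> s" "s \<le> 1" for s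
    proof -
      define xs where "xs = x' + s * (x - x')"
      define ys where "ys = y' + s * (y - y')"
      have conv: "\<bar>u' + s * (u - u') - v\<bar> \<le> b" if "\<bar>u - v\<bar> < b" "\<bar>u' - v\<bar> < b" for u u' v b
      proof -
        have "u' + s * (u - u') - v = (1 - s) * (u' - v) + s * (u - v)" by (simp add: algebra_simps)
        also have "\<bar>\<dots>\<bar> \<le> \<bar>(1 - s) * (u' - v)\<bar> + \<bar>s * (u - v)\<bar>" by (rule abs_triangle_ineq)
        also have "\<dots> = (1 - s) * \<bar>u' - v\<bar> + s * \<bar>u - v\<bar>" using s by (simp add: abs_mult)
        also have "\<dots> \<le> (1 - s) * b + s * b" using s that by (intro add_mono mult_left_mono) auto
        finally show ?thesis by (simp add: algebra_simps)
      qed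
      have xs: "\<bar>xs - xa t\<bar> \<le> M1 * R" "\<bar>ys - ya t\<bar> \<le> M2 * R"
        unfolding xs_def ys_def using conv h by auto
      let ?z = "(l, xs, ys, p)" and ?base = "(L t, xs, ys, \<mu>, 0::real)"
      have z: "?z \<in> rhs_dom" "\<bar>?F1 ?z - ?F1 ?base\<bar> < 1 / (16 * M1)" "\<bar>?F2 ?z - ?F2 ?base\<bar> < 1 / (8 * M2)"
        using e2(2)[OF inK[OF xs], of ?z] e3(2)[OF inK[OF xs], of ?z] close[OF h(1,6), of xs ys] d0
        by (auto simp: dist_real_def)
      have xpos: "xs > 0" and b: "\<bar>a t - 3 / xs ^ 4 - (\<mu> * w t + c t)\<bar> \<le> 1 / (4 * M1)"
        using lip[OF xs(1)] M by (auto simp: field_simps)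
      have f0: "?F1 ?base = - 3 / xs ^ 4 - (\<mu> * w t + c t)" "?F2 ?base = 0"
        using rhs_derivative_at_zero[OF L_pos[of t] xpos] by (auto simp: w_def c_def)
      have D: "(?F has_derivative fderiv ?F ?z) (at ?z)"
        by (rule Ck_on_Suc_has_derivative[OF open_rhs_dom Ck_on_rhs[of "Suc 0"] z(1)])
      have lin: "linear (fderiv ?F ?z)" using D by (rule has_derivative_linear)
      have "((\<lambda>s. (l, x' + s * (x - x'), y' + s * (y - y'), p)) has_derivative
          (\<lambda>h. (0, h * (x - x'), h * (y - y'), 0))) (at s)"
        by (auto intro!: derivative_eq_intros)
      then have "((\<lambda>s. ?F (l, x' + s * (x - x'), y' + s * (y - y'), p)) has_derivative
          (\<lambda>h. fderiv ?F ?z (0, h * (x - x'), h * (y - y'), 0))) (at s)"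
        by (rule has_derivative_compose) (use D in \<open>simp add: xs_def ys_def\<close>)
      moreover have "fderiv ?F ?z (0, h * (x - x'), h * (y - y'), 0)
          = ((x - x') * ?F1 ?z + (y - y') * ?F2 ?z) * h" for h
      proof -
        have "(0, h * (x - x'), h * (y - y'), 0) = (h * (x - x')) *\<^sub>R (0, 1, 0, 0) + (h * (y - y')) *\<^sub>R (0::real, 0::real, 1::real, 0::real \<times> real)"
          by simp
        then show ?thesis by (simp only: linear_add[OF lin] linear_cmul[OF lin]) (simp add: algebra_simps)
      qed
      ultimately have "((\<lambda>s. ?F (l, x' + s * (x - x'), y' + s * (y - y'), p)) has_real_derivative
          (x - x') * ?F1 ?z + (y - y') * ?F2 ?z) (at s)"
        by (simp add: has_field_derivative_def)
      then have "(\<phi> has_real_derivative a t * (x - x') + ((x - x') * ?F1 ?z + (y - y') * ?F2 ?z)) (at s)"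
        unfolding \<phi>_def[abs_def] by (auto intro!: derivative_eq_intros)
      moreover have "\<bar>a t * (x - x') + ((x - x') * ?F1 ?z + (y - y') * ?F2 ?z)\<bar>
          \<le> 5 / (16 * M1) * \<bar>x - x'\<bar> + 1 / (8 * M2) * \<bar>y - y'\<bar>"
      proof -
        have "\<bar>a t + ?F1 ?z\<bar> \<le> 1 / (4 * M1) + 1 / (16 * M1)"
          using z(2) b f0(1) by (simp only: abs_le_iff abs_less_iff) linarith
        also have "\<dots> = 5 / (16 * M1)" using M by (simp add: field_simps)
        finally have 1: "\<bar>(a t + ?F1 ?z) * (x - x')\<bar> \<le> 5 / (16 * M1) * \<bar>x - x'\<bar>"
          unfolding abs_mult by (rule mult_right_mono) auto
        have "\<bar>?F2 ?z\<bar> \<le> 1 / (8 * M2)" using z(3) f0(2) by simp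
        then have 2: "\<bar>?F2 ?z * (y - y')\<bar> \<le> 1 / (8 * M2) * \<bar>y - y'\<bar>"
          unfolding abs_mult by (rule mult_right_mono) auto
        have "a t * (x - x') + ((x - x') * ?F1 ?z + (y - y') * ?F2 ?z) = (a t + ?F1 ?z) * (x - x') + ?F2 ?z * (y - y')"
          by (simp add: algebra_simps)
        then show ?thesis using order_trans[OF abs_triangle_ineq add_mono[OF 1 2]] by (simp only:)
      qed
      ultimately show ?thesis by blast
    qed
    then obtain D where D: "\<And>s. 0 \<le> s \<Longrightarrow> s \<le> 1 \<Longrightarrow> (\<phi> has_real_derivative D s) (at s)"
      "\<And>s. 0 \<le> s \<Longrightarrow> s \<le> 1 \<Longrightarrow> \<bar>D s\<bar> \<le> 5 / (16 * M1) * \<bar>x - x'\<bar> + 1 / (8 * M2) * \<bar>y - y'\<bar>" by metis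
    obtain s where s: "0 < s" "s < 1" "\<phi> 1 - \<phi> 0 = (1 - 0) * D s"
      using MVT2[of 0 1 \<phi> D] D(1) by auto
    show "\<bar>a t * x + ?F (l, x, y, p) - (a t * x' + ?F (l, x', y', p))\<bar>
        \<le> 5 / (16 * M1) * \<bar>x - x'\<bar> + 1 / (8 * M2) * \<bar>y - y'\<bar>"
      using s D(2)[of s] by (simp add: \<phi>_def)
  qed
  then show ?thesis by blast
qed

text \<open>The phase velocities with the factor \<open>\<delta>\<close> cancelled, so that they too extend across \<open>\<delta> = 0\<close>.\<close>

definition rate1 :: "jet \<Rightarrow> real" where
  "rate1 z = sqrt (rhs_r z) / (fst (snd z) * sqrt (rhs_q z))"

definition rate2 :: "jet \<Rightarrow> real" where
  "rate2 z = fst (snd z) * sqrt (rhs_r z)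
     / (sqrt (rhs_q z) * (1 - snd (snd (snd (snd z))) * (fst (snd z))\<^sup>2))"

lemma rhs_dom_comagnitude:
  assumes "(l, x, y, \<mu>, \<delta>) \<in> rhs_dom"
  shows "1 - \<delta> * x\<^sup>2 > 0"
proof (cases "\<delta> \<ge> 0")
  case True
  then have "0 \<le> \<delta> * y\<^sup>2" by simp
  then show ?thesis using assms by (simp add: rhs_dom_def rhs_r_def algebra_simps)
next
  case False
  then have "\<delta> * x\<^sup>2 \<le> 0" by (simp add: mult_nonpos_nonneg)
  then show ?thesis by linarith
qed

lemma Ck_on_rate1: "Ck_on n rate1 rhs_dom"
  unfolding rate1_def[abs_def]
  by (intro Ck_intros open_rhs_dom Ck_on_rhs_q Ck_on_rhs_r) (auto simp: rhs_dom_def)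

lemma Ck_on_rate2: "Ck_on n rate2 rhs_dom"
  unfolding rate2_def[abs_def]
proof (intro Ck_intros open_rhs_dom Ck_on_rhs_q Ck_on_rhs_r)
  fix z assume z: "z \<in> rhs_dom"
  obtain l x y \<mu> \<delta> where "z = (l, x, y, \<mu>, \<delta>)" by (cases z)
  then show "sqrt (rhs_q z) * (1 - snd (snd (snd (snd z))) * (fst (snd z))\<^sup>2) \<noteq> 0"
    using z rhs_dom_comagnitude[of l x y \<mu> \<delta>] by (auto simp: rhs_dom_def)
qed (auto simp: rhs_dom_def)

section \<open>The branch as a family of fixed points\<close>

context magnitude_branch
begin

abbreviation "vf \<equiv> rhs k1 k2 d1"

text \<open>The source term of the approximate solution: \<open>G ga = xa\<close> and
  \<open>H ga = ya\<close>, so a ball around \<open>ga\<close> is carried into the tube around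
  \<open>(xa, ya)\<close>.\<close>

definition ga :: "real \<Rightarrow> real" where "ga t = deriv ya t + a t * xa t"

definition near :: "(real \<Rightarrow> real) \<Rightarrow> bool" where
  "near l \<longleftrightarrow> contper l \<and> (\<forall>t. \<bar>l t - L t\<bar> < d0)"

definition pars :: "(real \<times> real) set" where "pars = ball (\<mu>0, 0) d0"

definition tube :: "real \<Rightarrow> (real \<times> real) set" where
  "tube t = {w. \<bar>fst w - xa t\<bar> < M1 * R \<and> \<bar>snd w - ya t\<bar> < M2 * R}"

definition Nfun :: "(real \<Rightarrow> real) \<Rightarrow> real \<times> real \<Rightarrow> real \<Rightarrow> real \<Rightarrow> real \<Rightarrow> real" where
  "Nfun l p t x y = a t * x + vf (l t, x, y, p)"

text \<open>The radius \<open>7 * R / 8\<close> is strictly below R so that the closed ball of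
  source terms lands in the open tube, and large enough for twice its value of admissible defect,
  since \<open>3 * R / 8 \<le> 7 * R / 16\<close>.\<close>

definition sol :: "(real \<Rightarrow> real) \<Rightarrow> real \<times> real \<Rightarrow> real \<Rightarrow> real" where
  "sol l p = (SOME g. contper g \<and> (\<forall>t. \<bar>g t - ga t\<bar> \<le> 7 * R / 8) \<and> (\<forall>t. g t = Nfun l p t (G g t) (H g t)))"

definition X :: "(real \<Rightarrow> real) \<Rightarrow> real \<times> real \<Rightarrow> real \<Rightarrow> real" where "X l p = G (sol l p)"
definition Y :: "(real \<Rightarrow> real) \<Rightarrow> real \<times> real \<Rightarrow> real \<Rightarrow> real" where "Y l p = H (sol l p)"

lemma M_pos: "M1 > 0" "M2 > 0"
  using m_pos P_pos by (auto simp: M1_def M2_def intro!: divide_pos_pos mult_pos_pos)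

lemma pars_iff: "p \<in> pars \<longleftrightarrow> dist p (\<mu>0, 0) < d0"
  by (simp add: pars_def dist_commute)

lemma open_pars: "open pars"
  by (simp add: pars_def)

lemma near_L: "near L"
  using Ck_on_continuous[OF L_smooth[of 0]] L_periodic d0_pos by (auto simp: near_def contper_def)

lemma nearD: "near l \<Longrightarrow> \<bar>l t - L t\<bar> < d0" "near l \<Longrightarrow> contper l"
  by (auto simp: near_def)

lemma ya_eq: "ya = deriv xa"
  using xa_deriv DERIV_imp_deriv by (metis ext)

lemma ya_deriv: "(ya has_real_derivative deriv ya t) (at t)"
  unfolding ya_eq using Ck_on_all_DERIV(1)[OF Ck_on_all_DERIV(2)[OF xa_smooth]] .

lemma Ck_on_ga: "Ck_on n ga UNIV"
  unfolding ga_def[abs_def] unfolding ya_eq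
  by (intro Ck_intros Ck_on_all_DERIV(2)[OF Ck_on_all_DERIV(2)[OF xa_smooth]] smooth_a xa_smooth) auto

lemma contper_ga: "contper ga"
proof -
  have "periodic P (deriv ya)"
    using periodic_deriv[OF periodic_deriv[OF xa_periodic xa_deriv] ya_deriv] .
  then show ?thesis
    using Ck_on_continuous[OF Ck_on_ga[of 0]] xa_periodic periodic_a
    by (simp add: contper_def periodic_def ga_def)
qed

lemma G_ga: "G ga = xa" "H ga = ya"
proof -
  have "(ya has_real_derivative ga t - a t * xa t) (at t)" for t
    using ya_deriv[of t] by (simp add: ga_def)
  from G_unique[OF xa_deriv this xa_periodic contper_ga] show "G ga = xa" "H ga = ya" by simp_all
qed

lemma open_tube: "open (tube t)"
proof -
  have "tube t = {xa t - M1 * R<..<xa t + M1 * R} \<times> {ya t - M2 * R<..<ya t + M2 * R}"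
    by (auto simp: tube_def abs_less_iff)
  then show ?thesis by (simp add: open_Times)
qed

lemma ball_tube:
  assumes "contper g" "\<And>t. \<bar>g t - ga t\<bar> \<le> 7 * R / 8"
  shows "(G g t, H g t) \<in> tube t"
proof -
  have "\<bar>G g t - xa t\<bar> \<le> M1 * (7 * R / 8)" "\<bar>H g t - ya t\<bar> \<le> M2 * (7 * R / 8)"
    using GH_bound[OF contper_diff[OF assms(1) contper_ga] assms(2), of t] GH_diff[OF assms(1) contper_ga, of t]
    by (auto simp: G_ga)
  moreover have "M1 * (7 * R / 8) < M1 * R" "M2 * (7 * R / 8) < M2 * R"
    using M_pos R_pos by auto
  ultimately show ?thesis unfolding tube_def mem_Collect_eq fst_conv snd_conv by (meson le_less_trans)
qed

lemma tube_in_dom: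
  assumes "near l" "p \<in> pars" "(x, y) \<in> tube t"
  shows "(l t, x, y, p) \<in> rhs_dom"
  using tube_dom[of "l t" t x y p] assms by (auto simp: nearD tube_def pars_iff)

lemma Nfun_lip:
  assumes "near l" "p \<in> pars" "(x, y) \<in> tube t" "(x', y') \<in> tube t"
  shows "\<bar>Nfun l p t x y - Nfun l p t x' y'\<bar> \<le> \<alpha>0 * \<bar>x - x'\<bar> + \<beta>0 * \<bar>y - y'\<bar>"
  using tube_lip[of "l t" t x y x' y' p] assms by (auto simp: nearD tube_def pars_iff Nfun_def)

lemma contper_rhs:
  assumes "near l" "p \<in> pars" "contper x" "contper y" "\<And>t. (l t, x t, y t, p) \<in> rhs_dom"
  shows "contper (\<lambda>t. vf (l t, x t, y t, p))"
proof -
  have "continuous_on UNIV (\<lambda>t. vf (l t, x t, y t, p))"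
    using assms(3-) contperD(1)[OF nearD(2)[OF assms(1)]] contperD(1)
    by (intro continuous_on_compose2[OF Ck_on_continuous[OF Ck_on_rhs[of 0]]] continuous_intros) auto
  then show ?thesis
    using contperD(2)[OF nearD(2)[OF assms(1)]] contperD(2)[OF assms(3)] contperD(2)[OF assms(4)]
    by (simp add: contper_def periodic_def)
qed

lemma contper_Nfun:
  assumes "near l" "p \<in> pars" "contper g" "\<And>t. (G g t, H g t) \<in> tube t"
  shows "contper (\<lambda>t. Nfun l p t (G g t) (H g t))"
proof -
  have 1: "contper (\<lambda>t. vf (l t, G g t, H g t, p))"
    by (rule contper_rhs[OF assms(1,2) contper_GH[OF assms(3)] tube_in_dom[OF assms(1,2,4)]])
  have 2: "continuous_on UNIV a" using Ck_on_continuous[OF smooth_a[of 0]] .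
  show ?thesis unfolding Nfun_def
    using 1 2 periodic_a contper_GH(1)[OF assms(3)]
    by (auto simp: contper_def periodic_def intro!: continuous_intros)
qed

lemma Nfun_defect:
  assumes "near l" "p \<in> pars"
  shows "\<bar>Nfun l p t (G ga t) (H ga t) - ga t\<bar> \<le> 3 * R / 8"
  using tube_defect[of "l t" t p] assms by (simp add: G_ga Nfun_def ga_def nearD pars_iff)

text \<open>Comparing with \<open>ga\<close>, whose defect is at most \<open>3 * R / 8\<close>,
  stability improves the a priori radius \<open>7 * R / 8\<close> to \<open>3 * R / 4\<close>. The
  gap of \<open>R / 8\<close> is what local uniqueness consumes.\<close>

lemma sol_facts:
  assumes "near l" "p \<in> pars"
  shows "contper (sol l p)" and "sol l p t = Nfun l p t (G (sol l p) t) (H (sol l p) t)"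
    and "\<bar>sol l p t - ga t\<bar> \<le> 3 * R / 4"
    and "(G (sol l p) t, H (sol l p) t) \<in> tube t"
proof -
  have "\<exists>g. contper g \<and> (\<forall>t. \<bar>g t - ga t\<bar> \<le> 7 * R / 8) \<and> (\<forall>t. g t = Nfun l p t (G g t) (H g t))"
  proof (rule fixed_point_exists[where W=tube, OF contper_ga _ ball_tube contper_Nfun[OF assms _ ball_tube]
        Nfun_lip[OF assms] ab0])
    show "0 \<le> 7 * R / 8" using R_pos by simp
    show "\<bar>Nfun l p t (G ga t) (H ga t) - ga t\<bar> \<le> 7 * R / 8 / 2" for t
      using Nfun_defect[OF assms, of t] R_pos by simp
  qed auto
  from someI_ex[OF this, folded sol_def]
  have s: "contper (sol l p)" "\<And>t. \<bar>sol l p t - ga t\<bar> \<le> 7 * R / 8"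
    "\<And>t. sol l p t = Nfun l p t (G (sol l p) t) (H (sol l p) t)" by blast+
  show "contper (sol l p)" "sol l p t = Nfun l p t (G (sol l p) t) (H (sol l p) t)" by (rule s)+
  show "(G (sol l p) t, H (sol l p) t) \<in> tube t" by (rule ball_tube[OF s(1,2)])
  have ga: "\<bar>ga t - ga t\<bar> \<le> 7 * R / 8" for t using R_pos by simp
  have "\<bar>sol l p t - ga t\<bar> \<le> 2 * (3 * R / 8)"
    by (rule fixed_point_stable[where W=tube, OF s(1) ball_tube[OF s(1,2)] s(3) contper_ga ball_tube[OF contper_ga ga]
        Nfun_defect[OF assms] Nfun_lip[OF assms] ab0])
  then show "\<bar>sol l p t - ga t\<bar> \<le> 3 * R / 4" by simp
qed

lemma X_facts:
  assumes "near l" "p \<in> pars"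
  shows "(X l p has_real_derivative Y l p t) (at t)"
    and "(Y l p has_real_derivative vf (l t, X l p t, Y l p t, p)) (at t)"
    and "periodic P (X l p)" "periodic P (Y l p)"
    and "(l t, X l p t, Y l p t, p) \<in> rhs_dom"
    and "contper (X l p)" "contper (Y l p)"
proof -
  note s = sol_facts[OF assms]
  show "(X l p has_real_derivative Y l p t) (at t)" unfolding X_def Y_def by (rule G_deriv[OF s(1)])
  have "sol l p t - a t * X l p t = vf (l t, X l p t, Y l p t, p)"
    using s(2)[of t] by (simp add: Nfun_def X_def Y_def)
  then show "(Y l p has_real_derivative vf (l t, X l p t, Y l p t, p)) (at t)"
    using H_deriv[OF s(1), of t] by (simp add: X_def Y_def)
  show "periodic P (X l p)" "periodic P (Y l p)" "contper (X l p)" "contper (Y l p)"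
    unfolding X_def Y_def using periodic_GH[OF s(1)] contper_GH[OF s(1)] by auto
  show "(l t, X l p t, Y l p t, p) \<in> rhs_dom"
    unfolding X_def Y_def by (rule tube_in_dom[OF assms s(4)])
qed

text \<open>For a periodic solution y, the function \<open>y'' + a y\<close> is a fixed point,
  because y is recovered from it by \<open>G\<close>. In the ball of radius \<open>7 * R / 8\<close>
  there is only one.\<close>

lemma X_unique:
  assumes "near l" "p \<in> pars"
    and y: "\<And>t. (y has_real_derivative z t) (at t)"
    and z: "\<And>t. (z has_real_derivative vf (l t, y t, z t, p)) (at t)"
    and per: "periodic P y" and c: "contper (\<lambda>t. vf (l t, y t, z t, p))"
    and bound: "\<And>t. \<bar>vf (l t, y t, z t, p) + a t * y t - ga t\<bar> \<le> 7 * R / 8"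
  shows "y = X l p" "z = Y l p"
proof -
  define g where "g t = vf (l t, y t, z t, p) + a t * y t" for t
  have "continuous_on UNIV y"
    using y by (intro continuous_at_imp_continuous_on) (auto intro: DERIV_isCont)
  then have g: "contper g"
    using c per periodic_a Ck_on_continuous[OF smooth_a[of 0]]
    unfolding g_def contper_def by (auto simp: periodic_def intro!: continuous_intros)
  have "(z has_real_derivative g t - a t * y t) (at t)" for t using z[of t] by (simp add: g_def)
  from G_unique[OF y this per g] have yz: "y = G g" "z = H g" by simp_all
  have fix_g: "g t = Nfun l p t (G g t) (H g t)" for t
    unfolding yz[symmetric] by (simp add: g_def Nfun_def)
  have b: "\<bar>g t - ga t\<bar> \<le> 7 * R / 8" for t using bound[of t] by (simp add: g_def)
  note s = sol_facts[OF assms(1,2)]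
  have "\<bar>g t - sol l p t\<bar> \<le> 2 * 0" for t
    by (rule fixed_point_stable[where W=tube, OF g ball_tube[OF g b] fix_g s(1) s(4) _ Nfun_lip[OF assms(1,2)] ab0])
      (use s(2) in simp)
  then have "g = sol l p" by (auto simp: fun_eq_iff)
  then show "y = X l p" "z = Y l p" by (simp_all add: yz X_def Y_def)
qed

lemma sol_close:
  assumes "near l" "p \<in> pars"
    and "\<And>t. \<bar>vf (l t, X L p t, Y L p t, p) - vf (L t, X L p t, Y L p t, p)\<bar> \<le> e"
  shows "\<bar>sol l p t - sol L p t\<bar> \<le> 2 * e"
proof -
  note s = sol_facts[OF assms(1,2)] and s' = sol_facts[OF near_L assms(2)]
  show ?thesis
  proof (rule fixed_point_stable[where W=tube, OF s(1) s(4) s(2) s'(1) s'(4) _ Nfun_lip[OF assms(1,2)] ab0])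
    show "\<bar>Nfun l p t (G (sol L p) t) (H (sol L p) t) - sol L p t\<bar> \<le> e" for t
      using assms(3)[of t] s'(2)[of t] by (simp add: Nfun_def X_def Y_def)
  qed
qed

lemma sol_Ck: "Ck_on n (\<lambda>z. sol L (fst z) (snd z)) (pars \<times> UNIV)"
proof (rule family_Ck_on[where N="\<lambda>z. a (fst z) * fst (snd z) + vf (L (fst z), snd z)"
      and \<Omega>="{z. (L (fst z), snd z) \<in> rhs_dom}" and W=tube, OF open_pars ab0])
  have C: "Ck_on n (\<lambda>z. (L (fst z), snd z)) (UNIV :: (jet) set)" for n
    by (intro Ck_intros Ck_on_compose[where g=L, OF open_UNIV open_UNIV _ L_smooth]) auto
  show oO: "open {z. (L (fst z), snd z) \<in> rhs_dom}"
    using open_vimage[OF open_rhs_dom Ck_on_continuous[OF C[of 0]]] by (simp add: vimage_def)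
  have "Ck_on n (\<lambda>z. vf (L (fst z), snd z)) {z. (L (fst z), snd z) \<in> rhs_dom}"
    by (rule Ck_on_compose[OF oO open_rhs_dom _ Ck_on_rhs Ck_on_subset[OF C]]) auto
  then show "Ck_on n (\<lambda>z. a (fst z) * fst (snd z) + vf (L (fst z), snd z)) {z. (L (fst z), snd z) \<in> rhs_dom}"
    by (intro Ck_intros oO Ck_on_compose[where g=a, OF oO open_UNIV _ smooth_a]) auto
  show "open (tube t)" for t by (rule open_tube)
  fix t x y and p :: "real \<times> real"
  show "(t + P, x, y, p) \<in> {z. (L (fst z), snd z) \<in> rhs_dom} \<and>
     a (fst (t + P, x, y, p)) * fst (snd (t + P, x, y, p)) + vf (L (fst (t + P, x, y, p)), snd (t + P, x, y, p))
    = a (fst (t, x, y, p)) * fst (snd (t, x, y, p)) + vf (L (fst (t, x, y, p)), snd (t, x, y, p))"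
    if "(t, x, y, p) \<in> {z. (L (fst z), snd z) \<in> rhs_dom}"
    using that L_periodic periodic_a by (simp add: periodic_def)
next
  fix t x y and p :: "real \<times> real"
  assume "p \<in> pars" "(x, y) \<in> tube t"
  then show "(t, x, y, p) \<in> {z. (L (fst z), snd z) \<in> rhs_dom}"
    using tube_in_dom[OF near_L] by simp
next
  fix p :: "real \<times> real" and t x y x' y'
  assume "p \<in> pars" "(x, y) \<in> tube t" "(x', y') \<in> tube t"
  then show "\<bar>a (fst (t, x, y, p)) * fst (snd (t, x, y, p)) + vf (L (fst (t, x, y, p)), snd (t, x, y, p))
      - (a (fst (t, x', y', p)) * fst (snd (t, x', y', p)) + vf (L (fst (t, x', y', p)), snd (t, x', y', p)))\<bar>
      \<le> \<alpha>0 * \<bar>x - x'\<bar> + \<beta>0 * \<bar>y - y'\<bar>"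
    using Nfun_lip[OF near_L] by (simp add: Nfun_def)
next
  fix p :: "real \<times> real" and t
  assume p: "p \<in> pars"
  show "contper (\<lambda>t. sol L (fst (p, t)) (snd (p, t)))" using sol_facts(1)[OF near_L p] by simp
  show "(G (\<lambda>t. sol L (fst (p, t)) (snd (p, t))) t, H (\<lambda>t. sol L (fst (p, t)) (snd (p, t))) t) \<in> tube t"
    using sol_facts(4)[OF near_L p] by simp
  show "sol L (fst (p, t)) (snd (p, t)) = a (fst (t, G (\<lambda>t. sol L (fst (p, t)) (snd (p, t))) t, H (\<lambda>t. sol L (fst (p, t)) (snd (p, t))) t, p)) *
      fst (snd (t, G (\<lambda>t. sol L (fst (p, t)) (snd (p, t))) t, H (\<lambda>t. sol L (fst (p, t)) (snd (p, t))) t, p)) +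
      vf (L (fst (t, G (\<lambda>t. sol L (fst (p, t)) (snd (p, t))) t, H (\<lambda>t. sol L (fst (p, t)) (snd (p, t))) t, p)),
        snd (t, G (\<lambda>t. sol L (fst (p, t)) (snd (p, t))) t, H (\<lambda>t. sol L (fst (p, t)) (snd (p, t))) t, p))"
    unfolding fst_conv snd_conv using sol_facts(2)[OF near_L p, of t] unfolding Nfun_def .
qed

lemma XY_Ck:
  "Ck_on n (\<lambda>z. X L (fst z) (snd z)) (pars \<times> UNIV)" "Ck_on n (\<lambda>z. Y L (fst z) (snd z)) (pars \<times> UNIV)"
  using Ck_on_GH[OF open_pars sol_Ck] by (simp_all add: X_def Y_def)

text \<open>For a perturbed warp the fixed point equation is only known to be continuous in t, so
  the argument stops at continuity in the parameters. This is all that the topological argument for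
  persistence asks for.\<close>

lemma XY_continuous:
  assumes l: "near l"
  shows "continuous_on (pars \<times> UNIV) (\<lambda>z. X l (fst z) (snd z))"
    and "continuous_on (pars \<times> UNIV) (\<lambda>z. Y l (fst z) (snd z))"
proof -
  have C: "continuous_on UNIV (\<lambda>z :: jet. (l (fst z), snd z))"
    by (intro continuous_on_Pair continuous_on_fst continuous_on_snd continuous_on_id
      continuous_on_compose2[OF contperD(1)[OF nearD(2)[OF l], of UNIV]]) auto
  have oO: "open {z. (l (fst z), snd z) \<in> rhs_dom}"
    using open_vimage[OF open_rhs_dom C] by (simp add: vimage_def)
  have "continuous_on (pars \<times> UNIV) (\<lambda>z. sol l (fst z) (snd z))"
  proof (rule family_continuous[where N="\<lambda>z. a (fst z) * fst (snd z) + vf (l (fst z), snd z)"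
      and \<Omega>="{z. (l (fst z), snd z) \<in> rhs_dom}" and W=tube, OF open_pars oO _ _ _ _ ab0])
    show "continuous_on {z. (l (fst z), snd z) \<in> rhs_dom} (\<lambda>z. a (fst z) * fst (snd z) + vf (l (fst z), snd z))"
      by (intro continuous_on_add continuous_on_mult continuous_on_fst continuous_on_snd continuous_on_id
          continuous_on_compose2[OF Ck_on_continuous[OF smooth_a[of 0]]]
          continuous_on_compose2[OF Ck_on_continuous[OF Ck_on_rhs[of 0]]] continuous_on_subset[OF C]) auto
    fix t x y and p :: "real \<times> real"
    show "(t + P, x, y, p) \<in> {z. (l (fst z), snd z) \<in> rhs_dom} \<and>
       a (fst (t + P, x, y, p)) * fst (snd (t + P, x, y, p)) + vf (l (fst (t + P, x, y, p)), snd (t + P, x, y, p))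
      = a (fst (t, x, y, p)) * fst (snd (t, x, y, p)) + vf (l (fst (t, x, y, p)), snd (t, x, y, p))"
      if "(t, x, y, p) \<in> {z. (l (fst z), snd z) \<in> rhs_dom}"
      using that contperD(2)[OF nearD(2)[OF l]] periodic_a by (simp add: periodic_def)
  next
    fix t x y and p :: "real \<times> real"
    assume "p \<in> pars" "(x, y) \<in> tube t"
    then show "(t, x, y, p) \<in> {z. (l (fst z), snd z) \<in> rhs_dom}"
      using tube_in_dom[OF l] by simp
  next
    fix p :: "real \<times> real" and t x y x' y'
    assume "p \<in> pars" "(x, y) \<in> tube t" "(x', y') \<in> tube t"
    then show "\<bar>a (fst (t, x, y, p)) * fst (snd (t, x, y, p)) + vf (l (fst (t, x, y, p)), snd (t, x, y, p))
        - (a (fst (t, x', y', p)) * fst (snd (t, x', y', p)) + vf (l (fst (t, x', y', p)), snd (t, x', y', p)))\<bar>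
        \<le> \<alpha>0 * \<bar>x - x'\<bar> + \<beta>0 * \<bar>y - y'\<bar>"
      using Nfun_lip[OF l] by (simp add: Nfun_def)
  next
    fix p :: "real \<times> real" and t
    assume p: "p \<in> pars"
    show "contper (\<lambda>t. sol l (fst (p, t)) (snd (p, t)))" using sol_facts(1)[OF l p] by simp
    show "(G (\<lambda>t. sol l (fst (p, t)) (snd (p, t))) t, H (\<lambda>t. sol l (fst (p, t)) (snd (p, t))) t) \<in> tube t"
      using sol_facts(4)[OF l p] by simp
    show "sol l (fst (p, t)) (snd (p, t)) = a (fst (t, G (\<lambda>t. sol l (fst (p, t)) (snd (p, t))) t, H (\<lambda>t. sol l (fst (p, t)) (snd (p, t))) t, p)) *
        fst (snd (t, G (\<lambda>t. sol l (fst (p, t)) (snd (p, t))) t, H (\<lambda>t. sol l (fst (p, t)) (snd (p, t))) t, p)) +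
        vf (l (fst (t, G (\<lambda>t. sol l (fst (p, t)) (snd (p, t))) t, H (\<lambda>t. sol l (fst (p, t)) (snd (p, t))) t, p)),
          snd (t, G (\<lambda>t. sol l (fst (p, t)) (snd (p, t))) t, H (\<lambda>t. sol l (fst (p, t)) (snd (p, t))) t, p))"
      unfolding fst_conv snd_conv using sol_facts(2)[OF l p, of t] unfolding Nfun_def .
  qed
  then have "Ck_on 0 (\<lambda>z. sol l (fst z) (snd z)) (pars \<times> UNIV)" by simp
  from Ck_on_GH[OF open_pars this]
  show "continuous_on (pars \<times> UNIV) (\<lambda>z. X l (fst z) (snd z))"
    and "continuous_on (pars \<times> UNIV) (\<lambda>z. Y l (fst z) (snd z))" by (simp_all add: X_def Y_def)
qed

definition ret :: "(real \<Rightarrow> real) \<Rightarrow> real \<times> real \<Rightarrow> real \<times> real" where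
  "ret l p = (integral {0..P} (\<lambda>t. rate1 (l t, X l p t, Y l p t, p)),
     integral {0..P} (\<lambda>t. rate2 (l t, X l p t, Y l p t, p)))"

lemma jet_Ck:
  "Ck_on n (\<lambda>z. (L (snd z), X L (fst z) (snd z), Y L (fst z) (snd z), fst z)) (pars \<times> UNIV)"
proof -
  have o: "open (pars \<times> (UNIV :: real set))" by (simp add: open_Times open_pars)
  show ?thesis
    by (intro Ck_on_Pair XY_Ck Ck_on_compose[where g=L, OF o open_UNIV _ L_smooth] Ck_on_fst Ck_on_snd Ck_on_ident o) auto
qed

lemma compose_jet_Ck:
  assumes "Ck_on n F rhs_dom"
  shows "Ck_on n (\<lambda>z. F (L (snd z), X L (fst z) (snd z), Y L (fst z) (snd z), fst z)) (pars \<times> UNIV)"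
  by (rule Ck_on_compose[OF _ open_rhs_dom _ assms jet_Ck])
    (auto simp: open_Times open_pars X_facts(5)[OF near_L])

lemma ret_Ck: "Ck_on n (ret L) pars"
  unfolding ret_def[abs_def]
  using Ck_on_integral[OF open_pars compose_jet_Ck[OF Ck_on_rate1], of n 0 P]
    Ck_on_integral[OF open_pars compose_jet_Ck[OF Ck_on_rate2], of n 0 P]
  by (intro Ck_on_Pair open_pars) simp_all

lemma ret_continuous:
  assumes l: "near l"
  shows "continuous_on pars (ret l)"
proof -
  have jet: "continuous_on (pars \<times> cbox 0 P) (\<lambda>z. (l (snd z), X l (fst z) (snd z), Y l (fst z) (snd z), fst z))"
    by (intro continuous_on_Pair continuous_on_fst continuous_on_snd continuous_on_id
      continuous_on_compose2[OF contperD(1)[OF nearD(2)[OF l], of UNIV]] continuous_on_subset[OF XY_continuous(1)[OF l]]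
      continuous_on_subset[OF XY_continuous(2)[OF l]]) auto
  have "continuous_on pars (\<lambda>p. integral (cbox 0 P) (\<lambda>t. F (l t, X l p t, Y l p t, p)))"
    if "continuous_on rhs_dom F" for F :: "jet \<Rightarrow> real"
  proof (rule integral_continuous_on_param)
    have "continuous_on (pars \<times> cbox 0 P) (\<lambda>z. F (l (snd z), X l (fst z) (snd z), Y l (fst z) (snd z), fst z))"
      by (rule continuous_on_compose2[OF that jet]) (use X_facts(5)[OF l] in auto)
    then show "continuous_on (pars \<times> cbox 0 P) (\<lambda>(p, t). F (l t, X l p t, Y l p t, p))"
      by (simp add: case_prod_unfold)
  qed
  from this[OF Ck_on_continuous[OF Ck_on_rate1[of 0]]] this[OF Ck_on_continuous[OF Ck_on_rate2[of 0]]]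
  show ?thesis unfolding ret_def[abs_def] by (intro continuous_intros) simp_all
qed

end

section \<open>The derivative of the phase return\<close>

lemma DERIV_integral_param:
  fixes K :: "real \<times> real \<Rightarrow> real"
  assumes "open U" "Ck_on (Suc n) K (U \<times> UNIV)" "s0 \<in> U"
    and k: "\<And>t. ((\<lambda>s. K (s, t)) has_real_derivative k t) (at s0)"
  shows "((\<lambda>s. integral {a..b} (\<lambda>t. K (s, t))) has_real_derivative integral {a..b} k) (at s0)"
    and "continuous_on UNIV k"
proof -
  have o: "open (U \<times> (UNIV :: real set))" using assms(1) by (simp add: open_Times)
  have D: "fderiv K (s0, t) (v, 0) = v * k t" for v t
  proof -
    have d: "(K has_derivative fderiv K (s0, t)) (at (s0, t))"
      by (rule Ck_on_Suc_has_derivative[OF o assms(2)]) (use assms(3) in simp)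
    have "((\<lambda>s. (s, t)) has_derivative (\<lambda>v. (v, 0))) (at s0)" by (auto intro!: derivative_eq_intros)
    then have "((\<lambda>s. K (s, t)) has_derivative (\<lambda>v. fderiv K (s0, t) (v, 0))) (at s0)"
      by (rule has_derivative_compose) (rule d)
    moreover have "((\<lambda>s. K (s, t)) has_derivative (\<lambda>v. k t * v)) (at s0)"
      using k[of t] by (simp add: has_field_derivative_def)
    ultimately have "(\<lambda>v. fderiv K (s0, t) (v, 0)) = (\<lambda>v. k t * v)"
      by (rule has_derivative_unique)
    from fun_cong[OF this, of v] show ?thesis by (simp add: mult.commute)
  qed
  have "continuous_on UNIV (\<lambda>t. fderiv K (s0, t) (1, 0))"
    by (rule continuous_on_compose2[OF Ck_on_continuous[OF Ck_on_SucD[OF assms(2)]]])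
      (use assms(3) in \<open>auto intro!: continuous_intros\<close>)
  then show "continuous_on UNIV k" by (simp add: D)
  have "((\<lambda>s. integral {a..b} (\<lambda>t. K (s, t))) has_derivative (\<lambda>v. integral {a..b} (\<lambda>t. v * k t))) (at s0)"
    using has_derivative_integral_param[OF assms(1-3), of a b] by (simp add: D)
  then show "((\<lambda>s. integral {a..b} (\<lambda>t. K (s, t))) has_real_derivative integral {a..b} k) (at s0)"
    unfolding has_field_derivative_def by (rule has_derivative_eq_rhs) (simp add: fun_eq_iff)
qed

lemma integral_periodic_derivative:
  fixes f :: "real \<Rightarrow> real"
  assumes "periodic P f" "P \<ge> 0" "\<And>t. (f has_real_derivative f' t) (at t)"
  shows "integral {0..P} f' = 0"
proof -
  have "(f' has_integral f P - f 0) {0..P}"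
    using assms by (intro fundamental_theorem_of_calculus)
      (auto simp: real_vector_derivative intro: has_vector_derivative_at_within)
  moreover have "f P = f 0" using assms(1) unfolding periodic_def by (metis add_0)
  ultimately show ?thesis by (simp add: integral_unique)
qed

lemma integral_periodic_pos:
  fixes f :: "real \<Rightarrow> real"
  assumes "P > 0" "continuous_on UNIV f" "\<And>t. f t > 0"
  shows "integral {0..P} f > 0"
proof -
  obtain t0 where t0: "t0 \<in> {0..P}" "\<And>t. t \<in> {0..P} \<Longrightarrow> f t0 \<le> f t"
    using continuous_attains_inf[of "{0..P}" f] assms(1,2) continuous_on_subset by (metis atLeastAtMost_iff compact_Icc empty_iff less_imp_le order_refl subset_UNIV)
  have "P * f t0 = integral {0..P} (\<lambda>t. f t0)" using assms(1) by simp
  also have "\<dots> \<le> integral {0..P} f"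
    using t0 assms(2) by (intro integral_le integrable_continuous_real) (auto intro: continuous_on_subset)
  finally show ?thesis using assms(1,3) by (smt (verit) mult_pos_pos)
qed

lemma plane_map_inverse:
  fixes D :: "real \<times> real \<Rightarrow> real \<times> real"
  assumes "linear D" "fst (D (1, 0)) * snd (D (0, 1)) - snd (D (1, 0)) * fst (D (0, 1)) \<noteq> 0"
  obtains D' where "bounded_linear D'" "\<And>v. D (D' v) = v" "\<And>v. D' (D v) = v" "bij D"
proof -
  define p q r s where "p = fst (D (1, 0))" and "q = snd (D (1, 0))" and "r = fst (D (0, 1))" and "s = snd (D (0, 1))"
  define det where "det = p * s - q * r"
  have det: "det \<noteq> 0" using assms(2) by (simp add: det_def p_def q_def r_def s_def)
  have D: "D (x, y) = (x * p + y * r, x * q + y * s)" for x y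
  proof -
    have "(x, y) = x *\<^sub>R (1, 0) + y *\<^sub>R (0, 1)" by simp
    then have "D (x, y) = x *\<^sub>R D (1, 0) + y *\<^sub>R D (0, 1)"
      by (simp only: linear_add[OF assms(1)] linear_cmul[OF assms(1)])
    then show ?thesis by (simp add: prod_eq_iff p_def q_def r_def s_def)
  qed
  define D' where "D' v = ((fst v * s - snd v * r) / det, (snd v * p - fst v * q) / det)" for v
  have 1: "D (D' v) = v" for v
  proof -
    have "(fst v * s - snd v * r) * p + (snd v * p - fst v * q) * r = fst v * det"
      "(fst v * s - snd v * r) * q + (snd v * p - fst v * q) * s = snd v * det"
      by (simp_all add: det_def algebra_simps)
    then have "(fst v * s - snd v * r) * p / det + (snd v * p - fst v * q) * r / det = fst v"
      "(fst v * s - snd v * r) * q / det + (snd v * p - fst v * q) * s / det = snd v"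
      using det by (simp_all only: add_divide_distrib[symmetric] nonzero_mult_div_cancel_right not_False_eq_True)
    then show ?thesis by (simp add: D D'_def prod_eq_iff)
  qed
  have 2: "D' (D v) = v" for v
  proof -
    obtain x y where v: "v = (x, y)" by (cases v)
    have "(x * p + y * r) * s - (x * q + y * s) * r = x * det"
      "(x * q + y * s) * p - (x * p + y * r) * q = y * det"
      by (simp_all add: det_def algebra_simps)
    then show ?thesis using det by (simp add: v D D'_def)
  qed
  have "linear D'"
    by (rule linearI) (auto simp: D'_def add_divide_distrib[symmetric] algebra_simps)
  then have "bounded_linear D'" by (simp add: linear_conv_bounded_linear)
  moreover have "bij D" by (rule o_bij[of D' D]) (auto simp: fun_eq_iff 1 2)
  ultimately show thesis using 1 2 that by blast
qed

text \<open>With a prime denominator q, an interval longer than \<open>2 / q\<close> contains two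
  fractions with consecutive numerators, and q divides at most one of them. For a reduced fraction
  with prime denominator, integrality of \<open>j * \<rho>\<close> forces q to divide j.\<close>

lemma ex_fraction_large_denominator:
  fixes a b :: real and N :: nat
  assumes "a < b"
  obtains \<rho> where "\<rho> \<in> \<rat>" "a < \<rho>" "\<rho> < b" "\<And>j :: nat. j \<ge> 1 \<Longrightarrow> real j * \<rho> \<in> \<int> \<Longrightarrow> j > N"
proof -
  obtain M :: nat where M: "2 / (b - a) < real M" using reals_Archimedean2 by blast
  obtain q :: nat where q: "prime q" "q > max N M" using bigger_prime by blast
  have q0: "real q > 0" "q > N" using q prime_gt_0_nat by auto
  have "2 / (b - a) < real q" using M q(2) by linarith
  then have len: "2 < (b - a) * real q" using assms by (simp add: divide_less_eq mult.commute)
  define k where "k = \<lfloor>a * real q\<rfloor> + 1"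
  have k: "a * real q < of_int k" "of_int k + 1 < b * real q"
    using len by (simp_all add: k_def algebra_simps) linarith+
  have "\<exists>i :: int. a * real q < of_int i \<and> of_int i < b * real q \<and> \<not> int q dvd i"
  proof (cases "int q dvd k")
    case True
    have "\<not> int q dvd k + 1"
    proof
      assume "int q dvd k + 1"
      then have "int q dvd 1" using True by (metis dvd_add_right_iff)
      then show False using prime_gt_1_nat[OF q(1)] by simp
    qed
    then show ?thesis using k by (intro exI[of _ "k + 1"]) auto
  next
    case False
    then show ?thesis using k by (intro exI[of _ k]) auto
  qed
  then obtain i :: int where i: "a * real q < of_int i" "of_int i < b * real q" "\<not> int q dvd i" by blast
  show thesis
  proof (rule that[of "of_int i / real q"])
    show "of_int i / real q \<in> \<rat>" by simp
    show "a < of_int i / real q" "of_int i / real q < b" using i q0 by (auto simp: field_simps)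
    fix j :: nat assume j: "j \<ge> 1" "real j * (of_int i / real q) \<in> \<int>"
    then obtain n :: int where "real j * (of_int i / real q) = of_int n" by (auto elim: Ints_cases)
    then have "real_of_int (int j * i) = of_int (n * int q)" using q0 by (simp add: field_simps)
    then have "int j * i = n * int q" by (simp only: of_int_eq_iff)
    then have "int q dvd int j * i" by simp
    then have "int q dvd int j" using q(1) i(3) prime_dvd_mult_iff[of "int q" "int j" i] by simp
    then have "q dvd j" by simp
    then show "j > N" using j(1) q0(2) dvd_imp_le[of q j] by linarith
  qed
qed

section \<open>Signs of the derivatives of the phase return at the base point\<close>

context magnitude_branch
begin

abbreviation "w0 t \<equiv> L t powr (2 * real k1 / real k2)"
abbreviation "V0 t \<equiv> \<mu>0 * w0 t + (1 - d1 / (L t)\<^sup>2)"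
abbreviation "x0 \<equiv> X L (\<mu>0, 0)"
abbreviation "y0 \<equiv> Y L (\<mu>0, 0)"

lemma base_in_pars: "(\<mu>0, 0) \<in> pars"
  using d0_pos by (simp add: pars_def)

lemma line_in_pars: "\<bar>s\<bar> < d0 \<Longrightarrow> (\<mu>0 + s, 0) \<in> pars" "\<bar>s\<bar> < d0 \<Longrightarrow> (\<mu>0, s) \<in> pars"
  by (auto simp: pars_def dist_Pair_Pair dist_real_def)

lemma X_pos: "near l \<Longrightarrow> p \<in> pars \<Longrightarrow> X l p t > 0"
  using X_facts(5)[of l p t] by (simp add: rhs_dom_def)

lemma x0_facts:
  "x0 t > 0" "(x0 has_real_derivative y0 t) (at t)"
  "(y0 has_real_derivative 1 / x0 t ^ 3 - V0 t * x0 t) (at t)"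
  "periodic P x0" "periodic P y0" "continuous_on UNIV x0" "continuous_on UNIV y0"
  using X_facts[OF near_L base_in_pars] X_pos[OF near_L base_in_pars] contperD(1)
  by (auto simp: rhs_at_zero)

lemma ret_derivative:
  assumes "p \<in> pars"
  shows "(ret L has_derivative fderiv (ret L) p) (at p)"
  by (rule Ck_on_Suc_has_derivative[OF open_pars ret_Ck[of "Suc 0"] assms])

lemma ret_derivative_along:
  assumes v: "\<And>s. \<bar>s\<bar> < d0 \<Longrightarrow> (\<mu>0, 0) + s *\<^sub>R v \<in> pars" and f: "bounded_linear f"
    and F: "((\<lambda>s. f (ret L ((\<mu>0, 0) + s *\<^sub>R v))) has_real_derivative D) (at 0)"
  shows "f (fderiv (ret L) (\<mu>0, 0) v) = D"
proof -
  have d: "((\<lambda>s. (\<mu>0, 0) + s *\<^sub>R v) has_derivative (\<lambda>s. s *\<^sub>R v)) (at 0)"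
    by (auto intro!: derivative_eq_intros)
  have "((\<lambda>s. ret L ((\<mu>0, 0) + s *\<^sub>R v)) has_derivative
      (\<lambda>s. fderiv (ret L) (\<mu>0, 0) (s *\<^sub>R v))) (at 0)"
    by (rule has_derivative_compose[OF d]) (use ret_derivative[OF base_in_pars] in simp)
  from bounded_linear.has_derivative[OF f this]
  have "((\<lambda>s. f (ret L ((\<mu>0, 0) + s *\<^sub>R v))) has_derivative
      (\<lambda>s. f (fderiv (ret L) (\<mu>0, 0) (s *\<^sub>R v)))) (at 0)" .
  moreover have "((\<lambda>s. f (ret L ((\<mu>0, 0) + s *\<^sub>R v))) has_derivative (\<lambda>s. D * s)) (at 0)"
    using F by (simp add: has_field_derivative_def)
  ultimately have "(\<lambda>s. f (fderiv (ret L) (\<mu>0, 0) (s *\<^sub>R v))) = (\<lambda>s. D * s)"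
    by (rule has_derivative_unique)
  from fun_cong[OF this, of 1] show ?thesis by simp
qed

lemma curve_Ck:
  assumes v: "\<And>s. \<bar>s\<bar> < d0 \<Longrightarrow> (\<mu>0, 0) + s *\<^sub>R v \<in> pars" and "Ck_on n K (pars \<times> (UNIV :: real set))"
  shows "Ck_on n (\<lambda>z. K ((\<mu>0, 0) + fst z *\<^sub>R v, snd z)) ({-d0<..<d0} \<times> UNIV)"
proof -
  have o: "open ({-d0<..<d0} \<times> (UNIV :: real set))" "open (pars \<times> (UNIV :: real set))"
    by (auto simp: open_Times open_pars)
  show ?thesis
    by (rule Ck_on_compose[OF o _ assms(2)]) (auto intro!: Ck_intros Ck_on_scaleR o v)
qed

lemma curve_derivative:
  assumes v: "\<And>s. \<bar>s\<bar> < d0 \<Longrightarrow> (\<mu>0, 0) + s *\<^sub>R v \<in> pars" and "Ck_on (Suc 0) K (pars \<times> (UNIV :: real set))"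
  shows "\<exists>k. \<forall>t. ((\<lambda>s. K ((\<mu>0, 0) + s *\<^sub>R v, t)) has_real_derivative k t) (at 0)"
proof -
  have o: "open ({-d0<..<d0} \<times> (UNIV :: real set))" by (auto simp: open_Times)
  let ?K = "\<lambda>z. K ((\<mu>0, 0) + fst z *\<^sub>R v, snd z)"
  have "((\<lambda>s. K ((\<mu>0, 0) + s *\<^sub>R v, t)) has_real_derivative fderiv ?K (0, t) (1, 0)) (at 0)" for t
  proof -
    have d: "(?K has_derivative fderiv ?K (0, t)) (at (0, t))"
      by (rule Ck_on_Suc_has_derivative[OF o curve_Ck[OF assms]]) (use d0_pos in auto)
    have "((\<lambda>s. (s, t)) has_derivative (\<lambda>v. (v, 0))) (at 0)" by (auto intro!: derivative_eq_intros)
    then have "((\<lambda>s. ?K (s, t)) has_derivative (\<lambda>h. fderiv ?K (0, t) (h, 0))) (at 0)"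
      by (rule has_derivative_compose) (rule d)
    moreover have "(\<lambda>h. fderiv ?K (0, t) (h, 0)) = (*) (fderiv ?K (0, t) (1, 0))"
    proof
      show "fderiv ?K (0, t) (h, 0) = fderiv ?K (0, t) (1, 0) * h" for h
        using linear_cmul[OF has_derivative_linear[OF d], of h "(1, 0)"] by simp
    qed
    ultimately show ?thesis unfolding has_field_derivative_def by simp
  qed
  then show ?thesis by (intro exI allI)
qed

text \<open>At \<open>\<delta> = 0\<close> the rates are \<open>1 / x^2\<close> and 1. The sign of
  the first derivative comes from pairing the solutions for \<open>\<mu>0 + s\<close> and
  \<open>\<mu>0\<close>: their Wronskian is periodic, so its derivative has integral zero for each
  s. Differentiating this in s shows that the derivative of the first increment is half the integral
  of \<open>w x^2\<close>.\<close>

lemma ret_mu_derivative: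
  "fst (fderiv (ret L) (\<mu>0, 0) (1, 0)) > 0"
  "snd (fderiv (ret L) (\<mu>0, 0) (1, 0)) = 0"
proof -
  let ?v = "(1, 0) :: real \<times> real"
  let ?U = "{-d0<..<d0}"
  have v: "(\<mu>0, 0) + s *\<^sub>R ?v \<in> pars" if "\<bar>s\<bar> < d0" for s using line_in_pars(1)[OF that] by simp
  define \<xi> where "\<xi> s t = X L (\<mu>0 + s, 0) t" for s t
  have C\<xi>: "Ck_on n (\<lambda>z. \<xi> (fst z) (snd z)) (?U \<times> UNIV)" for n
    using curve_Ck[OF v XY_Ck(1)] by (simp add: \<xi>_def)
  obtain \<zeta> where "\<forall>t. ((\<lambda>s. (\<lambda>z. X L (fst z) (snd z)) ((\<mu>0, 0) + s *\<^sub>R ?v, t)) has_real_derivative \<zeta> t) (at 0)"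
    using curve_derivative[OF v XY_Ck(1)] by blast
  then have \<zeta>: "((\<lambda>s. \<xi> s t) has_real_derivative \<zeta> t) (at 0)" for t by (simp add: \<xi>_def)
  have \<xi>0: "\<xi> 0 = x0" by (simp add: \<xi>_def fun_eq_iff)
  have \<xi>pos: "\<xi> s t > 0" if "s \<in> ?U" for s t
    unfolding \<xi>_def by (rule X_pos[OF near_L line_in_pars(1)]) (use that in auto)
  have oU: "open ?U" "open (?U \<times> (UNIV :: real set))" by (auto simp: open_Times)
  have U0: "0 \<in> ?U" using d0_pos by simp
  have rates: "rate1 (L t, \<xi> s t, y, \<mu>, 0) = 1 / (\<xi> s t)\<^sup>2" "rate2 (L t, \<xi> s t, y, \<mu>, 0) = 1"
    if "s \<in> ?U" for s t y \<mu>
    using \<xi>pos[OF that, of t] by (simp_all add: rate1_def rate2_def rhs_q_def rhs_r_def power2_eq_square)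
  have ret: "ret L (\<mu>0 + s, 0) = (integral {0..P} (\<lambda>t. 1 / (\<xi> s t)\<^sup>2), P)" if "s \<in> ?U" for s
    using rates[OF that] P_pos by (simp add: ret_def flip: \<xi>_def)
  have F: "((\<lambda>s. snd (ret L ((\<mu>0, 0) + s *\<^sub>R ?v))) has_real_derivative 0) (at 0)"
    by (rule has_field_derivative_transform_within_open[OF DERIV_const oU(1) U0, of P]) (use ret in simp)
  show "snd (fderiv (ret L) (\<mu>0, 0) (1, 0)) = 0"
    by (rule ret_derivative_along[OF v bounded_linear_snd F])
  let ?w = "\<lambda>t. w0 t * (x0 t)\<^sup>2"
  define k1' where "k1' t = - 2 * \<zeta> t / x0 t ^ 3" for t
  have nz: "\<xi> s t \<noteq> 0" if "s \<in> ?U" for s t using \<xi>pos[OF that, of t] by simp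
  have x0nz: "x0 t \<noteq> 0" for t using x0_facts(1)[of t] by simp
  have Ckx0: "Ck_on n x0 UNIV" for n
  proof -
    have "Ck_on n (\<lambda>t. (\<lambda>z. X L (fst z) (snd z)) ((\<mu>0, 0), t)) UNIV"
      by (rule Ck_on_compose[OF open_UNIV _ _ XY_Ck(1)[of n]])
        (use base_in_pars in \<open>auto intro!: Ck_intros simp: open_Times open_pars\<close>)
    then show ?thesis by simp
  qed
  have Ckw: "Ck_on n w0 UNIV" for n by (intro Ck_intros L_smooth) (auto simp: L_pos)
  have K1: "((\<lambda>s. integral {0..P} (\<lambda>t. 1 / (\<xi> s t)\<^sup>2)) has_real_derivative integral {0..P} k1') (at 0)"
    "continuous_on UNIV k1'"
  proof -
    have C: "Ck_on (Suc 0) (\<lambda>z. 1 / (\<xi> (fst z) (snd z))\<^sup>2) (?U \<times> UNIV)"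
      by (intro Ck_intros C\<xi> oU) (use nz in auto)
    have D: "((\<lambda>s. 1 / (\<xi> (fst (s, t)) (snd (s, t)))\<^sup>2) has_real_derivative k1' t) (at 0)" for t
      unfolding fst_conv snd_conv k1'_def
      by (rule DERIV_cong[OF DERIV_divide[OF DERIV_const DERIV_power[OF \<zeta>]]])
        (use x0nz[of t] in \<open>simp_all add: \<xi>0 power2_eq_square power3_eq_cube\<close>)
    show "((\<lambda>s. integral {0..P} (\<lambda>t. 1 / (\<xi> s t)\<^sup>2)) has_real_derivative integral {0..P} k1') (at 0)"
      using DERIV_integral_param(1)[OF oU(1) C U0 D, of 0 P] by simp
    show "continuous_on UNIV k1'" by (rule DERIV_integral_param(2)[OF oU(1) C U0 D])
  qed
  have F: "((\<lambda>s. fst (ret L ((\<mu>0, 0) + s *\<^sub>R ?v))) has_real_derivative integral {0..P} k1') (at 0)"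
    by (rule has_field_derivative_transform_within_open[OF K1(1) oU(1) U0]) (use ret in simp)
  have D1: "fst (fderiv (ret L) (\<mu>0, 0) (1, 0)) = integral {0..P} k1'"
    by (rule ret_derivative_along[OF v bounded_linear_fst F])
  \<comment> \<open>The derivative of the Wronskian \<open>\<xi> y0 - x0 Y\<close>; the common
    potential cancels and only \<open>s * w0\<close> and the two cubic terms remain.
    \<open>k2'\<close> is its s-derivative at 0, equal to \<open>w0 x0^2 - 2 k1'\<close>.\<close>
  define h where "h s t = s * w0 t * x0 t * \<xi> s t + \<xi> s t / x0 t ^ 3 - x0 t / \<xi> s t ^ 3" for s t
  define k2' where "k2' t = w0 t * (x0 t)\<^sup>2 + 4 * \<zeta> t / x0 t ^ 3" for t
  have K2: "((\<lambda>s. integral {0..P} (h s)) has_real_derivative integral {0..P} k2') (at 0)"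
  proof -
    have comp: "Ck_on n (\<lambda>z. f (snd z)) (?U \<times> UNIV)" if "Ck_on n f UNIV" for n and f :: "real \<Rightarrow> real"
      by (rule Ck_on_compose[OF oU(2) open_UNIV _ that]) (auto intro!: Ck_intros oU)
    have C: "Ck_on (Suc 0) (\<lambda>z. h (fst z) (snd z)) (?U \<times> UNIV)"
      unfolding h_def
      by (intro Ck_on_add Ck_on_diff Ck_on_mult Ck_on_divide Ck_on_power Ck_on_fst Ck_on_ident C\<xi> oU
          comp[OF Ckx0] comp[OF Ckw]) (use nz x0nz in auto)
    have D: "((\<lambda>s. h (fst (s, t)) (snd (s, t))) has_real_derivative k2' t) (at 0)" for t
    proof -
      have i3: "((\<lambda>s. x0 t / \<xi> s t ^ 3) has_real_derivative - 3 * \<zeta> t / x0 t ^ 3) (at 0)"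
        by (rule DERIV_cong[OF DERIV_divide[OF DERIV_const DERIV_power[OF \<zeta>]]])
          (use x0nz[of t] in \<open>simp_all add: \<xi>0 power2_eq_square power3_eq_cube divide_simps\<close>)
      have i1: "((\<lambda>s. s * w0 t * x0 t * \<xi> s t) has_real_derivative w0 t * (x0 t)\<^sup>2) (at 0)"
        by (rule DERIV_cong[OF DERIV_mult[OF DERIV_cmult_right[OF DERIV_cmult_right[OF DERIV_ident]] \<zeta>]])
          (simp add: \<xi>0 power2_eq_square)
      show ?thesis unfolding fst_conv snd_conv h_def k2'_def
        by (rule DERIV_cong[OF DERIV_diff[OF DERIV_add[OF i1 DERIV_cdivide[OF \<zeta>]] i3]])
          (simp add: add_divide_distrib[symmetric] diff_divide_distrib[symmetric])
    qed
    show ?thesis using DERIV_integral_param(1)[OF oU(1) C U0 D, of 0 P] by simp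
  qed
  have h0: "integral {0..P} (h s) = 0" if s: "s \<in> ?U" for s
  proof (rule integral_periodic_derivative[where f="\<lambda>t. \<xi> s t * y0 t - x0 t * Y L (\<mu>0 + s, 0) t"])
    have ps: "(\<mu>0 + s, 0) \<in> pars" using line_in_pars(1)[of s] s by auto
    note f = X_facts[OF near_L ps]
    show "periodic P (\<lambda>t. \<xi> s t * y0 t - x0 t * Y L (\<mu>0 + s, 0) t)"
      using x0_facts(4,5) f(3,4) by (simp add: periodic_def \<xi>_def)
    show "P \<ge> 0" using P_pos by simp
    have f1: "(\<xi> s has_real_derivative Y L (\<mu>0 + s, 0) t) (at t)" for t unfolding \<xi>_def by (rule f(1))
    have f2: "(Y L (\<mu>0 + s, 0) has_real_derivative 1 / \<xi> s t ^ 3 - ((\<mu>0 + s) * w0 t + (1 - d1 / (L t)\<^sup>2)) * \<xi> s t) (at t)" for t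
      using f(2)[of t] rhs_at_zero[OF X_pos[OF near_L ps, of t]] by (simp add: \<xi>_def)
    show "((\<lambda>t. \<xi> s t * y0 t - x0 t * Y L (\<mu>0 + s, 0) t) has_real_derivative h s t) (at t)" for t
      by (rule DERIV_cong[OF DERIV_diff[OF DERIV_mult[OF f1 x0_facts(3)] DERIV_mult[OF x0_facts(2) f2]]])
        (simp add: h_def algebra_simps)
  qed
  have "((\<lambda>s. integral {0..P} (h s)) has_real_derivative 0) (at 0)"
    by (rule has_field_derivative_transform_within_open[OF DERIV_const oU(1) U0, of 0]) (use h0 in simp)
  then have k20: "integral {0..P} k2' = 0" using K2 DERIV_unique by blast
  have cw: "continuous_on UNIV ?w"
    using Ck_on_continuous[OF Ckw[of 0]] x0_facts(6)
    by (intro continuous_on_mult continuous_on_power)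
  have i: "?w integrable_on {0..P}" "(\<lambda>t. (- 2) * k1' t) integrable_on {0..P}"
    by (rule integrable_continuous_real[OF continuous_on_subset[OF cw]], simp)
      (rule integrable_continuous_real[OF continuous_on_subset[OF continuous_on_mult[OF continuous_on_const K1(2)]]], simp)
  have "k2' = (\<lambda>t. ?w t + (- 2) * k1' t)" by (auto simp: k2'_def k1'_def)
  then have "integral {0..P} k2' = integral {0..P} ?w + (- 2) * integral {0..P} k1'"
    using integral_add[OF i] by (simp only: integral_mult_right)
  moreover have "w0 t * (x0 t)\<^sup>2 > 0" for t using L_pos[of t] x0nz[of t] by simp
  then have "integral {0..P} ?w > 0" by (rule integral_periodic_pos[OF P_pos cw])
  ultimately show "fst (fderiv (ret L) (\<mu>0, 0) (1, 0)) > 0"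
    using k20 D1 by simp
qed

text \<open>A virial identity, the vanishing integral of the derivative of \<open>x y\<close>,
  replaces \<open>y^2 + 1/x^2\<close> under the integral by \<open>V0 x^2\<close>. What remains is
  \<open>-(V0 - 1) x^2 / 2\<close>, negative by \<open>elliptic\<close>.\<close>

lemma ret_delta_derivative:
  "snd (fderiv (ret L) (\<mu>0, 0) (0, 1)) < 0"
proof -
  let ?v = "(0, 1) :: real \<times> real"
  let ?U = "{-d0<..<d0}"
  have v: "(\<mu>0, 0) + s *\<^sub>R ?v \<in> pars" if "\<bar>s\<bar> < d0" for s using line_in_pars(2)[OF that] by simp
  have oU: "open ?U" by simp
  have U0: "0 \<in> ?U" using d0_pos by simp
  have x0nz: "x0 t \<noteq> 0" for t using x0_facts(1)[of t] by simp
  obtain \<zeta> where "\<forall>t. ((\<lambda>s. (\<lambda>z. X L (fst z) (snd z)) ((\<mu>0, 0) + s *\<^sub>R ?v, t)) has_real_derivative \<zeta> t) (at 0)"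
    using curve_derivative[OF v XY_Ck(1)] by blast
  then have \<zeta>: "((\<lambda>s. X L (\<mu>0, s) t) has_real_derivative \<zeta> t) (at 0)" for t by simp
  obtain \<theta> where "\<forall>t. ((\<lambda>s. (\<lambda>z. Y L (fst z) (snd z)) ((\<mu>0, 0) + s *\<^sub>R ?v, t)) has_real_derivative \<theta> t) (at 0)"
    using curve_derivative[OF v XY_Ck(2)] by blast
  then have \<theta>: "((\<lambda>s. Y L (\<mu>0, s) t) has_real_derivative \<theta> t) (at 0)" for t by simp
  \<comment> \<open>Only the explicit dependence on \<delta> contributes: at
    \<open>\<delta> = 0\<close> the rate is 1 whatever x and y are, so the variations \<zeta> and
    \<theta> drop out.\<close>
  define k where "k t = ((x0 t)\<^sup>2 - (y0 t)\<^sup>2 - 1 / (x0 t)\<^sup>2) / 2" for t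
  define K where "K = (\<lambda>z. rate2 (L (snd z), X L ((\<mu>0, 0) + fst z *\<^sub>R ?v) (snd z), Y L ((\<mu>0, 0) + fst z *\<^sub>R ?v) (snd z), (\<mu>0, 0) + fst z *\<^sub>R ?v))"
  have C: "Ck_on (Suc 0) K (?U \<times> UNIV)"
    using curve_Ck[OF v compose_jet_Ck[OF Ck_on_rate2]] by (simp add: K_def)
  have D: "((\<lambda>s. K (s, t)) has_real_derivative k t) (at 0)" for t
  proof -
    have e: "K (s, t) = X L (\<mu>0, s) t * sqrt (1 - s * ((X L (\<mu>0, s) t)\<^sup>2 + (Y L (\<mu>0, s) t)\<^sup>2))
       / (sqrt ((X L (\<mu>0, s) t)\<^sup>2 + s - s\<^sup>2 * (X L (\<mu>0, s) t)\<^sup>2) * (1 - s * (X L (\<mu>0, s) t)\<^sup>2))" for s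
      by (simp add: K_def rate2_def rhs_r_def rhs_q_def)
    have sq: "sqrt ((x0 t)\<^sup>2) = x0 t" using x0_facts(1)[of t] by simp
    show ?thesis unfolding e[abs_def]
      by (auto intro!: derivative_eq_intros \<zeta> \<theta> simp: x0nz x0_facts(1) k_def sq)
        (use x0nz[of t] x0_facts(1)[of t] in \<open>simp add: field_simps power2_eq_square\<close>)
  qed
  have ck: "continuous_on UNIV k" by (rule DERIV_integral_param(2)[OF oU C U0 D])
  have F: "((\<lambda>s. snd (ret L ((\<mu>0, 0) + s *\<^sub>R ?v))) has_real_derivative integral {0..P} k) (at 0)"
    using DERIV_integral_param(1)[OF oU C U0 D, of 0 P] by (simp add: ret_def K_def)
  have E: "snd (fderiv (ret L) (\<mu>0, 0) (0, 1)) = integral {0..P} k"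
    by (rule ret_derivative_along[OF v bounded_linear_snd F])
  have xy: "integral {0..P} (\<lambda>t. (y0 t)\<^sup>2 + 1 / (x0 t)\<^sup>2 - V0 t * (x0 t)\<^sup>2) = 0"
  proof (rule integral_periodic_derivative[where f="\<lambda>t. x0 t * y0 t"])
    show "periodic P (\<lambda>t. x0 t * y0 t)" using x0_facts(4,5) by (simp add: periodic_def)
    show "P \<ge> 0" using P_pos by simp
    show "((\<lambda>t. x0 t * y0 t) has_real_derivative (y0 t)\<^sup>2 + 1 / (x0 t)\<^sup>2 - V0 t * (x0 t)\<^sup>2) (at t)" for t
      by (rule DERIV_cong[OF DERIV_mult[OF x0_facts(2,3)]])
        (use x0nz[of t] in \<open>simp add: field_simps power2_eq_square power3_eq_cube\<close>)
  qed
  define j where "j t = (V0 t - 1) * (x0 t)\<^sup>2" for t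
  have Lnz: "L t \<noteq> 0" for t using L_pos[of t] by simp
  have cV: "continuous_on UNIV V0"
    using Ck_on_continuous[OF L_smooth[of 0]] by (intro continuous_intros) (auto simp: Lnz)
  have cj: "continuous_on UNIV j"
    unfolding j_def by (intro continuous_on_mult continuous_on_diff continuous_on_power continuous_on_const cV x0_facts(6))
  have cyx: "continuous_on UNIV (\<lambda>t. (y0 t)\<^sup>2 + 1 / (x0 t)\<^sup>2 - V0 t * (x0 t)\<^sup>2)"
    by (intro continuous_on_add continuous_on_diff continuous_on_divide continuous_on_mult continuous_on_power
      continuous_on_const cV x0_facts(6,7)) (simp add: x0nz)
  have alg: "2 * ((A - B - C) / 2) = - ((D - 1) * A) - (B + C - D * A)" for A B C D :: real
    by (simp add: left_diff_distrib)
  have "integral {0..P} (\<lambda>t. 2 * k t) = integral {0..P} (\<lambda>t. - j t - ((y0 t)\<^sup>2 + 1 / (x0 t)\<^sup>2 - V0 t * (x0 t)\<^sup>2))"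
    by (rule integral_cong) (simp only: k_def j_def alg)
  also have "\<dots> = integral {0..P} (\<lambda>t. - j t)
      - integral {0..P} (\<lambda>t. (y0 t)\<^sup>2 + 1 / (x0 t)\<^sup>2 - V0 t * (x0 t)\<^sup>2)"
    by (rule integral_diff)
      (rule integrable_continuous_real[OF continuous_on_subset[OF continuous_on_minus[OF cj]]], simp,
       rule integrable_continuous_real[OF continuous_on_subset[OF cyx]], simp)
  finally have "2 * integral {0..P} k = - integral {0..P} j" unfolding xy by simp
  moreover have "integral {0..P} j > 0"
    by (rule integral_periodic_pos[OF P_pos cj]) (use elliptic x0nz in \<open>simp add: j_def\<close>)
  ultimately show ?thesis using E by linarith
qed

section \<open>Invertibility of the return map and parameters with rational return\<close>

definition ret_det :: "real \<times> real \<Rightarrow> real" where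
  "ret_det p = fst (fderiv (ret L) p (1, 0)) * snd (fderiv (ret L) p (0, 1))
    - snd (fderiv (ret L) p (1, 0)) * fst (fderiv (ret L) p (0, 1))"

lemma ex_nondegenerate_radius:
  obtains d where "d > 0" "d \<le> d0" "\<And>p. dist p (\<mu>0, 0) < d \<Longrightarrow> ret_det p \<noteq> 0"
proof -
  have c: "continuous_on pars (\<lambda>p. fderiv (ret L) p v)" for v
    by (rule Ck_on_continuous[OF Ck_on_SucD[OF ret_Ck[of "Suc 0"]]])
  have "continuous_on pars ret_det"
    unfolding ret_det_def[abs_def] by (intro continuous_intros c)
  moreover have "ret_det (\<mu>0, 0) \<noteq> 0"
    using ret_mu_derivative ret_delta_derivative by (simp add: ret_det_def)
  ultimately obtain e where e: "e > 0" "\<And>p. p \<in> pars \<Longrightarrow> dist p (\<mu>0, 0) < e \<Longrightarrow> ret_det p \<noteq> 0"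
    using base_in_pars unfolding continuous_on_iff by (metis dist_self dist_commute less_irrefl zero_less_dist_iff)
  show thesis
    by (rule that[of "min e d0"]) (use e d0_pos in \<open>auto simp: pars_iff\<close>)
qed

lemma ret_open_image:
  assumes "p \<in> pars" "ret_det p \<noteq> 0" "open S" "p \<in> S" "S \<subseteq> pars"
  shows "ret L p \<in> interior (ret L ` S)"
proof -
  have d: "(ret L has_derivative fderiv (ret L) p) (at p)" by (rule ret_derivative[OF assms(1)])
  obtain D' where "bounded_linear D'" "\<And>v. fderiv (ret L) p (D' v) = v"
    by (rule plane_map_inverse[OF has_derivative_linear[OF d] assms(2)[unfolded ret_det_def]]) (rule that)
  then show ?thesis
    using assms Ck_on_continuous[OF ret_Ck[of 0]]
    by (intro sussmann_open_mapping[OF open_pars _ assms(1) d, of D' S]) (auto simp: fun_eq_iff interior_open)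
qed

text \<open>The image of a neighbourhood contains a small box, and rational points of the box are
  hit. Controlling the denominator of the second coordinate is enough, because a closing multiplier
  has to clear both.\<close>

lemma ex_rational_return:
  assumes "p \<in> pars" "ret_det p \<noteq> 0" "open S" "p \<in> S" "S \<subseteq> pars"
  obtains p' \<rho>1 \<rho>2 where "p' \<in> S" "\<rho>1 \<in> \<rat>" "\<rho>2 \<in> \<rat>" "ret L p' = (2 * pi * \<rho>1, 2 * pi * \<rho>2)"
    "\<And>j :: nat. j \<ge> 1 \<Longrightarrow> real j * \<rho>2 \<in> \<int> \<Longrightarrow> j > N"
proof -
  obtain T where T: "open T" "ret L p \<in> T" "T \<subseteq> ret L ` S"
    using ret_open_image[OF assms] by (meson interiorE)
  obtain A B where AB: "open A" "open B" "ret L p \<in> A \<times> B" "A \<times> B \<subseteq> T"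
    using open_prod_elim[OF T(1,2)] by blast
  obtain e where e: "e > 0" "ball (fst (ret L p)) e \<subseteq> A" using AB openE by (metis mem_Times_iff)
  obtain b where e': "b > 0" "ball (snd (ret L p)) b \<subseteq> B" using AB openE by (metis mem_Times_iff)
  have iv: "c / (2 * pi) < (c + r) / (2 * pi)" if "r > 0" for c r :: real
    using that by (simp add: divide_strict_right_mono)
  have in_ball: "2 * pi * \<rho> \<in> ball c r" if "c / (2 * pi) < \<rho>" "\<rho> < (c + r) / (2 * pi)" for c r \<rho> :: real
  proof -
    have "c < 2 * pi * \<rho>" "2 * pi * \<rho> < c + r" using that by (simp_all add: field_simps)
    then show ?thesis by (simp add: dist_real_def)
  qed
  obtain \<rho>1 where r1: "\<rho>1 \<in> \<rat>" "fst (ret L p) / (2 * pi) < \<rho>1" "\<rho>1 < (fst (ret L p) + e) / (2 * pi)"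
    by (rule ex_fraction_large_denominator[OF iv[OF e(1)]]) (rule that)
  obtain \<rho>2 where r2: "\<rho>2 \<in> \<rat>" "snd (ret L p) / (2 * pi) < \<rho>2" "\<rho>2 < (snd (ret L p) + b) / (2 * pi)"
    "\<And>j :: nat. j \<ge> 1 \<Longrightarrow> real j * \<rho>2 \<in> \<int> \<Longrightarrow> j > N"
    by (rule ex_fraction_large_denominator[OF iv[OF e'(1)]]) (rule that)
  have "(2 * pi * \<rho>1, 2 * pi * \<rho>2) \<in> A \<times> B"
    using in_ball[OF r1(2,3)] in_ball[OF r2(2,3)] e(2) e'(2) by auto
  then obtain p' where "p' \<in> S" "ret L p' = (2 * pi * \<rho>1, 2 * pi * \<rho>2)" using AB(4) T(3) by force
  then show thesis using r1(1) r2(1,4) that by blast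
qed

end

section \<open>Warped products\<close>

lemma sum_Basis_prod:
  fixes f :: "'a::euclidean_space \<times> 'b::euclidean_space \<Rightarrow> 'c::comm_monoid_add"
  shows "(\<Sum>i\<in>Basis. f i) = (\<Sum>i\<in>Basis. f (i, 0)) + (\<Sum>i\<in>Basis. f (0, i))"
proof -
  have "inj_on (\<lambda>u. (u::'a, 0::'b)) Basis" "inj_on (\<lambda>u. (0::'a, u::'b)) Basis"
    by (auto intro!: inj_onI)
  then show ?thesis
    unfolding Basis_prod_def by (subst sum.union_disjoint) (auto simp: sum.reindex)
qed

lemma frechet_derivative_cong_open:
  assumes "open S" "p \<in> S" "\<And>q. q \<in> S \<Longrightarrow> f q = g q"
  shows "fderiv f p = fderiv g p"
proof -
  have "(f has_derivative F) (at p) \<longleftrightarrow> (g has_derivative F) (at p)" for F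
    using assms by (metis has_derivative_transform_within_open)
  then show ?thesis by (simp add: frechet_derivative_def)
qed

lemma frechet_derivative_eqI: "(f has_derivative f') (at x) \<Longrightarrow> fderiv f x = f'"
  using frechet_derivative_at by metis

section \<open>Metrics in coordinates and their Christoffel symbols\<close>

definition inner_form :: "('e::euclidean_space \<Rightarrow> 'e \<Rightarrow> real) \<Rightarrow> bool" where
  "inner_form B \<longleftrightarrow> bilinear B \<and> (\<forall>u v. B u v = B v u) \<and> (\<forall>u. u \<noteq> 0 \<longrightarrow> B u u > 0)"

lemma riesz_eqI:
  assumes "inner_form B" "\<And>z. B w z = \<omega> z"
  shows "riesz B \<omega> = w"
  unfolding riesz_def
proof (rule the_equality)
  fix w' assume w': "\<forall>z. B w' z = \<omega> z"
  have bl: "bilinear B" using assms(1) by (simp add: inner_form_def)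
  have "B (w' - w) (w' - w) = 0"
    using w' assms(2) by (simp add: bilinear_lsub[OF bl])
  then show "w' = w" using assms(1) unfolding inner_form_def by (metis eq_iff_diff_eq_0 less_irrefl)
qed (use assms in auto)

text \<open>Positivity makes \<open>w \<mapsto> B w\<close> injective, hence surjective in finite
  dimension; this gives the description in \<open>riesz\<close> an actual value.\<close>

lemma riesz_works:
  assumes "inner_form B" "linear \<omega>"
  shows "B (riesz B \<omega>) z = \<omega> z"
proof -
  have bl: "bilinear B" using assms(1) by (simp add: inner_form_def)
  define T where "T w = (\<Sum>i\<in>Basis. B w i *\<^sub>R i)" for w
  have T: "T w \<bullet> z = B w z" for w z
  proof -
    have "B w z = (\<Sum>i\<in>Basis. (z \<bullet> i) *\<^sub>R B w i)"
      using linear_euclidean_expand[of "B w" z] bl by (simp add: bilinear_def)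
    then show ?thesis unfolding T_def inner_sum_left by (simp add: inner_commute[of z] mult.commute)
  qed
  have lT: "linear T"
    by (rule linearI) (auto simp: T_def bilinear_ladd[OF bl] bilinear_lmul[OF bl] scaleR_add_left sum.distrib scaleR_sum_right)
  have "inj T"
  proof (rule linear_injective_0[OF lT, THEN iffD2], intro allI impI)
    fix w assume "T w = 0"
    then have "B w w = 0" using T[of w w] by simp
    then show "w = 0" using assms(1) unfolding inner_form_def by (metis less_irrefl)
  qed
  then have "surj T" using linear_injective_imp_surjective[OF lT] by simp
  then obtain w where w: "T w = (\<Sum>i\<in>Basis. \<omega> i *\<^sub>R i)" by (metis surjD)
  have "B w z = \<omega> z" for z
  proof -
    have "B w z = (\<Sum>i\<in>Basis. \<omega> i *\<^sub>R i) \<bullet> z" using T[of w z] w by simp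
    also have "\<dots> = (\<Sum>i\<in>Basis. (z \<bullet> i) *\<^sub>R \<omega> i)"
      unfolding inner_sum_left by (simp add: inner_commute[of z] mult.commute)
    finally show ?thesis using linear_euclidean_expand[OF assms(2), of z] by simp
  qed
  then show ?thesis using riesz_eqI[OF assms(1), of w \<omega>] by simp
qed

definition metric_field :: "'e::euclidean_space field_of_forms \<Rightarrow> 'e set \<Rightarrow> bool" where
  "metric_field g S \<longleftrightarrow> open S \<and> (\<forall>p\<in>S. inner_form (g p)) \<and> (\<forall>u v. Ck_on 1 (\<lambda>p. g p u v) S)"

lemma metric_fieldD:
  assumes "metric_field g S"
  shows "open S" "p \<in> S \<Longrightarrow> inner_form (g p)" "p \<in> S \<Longrightarrow> bilinear (g p)" "p \<in> S \<Longrightarrow> g p u v = g p v u"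
    "p \<in> S \<Longrightarrow> ((\<lambda>p. g p u v) has_derivative fderiv (\<lambda>p. g p u v) p) (at p)"
  using assms Ck_on_Suc_has_derivative[of S 0 "\<lambda>p. g p u v" p] unfolding metric_field_def inner_form_def
  by auto

lemma sharp_works: "metric_field g S \<Longrightarrow> p \<in> S \<Longrightarrow> g p (sharp g p i) z = i \<bullet> z"
  unfolding sharp_def by (rule riesz_works[OF metric_fieldD(2)]) (auto simp: bounded_linear.linear bounded_linear_inner_right)

lemma metric_derivative_linear:
  assumes "metric_field g S" "p \<in> S"
  shows "fderiv (\<lambda>p. g p (u + u') v) p w
      = fderiv (\<lambda>p. g p u v) p w + fderiv (\<lambda>p. g p u' v) p w"
    and "fderiv (\<lambda>p. g p (c *\<^sub>R u) v) p w = c * fderiv (\<lambda>p. g p u v) p w"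
    and "fderiv (\<lambda>p. g p v (u + u')) p w
      = fderiv (\<lambda>p. g p v u) p w + fderiv (\<lambda>p. g p v u') p w"
    and "fderiv (\<lambda>p. g p v (c *\<^sub>R u)) p w = c * fderiv (\<lambda>p. g p v u) p w"
    and "fderiv (\<lambda>p. g p 0 v) p w = 0"
    and "fderiv (\<lambda>p. g p v 0) p w = 0"
    and "fderiv (\<lambda>p. g p u v) p w = fderiv (\<lambda>p. g p v u) p w"
proof -
  note o = metric_fieldD(1)[OF assms(1)] and bl = metric_fieldD(3)[OF assms(1)]
    and d = metric_fieldD(5)[OF assms]
  note cong = frechet_derivative_cong_open[OF o assms(2), THEN fun_cong]
  have sum: "fderiv (\<lambda>p. g p u v + g p u' v') p w
      = fderiv (\<lambda>p. g p u v) p w + fderiv (\<lambda>p. g p u' v') p w" for u v u' v'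
    using frechet_derivative_eqI[OF has_derivative_add[OF d d]] by (rule fun_cong)
  have cm: "fderiv (\<lambda>p. c * g p u v) p w = c * fderiv (\<lambda>p. g p u v) p w" for u v
    using frechet_derivative_eqI[OF has_derivative_mult_right[OF d]] by (rule fun_cong)
  have z: "fderiv (\<lambda>p::'a. 0::real) p w = 0"
    using frechet_derivative_eqI[OF has_derivative_const] by (rule fun_cong)
  show "fderiv (\<lambda>p. g p (u + u') v) p w
      = fderiv (\<lambda>p. g p u v) p w + fderiv (\<lambda>p. g p u' v) p w"
    unfolding sum[symmetric] by (rule cong) (simp add: bilinear_ladd[OF bl])
  show "fderiv (\<lambda>p. g p (c *\<^sub>R u) v) p w = c * fderiv (\<lambda>p. g p u v) p w"
    unfolding cm[symmetric] by (rule cong) (simp add: bilinear_lmul[OF bl])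
  show "fderiv (\<lambda>p. g p v (u + u')) p w
      = fderiv (\<lambda>p. g p v u) p w + fderiv (\<lambda>p. g p v u') p w"
    unfolding sum[symmetric] by (rule cong) (simp add: bilinear_radd[OF bl])
  show "fderiv (\<lambda>p. g p v (c *\<^sub>R u)) p w = c * fderiv (\<lambda>p. g p v u) p w"
    unfolding cm[symmetric] by (rule cong) (simp add: bilinear_rmul[OF bl])
  show "fderiv (\<lambda>p. g p 0 v) p w = 0"
    by (rule trans[OF cong z]) (simp add: bilinear_lzero[OF bl])
  show "fderiv (\<lambda>p. g p v 0) p w = 0"
    by (rule trans[OF cong z]) (simp add: bilinear_rzero[OF bl])
  show "fderiv (\<lambda>p. g p u v) p w = fderiv (\<lambda>p. g p v u) p w"
    by (rule cong) (rule metric_fieldD(4)[OF assms(1)])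
qed

text \<open>The Koszul formula for coordinate fields, that is, the Christoffel symbol with its upper
  index lowered. Metric identities are checked for it and transferred by
  \<open>riesz_eqI\<close>.\<close>

definition koszul :: "'e::euclidean_space field_of_forms \<Rightarrow> 'e \<Rightarrow> 'e \<Rightarrow> 'e \<Rightarrow> 'e \<Rightarrow> real" where
  "koszul g p u v z = (fderiv (\<lambda>q. g q v z) p u
      + fderiv (\<lambda>q. g q u z) p v
      - fderiv (\<lambda>q. g q u v) p z) / 2"

lemma christoffel_koszul: "christoffel g p u v = riesz (g p) (koszul g p u v)"
  by (simp add: christoffel_def koszul_def[abs_def])

lemma christoffel_works:
  assumes "metric_field g S" "p \<in> S"
  shows "g p (christoffel g p u v) z = koszul g p u v z"
  unfolding christoffel_koszul
proof (rule riesz_works[OF metric_fieldD(2)[OF assms]])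
  have l: "linear (fderiv (\<lambda>q. g q u v) p)"
    using metric_fieldD(5)[OF assms] has_derivative_linear by blast
  show "linear (koszul g p u v)"
    by (rule linearI)
      (simp_all add: koszul_def metric_derivative_linear[OF assms] linear_add[OF l] linear_cmul[OF l] algebra_simps
        add_divide_distrib diff_divide_distrib)
qed

lemma christoffel_scale:
  assumes "metric_field g S" "p \<in> S"
  shows "christoffel g p u (c *\<^sub>R v) = c *\<^sub>R christoffel g p u v"
  unfolding christoffel_koszul[of g p u "c *\<^sub>R v"]
proof (rule riesz_eqI[OF metric_fieldD(2)[OF assms]])
  have l: "linear (fderiv (\<lambda>q. g q u z) p)" for z
    using metric_fieldD(5)[OF assms] has_derivative_linear by blast
  show "g p (c *\<^sub>R christoffel g p u v) z = koszul g p u (c *\<^sub>R v) z" for z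
    by (simp add: bilinear_lmul[OF metric_fieldD(3)[OF assms]] christoffel_works[OF assms])
      (simp add: koszul_def metric_derivative_linear[OF assms] linear_cmul[OF l] algebra_simps)
qed

lemma bilinear_vector_scalar_mult: "bounded_bilinear ((*s) :: complex \<Rightarrow> complex ^ 'n \<Rightarrow> complex ^ 'n)"
  unfolding bilinear_conv_bounded_bilinear[symmetric]
  by (auto simp: bilinear_def vec_eq_iff algebra_simps intro!: linearI)

lemma inner_vector_scalar_mult: "(c *s x) \<bullet> (c *s y) = (cmod c)\<^sup>2 * (x \<bullet> y)" for x y :: "complex ^ 'n"
proof -
  have "(c * u) \<bullet> (c * v) = (cmod c)\<^sup>2 * (u \<bullet> v)" for u v :: complex
    unfolding inner_complex_def cmod_power2 by (simp add: algebra_simps power2_eq_square)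
  then show ?thesis by (simp add: inner_vec_def sum_distrib_left)
qed

lemma scaleR_vector_scalar_mult: "(r *\<^sub>R c) *s x = r *\<^sub>R (c *s x)" "c *s (r *\<^sub>R x) = r *\<^sub>R (c *s x)"
  for x :: "complex ^ 'n"
  by (auto simp: vec_eq_iff)

section \<open>The doubly warped product metric and maps that split along the factors\<close>

locale warped_geometry =
  fixes g1 :: "'e1::euclidean_space field_of_forms" and S1 :: "'e1 set"
    and g2 :: "'e2::euclidean_space field_of_forms" and S2 :: "'e2 set"
    and F1 :: "'e1 \<Rightarrow> complex ^ 'n1" and F2 :: "'e2 \<Rightarrow> complex ^ 'n2"
    and l1 l2 l1' l2' :: "real \<Rightarrow> real" and z1 z2 z1' z2' z1'' z2'' :: "real \<Rightarrow> complex"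
    and G :: "(real \<times> 'e1 \<times> 'e2) field_of_forms"
    and \<Phi> :: "real \<times> 'e1 \<times> 'e2 \<Rightarrow> (complex ^ 'n1) \<times> (complex ^ 'n2)"
  assumes g1: "metric_field g1 S1" and g2: "metric_field g2 S2"
    and F1: "Ck_on 2 F1 S1" and F2: "Ck_on 2 F2 S2"
    and l_pos: "\<And>t. l1 t > 0" "\<And>t. l2 t > 0"
    and l_deriv: "\<And>t. (l1 has_real_derivative l1' t) (at t)" "\<And>t. (l2 has_real_derivative l2' t) (at t)"
    and z_deriv: "\<And>t. (z1 has_vector_derivative z1' t) (at t)" "\<And>t. (z2 has_vector_derivative z2' t) (at t)"
    and z_deriv2: "\<And>t. (z1' has_vector_derivative z1'' t) (at t)" "\<And>t. (z2' has_vector_derivative z2'' t) (at t)"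
    and G_def: "G = (\<lambda>(t, p, q) (\<tau>, u, v) (\<tau>', u', v'). \<tau> * \<tau>' + (l1 t)\<^sup>2 * g1 p u u' + (l2 t)\<^sup>2 * g2 q v v')"
    and \<Phi>: "\<And>t p q. p \<in> S1 \<Longrightarrow> q \<in> S2 \<Longrightarrow> \<Phi> (t, p, q) = (z1 t *s F1 p, z2 t *s F2 q)"
begin

abbreviation "S \<equiv> UNIV \<times> S1 \<times> S2"

lemma open_S: "open S"
  using metric_fieldD(1)[OF g1] metric_fieldD(1)[OF g2] by (simp add: open_Times)

lemma inner_form_G:
  assumes "p \<in> S1" "q \<in> S2"
  shows "inner_form (G (t, p, q))"
proof -
  note b1 = metric_fieldD(3)[OF g1 assms(1)] and b2 = metric_fieldD(3)[OF g2 assms(2)]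
  have "bilinear (G (t, p, q))"
    unfolding bilinear_def G_def
    by (auto intro!: linearI simp: bilinear_ladd[OF b1] bilinear_radd[OF b1] bilinear_lmul[OF b1] bilinear_rmul[OF b1]
      bilinear_ladd[OF b2] bilinear_radd[OF b2] bilinear_lmul[OF b2] bilinear_rmul[OF b2] algebra_simps)
  moreover have "G (t, p, q) u v = G (t, p, q) v u" for u v
    using metric_fieldD(4)[OF g1 assms(1)] metric_fieldD(4)[OF g2 assms(2)]
    by (cases u, cases v) (simp add: G_def mult.commute)
  moreover have "G (t, p, q) u u > 0" if "u \<noteq> 0" for u
  proof -
    obtain \<tau> v w where u: "u = (\<tau>, v, w)" by (cases u)
    have nn: "B x x \<ge> 0" "x \<noteq> 0 \<Longrightarrow> B x x > 0" if "inner_form B" for B :: "'a::euclidean_space \<Rightarrow> 'a \<Rightarrow> real" and x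
      using that bilinear_lzero[of B 0] unfolding inner_form_def by (metis less_eq_real_def order_refl)+
    have e: "G (t, p, q) u u = \<tau> * \<tau> + (l1 t)\<^sup>2 * g1 p v v + (l2 t)\<^sup>2 * g2 q w w" by (simp add: u G_def)
    have a: "\<tau> * \<tau> \<ge> 0" "(l1 t)\<^sup>2 * g1 p v v \<ge> 0" "(l2 t)\<^sup>2 * g2 q w w \<ge> 0"
      using nn(1)[OF metric_fieldD(2)[OF g1 assms(1)]] nn(1)[OF metric_fieldD(2)[OF g2 assms(2)]] by auto
    have "\<tau> \<noteq> 0 \<or> v \<noteq> 0 \<or> w \<noteq> 0" using that by (auto simp: u zero_prod_def)
    then have "\<tau> * \<tau> > 0 \<or> (l1 t)\<^sup>2 * g1 p v v > 0 \<or> (l2 t)\<^sup>2 * g2 q w w > 0"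
      using nn(2)[OF metric_fieldD(2)[OF g1 assms(1)], of v] nn(2)[OF metric_fieldD(2)[OF g2 assms(2)], of w]
        l_pos(1)[of t] l_pos(2)[of t] by (auto simp: zero_less_mult_iff)
    then show ?thesis unfolding e using a by linarith
  qed
  ultimately show ?thesis by (simp add: inner_form_def)
qed

lemma sharp_G:
  assumes "p \<in> S1" "q \<in> S2"
  shows "sharp G (t, p, q) (1, 0, 0) = (1, 0, 0)"
    and "sharp G (t, p, q) (0, i, 0) = (0, (1 / (l1 t)\<^sup>2) *\<^sub>R sharp g1 p i, 0)"
    and "sharp G (t, p, q) (0, 0, j) = (0, 0, (1 / (l2 t)\<^sup>2) *\<^sub>R sharp g2 q j)"
proof -
  note b1 = metric_fieldD(3)[OF g1 assms(1)] and b2 = metric_fieldD(3)[OF g2 assms(2)]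
  note s = bilinear_lzero[OF b1] bilinear_lzero[OF b2] bilinear_lmul[OF b1] bilinear_lmul[OF b2]
    sharp_works[OF g1 assms(1)] sharp_works[OF g2 assms(2)] inner_prod_def
  have nz: "l1 t \<noteq> 0" "l2 t \<noteq> 0" using l_pos(1)[of t] l_pos(2)[of t] by auto
  show "sharp G (t, p, q) (1, 0, 0) = (1, 0, 0)"
    unfolding sharp_def by (rule riesz_eqI[OF inner_form_G[OF assms]]) (auto simp: G_def s)
  show "sharp G (t, p, q) (0, i, 0) = (0, (1 / (l1 t)\<^sup>2) *\<^sub>R sharp g1 p i, 0)"
    unfolding sharp_def[of G] by (rule riesz_eqI[OF inner_form_G[OF assms]]) (auto simp: G_def s nz)
  show "sharp G (t, p, q) (0, 0, j) = (0, 0, (1 / (l2 t)\<^sup>2) *\<^sub>R sharp g2 q j)"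
    unfolding sharp_def[of G] by (rule riesz_eqI[OF inner_form_G[OF assms]]) (auto simp: G_def s nz)
qed

lemma G_apply: "G (t, p, q) (\<tau>, u, v) (\<tau>', u', v') = \<tau> * \<tau>' + (l1 t)\<^sup>2 * g1 p u u' + (l2 t)\<^sup>2 * g2 q v v'"
  by (simp add: G_def)

lemma G_derivative:
  assumes "p \<in> S1" "q \<in> S2"
  shows "fderiv (\<lambda>P. G P (\<tau>, u, v) (\<tau>', u', v')) (t, p, q) (\<sigma>, h, k)
    = 2 * l1 t * l1' t * \<sigma> * g1 p u u' + (l1 t)\<^sup>2 * fderiv (\<lambda>p. g1 p u u') p h
    + (2 * l2 t * l2' t * \<sigma> * g2 q v v' + (l2 t)\<^sup>2 * fderiv (\<lambda>q. g2 q v v') q k)"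
proof -
  let ?P = "(t, p, q)"
  have e: "(\<lambda>P. G P (\<tau>, u, v) (\<tau>', u', v'))
      = (\<lambda>P. \<tau> * \<tau>' + (l1 (fst P))\<^sup>2 * g1 (fst (snd P)) u u' + (l2 (fst P))\<^sup>2 * g2 (snd (snd P)) v v')"
    by (auto simp: G_def)
  have L: "((\<lambda>P. l (fst P)) has_derivative (\<lambda>w. l' * fst w)) (at ?P)"
    if "(l has_real_derivative l') (at t)" for l l'
  proof -
    have 1: "(fst has_derivative fst) (at ?P)" by (auto intro!: derivative_eq_intros)
    show ?thesis using has_derivative_compose[OF 1, of l "(*) l'"] that by (simp add: has_field_derivative_def)
  qed
  have f1: "((\<lambda>P :: real \<times> 'e1 \<times> 'e2. fst (snd P)) has_derivative (\<lambda>w. fst (snd w))) (at ?P)"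
    and f2: "((\<lambda>P :: real \<times> 'e1 \<times> 'e2. snd (snd P)) has_derivative (\<lambda>w. snd (snd w))) (at ?P)"
    by (auto intro!: derivative_eq_intros)
  have d1: "((\<lambda>P :: real \<times> 'e1 \<times> 'e2. g1 (fst (snd P)) u u') has_derivative
      (\<lambda>w. fderiv (\<lambda>p. g1 p u u') p (fst (snd w)))) (at ?P)"
    by (rule has_derivative_compose[OF f1]) (use metric_fieldD(5)[OF g1 assms(1)] in simp)
  have d2: "((\<lambda>P :: real \<times> 'e1 \<times> 'e2. g2 (snd (snd P)) v v') has_derivative
      (\<lambda>w. fderiv (\<lambda>q. g2 q v v') q (snd (snd w)))) (at ?P)"
    by (rule has_derivative_compose[OF f2]) (use metric_fieldD(5)[OF g2 assms(2)] in simp)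
  show ?thesis unfolding e
    by (rule trans[OF fun_cong[OF frechet_derivative_eqI[OF has_derivative_add[OF has_derivative_add[OF has_derivative_const
      has_derivative_mult[OF has_derivative_power[OF L[OF l_deriv(1)], of 2] d1]] has_derivative_mult[OF has_derivative_power[OF L[OF l_deriv(2)], of 2] d2]]]]])
      (simp add: algebra_simps)
qed

text \<open>The metric is block diagonal, so the trace pairs each basis vector with a vector of its
  own block and these three cases are all it requires. The time component
  \<open>- l l' g(u, u')\<close> is the source of the first order terms in the Laplacian.\<close>

lemma christoffel_G:
  assumes "p \<in> S1" "q \<in> S2"
  shows "christoffel G (t, p, q) (1, 0, 0) (1, 0, 0) = 0"
    and "christoffel G (t, p, q) (0, u, 0) (0, u', 0) = (- l1 t * l1' t * g1 p u u', christoffel g1 p u u', 0)"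
    and "christoffel G (t, p, q) (0, 0, v) (0, 0, v') = (- l2 t * l2' t * g2 q v v', 0, christoffel g2 q v v')"
proof -
  note b1 = metric_fieldD(3)[OF g1 assms(1)] and b2 = metric_fieldD(3)[OF g2 assms(2)]
  note s = bilinear_lzero[OF b1] bilinear_lzero[OF b2] bilinear_rzero[OF b1] bilinear_rzero[OF b2]
    metric_derivative_linear(5,6)[OF g1 assms(1)] metric_derivative_linear(5,6)[OF g2 assms(2)]
    christoffel_works[OF g1 assms(1)] christoffel_works[OF g2 assms(2)]
  have l: "linear (fderiv (\<lambda>p. g1 p u v) p)" "linear (fderiv (\<lambda>q. g2 q u' v') q)" for u v u' v'
    using metric_fieldD(5)[OF g1 assms(1)] metric_fieldD(5)[OF g2 assms(2)] has_derivative_linear by blast+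
  note l0 = linear_0[OF l(1)] linear_0[OF l(2)]
  show "christoffel G (t, p, q) (1, 0, 0) (1, 0, 0) = 0"
    unfolding christoffel_koszul
    by (rule riesz_eqI[OF inner_form_G[OF assms]])
      (auto simp: koszul_def G_derivative[OF assms] s l0 G_apply zero_prod_def)
  show "christoffel G (t, p, q) (0, u, 0) (0, u', 0) = (- l1 t * l1' t * g1 p u u', christoffel g1 p u u', 0)"
    unfolding christoffel_koszul[of G]
    by (rule riesz_eqI[OF inner_form_G[OF assms]])
      (auto simp: koszul_def G_derivative[OF assms] s l0 G_apply algebra_simps add_divide_distrib diff_divide_distrib)
  show "christoffel G (t, p, q) (0, 0, v) (0, 0, v') = (- l2 t * l2' t * g2 q v v', 0, christoffel g2 q v v')"
    unfolding christoffel_koszul[of G]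
    by (rule riesz_eqI[OF inner_form_G[OF assms]])
      (auto simp: koszul_def G_derivative[OF assms] s l0 G_apply algebra_simps add_divide_distrib diff_divide_distrib)
qed

abbreviation "DF1 p \<equiv> fderiv F1 p"
abbreviation "DF2 q \<equiv> fderiv F2 q"

lemma DF:
  "p \<in> S1 \<Longrightarrow> (F1 has_derivative DF1 p) (at p)" "q \<in> S2 \<Longrightarrow> (F2 has_derivative DF2 q) (at q)"
  "p \<in> S1 \<Longrightarrow> ((\<lambda>p. DF1 p u) has_derivative fderiv (\<lambda>p. DF1 p u) p) (at p)"
  "q \<in> S2 \<Longrightarrow> ((\<lambda>q. DF2 q v) has_derivative fderiv (\<lambda>q. DF2 q v) q) (at q)"
  using F1 F2 metric_fieldD(1)[OF g1] metric_fieldD(1)[OF g2]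
  by (auto simp: numeral_2_eq_2 differentiable_on_eq_differentiable_at simp flip: frechet_derivative_works)

lemma scaled_derivative:
  fixes z :: "real \<Rightarrow> complex" and F :: "'e::euclidean_space \<Rightarrow> complex ^ 'n" and P :: "real \<times> 'b::real_normed_vector"
  assumes "(z has_vector_derivative z') (at t)" "(F has_derivative D) (at p)"
    and "(\<pi> has_derivative \<pi>) (at P)" "fst P = t" "\<pi> P = p"
  shows "((\<lambda>P. z (fst P) *s F (\<pi> P)) has_derivative (\<lambda>w. z t *s D (\<pi> w) + fst w *\<^sub>R (z' *s F p))) (at P)"
proof -
  have 1: "(fst has_derivative fst) (at P)" by (auto intro!: derivative_eq_intros)
  have 2: "((\<lambda>P. z (fst P)) has_derivative (\<lambda>w. fst w *\<^sub>R z')) (at P)"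
    by (rule has_derivative_compose[OF 1]) (use assms in \<open>simp add: has_vector_derivative_def\<close>)
  have 3: "((\<lambda>P. F (\<pi> P)) has_derivative (\<lambda>w. D (\<pi> w))) (at P)"
    by (rule has_derivative_compose[OF assms(3)]) (use assms in simp)
  show ?thesis
    using bounded_bilinear.FDERIV[OF bilinear_vector_scalar_mult 2 3] assms(4,5)
    by (simp add: scaleR_vector_scalar_mult)
qed

lemma projections:
  "((\<lambda>P :: real \<times> 'e1 \<times> 'e2. fst (snd P)) has_derivative (\<lambda>P. fst (snd P))) (at x)"
  "((\<lambda>P :: real \<times> 'e1 \<times> 'e2. snd (snd P)) has_derivative (\<lambda>P. snd (snd P))) (at x)"
  by (auto intro!: derivative_eq_intros)

lemma \<Phi>_derivative:
  assumes "p \<in> S1" "q \<in> S2"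
  shows "fderiv \<Phi> (t, p, q) (\<tau>, u, v)
    = (z1 t *s DF1 p u + \<tau> *\<^sub>R (z1' t *s F1 p), z2 t *s DF2 q v + \<tau> *\<^sub>R (z2' t *s F2 q))"
proof -
  let ?f = "\<lambda>P :: real \<times> 'e1 \<times> 'e2. (z1 (fst P) *s F1 (fst (snd P)), z2 (fst P) *s F2 (snd (snd P)))"
  have "fderiv \<Phi> (t, p, q) = fderiv ?f (t, p, q)"
    by (rule frechet_derivative_cong_open[OF open_S]) (use assms \<Phi> in auto)
  also have "\<dots> = (\<lambda>w. (z1 t *s DF1 p (fst (snd w)) + fst w *\<^sub>R (z1' t *s F1 p),
      z2 t *s DF2 q (snd (snd w)) + fst w *\<^sub>R (z2' t *s F2 q)))"
    by (rule frechet_derivative_eqI[OF has_derivative_Pair[OF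
      scaled_derivative[OF z_deriv(1) DF(1)[OF assms(1)] projections(1)]
      scaled_derivative[OF z_deriv(2) DF(2)[OF assms(2)] projections(2)]]]) auto
  finally show ?thesis by simp
qed

lemma \<Phi>_derivative2:
  assumes "p \<in> S1" "q \<in> S2"
  shows "fderiv (\<lambda>P. frechet_derivative \<Phi> (at P) (\<tau>, u, v)) (t, p, q) (\<tau>', u', v')
    = ((z1 t *s fderiv (\<lambda>p. DF1 p u) p u' + \<tau>' *\<^sub>R (z1' t *s DF1 p u))
        + \<tau> *\<^sub>R (z1' t *s DF1 p u' + \<tau>' *\<^sub>R (z1'' t *s F1 p)),
       (z2 t *s fderiv (\<lambda>q. DF2 q v) q v' + \<tau>' *\<^sub>R (z2' t *s DF2 q v))
        + \<tau> *\<^sub>R (z2' t *s DF2 q v' + \<tau>' *\<^sub>R (z2'' t *s F2 q)))"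
proof -
  let ?f = "\<lambda>P :: real \<times> 'e1 \<times> 'e2.
     (z1 (fst P) *s DF1 (fst (snd P)) u + \<tau> *\<^sub>R (z1' (fst P) *s F1 (fst (snd P))),
      z2 (fst P) *s DF2 (snd (snd P)) v + \<tau> *\<^sub>R (z2' (fst P) *s F2 (snd (snd P))))"
  have "fderiv (\<lambda>P. frechet_derivative \<Phi> (at P) (\<tau>, u, v)) (t, p, q) = fderiv ?f (t, p, q)"
    by (rule frechet_derivative_cong_open[OF open_S]) (use assms \<Phi>_derivative in auto)
  also have "\<dots> = (\<lambda>w. ((z1 t *s fderiv (\<lambda>p. DF1 p u) p (fst (snd w)) + fst w *\<^sub>R (z1' t *s DF1 p u))
        + \<tau> *\<^sub>R (z1' t *s DF1 p (fst (snd w)) + fst w *\<^sub>R (z1'' t *s F1 p)),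
       (z2 t *s fderiv (\<lambda>q. DF2 q v) q (snd (snd w)) + fst w *\<^sub>R (z2' t *s DF2 q v))
        + \<tau> *\<^sub>R (z2' t *s DF2 q (snd (snd w)) + fst w *\<^sub>R (z2'' t *s F2 q))))"
    by (rule frechet_derivative_eqI[OF has_derivative_Pair[OF
      has_derivative_add[OF scaled_derivative[OF z_deriv(1) DF(3)[OF assms(1)] projections(1)]
        has_derivative_scaleR_right[OF scaled_derivative[OF z_deriv2(1) DF(1)[OF assms(1)] projections(1)]]]
      has_derivative_add[OF scaled_derivative[OF z_deriv(2) DF(4)[OF assms(2)] projections(2)]
        has_derivative_scaleR_right[OF scaled_derivative[OF z_deriv2(2) DF(2)[OF assms(2)] projections(2)]]]]]) auto
  finally show ?thesis by simp
qed

lemma differential_norm2_\<Phi>: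
  assumes "p \<in> S1" "q \<in> S2" "norm (F1 p) = 1" "norm (F2 q) = 1"
  shows "differential_norm2 G \<Phi> (t, p, q) = (cmod (z1' t))\<^sup>2 + (cmod (z2' t))\<^sup>2
    + (cmod (z1 t))\<^sup>2 / (l1 t)\<^sup>2 * differential_norm2 g1 F1 p
    + (cmod (z2 t))\<^sup>2 / (l2 t)\<^sup>2 * differential_norm2 g2 F2 q"
proof -
  have F: "F1 p \<bullet> F1 p = 1" "F2 q \<bullet> F2 q = 1" using assms(3,4) by (simp_all add: norm_eq_1)
  have l: "linear (DF1 p)" "linear (DF2 q)" using DF(1)[OF assms(1)] DF(2)[OF assms(2)] has_derivative_linear by auto
  note s = linear_0[OF l(1)] linear_0[OF l(2)] linear_cmul[OF l(1)] linear_cmul[OF l(2)] scaleR_vector_scalar_mult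
    inner_vector_scalar_mult F inner_prod_def
  have z: "c *s 0 = (0 :: complex ^ 'n)" for c by (simp add: vec_eq_iff)
  show ?thesis
    unfolding differential_norm2_def sum_Basis_prod[where 'b="'e1 \<times> 'e2"] sum_Basis_prod[where 'a='e1]
    by (simp add: sharp_G[OF assms(1,2), unfolded zero_prod_def] \<Phi>_derivative[OF assms(1,2)] zero_prod_def s z sum_distrib_left)
qed

text \<open>Each basis direction of a factor contributes \<open>l' / l\<close> times the time
  derivative, since \<open>g(i, sharp i) = 1\<close>. The sum \<open>k1 l1'/l1 + k2 l2'/l2\<close>
  is the logarithmic derivative of the volume density.\<close>

lemma laplacian_\<Phi>:
  assumes "p \<in> S1" "q \<in> S2"
  shows "laplacian G \<Phi> (t, p, q)
    = (z1'' t *s F1 p + (DIM('e1) * l1' t / l1 t + DIM('e2) * l2' t / l2 t) *\<^sub>R (z1' t *s F1 p)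
         + (1 / (l1 t)\<^sup>2) *\<^sub>R (z1 t *s laplacian g1 F1 p),
       z2'' t *s F2 q + (DIM('e1) * l1' t / l1 t + DIM('e2) * l2' t / l2 t) *\<^sub>R (z2' t *s F2 q)
         + (1 / (l2 t)\<^sup>2) *\<^sub>R (z2 t *s laplacian g2 F2 q))"
proof -
  have l: "linear (DF1 p)" "linear (DF2 q)" using DF(1)[OF assms(1)] DF(2)[OF assms(2)] has_derivative_linear by auto
  have l2: "linear (fderiv (\<lambda>p. DF1 p u) p)" "linear (fderiv (\<lambda>q. DF2 q v) q)" for u v
    using DF(3)[OF assms(1)] DF(4)[OF assms(2)] has_derivative_linear by blast+
  have z: "c *s 0 = (0 :: complex ^ 'n)" for c by (simp add: vec_eq_iff)
  have zm: "c *s (x - y) = c *s x - c *s y" for c and x y :: "complex ^ 'n" by (simp add: vec_eq_iff algebra_simps)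
  have nz: "l1 t \<noteq> 0" "l2 t \<noteq> 0" using l_pos(1)[of t] l_pos(2)[of t] by auto
  note s = linear_0[OF l(1)] linear_0[OF l(2)] linear_cmul[OF l(1)] linear_cmul[OF l(2)] scaleR_vector_scalar_mult z
    linear_0[OF l2(1)] linear_0[OF l2(2)] linear_cmul[OF l2(1)] linear_cmul[OF l2(2)]
  have DFzero: "fderiv (\<lambda>p. DF1 p 0) p w = 0" "fderiv (\<lambda>q. DF2 q 0) q w' = 0" for w w'
  proof -
    have "fderiv (\<lambda>p. DF1 p 0) p = fderiv (\<lambda>p. 0) p"
      by (rule frechet_derivative_cong_open[OF metric_fieldD(1)[OF g1] assms(1)])
        (use DF(1) has_derivative_linear linear_0 in blast)
    then show "fderiv (\<lambda>p. DF1 p 0) p w = 0" by simp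
    have "fderiv (\<lambda>q. DF2 q 0) q = fderiv (\<lambda>q. 0) q"
      by (rule frechet_derivative_cong_open[OF metric_fieldD(1)[OF g2] assms(2)])
        (use DF(2) has_derivative_linear linear_0 in blast)
    then show "fderiv (\<lambda>q. DF2 q 0) q w' = 0" by simp
  qed
  have gs: "g1 p i (sharp g1 p i) = 1" if "i \<in> Basis" for i
    using sharp_works[OF g1 assms(1), of i i] metric_fieldD(4)[OF g1 assms(1), of i "sharp g1 p i"] that by simp
  have gs2: "g2 q i (sharp g2 q i) = 1" if "i \<in> Basis" for i
    using sharp_works[OF g2 assms(2), of i i] metric_fieldD(4)[OF g2 assms(2), of i "sharp g2 q i"] that by simp
  have h0: "covariant_hessian G \<Phi> (t, p, q) (1, 0, 0) (1, 0, 0) = (z1'' t *s F1 p, z2'' t *s F2 q)"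
    unfolding covariant_hessian_def christoffel_G(1)[OF assms] 
    using \<Phi>_derivative[OF assms, of t 0 0 0] by (simp add: \<Phi>_derivative2[OF assms] DFzero s zero_prod_def)
  have h1: "covariant_hessian G \<Phi> (t, p, q) (0, i, 0) (0, (1 / (l1 t)\<^sup>2) *\<^sub>R sharp g1 p i, 0)
     = ((1 / (l1 t)\<^sup>2) *\<^sub>R (z1 t *s covariant_hessian g1 F1 p i (sharp g1 p i)) + (l1' t / l1 t) *\<^sub>R (z1' t *s F1 p),
        (l1' t / l1 t) *\<^sub>R (z2' t *s F2 q))" if "i \<in> Basis" for i
    unfolding covariant_hessian_def christoffel_G(2)[OF assms] christoffel_scale[OF g1 assms(1)]
      bilinear_rmul[OF metric_fieldD(3)[OF g1 assms(1)]] gs[OF that] \<Phi>_derivative2[OF assms] \<Phi>_derivative[OF assms]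
    using nz by (simp add: DFzero s zm scaleR_diff_right power2_eq_square)
  have h2: "covariant_hessian G \<Phi> (t, p, q) (0, 0, i) (0, 0, (1 / (l2 t)\<^sup>2) *\<^sub>R sharp g2 q i)
     = ((l2' t / l2 t) *\<^sub>R (z1' t *s F1 p),
       (1 / (l2 t)\<^sup>2) *\<^sub>R (z2 t *s covariant_hessian g2 F2 q i (sharp g2 q i)) + (l2' t / l2 t) *\<^sub>R (z2' t *s F2 q))" if "i \<in> Basis" for i
    unfolding covariant_hessian_def christoffel_G(3)[OF assms] christoffel_scale[OF g2 assms(2)]
      bilinear_rmul[OF metric_fieldD(3)[OF g2 assms(2)]] gs2[OF that] \<Phi>_derivative2[OF assms] \<Phi>_derivative[OF assms]
    using nz by (simp add: DFzero s zm scaleR_diff_right power2_eq_square)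
  have sum_s: "(\<Sum>i\<in>I. c *s f i) = c *s (\<Sum>i\<in>I. f i)" for c I and f :: "'b \<Rightarrow> complex ^ 'n"
    by (simp add: vec_eq_iff sum_distrib_left)
  have of_nat_scale: "of_nat n * x = real n *\<^sub>R x" for n and x :: "complex ^ 'n"
    by (simp add: scaleR_conv_of_real)
  have pair_sum: "(\<Sum>i\<in>I. (f i, h i)) = (\<Sum>i\<in>I. f i, \<Sum>i\<in>I. h i)" for I and f :: "'b \<Rightarrow> complex ^ 'n1" and h :: "'b \<Rightarrow> complex ^ 'n2"
    by (simp add: prod_eq_iff fst_sum snd_sum)
  have "laplacian G \<Phi> (t, p, q) = (z1'' t *s F1 p, z2'' t *s F2 q)
    + ((\<Sum>i\<in>Basis. ((1 / (l1 t)\<^sup>2) *\<^sub>R (z1 t *s covariant_hessian g1 F1 p i (sharp g1 p i)) + (l1' t / l1 t) *\<^sub>R (z1' t *s F1 p),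
        (l1' t / l1 t) *\<^sub>R (z2' t *s F2 q)))
    + (\<Sum>i\<in>Basis. ((l2' t / l2 t) *\<^sub>R (z1' t *s F1 p),
       (1 / (l2 t)\<^sup>2) *\<^sub>R (z2 t *s covariant_hessian g2 F2 q i (sharp g2 q i)) + (l2' t / l2 t) *\<^sub>R (z2' t *s F2 q))))"
    unfolding laplacian_def[of G] sum_Basis_prod[where 'b="'e1 \<times> 'e2"] sum_Basis_prod[where 'a='e1]
    using h0 h1 h2 by (simp add: sharp_G[OF assms] sharp_G[OF assms, unfolded zero_prod_def] zero_prod_def)
  also have "\<dots> = (z1'' t *s F1 p, z2'' t *s F2 q)
    + (((1 / (l1 t)\<^sup>2) *\<^sub>R (z1 t *s laplacian g1 F1 p) + (DIM('e1) * l1' t / l1 t) *\<^sub>R (z1' t *s F1 p),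
        (DIM('e1) * l1' t / l1 t) *\<^sub>R (z2' t *s F2 q))
    + ((DIM('e2) * l2' t / l2 t) *\<^sub>R (z1' t *s F1 p),
       (1 / (l2 t)\<^sup>2) *\<^sub>R (z2 t *s laplacian g2 F2 q) + (DIM('e2) * l2' t / l2 t) *\<^sub>R (z2' t *s F2 q)))"
    unfolding laplacian_def pair_sum sum.distrib sum_s[symmetric] scaleR_sum_right
    by (simp add: of_nat_scale mult.commute)
  finally show ?thesis by (simp add: scaleR_add_left algebra_simps)
qed

end

section \<open>Harmonicity of reconstructions\<close>

lemma norm_vector_scalar_mult: "norm (c *s x) = cmod c * norm x" for x :: "complex ^ 'n"
proof -
  have "(norm (c *s x))\<^sup>2 = (cmod c * norm x)\<^sup>2"
    by (simp add: power2_norm_eq_inner inner_vector_scalar_mult power_mult_distrib)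
  then show ?thesis by (simp add: power2_eq_iff_nonneg)
qed

text \<open>The hypothesis on the derivative of p expresses conservation of angular momentum
  weighted by a density with logarithmic derivative h. It cancels the Coriolis term
  \<open>2 a1 p\<close>, so the angular part of the second derivative is just
  \<open>- a p h\<close>.\<close>

lemma polar_derivatives:
  fixes a a1 a2 s p h :: "real \<Rightarrow> real"
  assumes "\<And>t. (a has_real_derivative a1 t) (at t)" "\<And>t. (a1 has_real_derivative a2 t) (at t)"
    and "\<And>t. (s has_real_derivative p t) (at t)"
    and "\<And>t. (p has_real_derivative - p t * (h t + 2 * a1 t / a t)) (at t)" and "\<And>t. a t \<noteq> 0"
  shows "((\<lambda>t. of_real (a t) * cis (s t)) has_vector_derivative Complex (a1 t) (a t * p t) * cis (s t)) (at t)"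
    and "((\<lambda>t. Complex (a1 t) (a t * p t) * cis (s t)) has_vector_derivative
        Complex (a2 t - a t * (p t)\<^sup>2) (- a t * p t * h t) * cis (s t)) (at t)"
proof -
  have c: "((\<lambda>t. cis (s t)) has_vector_derivative p t *\<^sub>R (\<i> * cis (s t))) (at t)" for t
    using assms(3)[of t] unfolding has_vector_derivative_def has_field_derivative_def
    by (auto intro!: derivative_eq_intros simp: fun_eq_iff scaleR_conv_of_real algebra_simps)
  have r: "((\<lambda>t. complex_of_real (f t)) has_vector_derivative of_real f') (at t)" if "(f has_real_derivative f') (at t)" for f f' t
    using that by (rule has_vector_derivative_of_real)
  have cx: "Complex u v = of_real u + \<i> * of_real v" for u v by (simp add: complex_eq_iff)
  show "((\<lambda>t. of_real (a t) * cis (s t)) has_vector_derivative Complex (a1 t) (a t * p t) * cis (s t)) (at t)"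
    using has_vector_derivative_mult[OF r[OF assms(1)] c]
    by (simp add: cx scaleR_conv_of_real algebra_simps)
  have ap: "((\<lambda>t. a t * p t) has_real_derivative - a1 t * p t - a t * p t * h t) (at t)"
    by (rule DERIV_cong[OF DERIV_mult[OF assms(1,4)]]) (use assms(5)[of t] in \<open>simp add: field_simps\<close>)
  show "((\<lambda>t. Complex (a1 t) (a t * p t) * cis (s t)) has_vector_derivative
        Complex (a2 t - a t * (p t)\<^sup>2) (- a t * p t * h t) * cis (s t)) (at t)"
    unfolding cx
    using has_vector_derivative_mult[OF has_vector_derivative_add[OF r[OF assms(2)]
        has_vector_derivative_mult[OF has_vector_derivative_const[of \<i>] r[OF ap]]] c]
    by (simp add: scaleR_conv_of_real algebra_simps power2_eq_square)
qed

locale reconstruction =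
  fixes k1 k2 :: nat and d1 d2 :: real and D :: recon and l1' l2' :: "real \<Rightarrow> real"
  assumes rec: "is_reconstruction k1 k2 d1 d2 D"
    and l_deriv: "\<And>t. (warp1 D has_real_derivative l1' t) (at t)" "\<And>t. (warp2 D has_real_derivative l2' t) (at t)"
begin

abbreviation "c \<equiv> par_c D"
abbreviation "\<epsilon> \<equiv> par_eps D"
abbreviation "\<sigma> \<equiv> par_sig D"
abbreviation "a \<equiv> mag D"
abbreviation "a1 \<equiv> deriv a"
abbreviation "a2 \<equiv> deriv (deriv a)"
abbreviation "b \<equiv> co_magnitude a"
abbreviation "Q \<equiv> Q_fun c a"
abbreviation "R \<equiv> R_fun a"
abbreviation "F \<equiv> F_fun c \<epsilon> a"
abbreviation "T \<equiv> T_fun c a"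
abbreviation "p1 \<equiv> phase_rate1 c \<epsilon> \<sigma> a"
abbreviation "p2 \<equiv> phase_rate2 c \<epsilon> \<sigma> a"
abbreviation "b1 t \<equiv> - a t * a1 t / b t"
abbreviation "b2 t \<equiv> - ((a1 t)\<^sup>2 + a t * a2 t + (b1 t)\<^sup>2) / b t"
text \<open>The logarithmic derivative of \<open>F\<close>, read off from
  \<open>F^2 = \<epsilon> Q / (a^2 R)\<close>.\<close>

abbreviation "h t \<equiv> (c\<^sup>2 - 1) * a t * a1 t / Q t - a1 t / a t + a1 t * (a t + a2 t) / R t"

lemma basics:
  "\<epsilon> > 0" "\<sigma>\<^sup>2 = 1" "a t > 0" "a t < 1" "R t > 0" "Ck_on 2 a UNIV"
  "warp1 D t > 0" "warp2 D t > 0" "warp1 D t ^ k1 * warp2 D t ^ k2 = F t"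
  "d2 / (warp2 D t)\<^sup>2 - d1 / (warp1 D t)\<^sup>2 = T t"
  "(phase1 D has_real_derivative p1 t) (at t)" "(phase2 D has_real_derivative p2 t) (at t)"
  using rec by (auto simp: is_reconstruction_def)

lemma a_deriv: "(a has_real_derivative a1 t) (at t)" "(a1 has_real_derivative a2 t) (at t)"
  and a_Ck: "Ck_on 1 a1 UNIV" "Ck_on 2 a UNIV"
proof -
  have 2: "Ck_on (Suc (Suc 0)) a UNIV" using basics(6) by (simp add: numeral_2_eq_2)
  note 1 = Ck_on_Suc_DERIV[OF open_UNIV 2]
  show "(a has_real_derivative a1 t) (at t)" "Ck_on 1 a1 UNIV" using 1 by auto
  show "(a1 has_real_derivative a2 t) (at t)" using Ck_on_Suc_DERIV(1)[OF open_UNIV 1(2)] by auto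
  show "Ck_on 2 a UNIV" by (rule basics(6))
qed

lemma b_facts: "(b t)\<^sup>2 = 1 - (a t)\<^sup>2" "b t > 0" "1 - (a t)\<^sup>2 > 0"
proof -
  show p: "1 - (a t)\<^sup>2 > 0"
    using basics(3,4)[of t] by (simp add: power_less_one_iff abs_square_less_1)
  then show "(b t)\<^sup>2 = 1 - (a t)\<^sup>2" "b t > 0" by (simp_all add: co_magnitude_def)
qed

lemma Q_eq: "Q t = (b t)\<^sup>2 + c\<^sup>2 * (a t)\<^sup>2"
  unfolding b_facts by (simp add: Q_fun_def algebra_simps)

lemma Q_pos: "Q t > 0"
  unfolding Q_eq using b_facts(2)[of t] by (intro add_pos_nonneg) auto

lemma nonzero: "a t \<noteq> 0" "b t \<noteq> 0" "Q t \<noteq> 0" "R t \<noteq> 0" "\<epsilon> \<noteq> 0" "F t \<noteq> 0"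
proof -
  show "a t \<noteq> 0" "b t \<noteq> 0" "Q t \<noteq> 0" "R t \<noteq> 0" "\<epsilon> \<noteq> 0"
    using basics(1) basics(3,5)[of t] b_facts(2)[of t] Q_pos[of t] by auto
  then show "F t \<noteq> 0" by (simp add: F_fun_def)
qed

lemma F_facts: "F t > 0" "(F t)\<^sup>2 = \<epsilon> * Q t / ((a t)\<^sup>2 * R t)"
proof -
  have "\<epsilon> * Q t / ((a t)\<^sup>2 * R t) > 0"
    using basics(1) basics(3,5)[of t] Q_pos[of t] by (intro divide_pos_pos mult_pos_pos) auto
  then show "F t > 0" "(F t)\<^sup>2 = \<epsilon> * Q t / ((a t)\<^sup>2 * R t)" by (simp_all add: F_fun_def)
qed

lemma F_deriv: "(F has_real_derivative F t * h t) (at t)"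
proof -
  let ?E = "\<lambda>t. \<epsilon> * Q t / ((a t)\<^sup>2 * R t)"
  have dQ: "(Q has_real_derivative (c\<^sup>2 - 1) * (2 * a t * a1 t)) (at t)"
    unfolding Q_fun_def[abs_def] by (auto intro!: derivative_eq_intros a_deriv)
  have dR: "(R has_real_derivative - 2 * a1 t * (a t + a2 t)) (at t)"
    unfolding R_fun_def[abs_def] by (auto intro!: derivative_eq_intros a_deriv simp: algebra_simps)
  have da: "((\<lambda>t. (a t)\<^sup>2) has_real_derivative 2 * a t * a1 t) (at t)"
    by (auto intro!: derivative_eq_intros a_deriv)
  have dE: "(?E has_real_derivative ?E t * (2 * h t)) (at t)"
  proof (rule DERIV_cong[OF DERIV_divide[OF DERIV_cmult[OF dQ] DERIV_mult[OF da dR]]])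
    show "(a t)\<^sup>2 * R t \<noteq> 0" using nonzero by simp
    show "(\<epsilon> * ((c\<^sup>2 - 1) * (2 * a t * a1 t)) * ((a t)\<^sup>2 * R t) - \<epsilon> * Q t * (2 * a t * a1 t * R t + - 2 * a1 t * (a t + a2 t) * (a t)\<^sup>2)) /
        ((a t)\<^sup>2 * R t * ((a t)\<^sup>2 * R t)) = ?E t * (2 * h t)"
      using nonzero by (simp add: field_simps power2_eq_square)
  qed
  have F: "F t = sqrt (?E t)" "F = (\<lambda>t. sqrt (?E t))" by (auto simp: F_fun_def)
  have pos: "?E t > 0" using F_facts[of t] by (metis zero_less_power)
  have dS: "(sqrt has_real_derivative inverse (F t) / 2) (at (?E t))"
    unfolding F(1) by (rule DERIV_real_sqrt[OF pos])
  have "((\<lambda>t. sqrt (?E t)) has_real_derivative inverse (F t) / 2 * (?E t * (2 * h t))) (at t)"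
    by (rule DERIV_chain2[OF dS dE])
  moreover have "inverse (F t) / 2 * (?E t * (2 * h t)) = F t * h t"
    unfolding F_facts(2)[symmetric] using nonzero(6)[of t] by (simp add: power2_eq_square field_simps)
  ultimately show ?thesis unfolding F(2)[symmetric] by (simp only:)
qed

lemma b_deriv: "(b has_real_derivative b1 t) (at t)" "(b1 has_real_derivative b2 t) (at t)"
proof -
  show 1: "(b has_real_derivative b1 t) (at t)" for t
  proof -
    have e: "((\<lambda>t. 1 - (a t)\<^sup>2) has_real_derivative - 2 * a t * a1 t) (at t)"
      by (auto intro!: derivative_eq_intros a_deriv)
    have "(sqrt has_real_derivative inverse (b t) / 2) (at (1 - (a t)\<^sup>2))"
      unfolding co_magnitude_def by (rule DERIV_real_sqrt[OF b_facts(3)])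
    from DERIV_chain2[OF this e] have "((\<lambda>t. sqrt (1 - (a t)\<^sup>2)) has_real_derivative b1 t) (at t)"
      by (rule DERIV_cong) (simp add: field_simps)
    then show ?thesis by (simp only: co_magnitude_def[abs_def])
  qed
  have "((\<lambda>t. - a t * a1 t) has_real_derivative - ((a1 t)\<^sup>2 + a t * a2 t)) (at t)"
    by (auto intro!: derivative_eq_intros a_deriv simp: power2_eq_square)
  from DERIV_divide[OF this 1 nonzero(2)] show "(b1 has_real_derivative b2 t) (at t)"
    by (rule DERIV_cong) (use nonzero(2)[of t] in \<open>simp add: field_simps power2_eq_square\<close>)
qed

lemma p_deriv:
  "(p1 has_real_derivative - p1 t * (h t + 2 * a1 t / a t)) (at t)"
  "(p2 has_real_derivative - p2 t * (h t + 2 * b1 t / b t)) (at t)"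
proof -
  have gen: "((\<lambda>t. K / (F t * (u t)\<^sup>2)) has_real_derivative - (K / (F t * (u t)\<^sup>2)) * (H + 2 * u' / u t)) (at t)"
    if u: "(u has_real_derivative u') (at t)" "u t \<noteq> 0" and F: "(F has_real_derivative F t * H) (at t)" for u u' K H
  proof -
    have "((\<lambda>t. F t * (u t)\<^sup>2) has_real_derivative F t * H * (u t)\<^sup>2 + (2 * u t * u') * F t) (at t)"
      by (rule DERIV_mult[OF F]) (auto intro!: derivative_eq_intros u)
    moreover have nz: "F t * (u t)\<^sup>2 \<noteq> 0" using u(2) nonzero(6)[of t] by simp
    ultimately have "((\<lambda>t. K / (F t * (u t)\<^sup>2)) has_real_derivative
        (0 * (F t * (u t)\<^sup>2) - K * (F t * H * (u t)\<^sup>2 + 2 * u t * u' * F t)) / (F t * (u t)\<^sup>2 * (F t * (u t)\<^sup>2))) (at t)"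
      by (intro DERIV_divide DERIV_const)
    then show ?thesis
      by (rule DERIV_cong) (use u(2) nonzero(6)[of t] in \<open>simp add: field_simps power2_eq_square\<close>)
  qed
  show "(p1 has_real_derivative - p1 t * (h t + 2 * a1 t / a t)) (at t)"
    unfolding phase_rate1_def[abs_def] by (rule gen[OF a_deriv(1) nonzero(1) F_deriv])
  show "(p2 has_real_derivative - p2 t * (h t + 2 * b1 t / b t)) (at t)"
    unfolding phase_rate2_def[abs_def] by (rule gen[OF b_deriv(1) nonzero(2) F_deriv])
qed

lemma p_squares:
  "(a t)\<^sup>2 * (p1 t)\<^sup>2 = R t / Q t" "(b t)\<^sup>2 * (p2 t)\<^sup>2 = c\<^sup>2 * (a t)\<^sup>2 * R t / (Q t * (b t)\<^sup>2)"
  unfolding phase_rate1_def phase_rate2_def power_divide power_mult_distrib F_facts(2) basics(2)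
  using basics(1) nonzero by (simp_all add: field_simps power2_eq_square)

text \<open>As \<open>Q = b^2 + c^2 a^2\<close>, the angular parts add up to \<open>R / b^2\<close>;
  by \<open>a^2 + b^2 = 1\<close> the radial parts add up to \<open>a1^2 / b^2\<close>. The
  definition of R is exactly \<open>a1^2 + R = b^2\<close>.\<close>

lemma speed: "(a1 t)\<^sup>2 + (a t)\<^sup>2 * (p1 t)\<^sup>2 + ((b1 t)\<^sup>2 + (b t)\<^sup>2 * (p2 t)\<^sup>2) = 1"
proof -
  have "R t / Q t + c\<^sup>2 * (a t)\<^sup>2 * R t / (Q t * (b t)\<^sup>2) = R t / (b t)\<^sup>2"
  proof -
    have "R t / Q t + c\<^sup>2 * (a t)\<^sup>2 * R t / (Q t * (b t)\<^sup>2) = R t * ((b t)\<^sup>2 + c\<^sup>2 * (a t)\<^sup>2) / (Q t * (b t)\<^sup>2)"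
      using nonzero by (simp add: field_simps)
    then show ?thesis using nonzero(3)[of t] by (simp add: Q_eq[symmetric])
  qed
  moreover have "(a1 t)\<^sup>2 + (b1 t)\<^sup>2 = (a1 t)\<^sup>2 / (b t)\<^sup>2"
  proof -
    have "(a1 t)\<^sup>2 + (b1 t)\<^sup>2 = (a1 t)\<^sup>2 * ((b t)\<^sup>2 + (a t)\<^sup>2) / (b t)\<^sup>2"
      using nonzero(2)[of t] by (simp add: field_simps power2_eq_square)
    then show ?thesis by (simp add: b_facts(1))
  qed
  moreover have "(a1 t)\<^sup>2 / (b t)\<^sup>2 + R t / (b t)\<^sup>2 = 1"
  proof -
    have "(a1 t)\<^sup>2 + R t = (b t)\<^sup>2" unfolding R_fun_def b_facts(1) by simp
    then show ?thesis using nonzero(2)[of t] by (simp only: add_divide_distrib[symmetric]) simp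
  qed
  ultimately have "((a1 t)\<^sup>2 + (b1 t)\<^sup>2) + (R t / Q t + c\<^sup>2 * (a t)\<^sup>2 * R t / (Q t * (b t)\<^sup>2)) = 1"
    by (simp only:)
  then show ?thesis unfolding p_squares by (simp only: ac_simps)
qed

text \<open>The equation is linear in T with coefficient \<open>b^2 a\<close>, which is not zero,
  and T is its solution. Naming the fractions in T by X and Z turns the claim into a polynomial
  identity.\<close>

lemma magnitude_equation1: "a2 t - a t * (p1 t)\<^sup>2 + h t * a1 t + (1 + (b t)\<^sup>2 * T t) * a t = 0"
proof -
  have ap: "a t * (p1 t)\<^sup>2 = R t / (a t * Q t)"
    using p_squares(1)[of t] nonzero by (simp add: field_simps power2_eq_square)
  define A A1 A2 C q r where "A = a t" and "A1 = a1 t" and "A2 = a2 t" and "C = c\<^sup>2 - 1" and "q = Q t" and "r = R t"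
  have nz: "A \<noteq> 0" "q \<noteq> 0" "r \<noteq> 0" using nonzero by (auto simp: A_def q_def r_def)
  have q: "q = 1 + C * A\<^sup>2" and r: "r = 1 - A\<^sup>2 - A1\<^sup>2"
    by (simp_all add: q_def r_def C_def A_def A1_def Q_fun_def R_fun_def)
  define X where "X = (A + A2) / r"
  define Z where "Z = 1 / (A * q)"
  have X: "r * X = A + A2" and Z: "A * q * Z = 1" using nz by (auto simp: X_def Z_def)
  have "A2 - r * Z + (C * A\<^sup>2 * A1 * Z - A1 * (q * Z) + A1 * X) * A1 + A + (1 - A\<^sup>2) * (Z - X) = 0"
  proof -
    have "A2 - r * Z + (C * A\<^sup>2 * A1 * Z - A1 * (q * Z) + A1 * X) * A1 + A + (1 - A\<^sup>2) * (Z - X)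
      = (A + A2 - (1 - A\<^sup>2 - A1\<^sup>2) * X) + Z * (C * A\<^sup>2 * A1\<^sup>2 - A1\<^sup>2 * q + (1 - A\<^sup>2) - r)"
      by (simp add: power2_eq_square algebra_simps)
    also have "\<dots> = 0" using X by (simp add: q r power2_eq_square algebra_simps)
    finally show ?thesis .
  qed
  moreover have "r / (A * q) = r * Z" "C * A * A1 / q = C * A\<^sup>2 * A1 * Z" "A1 / A = A1 * (q * Z)" "A1 * (A + A2) / r = A1 * X"
    "(1 / (A\<^sup>2 * q) - (A + A2) / (A * r)) * A = Z - X"
    using nz by (simp_all add: X_def Z_def field_simps power2_eq_square)
  ultimately have "A2 - r / (A * q) + (C * A * A1 / q - A1 / A + A1 * (A + A2) / r) * A1
      + (1 + (1 - A\<^sup>2) * (1 / (A\<^sup>2 * q) - (A + A2) / (A * r))) * A = 0"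
    by (simp add: distrib_right mult.assoc)
  then show ?thesis
    unfolding ap b_facts(1) T_fun_def by (simp add: A_def A1_def A2_def C_def q_def r_def)
qed

text \<open>Multiplied by b, the second radial equation is a combination of the first one, of the
  second derivative of \<open>a^2 + b^2 = 1\<close>, and of the unit speed identity.\<close>

lemma magnitude_equation2: "b2 t - b t * (p2 t)\<^sup>2 + h t * b1 t + (1 - (a t)\<^sup>2 * T t) * b t = 0"
proof -
  define H where "H = h t"
  define B1 where "B1 = b1 t"
  have bB: "b t * B1 = - a t * a1 t" using nonzero(2)[of t] by (simp add: B1_def)
  have bb2: "b t * b2 t = - ((a1 t)\<^sup>2 + a t * a2 t + B1\<^sup>2)" using nonzero(2)[of t] by (simp add: B1_def)
  have e1: "a2 t - a t * (p1 t)\<^sup>2 + H * a1 t + (1 + (b t)\<^sup>2 * T t) * a t = 0"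
    unfolding H_def by (rule magnitude_equation1)
  have sp: "(a1 t)\<^sup>2 + (a t)\<^sup>2 * (p1 t)\<^sup>2 + (B1\<^sup>2 + (b t)\<^sup>2 * (p2 t)\<^sup>2) = 1"
    unfolding B1_def by (rule speed)
  have "b t * (b2 t - b t * (p2 t)\<^sup>2 + H * B1 + (1 - (a t)\<^sup>2 * T t) * b t)
     = b t * b2 t - (b t)\<^sup>2 * (p2 t)\<^sup>2 + H * (b t * B1) + (b t)\<^sup>2 - (a t)\<^sup>2 * (b t)\<^sup>2 * T t"
    by (simp add: algebra_simps power2_eq_square)
  also have "\<dots> = - (a t) * (a2 t - a t * (p1 t)\<^sup>2 + H * a1 t + (1 + (b t)\<^sup>2 * T t) * a t)
      - ((a1 t)\<^sup>2 + (a t)\<^sup>2 * (p1 t)\<^sup>2 + (B1\<^sup>2 + (b t)\<^sup>2 * (p2 t)\<^sup>2)) + ((a t)\<^sup>2 + (b t)\<^sup>2)"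
    unfolding bb2 bB by (simp add: algebra_simps power2_eq_square)
  also have "\<dots> = 0" unfolding e1 sp unfolding b_facts(1) by simp
  finally show ?thesis using nonzero(2)[of t] unfolding H_def B1_def by simp
qed

lemma warp_log_derivative: "k1 * l1' t / warp1 D t + k2 * l2' t / warp2 D t = h t"
proof -
  note p = basics(7,8)[of t]
  have pw: "((\<lambda>t. w t ^ k) has_real_derivative w t ^ k * (k * w' / w t)) (at t)"
    if "(w has_real_derivative w') (at t)" "w t > 0" for w w' k
  proof (rule DERIV_cong[OF DERIV_power[OF that(1)]])
    show "real k * (w' * w t ^ (k - Suc 0)) = w t ^ k * (k * w' / w t)"
      using that(2) by (cases k) auto
  qed
  have "(\<lambda>t. warp1 D t ^ k1 * warp2 D t ^ k2) = F" by (rule ext) (rule basics(9))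
  moreover have "((\<lambda>t. warp1 D t ^ k1 * warp2 D t ^ k2) has_real_derivative
      F t * (k1 * l1' t / warp1 D t + k2 * l2' t / warp2 D t)) (at t)"
    by (rule DERIV_cong[OF DERIV_mult[OF pw[OF l_deriv(1) p(1)] pw[OF l_deriv(2) p(2)]]])
      (simp add: basics(9)[symmetric] algebra_simps)
  ultimately have "(F has_real_derivative F t * (k1 * l1' t / warp1 D t + k2 * l2' t / warp2 D t)) (at t)"
    by (simp only:)
  from DERIV_unique[OF this F_deriv]
  have "F t * (k1 * l1' t / warp1 D t + k2 * l2' t / warp2 D t) = F t * h t" .
  then show ?thesis using nonzero(6)[of t] by simp
qed

definition z1 :: "real \<Rightarrow> complex" where "z1 t = of_real (a t) * cis (phase1 D t)"
definition z2 :: "real \<Rightarrow> complex" where "z2 t = of_real (b t) * cis (phase2 D t)"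
definition z1' :: "real \<Rightarrow> complex" where "z1' t = Complex (a1 t) (a t * p1 t) * cis (phase1 D t)"
definition z2' :: "real \<Rightarrow> complex" where "z2' t = Complex (b1 t) (b t * p2 t) * cis (phase2 D t)"
definition z1'' :: "real \<Rightarrow> complex" where
  "z1'' t = Complex (a2 t - a t * (p1 t)\<^sup>2) (- a t * p1 t * h t) * cis (phase1 D t)"
definition z2'' :: "real \<Rightarrow> complex" where
  "z2'' t = Complex (b2 t - b t * (p2 t)\<^sup>2) (- b t * p2 t * h t) * cis (phase2 D t)"

lemma z_deriv:
  "(z1 has_vector_derivative z1' t) (at t)" "(z2 has_vector_derivative z2' t) (at t)"
  "(z1' has_vector_derivative z1'' t) (at t)" "(z2' has_vector_derivative z2'' t) (at t)"
  unfolding z1_def[abs_def] z2_def[abs_def] z1'_def[abs_def] z2'_def[abs_def] z1''_def z2''_def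
  by (rule polar_derivatives[OF a_deriv basics(11) p_deriv(1) nonzero(1)]
    polar_derivatives[OF b_deriv basics(12) p_deriv(2) nonzero(2)])+

lemma z_norm:
  "(cmod (z1 t))\<^sup>2 = (a t)\<^sup>2" "(cmod (z2 t))\<^sup>2 = (b t)\<^sup>2" "(cmod (z1' t))\<^sup>2 + (cmod (z2' t))\<^sup>2 = 1"
proof -
  show "(cmod (z1 t))\<^sup>2 = (a t)\<^sup>2" "(cmod (z2 t))\<^sup>2 = (b t)\<^sup>2"
    by (simp_all add: z1_def z2_def norm_mult)
  have "(cmod (Complex x y * cis s))\<^sup>2 = x\<^sup>2 + y\<^sup>2" for x y s by (simp add: norm_mult cmod_power2)
  then show "(cmod (z1' t))\<^sup>2 + (cmod (z2' t))\<^sup>2 = 1"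
    using speed[of t] unfolding z1'_def z2'_def by (simp add: power_mult_distrib)
qed

lemma profile_eq: "profile D t = (z1 t, z2 t)"
  by (simp add: profile_def z1_def z2_def)

lemma unit_speed: "unit_speed D"
  unfolding unit_speed_def
proof (intro allI exI conjI)
  fix t
  show "(profile D has_vector_derivative (z1' t, z2' t)) (at t)"
    using has_vector_derivative_Pair[OF z_deriv(1,2)] by (simp add: profile_eq[abs_def])
  show "norm (z1' t, z2' t) = 1" by (simp add: norm_Pair z_norm(3))
qed

text \<open>Using \<open>a^2 + b^2 = 1\<close>, the energy density minus either eigenvalue term
  depends on the warps only through their difference T. The friction coefficient is h because the
  product of powers of the warps is F, so the two radial equations finish the computation.\<close>

lemma tension_equation:
  assumes "e = 1 + (a t)\<^sup>2 / (warp1 D t)\<^sup>2 * d1 + (b t)\<^sup>2 / (warp2 D t)\<^sup>2 * d2"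
  shows "z1'' t + (k1 * l1' t / warp1 D t + k2 * l2' t / warp2 D t) *\<^sub>R z1' t + (e - d1 / (warp1 D t)\<^sup>2) *\<^sub>R z1 t = 0"
    and "z2'' t + (k1 * l1' t / warp1 D t + k2 * l2' t / warp2 D t) *\<^sub>R z2' t + (e - d2 / (warp2 D t)\<^sup>2) *\<^sub>R z2 t = 0"
proof -
  define m1 where "m1 = d1 / (warp1 D t)\<^sup>2"
  define m2 where "m2 = d2 / (warp2 D t)\<^sup>2"
  have T: "T t = m2 - m1" unfolding m1_def m2_def basics(10)[of t] ..
  have e: "e = 1 + (1 - (b t)\<^sup>2) * m1 + (b t)\<^sup>2 * m2" "e = 1 + (a t)\<^sup>2 * m1 + (1 - (a t)\<^sup>2) * m2"
    using assms b_facts(1)[of t] by (simp_all add: m1_def m2_def)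
  have e1: "e - m1 = 1 + (b t)\<^sup>2 * T t" unfolding e(1) T by (simp add: algebra_simps)
  have e2: "e - m2 = 1 - (a t)\<^sup>2 * T t" unfolding e(2) T by (simp add: algebra_simps)
  have gen: "Complex (u2 - u * p\<^sup>2) (- u * p * H) * w + H *\<^sub>R (Complex u1 (u * p) * w) + E *\<^sub>R (of_real u * w) = 0"
    if "u2 - u * p\<^sup>2 + H * u1 + E * u = 0" for u u1 u2 p H E :: real and w
  proof -
    have "Complex (u2 - u * p\<^sup>2) (- u * p * H) * w + H *\<^sub>R (Complex u1 (u * p) * w) + E *\<^sub>R (of_real u * w)
       = of_real (u2 - u * p\<^sup>2 + H * u1 + E * u) * w"
      by (simp add: complex_eq_iff algebra_simps)
    then show ?thesis using that by simp
  qed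
  show "z1'' t + (k1 * l1' t / warp1 D t + k2 * l2' t / warp2 D t) *\<^sub>R z1' t + (e - d1 / (warp1 D t)\<^sup>2) *\<^sub>R z1 t = 0"
    unfolding warp_log_derivative m1_def[symmetric] e1 unfolding z1_def z1'_def z1''_def
    by (rule gen[OF magnitude_equation1])
  show "z2'' t + (k1 * l1' t / warp1 D t + k2 * l2' t / warp2 D t) *\<^sub>R z2' t + (e - d2 / (warp2 D t)\<^sup>2) *\<^sub>R z2 t = 0"
    unfolding warp_log_derivative m2_def[symmetric] e2 unfolding z2_def z2'_def z2''_def
    by (rule gen[OF magnitude_equation2])
qed

text \<open>F contains the derivative of a, so the phase velocities are only of class 1; integrating
  them brings the phases back to class 2.\<close>

lemma z_Ck: "Ck_on 2 z1 UNIV" "Ck_on 2 z2 UNIV"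
proof -
  have a12: "Ck_on 1 a UNIV" "Ck_on 2 a UNIV" using a_Ck(2) Ck_on_mono[of 1 2] by auto
  have Q: "Ck_on 1 Q UNIV" and R: "Ck_on 1 R UNIV"
    unfolding Q_fun_def[abs_def] R_fun_def[abs_def] by (intro Ck_intros a12 a_Ck open_UNIV)+
  have E: "\<epsilon> * Q t / ((a t)\<^sup>2 * R t) > 0" for t using F_facts[of t] by (metis zero_less_power)
  have F: "Ck_on 1 F UNIV"
    unfolding F_fun_def[abs_def] by (intro Ck_intros Q R a12 open_UNIV E) (simp add: nonzero)
  have b: "Ck_on n b UNIV" if "Ck_on n a UNIV" for n
    unfolding co_magnitude_def[abs_def] by (intro Ck_intros that open_UNIV b_facts(3))
  have p: "Ck_on 1 p1 UNIV" "Ck_on 1 p2 UNIV"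
    unfolding phase_rate1_def[abs_def] phase_rate2_def[abs_def]
    by (intro Ck_intros F a12 b open_UNIV; simp add: nonzero)+
  have s: "Ck_on 2 (phase1 D) UNIV" "Ck_on 2 (phase2 D) UNIV"
    using Ck_on_SucI_DERIV[OF open_UNIV basics(11) p(1)] Ck_on_SucI_DERIV[OF open_UNIV basics(12) p(2)]
    by (simp_all add: numeral_2_eq_2)
  show "Ck_on 2 z1 UNIV" "Ck_on 2 z2 UNIV"
    unfolding z1_def[abs_def] z2_def[abs_def]
    by (intro Ck_on_mult Ck_on_of_real Ck_on_cis open_UNIV a12 b s)+
qed

end

section \<open>From the profile equations to harmonicity in product charts\<close>

lemma cimg_warped_chart: "cimg (warped_chart l1 l2 C1 C2) = UNIV \<times> cimg C1 \<times> cimg C2"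
  by (force simp: cimg_def warped_chart_def)

lemma riemannian_chart_inverse:
  assumes "riemannian_chart C"
  shows "x \<in> cdom C \<Longrightarrow> cpar C (cmap C x) = x" "p \<in> cimg C \<Longrightarrow> cpar C p \<in> cdom C" "p \<in> cimg C \<Longrightarrow> cmap C (cpar C p) = p"
  using assms unfolding riemannian_chart_def homeomorphism_def by auto

lemma cpar_warped_chart:
  assumes "riemannian_chart C1" "riemannian_chart C2" "p \<in> cimg C1" "q \<in> cimg C2"
  shows "cpar (warped_chart l1 l2 C1 C2) (t, p, q) = (t, cpar C1 p, cpar C2 q)"
proof -
  let ?f = "\<lambda>(t, x, y). (t, cmap C1 x, cmap C2 y)" and ?A = "UNIV \<times> cdom C1 \<times> cdom C2"
  have inj: "inj_on ?f ?A"
    using riemannian_chart_inverse(1)[OF assms(1)] riemannian_chart_inverse(1)[OF assms(2)]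
    by (auto intro!: inj_onI) metis+
  have "inv_into ?A ?f (?f (t, cpar C1 p, cpar C2 q)) = (t, cpar C1 p, cpar C2 q)"
    using riemannian_chart_inverse(2)[OF assms(1,3)] riemannian_chart_inverse(2)[OF assms(2,4)]
    by (intro inv_into_f_f[OF inj]) auto
  then show ?thesis
    using riemannian_chart_inverse(3)[OF assms(1,3)] riemannian_chart_inverse(3)[OF assms(2,4)]
    unfolding cpar_def[of "warped_chart l1 l2 C1 C2"] by (simp add: warped_chart_def)
qed

lemma riemannian_chart_metric_field:
  assumes "riemannian_chart C"
  shows "metric_field (cmet C) (cimg C)"
  using assms by (auto simp: metric_field_def inner_form_def riemannian_chart_def smooth_on_def)

lemma harmonic_reconstructionI:
  fixes A1 :: "('m1::{t2_space, second_countable_topology}, 'e1::euclidean_space) rchart set"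
    and A2 :: "('m2::{t2_space, second_countable_topology}, 'e2::euclidean_space) rchart set"
    and f1 :: "'m1 \<Rightarrow> complex ^ 'n1" and f2 :: "'m2 \<Rightarrow> complex ^ 'n2"
  assumes atlas: "riemannian_atlas A1" "riemannian_atlas A2"
    and eigen: "eigenmap A1 f1 d1" "eigenmap A2 f2 d2"
    and rec: "is_reconstruction DIM('e1) DIM('e2) d1 d2 D"
    and l: "\<And>t. (warp1 D has_real_derivative l1' t) (at t)" "\<And>t. (warp2 D has_real_derivative l2' t) (at t)"
  shows "harmonic_reconstruction A1 A2 f1 f2 d1 d2 D"
proof -
  interpret reconstruction "DIM('e1)" "DIM('e2)" d1 d2 D l1' l2'
    by unfold_locales (rule rec l)+
  let ?\<Psi> = "recon_map D f1 f2"
  have map: "?\<Psi> (t, x, y) = (z1 t *s f1 x, z2 t *s f2 y)" for t x y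
    by (simp add: recon_map_def profile_eq)
  have norm1: "norm (f1 x) = 1" "norm (f2 y) = 1" for x y using eigen by (auto simp: eigenmap_def)
  have n\<Psi>: "norm (?\<Psi> w) = 1" for w
  proof -
    obtain t x y where w: "w = (t, x, y)" by (cases w)
    have "(cmod (z1 t))\<^sup>2 + (cmod (z2 t))\<^sup>2 = 1" unfolding z_norm b_facts(1) by simp
    then show ?thesis by (simp add: w map norm_Pair norm_vector_scalar_mult norm1)
  qed
  have chart: "Ck_on 2 (?\<Psi> \<circ> cpar C) (cimg C) \<and> (\<forall>w\<in>cimg C. sphere_tension (cmet C) (?\<Psi> \<circ> cpar C) w = 0)"
    if C: "C \<in> warped_atlas (warp1 D) (warp2 D) A1 A2" for C
  proof -
    obtain C1 C2 where C12: "C1 \<in> A1" "C2 \<in> A2" and Ceq: "C = warped_chart (warp1 D) (warp2 D) C1 C2"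
      using C by (auto simp: warped_atlas_def)
    have rc: "riemannian_chart C1" "riemannian_chart C2" using atlas C12 by (auto simp: riemannian_atlas_def)
    note mf = riemannian_chart_metric_field[OF rc(1)] riemannian_chart_metric_field[OF rc(2)]
    let ?F1 = "f1 \<circ> cpar C1" and ?F2 = "f2 \<circ> cpar C2"
    have F: "Ck_on 2 ?F1 (cimg C1)" "Ck_on 2 ?F2 (cimg C2)"
      using eigen C12 by (auto simp: eigenmap_def smooth_on_def)
    have cm: "cmet C = (\<lambda>(t, p, q) (\<tau>, u, v) (\<tau>', u', v').
        \<tau> * \<tau>' + (warp1 D t)\<^sup>2 * cmet C1 p u u' + (warp2 D t)\<^sup>2 * cmet C2 q v v')"
      by (simp add: Ceq warped_chart_def)
    have eq: "(?\<Psi> \<circ> cpar C) (t, p, q) = (z1 t *s ?F1 p, z2 t *s ?F2 q)" if "p \<in> cimg C1" "q \<in> cimg C2" for t p q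
      using cpar_warped_chart[OF rc that] by (simp add: Ceq map)
    interpret W: warped_geometry "cmet C1" "cimg C1" "cmet C2" "cimg C2" ?F1 ?F2 "warp1 D" "warp2 D" l1' l2'
      z1 z2 z1' z2' z1'' z2'' "cmet C" "?\<Psi> \<circ> cpar C"
      by unfold_locales (rule mf F basics(7,8) l z_deriv cm eq; assumption?)+
    have img: "cimg C = UNIV \<times> cimg C1 \<times> cimg C2" by (simp add: Ceq cimg_warped_chart)
    have "Ck_on 2 (\<lambda>P. (z1 (fst P) *s ?F1 (fst (snd P)), z2 (fst P) *s ?F2 (snd (snd P)))) (cimg C)"
      unfolding img
      by (intro Ck_on_Pair Ck_on_bilinear[OF bilinear_vector_scalar_mult] W.open_S
        Ck_on_compose[OF W.open_S open_UNIV _ z_Ck(1)] Ck_on_compose[OF W.open_S open_UNIV _ z_Ck(2)]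
        Ck_on_compose[OF W.open_S metric_fieldD(1)[OF mf(1)] _ F(1)] Ck_on_compose[OF W.open_S metric_fieldD(1)[OF mf(2)] _ F(2)]
        Ck_on_fst Ck_on_snd Ck_on_ident) auto
    then have "Ck_on 2 (?\<Psi> \<circ> cpar C) (cimg C)"
      unfolding img by (subst Ck_on_cong[OF W.open_S]) (auto simp: eq simp del: comp_apply)
    moreover have "sphere_tension (cmet C) (?\<Psi> \<circ> cpar C) w = 0" if "w \<in> cimg C" for w
    proof -
      obtain t p q where w: "w = (t, p, q)" "p \<in> cimg C1" "q \<in> cimg C2" using \<open>w \<in> cimg C\<close> unfolding img by auto
      have lap: "laplacian (cmet C1) ?F1 p = - d1 *\<^sub>R ?F1 p" "laplacian (cmet C2) ?F2 q = - d2 *\<^sub>R ?F2 q"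
        "differential_norm2 (cmet C1) ?F1 p = d1" "differential_norm2 (cmet C2) ?F2 q = d2"
        using eigen C12 w by (auto simp: eigenmap_def)
      have nF: "norm (?F1 p) = 1" "norm (?F2 q) = 1" by (simp_all add: norm1)
      define e where "e = differential_norm2 (cmet C) (?\<Psi> \<circ> cpar C) (t, p, q)"
      have e: "e = 1 + (a t)\<^sup>2 / (warp1 D t)\<^sup>2 * d1 + (b t)\<^sup>2 / (warp2 D t)\<^sup>2 * d2"
        unfolding e_def W.differential_norm2_\<Phi>[OF w(2,3) nF] lap z_norm ..
      have gen: "z'' *s F + H *\<^sub>R (z' *s F) + (1 / l\<^sup>2) *\<^sub>R (z *s (- d *\<^sub>R F)) + e *\<^sub>R (z *s F) = 0"
        if "z'' + H *\<^sub>R z' + (e - d / l\<^sup>2) *\<^sub>R z = 0" for z z' z'' :: complex and F :: "complex ^ 'n" and H l d :: real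
      proof -
        have "z'' *s F + H *\<^sub>R (z' *s F) + (1 / l\<^sup>2) *\<^sub>R (z *s (- d *\<^sub>R F)) + e *\<^sub>R (z *s F)
          = (z'' + H *\<^sub>R z' + (e - d / l\<^sup>2) *\<^sub>R z) *s F"
          unfolding vec_eq_iff vector_add_component vector_scaleR_component vector_smult_component
          by (simp add: scaleR_conv_of_real algebra_simps)
        then show ?thesis using that by simp
      qed
      show ?thesis
        unfolding sphere_tension_def w(1) e_def[symmetric] W.laplacian_\<Phi>[OF w(2,3)] eq[OF w(2,3)] lap
        using gen[OF tension_equation(1)[OF e], of "?F1 p"] gen[OF tension_equation(2)[OF e], of "?F2 q"]
        by (simp only: add_Pair scaleR_Pair zero_prod_def)
    qed
    ultimately show ?thesis by blast
  qed
  show ?thesis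
    unfolding harmonic_reconstruction_def harmonic_into_sphere_def
    using rec unit_speed n\<Psi> chart by blast
qed

section \<open>Periodic Hoelder spaces\<close>

lemma Ck_on_deriv_funpow:
  fixes f :: "real \<Rightarrow> real"
  assumes "Ck_on r f UNIV" "j \<le> r"
  shows "Ck_on (r - j) ((deriv ^^ j) f) UNIV"
  using assms(2)
proof (induction j)
  case (Suc j)
  then have "Ck_on (Suc (r - Suc j)) ((deriv ^^ j) f) UNIV" by (simp add: Suc_diff_Suc)
  then show ?case using Ck_on_Suc_DERIV(2)[OF open_UNIV] by simp
qed (use assms(1) in simp)

lemma periodic_deriv_funpow:
  fixes f :: "real \<Rightarrow> real"
  assumes "Ck_on r f UNIV" "periodic P f" "j \<le> r"
  shows "periodic P ((deriv ^^ j) f)"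
  using assms(3)
proof (induction j)
  case (Suc j)
  then have "Ck_on (Suc (r - Suc j)) ((deriv ^^ j) f) UNIV"
    using Ck_on_deriv_funpow[OF assms(1), of j] by (simp add: Suc_diff_Suc)
  from Ck_on_Suc_DERIV(1)[OF open_UNIV this] show ?case
    using periodic_deriv[of P "(deriv ^^ j) f" "(deriv ^^ Suc j) f"] Suc by simp
qed (use assms(2) in simp)

lemma DERIV_bound_imp_Lipschitz:
  fixes f :: "real \<Rightarrow> real"
  assumes "\<And>t. (f has_real_derivative f' t) (at t)" "\<And>t. \<bar>f' t\<bar> \<le> B"
  shows "\<bar>f s - f t\<bar> \<le> B * \<bar>s - t\<bar>"
  using field_differentiable_bound[of UNIV f f' B s t] assms by simp

lemma holder_norm_0: "holder_norm 0 \<alpha> f = (SUP t. \<bar>f t\<bar>) + Sup (holder_quotients \<alpha> f)"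
  by (simp add: holder_norm_def)

lemma holder_norm_2:
  "holder_norm 2 \<alpha> f = (SUP t. \<bar>f t\<bar>) + (SUP t. \<bar>deriv f t\<bar>) + (SUP t. \<bar>deriv (deriv f) t\<bar>)
     + Sup (holder_quotients \<alpha> (deriv (deriv f)))"
  by (simp add: holder_norm_def numeral_2_eq_2)

lemma holder_per_bounds:
  assumes P: "P > 0" and f: "f \<in> holder_per P r \<alpha>"
  shows "j \<le> r \<Longrightarrow> \<bar>(deriv ^^ j) f t\<bar> \<le> holder_norm r \<alpha> f"
    and "\<bar>(deriv ^^ r) f s - (deriv ^^ r) f t\<bar> \<le> holder_norm r \<alpha> f * \<bar>s - t\<bar> powr \<alpha>"
    and "0 \<le> holder_norm r \<alpha> f"
proof -
  have C: "Ck_on r f UNIV" "periodic P f" and Q: "bdd_above (holder_quotients \<alpha> ((deriv ^^ r) f))"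
    using f by (auto simp: holder_per_def)
  let ?S = "\<lambda>j. SUP t. \<bar>(deriv ^^ j) f t\<bar>" and ?Q = "Sup (holder_quotients \<alpha> ((deriv ^^ r) f))"
  have S: "\<bar>(deriv ^^ j) f t\<bar> \<le> ?S j" if j: "j \<le> r" for j t
  proof -
    obtain B where "\<And>t. \<bar>(deriv ^^ j) f t\<bar> \<le> B"
      using periodic_bounded[OF P periodic_deriv_funpow[OF C j] Ck_on_continuous[OF Ck_on_deriv_funpow[OF C(1) j]]]
      by blast
    then show ?thesis by (intro cSUP_upper) (auto intro!: bdd_aboveI)
  qed
  have Q1: "\<bar>(deriv ^^ r) f s - (deriv ^^ r) f t\<bar> / \<bar>s - t\<bar> powr \<alpha> \<le> ?Q" if "s \<noteq> t" for s t
    by (intro cSup_upper Q) (use that in \<open>auto simp: holder_quotients_def\<close>)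
  have Q0: "?Q \<ge> 0" by (rule order_trans[OF _ Q1[of 0 1]]) auto
  have S0: "?S j \<ge> 0" if "j \<le> r" for j using S[OF that, of 0] by linarith
  have sum: "?S j \<le> (\<Sum>j\<le>r. ?S j)" if "j \<le> r" for j
    using that S0 by (intro member_le_sum) auto
  have n: "holder_norm r \<alpha> f = (\<Sum>j\<le>r. ?S j) + ?Q" by (simp add: holder_norm_def)
  have s0: "(\<Sum>j\<le>r. ?S j) \<ge> 0" using S0 by (intro sum_nonneg) auto
  show "j \<le> r \<Longrightarrow> \<bar>(deriv ^^ j) f t\<bar> \<le> holder_norm r \<alpha> f"
    using S[of j t] sum[of j] Q0 n by linarith
  show "0 \<le> holder_norm r \<alpha> f" using n s0 Q0 by linarith
  show "\<bar>(deriv ^^ r) f s - (deriv ^^ r) f t\<bar> \<le> holder_norm r \<alpha> f * \<bar>s - t\<bar> powr \<alpha>"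
  proof (cases "s = t")
    case False
    then have "\<bar>(deriv ^^ r) f s - (deriv ^^ r) f t\<bar> / \<bar>s - t\<bar> powr \<alpha> \<le> holder_norm r \<alpha> f"
      using Q1[OF False] n s0 by linarith
    then show ?thesis using False by (simp add: pos_divide_le_eq)
  qed simp
qed

lemma Sup_holder_quotients_le:
  fixes f :: "real \<Rightarrow> real"
  assumes "\<And>s t. \<bar>f s - f t\<bar> \<le> B * \<bar>s - t\<bar> powr \<alpha>"
  shows "Sup (holder_quotients \<alpha> f) \<le> B" "bdd_above (holder_quotients \<alpha> f)"
proof -
  have b: "y \<le> B" if "y \<in> holder_quotients \<alpha> f" for y
    using that assms by (auto simp: holder_quotients_def pos_divide_le_eq)
  have "\<bar>f 0 - f 1\<bar> / \<bar>0 - 1\<bar> powr \<alpha> \<in> holder_quotients \<alpha> f" unfolding holder_quotients_def by force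
  then show "Sup (holder_quotients \<alpha> f) \<le> B" using b by (intro cSup_least) auto
  show "bdd_above (holder_quotients \<alpha> f)" using b by (rule bdd_aboveI)
qed

lemma holder0I:
  fixes f :: "real \<Rightarrow> real"
  assumes "periodic P f" "continuous_on UNIV f" "\<And>t. \<bar>f t\<bar> \<le> A"
    and "\<And>s t. \<bar>f s - f t\<bar> \<le> B * \<bar>s - t\<bar> powr \<alpha>"
  shows "f \<in> holder_per P 0 \<alpha>" "holder_norm 0 \<alpha> f \<le> A + B"
proof -
  show "f \<in> holder_per P 0 \<alpha>"
    using assms(1,2) Sup_holder_quotients_le(2)[of f B \<alpha>, OF assms(4)] by (simp add: holder_per_def)
  have "(SUP t. \<bar>f t\<bar>) \<le> A" using assms(3) by (intro cSUP_least) auto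
  then show "holder_norm 0 \<alpha> f \<le> A + B"
    unfolding holder_norm_0 using Sup_holder_quotients_le(1)[of f B \<alpha>, OF assms(4)] by linarith
qed

lemma holder2I:
  fixes h :: "real \<Rightarrow> real"
  assumes "periodic P h" and h1: "\<And>t. (h has_real_derivative h1 t) (at t)"
    and h2: "\<And>t. (h1 has_real_derivative h2 t) (at t)" and c: "continuous_on UNIV h2"
    and b: "\<And>t. \<bar>h t\<bar> \<le> A0" "\<And>t. \<bar>h1 t\<bar> \<le> A1" "\<And>t. \<bar>h2 t\<bar> \<le> A2"
    and B: "\<And>s t. \<bar>h2 s - h2 t\<bar> \<le> B * \<bar>s - t\<bar> powr \<alpha>"
  shows "h \<in> holder_per P 2 \<alpha>" "holder_norm 2 \<alpha> h \<le> A0 + A1 + A2 + B"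
proof -
  have d: "deriv h = h1" "deriv h1 = h2" using h1 h2 by (auto intro!: ext DERIV_imp_deriv)
  have "Ck_on (Suc (Suc 0)) h UNIV"
    using c by (intro Ck_on_SucI_DERIV[OF open_UNIV h1] Ck_on_SucI_DERIV[OF open_UNIV h2]) auto
  then show "h \<in> holder_per P 2 \<alpha>"
    using assms(1) Sup_holder_quotients_le(2)[of h2 B \<alpha>, OF B] by (simp add: holder_per_def d numeral_2_eq_2)
  have "(SUP t. \<bar>h t\<bar>) \<le> A0" "(SUP t. \<bar>h1 t\<bar>) \<le> A1" "(SUP t. \<bar>h2 t\<bar>) \<le> A2"
    using b by (auto intro!: cSUP_least)
  then show "holder_norm 2 \<alpha> h \<le> A0 + A1 + A2 + B"
    unfolding holder_norm_2 d using Sup_holder_quotients_le(1)[of h2 B \<alpha>, OF B] by linarith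
qed

lemma holder2D:
  assumes P: "P > 0" and h: "h \<in> holder_per P 2 \<alpha>"
  shows "(h has_real_derivative deriv h t) (at t)" "(deriv h has_real_derivative deriv (deriv h) t) (at t)"
    and "continuous_on UNIV (deriv (deriv h))"
    and "periodic P h" "periodic P (deriv h)" "periodic P (deriv (deriv h))"
    and "\<bar>h t\<bar> \<le> holder_norm 2 \<alpha> h" "\<bar>deriv h t\<bar> \<le> holder_norm 2 \<alpha> h" "\<bar>deriv (deriv h) t\<bar> \<le> holder_norm 2 \<alpha> h"
    and "\<bar>deriv (deriv h) s - deriv (deriv h) t\<bar> \<le> holder_norm 2 \<alpha> h * \<bar>s - t\<bar> powr \<alpha>"
proof -
  have C: "Ck_on (Suc (Suc 0)) h UNIV" and p: "periodic P h" using h by (auto simp: holder_per_def numeral_2_eq_2)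
  note 1 = Ck_on_Suc_DERIV[OF open_UNIV C]
  note 2 = Ck_on_Suc_DERIV[OF open_UNIV 1(2)]
  show d: "(h has_real_derivative deriv h t) (at t)" "(deriv h has_real_derivative deriv (deriv h) t) (at t)" for t
    using 1(1) 2(1) by auto
  show "continuous_on UNIV (deriv (deriv h))" using 2(2) by simp
  show "periodic P h" by (rule p)
  show p': "periodic P (deriv h)" by (rule periodic_deriv[OF p d(1)])
  show "periodic P (deriv (deriv h))" by (rule periodic_deriv[OF p' d(2)])
  note b = holder_per_bounds[OF P h]
  show "\<bar>h t\<bar> \<le> holder_norm 2 \<alpha> h" "\<bar>deriv h t\<bar> \<le> holder_norm 2 \<alpha> h" "\<bar>deriv (deriv h) t\<bar> \<le> holder_norm 2 \<alpha> h"
    "\<bar>deriv (deriv h) s - deriv (deriv h) t\<bar> \<le> holder_norm 2 \<alpha> h * \<bar>s - t\<bar> powr \<alpha>"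
    using b(1)[of 0 t] b(1)[of 1 t] b(1)[of 2 t] b(2)[of s t] by (simp_all add: numeral_2_eq_2)
qed

lemma holder0D:
  assumes P: "P > 0" and h: "h \<in> holder_per P 0 \<alpha>"
  shows "continuous_on UNIV h" "periodic P h" "\<bar>h t\<bar> \<le> holder_norm 0 \<alpha> h"
    and "\<bar>h s - h t\<bar> \<le> holder_norm 0 \<alpha> h * \<bar>s - t\<bar> powr \<alpha>"
  using h holder_per_bounds[OF P h] holder_per_bounds(1)[OF P h, of 0] by (auto simp: holder_per_def)

text \<open>At distance at most 1 one has
  \<open>\<bar>s - t\<bar> \<le> \<bar>s - t\<bar> powr \<alpha>\<close>; farther apart the power is
  at least 1 and the sup bound suffices.\<close>

lemma Lipschitz_imp_holder:
  fixes f :: "real \<Rightarrow> real"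
  assumes "0 < \<alpha>" "\<alpha> < 1" "\<And>t. \<bar>f t\<bar> \<le> A" "\<bar>f s - f t\<bar> \<le> B * \<bar>s - t\<bar>" "B \<ge> 0"
  shows "\<bar>f s - f t\<bar> \<le> (2 * A + B) * \<bar>s - t\<bar> powr \<alpha>"
proof (cases "\<bar>s - t\<bar> \<le> 1")
  case True
  have A0: "A \<ge> 0" using assms(3)[of 0] by linarith
  have "\<bar>s - t\<bar> \<le> \<bar>s - t\<bar> powr \<alpha>"
  proof (cases "s = t")
    case False
    then have "\<bar>s - t\<bar> powr 1 \<le> \<bar>s - t\<bar> powr \<alpha>" using True assms(2) by (intro powr_mono') auto
    then show ?thesis using False by simp
  qed simp
  then have "B * \<bar>s - t\<bar> \<le> B * \<bar>s - t\<bar> powr \<alpha>" using assms(5) by (rule mult_left_mono)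
  moreover have "0 \<le> (2 * A) * \<bar>s - t\<bar> powr \<alpha>" using A0 by simp
  ultimately show ?thesis using assms(4) by (simp only: distrib_right)
next
  case False
  have A0: "A \<ge> 0" using assms(3)[of 0] by linarith
  have 1: "1 \<le> \<bar>s - t\<bar> powr \<alpha>" using False assms(1) by (intro ge_one_powr_ge_zero) auto
  have "\<bar>f s - f t\<bar> \<le> 2 * A" using assms(3)[of s] assms(3)[of t] by linarith
  also have "\<dots> \<le> (2 * A + B) * 1" using assms(5) by simp
  also have "\<dots> \<le> (2 * A + B) * \<bar>s - t\<bar> powr \<alpha>" using 1 A0 assms(5) by (intro mult_left_mono) auto
  finally show ?thesis .
qed

lemma Lipschitz_holder0:
  fixes f :: "real \<Rightarrow> real"
  assumes "0 < \<alpha>" "\<alpha> < 1" "periodic P f" "\<And>t. \<bar>f t\<bar> \<le> A" "\<And>s t. \<bar>f s - f t\<bar> \<le> B * \<bar>s - t\<bar>" "B \<ge> 0"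
  shows "f \<in> holder_per P 0 \<alpha>" "holder_norm 0 \<alpha> f \<le> 3 * A + B"
proof -
  have "B-lipschitz_on UNIV f"
    by (rule lipschitz_onI) (use assms(5,6) in \<open>auto simp: dist_real_def\<close>)
  then have c: "continuous_on UNIV f" by (rule lipschitz_on_continuous_on)
  have l: "\<bar>f s - f t\<bar> \<le> (2 * A + B) * \<bar>s - t\<bar> powr \<alpha>" for s t
    by (rule Lipschitz_imp_holder[OF assms(1,2,4,5,6)])
  show "f \<in> holder_per P 0 \<alpha>" "holder_norm 0 \<alpha> f \<le> 3 * A + B"
    using holder0I[OF assms(3) c assms(4) l] by auto
qed

section \<open>Composition and Taylor estimates along curves\<close>

lemma has_vector_derivative_along_curve:
  assumes "(g has_vector_derivative v) (at t)" "(f has_derivative f') (at (g t))"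
  shows "((\<lambda>t. f (g t)) has_vector_derivative f' v) (at t)"
  using has_derivative_compose[OF assms(1)[unfolded has_vector_derivative_def] assms(2)]
    linear_cmul[OF has_derivative_linear[OF assms(2)]] by (simp add: has_vector_derivative_def)

lemma has_real_derivative_along_curve:
  fixes f :: "'a::real_normed_vector \<Rightarrow> real"
  assumes "(g has_vector_derivative v) (at t)" "(f has_derivative f') (at (g t))"
  shows "((\<lambda>t. f (g t)) has_real_derivative f' v) (at t)"
  unfolding real_vector_derivative
  by (rule has_vector_derivative_along_curve[OF assms])

lemma vector_derivative_bound_imp_Lipschitz:
  fixes f :: "real \<Rightarrow> 'a::real_normed_vector"
  assumes "\<And>t. (f has_vector_derivative f' t) (at t)" "\<And>t. norm (f' t) \<le> B"
  shows "norm (f s - f t) \<le> B * \<bar>s - t\<bar>"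
proof -
  have B: "B \<ge> 0" using assms(2)[of 0] norm_ge_zero order_trans by blast
  have "onorm (\<lambda>h. h *\<^sub>R f' t) \<le> B" for t
    by (rule onorm_bound[OF B]) (use mult_left_mono[OF assms(2)[of t] abs_ge_zero] in \<open>simp add: mult.commute\<close>)
  then show ?thesis
    using differentiable_bound[of UNIV f "\<lambda>t h. h *\<^sub>R f' t" B s t] assms(1) by (simp add: has_vector_derivative_def)
qed

text \<open>A perturbation that is small together with its derivative changes \<phi> along the curve
  by something small in the Lipschitz norm. The derivative of the difference is
  \<open>(F(z+H) - F(z)) (z' + H') + F(z) H'\<close>, and both terms are small.\<close>

lemma compose_close_along_curve:
  fixes \<phi> :: "'a::euclidean_space \<Rightarrow> 'b::real_normed_vector" and z z' :: "real \<Rightarrow> 'a"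
  assumes W: "open W" and \<phi>: "\<And>n. Ck_on n \<phi> W"
    and z: "\<And>t. (z has_vector_derivative z' t) (at t)" "\<And>t. norm (z' t) \<le> B"
    and K: "compact K" "K \<subseteq> W" "\<And>t. z t \<in> K" and e: "e > 0"
  obtains \<theta> where "\<theta> > 0" and "\<And>t v. norm v < \<theta> \<Longrightarrow> z t + v \<in> W \<and> norm (\<phi> (z t + v) - \<phi> (z t)) \<le> e"
    and "\<And>H H' s t. (\<And>t. (H has_vector_derivative H' t) (at t)) \<Longrightarrow> (\<And>t. norm (H t) < \<theta>) \<Longrightarrow> (\<And>t. norm (H' t) < \<theta>) \<Longrightarrow>
      norm ((\<phi> (z s + H s) - \<phi> (z s)) - (\<phi> (z t + H t) - \<phi> (z t))) \<le> e * \<bar>s - t\<bar>"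
proof -
  have B0: "B \<ge> 0" using z(2)[of 0] norm_ge_zero order_trans by blast
  \<comment> \<open>Half of e is spent on the oscillation of F times the speed, at most
    \<open>B + 1\<close>; the other half on \<open>C * \<theta>\<close>.\<close>
  define e' where "e' = e / (2 * (B + 1))"
  have e': "e' > 0" using e B0 by (simp add: e'_def)
  obtain F where F0: "\<And>x. x \<in> W \<Longrightarrow> (\<phi> has_derivative blinfun_apply (F x)) (at x)"
    and "\<And>x. x \<in> W \<Longrightarrow> blinfun_apply (F x) = fderiv \<phi> x" and F: "continuous_on W F"
    using Ck_on_Suc_blinfun[OF W \<phi>[of "Suc 0"]] by blast
  obtain C where C: "C > 0" "\<And>x. x \<in> K \<Longrightarrow> norm (F x) \<le> C"
  proof -
    have "bounded (F ` K)"
      using F K(1,2) continuous_on_subset compact_continuous_image compact_imp_bounded by metis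
    then show ?thesis using that unfolding bounded_pos by blast
  qed
  have "\<exists>d>0. \<forall>y\<in>K. \<forall>y'. dist y y' < d \<longrightarrow> y' \<in> W \<and> dist (F y') (F y) < e'"
    by (rule uniform_near_compact[OF W F K(1,2) e'])
  then obtain \<delta>1 where d1: "\<delta>1 > 0" "\<And>y y'. y \<in> K \<Longrightarrow> dist y y' < \<delta>1 \<Longrightarrow> y' \<in> W \<and> dist (F y') (F y) < e'" by metis
  have "\<exists>d>0. \<forall>y\<in>K. \<forall>y'. dist y y' < d \<longrightarrow> y' \<in> W \<and> dist (\<phi> y') (\<phi> y) < e"
    by (rule uniform_near_compact[OF W Ck_on_continuous[OF \<phi>[of 0]] K(1,2) e])
  then obtain \<delta>2 where d2: "\<delta>2 > 0" "\<And>y y'. y \<in> K \<Longrightarrow> dist y y' < \<delta>2 \<Longrightarrow> y' \<in> W \<and> dist (\<phi> y') (\<phi> y) < e" by metis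
  define \<theta> where "\<theta> = min (min \<delta>1 \<delta>2) (min 1 (e / (2 * C)))"
  have \<theta>: "\<theta> > 0" "\<theta> \<le> \<delta>1" "\<theta> \<le> \<delta>2" "\<theta> \<le> 1" "\<theta> \<le> e / (2 * C)"
    using d1 d2 e C by (auto simp: \<theta>_def)
  show ?thesis
  proof (rule that[OF \<theta>(1)])
    show "z t + v \<in> W \<and> norm (\<phi> (z t + v) - \<phi> (z t)) \<le> e" if "norm v < \<theta>" for t v
      using d2(2)[OF K(3), of t "z t + v"] that \<theta>(3) by (simp add: dist_norm)
    fix H H' :: "real \<Rightarrow> 'a" and s t
    assume H: "\<And>t. (H has_vector_derivative H' t) (at t)" "\<And>t. norm (H t) < \<theta>" "\<And>t. norm (H' t) < \<theta>"
    show "norm ((\<phi> (z s + H s) - \<phi> (z s)) - (\<phi> (z t + H t) - \<phi> (z t))) \<le> e * \<bar>s - t\<bar>"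
    proof (rule vector_derivative_bound_imp_Lipschitz)
      fix t
      have n: "z t + H t \<in> W" "norm (F (z t + H t) - F (z t)) \<le> e'" "z t \<in> W"
        using d1(2)[OF K(3), of t "z t + H t"] H(2)[of t] \<theta>(2) K by (auto simp: dist_norm)
      let ?d = "blinfun_apply (F (z t + H t)) (z' t + H' t) - blinfun_apply (F (z t)) (z' t)"
      show "((\<lambda>t. \<phi> (z t + H t) - \<phi> (z t)) has_vector_derivative ?d) (at t)"
        by (intro has_vector_derivative_diff has_vector_derivative_along_curve[OF has_vector_derivative_add[OF z(1) H(1)] F0[OF n(1)]]
            has_vector_derivative_along_curve[OF z(1) F0[OF n(3)]])
      have "?d = blinfun_apply (F (z t + H t) - F (z t)) (z' t + H' t) + blinfun_apply (F (z t)) (H' t)"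
        by (simp add: blinfun.diff_left blinfun.add_right)
      then have "norm ?d \<le> norm (F (z t + H t) - F (z t)) * norm (z' t + H' t) + norm (F (z t)) * norm (H' t)"
        by (metis norm_triangle_mono norm_blinfun)
      also have "\<dots> \<le> e' * (B + 1) + C * (e / (2 * C))"
      proof (intro add_mono mult_mono)
        show "norm (z' t + H' t) \<le> B + 1"
          using norm_triangle_ineq[of "z' t" "H' t"] z(2)[of t] H(3)[of t] \<theta>(4) by linarith
      qed (use n(2) e' C(1) C(2)[OF K(3)] H(3)[of t] \<theta>(5) in auto)
      also have "e' * (B + 1) = e / 2" using B0 by (simp add: e'_def field_simps)
      also have "C * (e / (2 * C)) = e / 2" using C(1) by simp
      also have "e / 2 + e / 2 = e" by simp
      finally show "norm ?d \<le> e" .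
    qed
  qed
qed

text \<open>The mean value theorem in the scaling parameter of the increment gives the Lipschitz bound of the
  Taylor remainder without using the symmetry of second derivatives.\<close>

lemma Taylor_remainder_along_curve:
  fixes \<phi> :: "'a::euclidean_space \<Rightarrow> real" and z z' :: "real \<Rightarrow> 'a"
  assumes W: "open W" and \<phi>: "\<And>n. Ck_on n \<phi> W"
    and z: "\<And>t. (z has_vector_derivative z' t) (at t)" "\<And>t. norm (z' t) \<le> B"
    and K: "compact K" "K \<subseteq> W" "\<And>t. z t \<in> K" and e: "e > 0"
  defines "rem \<equiv> \<lambda>H t. \<phi> (z t + H t) - \<phi> (z t) - fderiv \<phi> (z t) (H t)"
  shows "\<exists>\<theta>>0. \<forall>\<eta> H H'. \<eta> < \<theta> \<longrightarrow> (\<forall>t. (H has_vector_derivative H' t) (at t)) \<longrightarrow> (\<forall>t. norm (H t) \<le> \<eta> \<and> norm (H' t) \<le> \<eta>) \<longrightarrow>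
     (\<forall>s t. \<bar>rem H t\<bar> \<le> e * \<eta> \<and> \<bar>rem H s - rem H t\<bar> \<le> e * \<eta> * \<bar>s - t\<bar>)"
proof -
  \<comment> \<open>The gradient: as a single vector-valued map it falls under the preceding lemma,
    whose Lipschitz estimate is then available for the derivative of \<phi>.\<close>
  define G where "G x = (\<Sum>i\<in>Basis. fderiv \<phi> x i *\<^sub>R i)" for x
  have CG: "Ck_on n G W" for n
    unfolding G_def[abs_def] by (intro Ck_on_sum Ck_on_scaleR Ck_on_const Ck_on_SucD[OF \<phi>] W)
  have D\<phi>: "(\<phi> has_derivative fderiv \<phi> x) (at x)" if "x \<in> W" for x
    by (rule Ck_on_Suc_has_derivative[OF W \<phi>[of "Suc 0"] that])
  have grad: "fderiv \<phi> x v = G x \<bullet> v" if "x \<in> W" for x v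
    unfolding linear_euclidean_expand[OF has_derivative_linear[OF D\<phi>[OF that]], of v] G_def
    by (simp add: inner_sum_left inner_commute[of v] mult.commute)
  have e2: "e / 2 > 0" using e by simp
  obtain \<theta> where \<theta>: "\<theta> > 0" and val: "\<And>t v. norm v < \<theta> \<Longrightarrow> z t + v \<in> W \<and> norm (G (z t + v) - G (z t)) \<le> e / 2"
    and lip: "\<And>H H' s t. (\<And>t. (H has_vector_derivative H' t) (at t)) \<Longrightarrow> (\<And>t. norm (H t) < \<theta>) \<Longrightarrow> (\<And>t. norm (H' t) < \<theta>) \<Longrightarrow>
      norm ((G (z s + H s) - G (z s)) - (G (z t + H t) - G (z t))) \<le> e / 2 * \<bar>s - t\<bar>"
    using compose_close_along_curve[OF W CG z K e2] by blast
  show ?thesis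
  proof (intro exI[of _ \<theta>] conjI[OF \<theta>] allI impI)
    fix \<eta> s t :: real and H H' :: "real \<Rightarrow> 'a"
    assume \<eta>: "\<eta> < \<theta>" and dH: "\<forall>t. (H has_vector_derivative H' t) (at t)"
      and bH: "\<forall>t. norm (H t) \<le> \<eta> \<and> norm (H' t) \<le> \<eta>"
    have \<eta>0: "\<eta> \<ge> 0" using bH norm_ge_zero order_trans by blast
    have small: "norm (\<sigma> *\<^sub>R H t) < \<theta>" "norm (\<sigma> *\<^sub>R H' t) < \<theta>" if "0 \<le> \<sigma>" "\<sigma> \<le> 1" for \<sigma> t
      using that bH[rule_format, of t] \<eta> mult_left_le_one_le[of "norm (H t)" \<sigma>] mult_left_le_one_le[of "norm (H' t)" \<sigma>]
      by auto
    define g where "g \<sigma> t = G (z t + \<sigma> *\<^sub>R H t) - G (z t)" for \<sigma> t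
    have g: "norm (g \<sigma> t) \<le> e / 2" "norm (g \<sigma> s - g \<sigma> t) \<le> e / 2 * \<bar>s - t\<bar>" if "0 \<le> \<sigma>" "\<sigma> \<le> 1" for \<sigma> s t
    proof -
      show "norm (g \<sigma> t) \<le> e / 2" unfolding g_def using val[OF small(1)[OF that]] by blast
      show "norm (g \<sigma> s - g \<sigma> t) \<le> e / 2 * \<bar>s - t\<bar>" unfolding g_def
        by (rule lip[where H="\<lambda>t. \<sigma> *\<^sub>R H t" and H'="\<lambda>t. \<sigma> *\<^sub>R H' t"])
          (use small[OF that] dH in \<open>auto intro!: derivative_eq_intros\<close>)
    qed
    let ?f = "\<lambda>\<sigma> t. \<phi> (z t + \<sigma> *\<^sub>R H t) - \<sigma> * fderiv \<phi> (z t) (H t)"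
    have df: "((\<lambda>\<sigma>. ?f \<sigma> t) has_real_derivative g \<sigma> t \<bullet> H t) (at \<sigma>)" if "0 \<le> \<sigma>" "\<sigma> \<le> 1" for \<sigma> t
    proof -
      have W': "z t + \<sigma> *\<^sub>R H t \<in> W" "z t \<in> W" using val[OF small(1)[OF that]] K by auto
      have "((\<lambda>\<sigma>. z t + \<sigma> *\<^sub>R H t) has_vector_derivative H t) (at \<sigma>)"
        by (auto intro!: derivative_eq_intros)
      from has_real_derivative_along_curve[OF this D\<phi>[OF W'(1)]] show ?thesis
        unfolding g_def inner_diff_left grad[OF W'(1)] grad[OF W'(2)] by (auto intro!: derivative_eq_intros)
    qed
    have rem: "rem H t = ?f 1 t - ?f 0 t" for t by (simp add: rem_def)
    obtain \<sigma> where \<sigma>: "0 < \<sigma>" "\<sigma> < 1" "rem H t = g \<sigma> t \<bullet> H t"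
      using MVT2[of 0 1 "\<lambda>\<sigma>. ?f \<sigma> t" "\<lambda>\<sigma>. g \<sigma> t \<bullet> H t"] df unfolding rem by auto
    have "norm (g \<sigma> t) * norm (H t) \<le> e / 2 * \<eta>" using g(1)[of \<sigma> t] \<sigma> bH e by (intro mult_mono) auto
    then have "\<bar>rem H t\<bar> \<le> e / 2 * \<eta>" unfolding \<sigma>(3) by (rule order_trans[OF Cauchy_Schwarz_ineq2])
    then have "\<bar>rem H t\<bar> \<le> e * \<eta>" using e \<eta>0 by (simp add: field_simps)
    moreover have "\<bar>rem H s - rem H t\<bar> \<le> e * \<eta> * \<bar>s - t\<bar>"
    proof -
      obtain \<tau> where \<tau>: "0 < \<tau>" "\<tau> < 1" "rem H s - rem H t = g \<tau> s \<bullet> H s - g \<tau> t \<bullet> H t"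
        using MVT2[of 0 1 "\<lambda>\<sigma>. ?f \<sigma> s - ?f \<sigma> t" "\<lambda>\<sigma>. g \<sigma> s \<bullet> H s - g \<sigma> t \<bullet> H t"] DERIV_diff[OF df df]
        unfolding rem by (auto simp: algebra_simps)
      have "norm (H s - H t) \<le> \<eta> * \<bar>s - t\<bar>"
        by (rule vector_derivative_bound_imp_Lipschitz) (use dH bH in auto)
      then have "norm (g \<tau> s - g \<tau> t) * norm (H s) + norm (g \<tau> t) * norm (H s - H t) \<le> (e / 2 * \<bar>s - t\<bar>) * \<eta> + e / 2 * (\<eta> * \<bar>s - t\<bar>)"
        using g[of \<tau>] \<tau> bH e by (intro add_mono mult_mono) auto
      moreover have "rem H s - rem H t = (g \<tau> s - g \<tau> t) \<bullet> H s + g \<tau> t \<bullet> (H s - H t)"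
        unfolding \<tau>(3) by (simp add: inner_diff_left inner_diff_right)
      ultimately show ?thesis
        using Cauchy_Schwarz_ineq2[of "g \<tau> s - g \<tau> t" "H s"] Cauchy_Schwarz_ineq2[of "g \<tau> t" "H s - H t"]
        by (simp add: field_simps)
    qed
    ultimately show "\<bar>rem H t\<bar> \<le> e * \<eta> \<and> \<bar>rem H s - rem H t\<bar> \<le> e * \<eta> * \<bar>s - t\<bar>" ..
  qed
qed

section \<open>Reconstructions from solutions of the magnitude equation\<close>

text \<open>The antiderivative is written as an integral over a fixed interval, so that its joint smoothness in
  time and parameters is an instance of differentiation under the integral.\<close>

definition ramp :: "(real \<Rightarrow> real) \<Rightarrow> real \<Rightarrow> real" where
  "ramp f t = integral {0..1} (\<lambda>\<sigma>. t * f (t * \<sigma>))"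

lemma ramp_deriv:
  assumes "continuous_on UNIV f"
  shows "(ramp f has_real_derivative f t) (at t)"
proof -
  obtain F where F: "\<And>t. (F has_real_derivative f t) (at t)" using ex_antiderivative[OF assms] by blast
  have "ramp f t = F t - F 0" for t
  proof -
    have "((\<lambda>\<sigma>. t * f (t * \<sigma>)) has_integral F (t * 1) - F (t * 0)) {0..1}"
    proof (rule fundamental_theorem_of_calculus)
      fix \<sigma> :: real
      have "((\<lambda>\<sigma>. t * \<sigma>) has_real_derivative t) (at \<sigma> within {0..1})" by (auto intro!: derivative_eq_intros)
      from DERIV_chain2[OF F this] show "((\<lambda>\<sigma>. F (t * \<sigma>)) has_vector_derivative t * f (t * \<sigma>)) (at \<sigma> within {0..1})"
        by (simp add: real_vector_derivative[symmetric] mult.commute)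
    qed simp
    from integral_unique[OF this] show ?thesis by (simp only: ramp_def mult_1_right mult_zero_right)
  qed
  then have "ramp f = (\<lambda>t. F t - F 0)" by auto
  then show ?thesis using F[of t] by (auto intro!: derivative_eq_intros)
qed

text \<open>The product equation for the warps solved for the second warp with
  \<open>\<epsilon> = \<delta>^2 (d2/\<mu>)^k2\<close>. The power of \<delta> cancels, so the
  expression stays regular and bounded away from zero as \<delta> tends to 0.\<close>

definition warp2_fun :: "nat \<Rightarrow> nat \<Rightarrow> real \<Rightarrow> jet \<Rightarrow> real" where
  "warp2_fun k1 k2 d2 z = sqrt (d2 / fst (snd (snd (snd z)))
     * (rhs_q z / ((fst (snd z))\<^sup>2 * rhs_r z)) powr (1 / real k2) / fst z powr (2 * real k1 / real k2))"

lemma open_rhs_dom_mu: "open (rhs_dom \<inter> {z. fst (snd (snd (snd z))) > 0})"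
  by (intro open_Int open_rhs_dom open_Collect_less continuous_intros)

lemma warp2_fun_pos:
  assumes "z \<in> rhs_dom \<inter> {z. fst (snd (snd (snd z))) > 0}" "d2 > 0"
  shows "0 < d2 / fst (snd (snd (snd z))) * (rhs_q z / ((fst (snd z))\<^sup>2 * rhs_r z)) powr (1 / real k2) / fst z powr (2 * real k1 / real k2)"
  using assms by (auto simp: rhs_dom_def intro!: divide_pos_pos mult_pos_pos)

lemma Ck_on_warp2_fun:
  assumes "d2 > 0"
  shows "Ck_on n (warp2_fun k1 k2 d2) (rhs_dom \<inter> {z. fst (snd (snd (snd z))) > 0})"
  unfolding warp2_fun_def[abs_def]
  by (intro Ck_on_sqrt Ck_on_divide Ck_on_mult Ck_on_powr Ck_on_fst Ck_on_snd Ck_on_ident Ck_on_const Ck_on_power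
      Ck_on_rhs_q Ck_on_rhs_r open_rhs_dom_mu)
    (use warp2_fun_pos[OF _ assms] in \<open>auto simp: rhs_dom_def\<close>)

definition recon_of ::
  "nat \<Rightarrow> nat \<Rightarrow> real \<Rightarrow> (real \<Rightarrow> real) \<Rightarrow> (real \<Rightarrow> real) \<Rightarrow> (real \<Rightarrow> real) \<Rightarrow> real \<times> real \<Rightarrow> recon" where
  "recon_of k1 k2 d2 l x y p = \<lparr>
     par_c = 1 / snd p, par_eps = datum_eps k2 d2 (fst p) (snd p), par_sig = 1,
     mag = datum_mag (snd p) x, warp1 = l, warp2 = (\<lambda>t. warp2_fun k1 k2 d2 (l t, x t, y t, p)),
     phase1 = ramp (\<lambda>t. rate1 (l t, x t, y t, p)), phase2 = ramp (\<lambda>t. rate2 (l t, x t, y t, p))\<rparr>"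

lemma powr_root_power:
  fixes u :: real
  assumes "u > 0" "k > 0"
  shows "(u powr (1 / real k)) ^ k = u"
  using assms by (simp add: powr_realpow[symmetric] powr_powr)

text \<open>The warp is only assumed differentiable, so that the locale serves both the smooth warp
  and its perturbations of finite regularity.\<close>

locale datum_solution =
  fixes k1 k2 :: nat and d1 d2 P :: real and l l' x y :: "real \<Rightarrow> real" and \<mu> \<delta> :: real
  assumes k2: "k2 > 0" and d2: "d2 > 0" and P: "P > 0" and \<mu>: "\<mu> > 0" and \<delta>: "\<delta> > 0"
    and l_deriv: "\<And>t. (l has_real_derivative l' t) (at t)" and l_per: "periodic P l"
    and x_deriv: "\<And>t. (x has_real_derivative y t) (at t)"
    and y_deriv: "\<And>t. (y has_real_derivative rhs k1 k2 d1 (l t, x t, y t, \<mu>, \<delta>)) (at t)"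
    and x_per: "periodic P x" and dom: "\<And>t. (l t, x t, y t, \<mu>, \<delta>) \<in> rhs_dom"
begin

abbreviation "zz t \<equiv> (l t, x t, y t, \<mu>, \<delta>)"
abbreviation "DD \<equiv> recon_of k1 k2 d2 l x y (\<mu>, \<delta>)"
abbreviation "q t \<equiv> rhs_q (zz t)"
abbreviation "r t \<equiv> rhs_r (zz t)"

lemma pos: "l t > 0" "x t > 0" "q t > 0" "r t > 0" "1 - \<delta> * (x t)\<^sup>2 > 0"
  using dom[of t] rhs_dom_comagnitude[OF dom[of t]] by (auto simp: rhs_dom_def)

lemma continuous_lxy: "continuous_on S l" "continuous_on S x" "continuous_on S y"
  using l_deriv x_deriv y_deriv by (auto intro!: continuous_at_imp_continuous_on DERIV_isCont)

lemma continuous_zz: "continuous_on S zz"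
  by (intro continuous_on_Pair continuous_lxy continuous_on_const)

lemma y_per: "periodic P y"
  by (rule periodic_deriv[OF x_per x_deriv])

lemma zz_per: "zz (t + P) = zz t"
  using l_per x_per y_per by (simp add: periodic_def)

lemma continuous_along: "Ck_on 0 f rhs_dom \<Longrightarrow> continuous_on UNIV (\<lambda>t. f (zz t))"
  by (rule continuous_on_compose2[OF _ continuous_zz]) (auto simp: dom)

lemma deriv_xy: "deriv x = y" "deriv y = (\<lambda>t. rhs k1 k2 d1 (zz t))"
  using x_deriv y_deriv by (auto intro!: ext DERIV_imp_deriv)

lemma x_Ck2: "Ck_on 2 x UNIV"
proof -
  have "Ck_on (Suc (Suc 0)) x UNIV"
    using continuous_along[OF Ck_on_rhs]
    by (intro Ck_on_SucI_DERIV[OF open_UNIV x_deriv] Ck_on_SucI_DERIV[OF open_UNIV y_deriv]) auto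
  then show ?thesis by (simp add: numeral_2_eq_2)
qed

lemma datum: "magnitude_datum k1 k2 d1 P l \<mu> \<delta> x"
  using pos \<mu> \<delta> x_per x_Ck2
  by (auto simp: magnitude_datum_def residual_rhs deriv_xy r_fun_def rhs_r_def)

text \<open>Bootstrapping: x'' is a smooth function of l, x and x', so x gains two derivatives over
  the warp.\<close>

lemma Ck_on_x: "Ck_on n l UNIV \<Longrightarrow> Ck_on (n + 2) x UNIV"
proof (induction n)
  case 0
  show ?case using x_Ck2 by (simp only: add_0)
next
  case (Suc n)
  have x: "Ck_on (Suc (Suc n)) x UNIV" using Suc.IH[OF Ck_on_Suc_imp[OF Suc.prems]] by (simp only: add_2_eq_Suc')
  have y: "Ck_on (Suc n) y UNIV" using Ck_on_Suc_DERIV(2)[OF open_UNIV x] by (simp add: deriv_xy)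
  have "Ck_on (Suc n) zz UNIV"
    by (intro Ck_on_Pair open_UNIV Ck_on_const Suc.prems y Ck_on_Suc_imp[OF x])
  then have "Ck_on (Suc n) (\<lambda>t. rhs k1 k2 d1 (zz t)) UNIV"
    by (intro Ck_on_compose[OF open_UNIV open_rhs_dom _ Ck_on_rhs]) (use dom in auto)
  then have "Ck_on (Suc (Suc (Suc n))) x UNIV"
    by (intro Ck_on_SucI_DERIV[OF open_UNIV x_deriv] Ck_on_SucI_DERIV[OF open_UNIV y_deriv])
  then show ?case by (simp only: add_2_eq_Suc')
qed

lemma deriv_mag: "deriv (datum_mag \<delta> x) = (\<lambda>t. sqrt \<delta> * y t)"
    "deriv (deriv (datum_mag \<delta> x)) = (\<lambda>t. sqrt \<delta> * rhs k1 k2 d1 (zz t))"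
proof -
  show 1: "deriv (datum_mag \<delta> x) = (\<lambda>t. sqrt \<delta> * y t)"
    unfolding datum_mag_def[abs_def] by (intro ext DERIV_imp_deriv DERIV_cmult x_deriv)
  show "deriv (deriv (datum_mag \<delta> x)) = (\<lambda>t. sqrt \<delta> * rhs k1 k2 d1 (zz t))"
    unfolding 1 by (intro ext DERIV_imp_deriv DERIV_cmult y_deriv)
qed

lemma mag_square: "(datum_mag \<delta> x t)\<^sup>2 = \<delta> * (x t)\<^sup>2"
  using \<delta> by (simp add: datum_mag_def power_mult_distrib)

lemma Q_eq: "Q_fun (1 / \<delta>) (datum_mag \<delta> x) t = q t / \<delta>"
  and R_eq: "R_fun (datum_mag \<delta> x) t = r t"
  and co_eq: "(co_magnitude (datum_mag \<delta> x) t)\<^sup>2 = 1 - \<delta> * (x t)\<^sup>2"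
proof -
  show "Q_fun (1 / \<delta>) (datum_mag \<delta> x) t = q t / \<delta>"
    unfolding Q_fun_def mag_square using \<delta> by (simp add: rhs_q_def field_simps power2_eq_square)
  show "R_fun (datum_mag \<delta> x) t = r t"
    unfolding R_fun_def deriv_mag mag_square using \<delta> by (simp add: rhs_r_def power_mult_distrib algebra_simps)
  show "(co_magnitude (datum_mag \<delta> x) t)\<^sup>2 = 1 - \<delta> * (x t)\<^sup>2"
    unfolding co_magnitude_def mag_square using pos(5)[of t] by simp
qed

lemma F_eq: "F_fun (1 / \<delta>) (datum_eps k2 d2 \<mu> \<delta>) (datum_mag \<delta> x) t = sqrt ((d2 / \<mu>) ^ k2 * (q t / ((x t)\<^sup>2 * r t)))"
proof -
  have "datum_eps k2 d2 \<mu> \<delta> * (q t / \<delta>) / ((datum_mag \<delta> x t)\<^sup>2 * r t) = (d2 / \<mu>) ^ k2 * (q t / ((x t)\<^sup>2 * r t))"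
    unfolding datum_eps_def mag_square using \<delta> pos(2,4)[of t] by (simp add: power2_eq_square)
  then show ?thesis unfolding F_fun_def Q_eq R_eq by simp
qed

lemma phase_rates:
  "phase_rate1 (1 / \<delta>) (datum_eps k2 d2 \<mu> \<delta>) 1 (datum_mag \<delta> x) = (\<lambda>t. rate1 (zz t))"
  "phase_rate2 (1 / \<delta>) (datum_eps k2 d2 \<mu> \<delta>) 1 (datum_mag \<delta> x) = (\<lambda>t. rate2 (zz t))"
proof -
  define K where "K = sqrt ((d2 / \<mu>) ^ k2)"
  have K: "K > 0" using d2 \<mu> by (simp add: K_def)
  have e: "sqrt (datum_eps k2 d2 \<mu> \<delta>) = \<delta> * K"
    using \<delta> by (simp add: datum_eps_def K_def real_sqrt_mult)
  have F: "F_fun (1 / \<delta>) (datum_eps k2 d2 \<mu> \<delta>) (datum_mag \<delta> x) t = K * sqrt (q t) / (x t * sqrt (r t))" for t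
    unfolding F_eq real_sqrt_mult real_sqrt_divide K_def[symmetric] using pos(2)[of t] by simp
  have nz: "x t \<noteq> 0" "sqrt (q t) \<noteq> 0" "sqrt (r t) \<noteq> 0" "1 - \<delta> * (x t)\<^sup>2 \<noteq> 0" for t
    using pos[of t] by auto
  have rr: "sqrt (r t) * sqrt (r t) = r t" for t using pos(4)[of t] by simp
  show "phase_rate1 (1 / \<delta>) (datum_eps k2 d2 \<mu> \<delta>) 1 (datum_mag \<delta> x) = (\<lambda>t. rate1 (zz t))"
  proof
    fix t
    show "phase_rate1 (1 / \<delta>) (datum_eps k2 d2 \<mu> \<delta>) 1 (datum_mag \<delta> x) t = rate1 (zz t)"
      unfolding phase_rate1_def e F mag_square rate1_def using K nz[of t] \<delta>
      by (simp add: field_simps power2_eq_square)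
  qed
  show "phase_rate2 (1 / \<delta>) (datum_eps k2 d2 \<mu> \<delta>) 1 (datum_mag \<delta> x) = (\<lambda>t. rate2 (zz t))"
  proof
    fix t
    show "phase_rate2 (1 / \<delta>) (datum_eps k2 d2 \<mu> \<delta>) 1 (datum_mag \<delta> x) t = rate2 (zz t)"
      unfolding phase_rate2_def e F co_eq rate2_def using K nz[of t] \<delta>
      by (simp add: field_simps)
  qed
qed

lemma datum_return_eq:
  "datum_return k2 d2 P \<mu> \<delta> x = (integral {0..P} (\<lambda>t. rate1 (zz t)), integral {0..P} (\<lambda>t. rate2 (zz t)))"
  unfolding datum_return_def phase_increments_def phase_rates ..

lemma warp2_square: "(warp2_fun k1 k2 d2 (zz t))\<^sup>2
   = d2 / \<mu> * (q t / ((x t)\<^sup>2 * r t)) powr (1 / real k2) / l t powr (2 * real k1 / real k2)"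
  and warp2_pos: "warp2_fun k1 k2 d2 (zz t) > 0"
proof -
  have z: "zz t \<in> rhs_dom \<inter> {z. fst (snd (snd (snd z))) > 0}" using dom[of t] \<mu> by simp
  from warp2_fun_pos[OF z d2, of k2 k1]
  show "(warp2_fun k1 k2 d2 (zz t))\<^sup>2 = d2 / \<mu> * (q t / ((x t)\<^sup>2 * r t)) powr (1 / real k2) / l t powr (2 * real k1 / real k2)"
    "warp2_fun k1 k2 d2 (zz t) > 0" by (simp_all add: warp2_fun_def)
qed

lemma warp_product: "l t ^ k1 * warp2_fun k1 k2 d2 (zz t) ^ k2 = F_fun (1 / \<delta>) (datum_eps k2 d2 \<mu> \<delta>) (datum_mag \<delta> x) t"
proof -
  let ?u = "q t / ((x t)\<^sup>2 * r t)"
  have u: "?u > 0" using pos[of t] by (intro divide_pos_pos mult_pos_pos) auto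
  have lp: "(l t powr (2 * real k1 / real k2)) ^ k2 = l t ^ (2 * k1)"
  proof -
    have "(l t powr (2 * real k1 / real k2)) ^ k2 = l t powr (real (2 * k1))"
      using pos(1)[of t] k2 by (simp add: powr_realpow[symmetric] powr_powr)
    then show ?thesis using pos(1)[of t] by (simp only: powr_realpow)
  qed
  have "(warp2_fun k1 k2 d2 (zz t) ^ k2)\<^sup>2 = ((warp2_fun k1 k2 d2 (zz t))\<^sup>2) ^ k2"
    by (simp add: power_mult[symmetric] mult.commute)
  also have "\<dots> = (d2 / \<mu>) ^ k2 * ?u / l t ^ (2 * k1)"
    unfolding warp2_square power_divide[of _ "l t powr _"] power_mult_distrib lp powr_root_power[OF u k2] ..
  finally have "(l t ^ k1 * warp2_fun k1 k2 d2 (zz t) ^ k2)\<^sup>2 = (d2 / \<mu>) ^ k2 * ?u"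
    using pos(1)[of t] by (simp add: power_mult_distrib power_mult[symmetric] mult.commute)
  then show ?thesis
    unfolding F_eq using pos(1)[of t] warp2_pos[of t] by (intro real_sqrt_unique[symmetric]) auto
qed

text \<open>The magnitude equation is the second warp equation solved for x''. Once the first warp
  is prescribed and the product equation determines the second, this is the only condition left on
  x.\<close>

lemma warp_difference: "d2 / (warp2_fun k1 k2 d2 (zz t))\<^sup>2 - d1 / (l t)\<^sup>2 = T_fun (1 / \<delta>) (datum_mag \<delta> x) t"
proof -
  let ?w = "l t powr (2 * real k1 / real k2)" and ?v = "((x t)\<^sup>2 * r t / q t) powr (1 / real k2)"
  note p = pos[of t]
  have nz: "x t \<noteq> 0" "q t \<noteq> 0" "r t \<noteq> 0" using p by auto
  have "(q t / ((x t)\<^sup>2 * r t)) powr (1 / real k2) = inverse ?v"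
    using p by (simp add: powr_divide field_simps)
  then have 1: "d2 / (warp2_fun k1 k2 d2 (zz t))\<^sup>2 = \<mu> * ?w * ?v"
    unfolding warp2_square using d2 \<mu> p by (simp add: field_simps)
  have sd: "sqrt \<delta> \<noteq> 0" using \<delta> by simp
  have "T_fun (1 / \<delta>) (datum_mag \<delta> x) t = 1 / ((x t)\<^sup>2 * q t) - (x t + rhs k1 k2 d1 (zz t)) / (x t * r t)"
  proof -
    have "1 / ((datum_mag \<delta> x t)\<^sup>2 * (q t / \<delta>)) = 1 / ((x t)\<^sup>2 * q t)"
      unfolding mag_square using \<delta> by simp
    moreover have "(datum_mag \<delta> x t + sqrt \<delta> * rhs k1 k2 d1 (zz t)) / (datum_mag \<delta> x t * r t) = (x t + rhs k1 k2 d1 (zz t)) / (x t * r t)"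
      using sd by (simp add: datum_mag_def distrib_left[symmetric] mult.assoc)
    ultimately show ?thesis unfolding T_fun_def Q_eq R_eq deriv_mag(2) by (simp only:)
  qed
  also have "rhs k1 k2 d1 (zz t) = r t / (x t * q t) - x t - r t * x t * (\<mu> * ?w * ?v - d1 / (l t)\<^sup>2)"
    by (simp add: rhs_def)
  also have "1 / ((x t)\<^sup>2 * q t) - (x t + (r t / (x t * q t) - x t - r t * x t * (\<mu> * ?w * ?v - d1 / (l t)\<^sup>2))) / (x t * r t)
      = \<mu> * ?w * ?v - d1 / (l t)\<^sup>2"
  proof -
    have "(r t / (x t * q t) - r t * x t * E) / (x t * r t) = 1 / ((x t)\<^sup>2 * q t) - E" for E
      using nz by (simp add: field_simps power2_eq_square)
    then show ?thesis by simp
  qed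
  finally show ?thesis using 1 by simp
qed

lemma is_reconstruction: "is_reconstruction k1 k2 d1 d2 DD"
proof -
  have "datum_eps k2 d2 \<mu> \<delta> > 0" using \<delta> d2 \<mu> by (simp add: datum_eps_def)
  moreover have "Ck_on 2 (datum_mag \<delta> x) UNIV"
    unfolding datum_mag_def[abs_def] by (intro Ck_on_mult Ck_on_const open_UNIV x_Ck2)
  moreover have "0 < datum_mag \<delta> x t \<and> datum_mag \<delta> x t < 1" for t
  proof -
    have "(datum_mag \<delta> x t)\<^sup>2 < 1\<^sup>2" unfolding mag_square using pos(5)[of t] by simp
    then show ?thesis using \<delta> pos(2)[of t] power_less_imp_less_base[of "datum_mag \<delta> x t" 2 1] by (simp add: datum_mag_def)
  qed
  moreover have "(ramp (\<lambda>t. rate1 (zz t)) has_real_derivative rate1 (zz t)) (at t)"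
      "(ramp (\<lambda>t. rate2 (zz t)) has_real_derivative rate2 (zz t)) (at t)" for t
    by (intro ramp_deriv continuous_along Ck_on_rate1 Ck_on_rate2)+
  ultimately show ?thesis
    unfolding is_reconstruction_def recon_of_def
    using pos warp2_pos warp_product warp_difference by (simp add: R_eq phase_rates)
qed

lemma warp2_deriv: "\<exists>l2'. \<forall>t. (warp2 DD has_real_derivative l2' t) (at t)"
proof -
  let ?S = "rhs_dom \<inter> {z. fst (snd (snd (snd z))) > 0}"
  have "(zz has_vector_derivative (l' t, y t, rhs k1 k2 d1 (zz t), 0, 0)) (at t)" for t
    using l_deriv[of t] x_deriv[of t] y_deriv[of t]
    by (intro has_vector_derivative_Pair has_vector_derivative_const)
      (simp_all add: real_vector_derivative)
  moreover have "(warp2_fun k1 k2 d2 has_derivative fderiv (warp2_fun k1 k2 d2) (zz t)) (at (zz t))" for t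
    by (rule Ck_on_Suc_has_derivative[OF open_rhs_dom_mu Ck_on_warp2_fun[OF d2, of "Suc 0"]]) (use dom \<mu> in simp)
  ultimately have "((\<lambda>t. warp2_fun k1 k2 d2 (zz t)) has_real_derivative
      fderiv (warp2_fun k1 k2 d2) (zz t) (l' t, y t, rhs k1 k2 d1 (zz t), 0, 0)) (at t)" for t
    by (rule has_real_derivative_along_curve)
  then show ?thesis
    by (intro exI[of _ "\<lambda>t. fderiv (warp2_fun k1 k2 d2) (zz t) (l' t, y t, rhs k1 k2 d1 (zz t), 0, 0)"])
      (simp add: recon_of_def)
qed

lemma periodic_data: "P_periodic_data P DD"
  using zz_per l_per x_per
  by (auto simp: P_periodic_data_def recon_of_def periodic_def datum_mag_def co_magnitude_def)

lemma realizes: "realizes_datum k2 d2 l \<mu> \<delta> x DD"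
  by (simp add: realizes_datum_def recon_of_def)

lemma mag_Ck: "Ck_on n l UNIV \<Longrightarrow> Ck_on (n + 2) (mag DD) UNIV"
  using Ck_on_mult[OF open_UNIV Ck_on_const Ck_on_x] by (simp add: recon_of_def datum_mag_def[abs_def])

lemma phase_shift:
  "phase1 DD (t + real m * P) = phase1 DD t + real m * fst (datum_return k2 d2 P \<mu> \<delta> x)"
  "phase2 DD (t + real m * P) = phase2 DD t + real m * snd (datum_return k2 d2 P \<mu> \<delta> x)"
proof -
  have gen: "ramp f (t + real m * P) = ramp f t + real m * integral {0..P} f"
    if c: "continuous_on UNIV f" and p: "\<And>t. f (t + P) = f t" for f
  proof -
    note d = ramp_deriv[OF c]
    have dP: "((\<lambda>t. ramp f (t + P)) has_real_derivative f t) (at t)" for t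
      using d[of "t + P"] by (simp add: DERIV_shift p)
    have "((\<lambda>t. ramp f (t + P) - ramp f t) has_real_derivative 0) (at t)" for t
      using DERIV_diff[OF dP d, of t] by simp
    then have s: "ramp f (t + P) - ramp f t = ramp f (0 + P) - ramp f 0" for t
      using DERIV_isconst_all by blast
    have "(f has_integral ramp f P - ramp f 0) {0..P}"
      using P d by (intro fundamental_theorem_of_calculus)
        (auto simp: real_vector_derivative[symmetric] intro: has_field_derivative_at_within)
    then have I: "ramp f P - ramp f 0 = integral {0..P} f" by (simp add: integral_unique)
    show ?thesis
    proof (induction m)
      case (Suc m)
      have "ramp f (t + real (Suc m) * P) = ramp f ((t + real m * P) + P)" by (simp add: algebra_simps)
      then show ?case using s[of "t + real m * P"] Suc I by (simp add: algebra_simps)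
    qed simp
  qed
  show "phase1 DD (t + real m * P) = phase1 DD t + real m * fst (datum_return k2 d2 P \<mu> \<delta> x)"
    "phase2 DD (t + real m * P) = phase2 DD t + real m * snd (datum_return k2 d2 P \<mu> \<delta> x)"
    unfolding datum_return_eq recon_of_def using gen[OF continuous_along[OF Ck_on_rate1]] gen[OF continuous_along[OF Ck_on_rate2]]
    by (simp_all add: zz_per)
qed

lemma profile_shift:
  "profile DD (t + real m * P) = (let D = datum_return k2 d2 P \<mu> \<delta> x in
     (fst (profile DD t) * cis (real m * fst D), snd (profile DD t) * cis (real m * snd D)))"
proof -
  have "periodic P (mag DD)" "periodic P (co_magnitude (mag DD))" using periodic_data by (auto simp: P_periodic_data_def)
  then have "mag DD (t + real m * P) = mag DD t" "co_magnitude (mag DD) (t + real m * P) = co_magnitude (mag DD) t"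
    using periodic_of_int[of P _ t "int m"] by auto
  then show ?thesis unfolding profile_def phase_shift by (simp add: Let_def cis_mult[symmetric])
qed

lemma profile_closes:
  assumes "datum_return k2 d2 P \<mu> \<delta> x = (2 * pi * \<rho>1, 2 * pi * \<rho>2)" "\<rho>1 \<in> \<rat>" "\<rho>2 \<in> \<rat>"
  shows "profile_closes P DD"
proof -
  obtain i1 i2 :: int and n1 n2 :: nat where \<rho>: "\<rho>1 = i1 / n1" "n1 \<noteq> 0" "\<rho>2 = i2 / n2" "n2 \<noteq> 0"
    using assms(2,3) by (auto simp: Rats_eq_int_div_nat)
  define m where "m = n1 * n2"
  have m: "real m * \<rho>1 = of_int (i1 * int n2)" "real m * \<rho>2 = of_int (i2 * int n1)" "m \<ge> 1"
    using \<rho>(2,4) by (simp_all add: m_def \<rho>(1,3))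
  have c: "cis (real m * (2 * pi * \<rho>)) = 1" if "real m * \<rho> = of_int j" for \<rho> j
  proof -
    have "real m * (2 * pi * \<rho>) = 2 * pi * (real m * \<rho>)" by simp
    then show ?thesis using cis_multiple_2pi[of "of_int j"] that by (simp only: Ints_of_int)
  qed
  have "periodic (real m * P) (profile DD)"
    unfolding periodic_def profile_shift assms(1) Let_def fst_conv snd_conv c[OF m(1)] c[OF m(2)] by simp
  then show ?thesis using m(3) unfolding profile_closes_def closing_multiplier_def by auto
qed

text \<open>The co-magnitude never vanishes, so closing of the second complex coordinate forces its
  phase to return to itself modulo a full turn.\<close>

lemma closing_multiplier_Ints:
  assumes "datum_return k2 d2 P \<mu> \<delta> x = (2 * pi * \<rho>1, 2 * pi * \<rho>2)" "closing_multiplier P DD m"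
  shows "m \<ge> 1" "real m * \<rho>2 \<in> \<int>"
proof -
  show "m \<ge> 1" using assms(2) by (simp add: closing_multiplier_def)
  have "profile DD (0 + real m * P) = profile DD 0"
    using assms(2) unfolding closing_multiplier_def periodic_def by blast
  then have "snd (profile DD 0) * cis (real m * (2 * pi * \<rho>2)) = snd (profile DD 0)"
    unfolding profile_shift assms(1) Let_def by (metis snd_conv)
  moreover have "co_magnitude (mag DD) 0 \<noteq> 0"
    using co_eq[of 0] pos(5)[of 0] by (auto simp: recon_of_def)
  then have "snd (profile DD 0) \<noteq> 0" by (simp add: profile_def)
  ultimately have "cis (real m * (2 * pi * \<rho>2)) = 1" by simp
  then have "cos (real m * (2 * pi * \<rho>2)) = 1" by (simp add: complex_eq_iff)
  then obtain n :: int where "real m * (2 * pi * \<rho>2) = of_int n * 2 * pi" unfolding cos_one_2pi_int by blast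
  then have "real m * \<rho>2 = of_int n" by (simp add: field_simps)
  then show "real m * \<rho>2 \<in> \<int>" by simp
qed

lemma harmonic:
  fixes A1 :: "('m1::{t2_space, second_countable_topology}, 'e1::euclidean_space) rchart set"
    and A2 :: "('m2::{t2_space, second_countable_topology}, 'e2::euclidean_space) rchart set"
    and f1 :: "'m1 \<Rightarrow> complex ^ 'n1" and f2 :: "'m2 \<Rightarrow> complex ^ 'n2"
  assumes "riemannian_atlas A1" "riemannian_atlas A2" "eigenmap A1 f1 d1" "eigenmap A2 f2 d2"
    and "k1 = DIM('e1)" "k2 = DIM('e2)"
  shows "harmonic_reconstruction A1 A2 f1 f2 d1 d2 DD"
proof -
  obtain l2' where l2': "\<And>t. (warp2 DD has_real_derivative l2' t) (at t)" using warp2_deriv by blast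
  have l1': "(warp1 DD has_real_derivative l' t) (at t)" for t using l_deriv by (simp add: recon_of_def)
  show ?thesis
    by (rule harmonic_reconstructionI[OF assms(1-4) _ l1' l2']) (use is_reconstruction assms(5,6) in simp)
qed

end

lemma magnitude_datum_solution:
  assumes "k2 > 0" "d2 > 0" "P > 0" and l: "\<And>t. (l has_real_derivative l' t) (at t)" "periodic P l" "\<And>t. l t > 0"
    and x: "magnitude_datum k1 k2 d1 P l \<mu> \<delta> x"
  shows "datum_solution k1 k2 d1 d2 P l l' x (deriv x) \<mu> \<delta>"
proof -
  have C: "Ck_on (Suc (Suc 0)) x UNIV" and p: "\<mu> > 0" "\<delta> > 0" "periodic P x"
    and pos: "x t > 0" "r_fun \<delta> x t > 0" and res: "magnitude_residual k1 k2 d1 l \<mu> \<delta> x t = 0" for t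
    using x by (auto simp: magnitude_datum_def numeral_2_eq_2)
  note 1 = Ck_on_Suc_DERIV[OF open_UNIV C]
  note 2 = Ck_on_Suc_DERIV[OF open_UNIV 1(2)]
  have r: "deriv (deriv x) t = rhs k1 k2 d1 (l t, x t, deriv x t, \<mu>, \<delta>)" for t
    using res[of t] by (simp add: residual_rhs)
  have "(l t, x t, deriv x t, \<mu>, \<delta>) \<in> rhs_dom" for t
  proof -
    \<comment> \<open>Positivity of q is not part of a datum. It follows from \<open>r > 0\<close>,
      which gives \<open>\<delta> x^2 < 1\<close> and hence
      \<open>\<delta> - \<delta>^2 x^2 > 0\<close>.\<close>
    have "\<delta> * ((x t)\<^sup>2 + (deriv x t)\<^sup>2) < 1" using pos(2)[of t] by (simp add: r_fun_def)
    moreover have "0 \<le> \<delta> * (deriv x t)\<^sup>2" using p(2) by simp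
    ultimately have "\<delta> * (x t)\<^sup>2 < 1" by (simp add: distrib_left)
    then have "\<delta> * (\<delta> * (x t)\<^sup>2) < \<delta> * 1" using p(2) by (intro mult_strict_left_mono)
    then have "0 < \<delta> - \<delta>\<^sup>2 * (x t)\<^sup>2" by (simp add: power2_eq_square mult.assoc)
    moreover have "0 \<le> (x t)\<^sup>2" by simp
    ultimately have "(x t)\<^sup>2 + \<delta> - \<delta>\<^sup>2 * (x t)\<^sup>2 > 0" by linarith
    then have "rhs_q (l t, x t, deriv x t, \<mu>, \<delta>) > 0" by (simp add: rhs_q_def)
    then show ?thesis using l(3)[of t] pos[of t] by (simp add: rhs_dom_def r_fun_def rhs_r_def)
  qed
  then show ?thesis
    using assms(1-3) p l 1(1) 2(1) r by unfold_locales auto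
qed

section \<open>The linearized magnitude equation\<close>

context magnitude_branch
begin

abbreviation jet :: "real \<times> real \<Rightarrow> real \<Rightarrow> jet" where
  "jet p t \<equiv> (L t, X L p t, Y L p t, p)"

definition c0 :: "real \<times> real \<Rightarrow> real \<Rightarrow> real" where
  "c0 p t = fderiv vf (jet p t) (0, 1, 0, 0)"

definition c1 :: "real \<times> real \<Rightarrow> real \<Rightarrow> real" where
  "c1 p t = fderiv vf (jet p t) (0, 0, 1, 0)"

definition lin :: "real \<times> real \<Rightarrow> (real \<Rightarrow> real) \<Rightarrow> real \<Rightarrow> real" where
  "lin p h t = deriv (deriv h) t - (c0 p t * h t + c1 p t * deriv h t)"

lemma rhs_derivative:
  "z \<in> rhs_dom \<Longrightarrow> (vf has_derivative fderiv vf z) (at z)"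
  by (rule Ck_on_Suc_has_derivative[OF open_rhs_dom Ck_on_rhs[of "Suc 0"]])

lemma rhs_derivative_split:
  assumes "p \<in> pars"
  shows "fderiv vf (jet p t) (0, u, v, 0) = c0 p t * u + c1 p t * v"
proof -
  let ?D = "fderiv vf (jet p t)"
  have l: "linear ?D" by (rule has_derivative_linear[OF rhs_derivative[OF X_facts(5)[OF near_L assms]]])
  have "(0, u, v, 0) = u *\<^sub>R (0, 1, 0, 0) + v *\<^sub>R (0::real, 0::real, 1::real, 0::real \<times> real)" by simp
  then have "?D (0, u, v, 0) = u *\<^sub>R ?D (0, 1, 0, 0) + v *\<^sub>R ?D (0, 0, 1, 0)"
    by (simp only: linear_add[OF l] linear_cmul[OF l])
  then show ?thesis by (simp add: c0_def c1_def mult.commute)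
qed

lemma c_Ck: assumes "p \<in> pars" shows "Ck_on n (c0 p) UNIV" "Ck_on n (c1 p) UNIV"
proof -
  have gen: "Ck_on n (\<lambda>t. fderiv vf (jet p t) v) UNIV" for v
    using Ck_on_compose[OF open_UNIV open_Times[OF open_pars open_UNIV] _ compose_jet_Ck[OF Ck_on_SucD[OF Ck_on_rhs]], of "\<lambda>t. (p, t)" n k1 k2 d1 v]
      assms Ck_on_Pair[OF open_UNIV Ck_on_const Ck_on_ident[OF open_UNIV]] by auto
  show "Ck_on n (c0 p) UNIV" "Ck_on n (c1 p) UNIV" unfolding c0_def[abs_def] c1_def[abs_def] by (rule gen)+
qed

lemma jet_per: "p \<in> pars \<Longrightarrow> jet p (t + P) = jet p t"
  using X_facts(3,4)[OF near_L, of p] L_periodic by (simp add: periodic_def)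

lemma c_per: assumes "p \<in> pars" shows "periodic P (c0 p)" "periodic P (c1 p)"
  unfolding periodic_def c0_def c1_def jet_per[OF assms] by simp_all

lemma c_contper: assumes "p \<in> pars" shows "contper (c0 p)" "contper (c1 p)"
  using c_per[OF assms] c_Ck[OF assms, of 0] by (simp_all add: contper_def)

text \<open>The Lipschitz bound on the tube, differentiated at a branch point: the linearized
  equation inherits the contraction constants at every parameter of the disc, not only at the base
  point.\<close>

lemma c_bound:
  assumes p: "p \<in> pars"
  shows "\<bar>(a t + c0 p t) * u + c1 p t * v\<bar> \<le> \<alpha>0 * \<bar>u\<bar> + \<beta>0 * \<bar>v\<bar>"
proof -
  let ?N = "\<lambda>z :: jet. a t * fst (snd z) + vf (L t, snd z)"
  let ?DN = "\<lambda>v. a t * fst (snd v) + fderiv vf (jet p t) (0, snd v)"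
  have D: "((\<lambda>z. vf (L t, snd z)) has_derivative (\<lambda>v. fderiv vf (jet p t) (0, snd v))) (at (t, X L p t, Y L p t, p))"
    by (rule has_derivative_compose[of "\<lambda>z. (L t, snd z)"])
      (auto intro!: derivative_eq_intros rhs_derivative X_facts(5)[OF near_L p])
  have N: "(?N has_derivative ?DN) (at (t, X L p t, Y L p t, p))"
    by (intro has_derivative_add D) (auto intro!: derivative_eq_intros)
  have m: "(X L p t, Y L p t) \<in> tube t" using sol_facts(4)[OF near_L p] by (simp add: X_def Y_def)
  have lip: "\<bar>?N (t, x, y, p) - ?N (t, x', y', p)\<bar> \<le> \<alpha>0 * \<bar>x - x'\<bar> + \<beta>0 * \<bar>y - y'\<bar>"
    if "(x, y) \<in> tube t" "(x', y') \<in> tube t" for x y x' y'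
    using Nfun_lip[OF near_L p that] by (simp add: Nfun_def)
  have "\<bar>?DN (0, u, v, 0)\<bar> \<le> \<alpha>0 * \<bar>u\<bar> + \<beta>0 * \<bar>v\<bar>"
    using lipschitz_imp_derivative_bound[OF open_tube m N lip, where h=u and k=v] by simp
  then show ?thesis by (simp add: rhs_derivative_split[OF p] algebra_simps)
qed

text \<open>In terms of \<open>g = h'' + a h\<close> the linear equation is a fixed point equation
  with affine term f. Comparison with zero, whose defect is f, bounds g by twice the bound of f, and
  \<open>G\<close> and \<open>H\<close> transfer this to h and h'.\<close>

lemma linear_apriori:
  assumes p: "p \<in> pars" and f: "contper f" "\<And>t. \<bar>f t\<bar> \<le> B"
    and h: "\<And>t. (h has_real_derivative h1 t) (at t)"
      "\<And>t. (h1 has_real_derivative f t + (c0 p t * h t + c1 p t * h1 t)) (at t)" "periodic P h"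
  shows "\<bar>h t\<bar> \<le> M1 * (2 * B)" "\<bar>h1 t\<bar> \<le> M2 * (2 * B)"
    and "\<bar>f t + (c0 p t * h t + c1 p t * h1 t)\<bar> \<le> 2 * B + \<bar>a t\<bar> * (M1 * (2 * B))"
proof -
  define g where "g t = f t + (c0 p t * h t + c1 p t * h1 t) + a t * h t" for t
  have ch: "continuous_on UNIV h" "continuous_on UNIV h1"
    using h(1,2) by (auto intro!: continuous_at_imp_continuous_on DERIV_isCont)
  have ph1: "periodic P h1" by (rule periodic_deriv[OF h(3) h(1)])
  have ca: "continuous_on UNIV a" using Ck_on_continuous[OF smooth_a[of 0]] .
  have cg: "contper g"
    unfolding contper_def
  proof
    show "continuous_on UNIV g" unfolding g_def[abs_def]
      using c_contper[OF p] f(1) by (intro continuous_intros ch ca) (auto simp: contper_def)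
    show "periodic P g"
      using c_per[OF p] f(1) h(3) ph1 periodic_a by (simp add: periodic_def g_def contper_def)
  qed
  have h2: "(h1 has_real_derivative g t - a t * h t) (at t)" for t using h(2)[of t] by (simp add: g_def)
  note G = G_unique[OF h(1) h2 h(3) cg]
  note z = GH_zero
  have g: "\<bar>g t - 0\<bar> \<le> 2 * B" for t
  proof (rule fixed_point_stable[where W="\<lambda>_. UNIV" and N="\<lambda>t u v. f t + ((a t + c0 p t) * u + c1 p t * v)" and h="\<lambda>_. 0", OF cg _ _ z(1) _ _ _ ab0])
    show "g t = f t + ((a t + c0 p t) * G g t + c1 p t * H g t)" for t
      unfolding G[symmetric] by (simp add: g_def algebra_simps)
    show "\<bar>f t + ((a t + c0 p t) * G (\<lambda>_. 0) t + c1 p t * H (\<lambda>_. 0) t) - 0\<bar> \<le> B" for t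
      using f(2) by (simp add: z)
    show "\<bar>f t + ((a t + c0 p t) * u + c1 p t * v) - (f t + ((a t + c0 p t) * u' + c1 p t * v'))\<bar> \<le> \<alpha>0 * \<bar>u - u'\<bar> + \<beta>0 * \<bar>v - v'\<bar>" for t u v u' v'
      using c_bound[OF p, of t "u - u'" "v - v'"] by (simp add: algebra_simps)
  qed auto
  then have g2: "\<bar>g t\<bar> \<le> 2 * B" for t by simp
  show hb: "\<bar>h t\<bar> \<le> M1 * (2 * B)" "\<bar>h1 t\<bar> \<le> M2 * (2 * B)" for t
    using GH_bound[OF cg g2] by (auto simp: G[symmetric])
  have "\<bar>f t + (c0 p t * h t + c1 p t * h1 t)\<bar> = \<bar>g t - a t * h t\<bar>" by (simp add: g_def)
  also have "\<dots> \<le> \<bar>g t\<bar> + \<bar>a t\<bar> * \<bar>h t\<bar>" unfolding abs_mult[symmetric] by (rule abs_triangle_ineq4)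
  also have "\<dots> \<le> 2 * B + \<bar>a t\<bar> * (M1 * (2 * B))" using g2 hb by (intro add_mono mult_left_mono) auto
  finally show "\<bar>f t + (c0 p t * h t + c1 p t * h1 t)\<bar> \<le> 2 * B + \<bar>a t\<bar> * (M1 * (2 * B))" .
qed

lemma linear_solvable:
  assumes p: "p \<in> pars" and f: "contper f"
  obtains h h1 where "\<And>t. (h has_real_derivative h1 t) (at t)"
    "\<And>t. (h1 has_real_derivative f t + (c0 p t * h t + c1 p t * h1 t)) (at t)" "periodic P h"
proof -
  obtain B where B: "\<And>t. \<bar>f t\<bar> \<le> B" "B \<ge> 0" using contper_sup[OF f] by metis
  note z = GH_zero
  have "\<exists>g. contper g \<and> (\<forall>t. \<bar>g t - 0\<bar> \<le> 2 * B) \<and> (\<forall>t. g t = f t + ((a t + c0 p t) * G g t + c1 p t * H g t))"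
  proof (rule fixed_point_exists[where W="\<lambda>_. UNIV" and N="\<lambda>t u v. f t + ((a t + c0 p t) * u + c1 p t * v)", OF z(1) _ _ _ _ ab0])
    fix g assume g: "contper g"
    show "contper (\<lambda>t. f t + ((a t + c0 p t) * G g t + c1 p t * H g t))"
      unfolding contper_def
    proof
      show "continuous_on UNIV (\<lambda>t. f t + ((a t + c0 p t) * G g t + c1 p t * H g t))"
        using c_contper[OF p] f contper_GH[OF g] Ck_on_continuous[OF smooth_a[of 0]]
        by (intro continuous_intros) (auto simp: contper_def)
      show "periodic P (\<lambda>t. f t + ((a t + c0 p t) * G g t + c1 p t * H g t))"
        using c_contper[OF p] f contper_GH[OF g] periodic_a by (simp add: periodic_def contper_def)
    qed
  next
    fix t u v u' v'
    show "\<bar>f t + ((a t + c0 p t) * u + c1 p t * v) - (f t + ((a t + c0 p t) * u' + c1 p t * v'))\<bar> \<le> \<alpha>0 * \<bar>u - u'\<bar> + \<beta>0 * \<bar>v - v'\<bar>"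
      using c_bound[OF p, of t "u - u'" "v - v'"] by (simp add: algebra_simps)
  qed (use B z in auto)
  then obtain g where g: "contper g" and eq: "\<And>t. g t = f t + ((a t + c0 p t) * G g t + c1 p t * H g t)" by blast
  show ?thesis
  proof (rule that)
    show "(G g has_real_derivative H g t) (at t)" for t by (rule G_deriv[OF g])
    show "(H g has_real_derivative f t + (c0 p t * G g t + c1 p t * H g t)) (at t)" for t
      by (rule DERIV_cong[OF H_deriv[OF g]]) (subst eq, simp add: algebra_simps)
    show "periodic P (G g)" by (rule periodic_GH(1)[OF g])
  qed
qed

text \<open>With h bounded up to second order, the lower order part is Lipschitz. It therefore lies
  in each Hoelder class with exponent between 0 and 1, and only the leading term has to be estimated
  in the Hoelder seminorm.\<close>

lemma lower_order_bounds:
  assumes p: "p \<in> pars"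
  obtains C where "C > 0"
    and "\<And>h h1 h2 n s t. (\<And>t. (h has_real_derivative h1 t) (at t)) \<Longrightarrow> (\<And>t. (h1 has_real_derivative h2 t) (at t)) \<Longrightarrow>
      (\<And>t. \<bar>h t\<bar> \<le> n) \<Longrightarrow> (\<And>t. \<bar>h1 t\<bar> \<le> n) \<Longrightarrow> (\<And>t. \<bar>h2 t\<bar> \<le> n) \<Longrightarrow>
      \<bar>c0 p t * h t + c1 p t * h1 t\<bar> \<le> C * n \<and>
      \<bar>(c0 p s * h s + c1 p s * h1 s) - (c0 p t * h t + c1 p t * h1 t)\<bar> \<le> C * n * \<bar>s - t\<bar>"
proof -
  note d1 = Ck_on_all_DERIV[OF c_Ck(1)[OF p]] and d2 = Ck_on_all_DERIV[OF c_Ck(2)[OF p]]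
  have b: "\<exists>B>0. \<forall>t. \<bar>u t\<bar> \<le> B" if u: "Ck_on 0 u UNIV" "periodic P u" for u :: "real \<Rightarrow> real"
    using periodic_bounded[OF P_pos u(2) Ck_on_continuous[OF u(1)]] by blast
  obtain B0 B1 D0 D1 where B: "B0 > 0" "B1 > 0" "D0 > 0" "D1 > 0" "\<And>t. \<bar>c0 p t\<bar> \<le> B0" "\<And>t. \<bar>c1 p t\<bar> \<le> B1"
    "\<And>t. \<bar>deriv (c0 p) t\<bar> \<le> D0" "\<And>t. \<bar>deriv (c1 p) t\<bar> \<le> D1"
    using b[OF c_Ck(1)[OF p] c_per(1)[OF p]] b[OF c_Ck(2)[OF p] c_per(2)[OF p]]
      b[OF d1(2) periodic_deriv[OF c_per(1)[OF p] d1(1)]] b[OF d2(2) periodic_deriv[OF c_per(2)[OF p] d2(1)]] by blast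
  define C where "C = (B0 + B1) + (D0 + D1)"
  show ?thesis
  proof (rule that[of C])
    show "C > 0" using B by (simp add: C_def)
    fix h h1 h2 :: "real \<Rightarrow> real" and n s t :: real
    assume h: "\<And>t. (h has_real_derivative h1 t) (at t)" "\<And>t. (h1 has_real_derivative h2 t) (at t)"
      and n: "\<And>t. \<bar>h t\<bar> \<le> n" "\<And>t. \<bar>h1 t\<bar> \<le> n" "\<And>t. \<bar>h2 t\<bar> \<le> n"
    have n0: "n \<ge> 0" using n(1)[of 0] by linarith
    have pr: "\<bar>u * v\<bar> \<le> U * n" if "\<bar>u\<bar> \<le> U" "\<bar>v\<bar> \<le> n" for u v U
      unfolding abs_mult using that by (intro mult_mono) auto
    have Cn: "C * n = B0 * n + B1 * n + (D0 * n + D1 * n)" by (simp add: C_def algebra_simps)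
    have nn: "0 \<le> B0 * n" "0 \<le> B1 * n" "0 \<le> D0 * n" "0 \<le> D1 * n" using B n0 by auto
    have "\<bar>(c0 p s * h s + c1 p s * h1 s) - (c0 p t * h t + c1 p t * h1 t)\<bar> \<le> C * n * \<bar>s - t\<bar>"
    proof (rule DERIV_bound_imp_Lipschitz)
      fix t
      show "((\<lambda>t. c0 p t * h t + c1 p t * h1 t) has_real_derivative
          (deriv (c0 p) t * h t + h1 t * c0 p t) + (deriv (c1 p) t * h1 t + h2 t * c1 p t)) (at t)"
        by (intro DERIV_add DERIV_mult d1(1) d2(1) h)
      show "\<bar>(deriv (c0 p) t * h t + h1 t * c0 p t) + (deriv (c1 p) t * h1 t + h2 t * c1 p t)\<bar> \<le> C * n"
        using pr[OF B(7)[of t] n(1)[of t]] pr[OF B(5)[of t] n(2)[of t]] pr[OF B(8)[of t] n(2)[of t]] pr[OF B(6)[of t] n(3)[of t]]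
        unfolding Cn by (simp add: mult.commute)
    qed
    moreover have "\<bar>c0 p t * h t + c1 p t * h1 t\<bar> \<le> C * n"
      using pr[OF B(5)[of t] n(1)[of t]] pr[OF B(6)[of t] n(2)[of t]] nn unfolding Cn by linarith
    ultimately show "\<bar>c0 p t * h t + c1 p t * h1 t\<bar> \<le> C * n \<and>
      \<bar>(c0 p s * h s + c1 p s * h1 s) - (c0 p t * h t + c1 p t * h1 t)\<bar> \<le> C * n * \<bar>s - t\<bar>" by blast
  qed
qed

lemma holder_contper: "f \<in> holder_per P 0 \<alpha> \<Longrightarrow> contper f"
  using holder0D(1,2)[OF P_pos] by (simp add: contper_def)

lemma deriv_X: "p \<in> pars \<Longrightarrow> deriv (X L p) = Y L p" "p \<in> pars \<Longrightarrow> deriv (Y L p) = (\<lambda>t. vf (jet p t))"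
  by (intro ext DERIV_imp_deriv X_facts(1,2)[OF near_L]; assumption)+

lemma L_deriv: "(L has_real_derivative deriv L t) (at t)"
  by (rule Ck_on_all_DERIV(1)[OF L_smooth])

abbreviation djet :: "real \<times> real \<Rightarrow> real \<Rightarrow> jet" where
  "djet p t \<equiv> (deriv L t, Y L p t, vf (jet p t), 0)"

lemma jet_curve:
  assumes p: "p \<in> pars"
  shows "(jet p has_vector_derivative djet p t) (at t)"
    and "compact (range (jet p))" "range (jet p) \<subseteq> rhs_dom" "\<exists>B. \<forall>t. norm (djet p t) \<le> B"
proof -
  note xf = X_facts[OF near_L p]
  show z: "(jet p has_vector_derivative djet p t) (at t)" for t
    using L_deriv[of t] xf(1,2)[of t]
    by (intro has_vector_derivative_Pair has_vector_derivative_const)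
      (simp_all add: real_vector_derivative)
  have cj: "continuous_on UNIV (jet p)"
    using z by (auto intro!: continuous_at_imp_continuous_on has_vector_derivative_continuous)
  have pj: "periodic P (jet p)" unfolding periodic_def by (intro allI jet_per[OF p])
  have cL': "continuous_on UNIV (deriv L)" using Ck_on_continuous[OF Ck_on_all_DERIV(2)[OF L_smooth, of 0]] .
  have cr: "continuous_on UNIV (\<lambda>t. vf (jet p t))"
    by (rule continuous_on_compose2[OF Ck_on_continuous[OF Ck_on_rhs[of 0]] cj]) (use xf(5) in auto)
  have cz: "continuous_on UNIV (\<lambda>t. norm (djet p t))"
    using xf(7) by (intro continuous_on_norm continuous_on_Pair cL' cr continuous_on_const) (simp add: contper_def)
  have pz: "periodic P (\<lambda>t. norm (djet p t))"
    using periodic_deriv[OF L_periodic L_deriv] xf(4) jet_per[OF p] by (simp add: periodic_def)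
  obtain B where B: "\<And>t. \<bar>norm (djet p t)\<bar> \<le> B" using periodic_bounded[OF P_pos pz cz] by blast
  show "compact (range (jet p))" by (rule periodic_compact_range[OF P_pos pj cj])
  show "range (jet p) \<subseteq> rhs_dom" using xf(5) by blast
  show "\<exists>B. \<forall>t. norm (djet p t) \<le> B"
  proof (intro exI allI)
    show "norm (djet p t) \<le> B" for t using B[of t] by (rule order_trans[OF abs_ge_self])
  qed
qed

lemma lin_holder:
  assumes p: "p \<in> pars" and \<alpha>: "0 < \<alpha>" "\<alpha> < 1"
  shows "\<exists>K. \<forall>h\<in>holder_per P 2 \<alpha>. lin p h \<in> holder_per P 0 \<alpha> \<and> holder_norm 0 \<alpha> (lin p h) \<le> K * holder_norm 2 \<alpha> h"
proof -
  obtain C where C: "C > 0" and lo: "\<And>h h1 h2 n s t. (\<And>t. (h has_real_derivative h1 t) (at t)) \<Longrightarrow> (\<And>t. (h1 has_real_derivative h2 t) (at t)) \<Longrightarrow>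
      (\<And>t. \<bar>h t\<bar> \<le> n) \<Longrightarrow> (\<And>t. \<bar>h1 t\<bar> \<le> n) \<Longrightarrow> (\<And>t. \<bar>h2 t\<bar> \<le> n) \<Longrightarrow>
      \<bar>c0 p t * h t + c1 p t * h1 t\<bar> \<le> C * n \<and>
      \<bar>(c0 p s * h s + c1 p s * h1 s) - (c0 p t * h t + c1 p t * h1 t)\<bar> \<le> C * n * \<bar>s - t\<bar>"
    by (rule lower_order_bounds[OF p]) blast
  have "lin p h \<in> holder_per P 0 \<alpha> \<and> holder_norm 0 \<alpha> (lin p h) \<le> (2 + 4 * C) * holder_norm 2 \<alpha> h"
    if h: "h \<in> holder_per P 2 \<alpha>" for h
  proof -
    note hD = holder2D[OF P_pos h]
    define n where "n = holder_norm 2 \<alpha> h"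
    have n0: "n \<ge> 0" unfolding n_def by (rule holder_per_bounds(3)[OF P_pos h])
    define u where "u t = c0 p t * h t + c1 p t * deriv h t" for t
    have u: "\<bar>u t\<bar> \<le> C * n" "\<bar>u s - u t\<bar> \<le> C * n * \<bar>s - t\<bar>" for s t
      using lo[OF hD(1,2,7,8,9)] unfolding u_def n_def by blast+
    have uh: "\<bar>u s - u t\<bar> \<le> (2 * (C * n) + C * n) * \<bar>s - t\<bar> powr \<alpha>" for s t
      by (rule Lipschitz_imp_holder[OF \<alpha> u]) (use C n0 in simp)
    have cont: "continuous_on UNIV h" "continuous_on UNIV (deriv h)"
      using hD(1,2) by (auto intro!: continuous_at_imp_continuous_on DERIV_isCont)
    have l: "lin p h = (\<lambda>t. deriv (deriv h) t - u t)" by (simp add: lin_def u_def fun_eq_iff)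
    have per: "periodic P (lin p h)"
      using hD(4,5,6) c_per[OF p] by (simp add: lin_def periodic_def)
    have c: "continuous_on UNIV (lin p h)"
      unfolding l u_def[abs_def] using c_contper[OF p] hD(3) cont by (intro continuous_intros) (auto simp: contper_def)
    have s: "\<bar>lin p h t\<bar> \<le> n + C * n" for t
      using u(1)[of t] hD(9)[of t] unfolding l n_def by linarith
    have q: "\<bar>lin p h s - lin p h t\<bar> \<le> (n + (2 * (C * n) + C * n)) * \<bar>s - t\<bar> powr \<alpha>" for s t
      using uh[of s t] hD(10)[of s t] unfolding l n_def[symmetric] distrib_right by linarith
    show ?thesis
      using holder0I[OF per c s q] unfolding n_def[symmetric] by (simp add: algebra_simps)
  qed
  then show ?thesis by blast
qed

text \<open>The one-dimensional Schauder estimate: the sup bounds control h and h', the equation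
  then controls h'', and the seminorm of h'' is that of f plus a Lipschitz term.\<close>

lemma lin_inverse_bound:
  assumes p: "p \<in> pars" and \<alpha>: "0 < \<alpha>" "\<alpha> < 1"
  obtains K where "\<And>f h h1. f \<in> holder_per P 0 \<alpha> \<Longrightarrow> (\<And>t. (h has_real_derivative h1 t) (at t)) \<Longrightarrow>
    (\<And>t. (h1 has_real_derivative f t + (c0 p t * h t + c1 p t * h1 t)) (at t)) \<Longrightarrow> periodic P h \<Longrightarrow>
    h \<in> holder_per P 2 \<alpha> \<and> holder_norm 2 \<alpha> h \<le> K * holder_norm 0 \<alpha> f"
proof -
  obtain C where C: "C > 0" and lo: "\<And>h h1 h2 n s t. (\<And>t. (h has_real_derivative h1 t) (at t)) \<Longrightarrow> (\<And>t. (h1 has_real_derivative h2 t) (at t)) \<Longrightarrow>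
      (\<And>t. \<bar>h t\<bar> \<le> n) \<Longrightarrow> (\<And>t. \<bar>h1 t\<bar> \<le> n) \<Longrightarrow> (\<And>t. \<bar>h2 t\<bar> \<le> n) \<Longrightarrow>
      \<bar>c0 p t * h t + c1 p t * h1 t\<bar> \<le> C * n \<and>
      \<bar>(c0 p s * h s + c1 p s * h1 s) - (c0 p t * h t + c1 p t * h1 t)\<bar> \<le> C * n * \<bar>s - t\<bar>"
    by (rule lower_order_bounds[OF p]) blast
  obtain am where am: "am > 0" "\<And>t. \<bar>a t\<bar> \<le> am"
    using periodic_bounded[OF P_pos periodic_a Ck_on_continuous[OF smooth_a[of 0]]] by blast
  \<comment> \<open>\<open>E * B\<close> dominates the a priori bounds of h, h' and h'' at once, the
    last through the maximum of a.\<close>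
  define E where "E = 2 * M1 + 2 * M2 + (2 + am * (2 * M1))"
  have E0: "E \<ge> 0" using M_pos am by (simp add: E_def)
  show ?thesis
  proof (rule that)
    fix f h h1 assume f: "f \<in> holder_per P 0 \<alpha>" and h: "\<And>t. (h has_real_derivative h1 t) (at t)"
      and h1: "\<And>t. (h1 has_real_derivative f t + (c0 p t * h t + c1 p t * h1 t)) (at t)" and per: "periodic P h"
    define B where "B = holder_norm 0 \<alpha> f"
    have B0: "B \<ge> 0" unfolding B_def by (rule holder_per_bounds(3)[OF P_pos f])
    note fD = holder0D[OF P_pos f, folded B_def]
    note ap = linear_apriori[OF p holder_contper[OF f] fD(3) h h1 per]
    define n where "n = E * B"
    have EB: "n = M1 * (2 * B) + M2 * (2 * B) + (2 * B + am * (M1 * (2 * B)))" by (simp add: n_def E_def algebra_simps)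
    have nn: "0 \<le> M1 * (2 * B)" "0 \<le> M2 * (2 * B)" "0 \<le> am * (M1 * (2 * B))" using M_pos B0 am by auto
    have b: "\<bar>h t\<bar> \<le> n" "\<bar>h1 t\<bar> \<le> n" for t using ap(1,2)[of t] nn B0 unfolding EB by linarith+
    have "\<bar>a t\<bar> * (M1 * (2 * B)) \<le> am * (M1 * (2 * B))" for t using am(2) nn by (intro mult_right_mono) auto
    then have b2: "\<bar>f t + (c0 p t * h t + c1 p t * h1 t)\<bar> \<le> n" for t using ap(3)[of t] nn B0 unfolding EB by (smt (verit))
    have n0: "n \<ge> 0" using E0 B0 by (simp add: n_def)
    define u where "u t = c0 p t * h t + c1 p t * h1 t" for t
    have u: "\<bar>u t\<bar> \<le> C * n" "\<bar>u s - u t\<bar> \<le> C * n * \<bar>s - t\<bar>" for s t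
      using lo[OF h h1 b b2] unfolding u_def by blast+
    have uh: "\<bar>u s - u t\<bar> \<le> (2 * (C * n) + C * n) * \<bar>s - t\<bar> powr \<alpha>" for s t
      by (rule Lipschitz_imp_holder[OF \<alpha> u]) (use C n0 in simp)
    have q: "\<bar>(f s + u s) - (f t + u t)\<bar> \<le> (B + (2 * (C * n) + C * n)) * \<bar>s - t\<bar> powr \<alpha>" for s t
      using uh[of s t] fD(4)[of s t] unfolding distrib_right by linarith
    have c: "continuous_on UNIV (\<lambda>t. f t + (c0 p t * h t + c1 p t * h1 t))"
      using c_contper[OF p] fD(1) h h1
      by (intro continuous_intros) (auto simp: contper_def intro!: continuous_at_imp_continuous_on DERIV_isCont)
    have "h \<in> holder_per P 2 \<alpha>" "holder_norm 2 \<alpha> h \<le> n + n + n + (B + (2 * (C * n) + C * n))"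
      using holder2I[OF per h h1 c b b2 q[unfolded u_def]] by auto
    then show "h \<in> holder_per P 2 \<alpha> \<and> holder_norm 2 \<alpha> h \<le> (3 * E + 1 + 3 * C * E) * holder_norm 0 \<alpha> f"
      unfolding B_def[symmetric] by (simp add: n_def algebra_simps)
  qed
qed

lemma lin_solution:
  assumes h: "h \<in> holder_per P 2 \<alpha>"
  shows "\<And>t. (h has_real_derivative deriv h t) (at t)"
    "\<And>t. (deriv h has_real_derivative lin p h t + (c0 p t * h t + c1 p t * deriv h t)) (at t)" "periodic P h"
  using holder2D(1,2,4)[OF P_pos h] by (simp_all add: lin_def)

lemma lin_comb:
  assumes "h \<in> holder_per P 2 \<alpha>" "h' \<in> holder_per P 2 \<alpha>"
  shows "lin p (\<lambda>t. s * h t + s' * h' t) = (\<lambda>t. s * lin p h t + s' * lin p h' t)"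
    and "deriv (\<lambda>t. s * h t + s' * h' t) = (\<lambda>t. s * deriv h t + s' * deriv h' t)"
proof -
  note hD = holder2D(1,2)[OF P_pos assms(1)] and hD' = holder2D(1,2)[OF P_pos assms(2)]
  show 1: "deriv (\<lambda>t. s * h t + s' * h' t) = (\<lambda>t. s * deriv h t + s' * deriv h' t)"
    by (intro ext DERIV_imp_deriv DERIV_add DERIV_cmult hD(1) hD'(1))
  have 2: "deriv (\<lambda>t. s * deriv h t + s' * deriv h' t) = (\<lambda>t. s * deriv (deriv h) t + s' * deriv (deriv h') t)"
    by (intro ext DERIV_imp_deriv DERIV_add DERIV_cmult hD(2) hD'(2))
  show "lin p (\<lambda>t. s * h t + s' * h' t) = (\<lambda>t. s * lin p h t + s' * lin p h' t)"
    unfolding lin_def[abs_def] 1 2 by (auto simp: algebra_simps)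
qed

lemma lin_remainder:
  assumes p: "p \<in> pars" and \<alpha>: "0 < \<alpha>" "\<alpha> < 1" and e: "e > 0"
  shows "\<exists>\<theta>>0. \<forall>h\<in>holder_per P 2 \<alpha>. holder_norm 2 \<alpha> h < \<theta> \<longrightarrow>
        (let rem = (\<lambda>t. magnitude_residual k1 k2 d1 L (fst p) (snd p) (\<lambda>s. X L p s + h s) t
                        - magnitude_residual k1 k2 d1 L (fst p) (snd p) (X L p) t - lin p h t) in
         rem \<in> holder_per P 0 \<alpha> \<and> holder_norm 0 \<alpha> rem \<le> e * holder_norm 2 \<alpha> h)"
proof -
  note xf = X_facts[OF near_L p]
  note z = jet_curve(1)[OF p] and K = jet_curve(2,3)[OF p]
  obtain B where B': "\<And>t. norm (djet p t) \<le> B" using jet_curve(4)[OF p] by blast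
  \<comment> \<open>The jet increment and its derivative have norm at most \<open>2 * n\<close>, and
    passing from sup and Lipschitz bounds to the Hoelder norm costs a factor \<open>3 + 1\<close>;
    hence the eighth.\<close>
  have e8: "e / 8 > 0" using e by simp
  let ?rem = "\<lambda>H t. vf (jet p t + H t) - vf (jet p t) - fderiv vf (jet p t) (H t)"
  obtain \<theta> where \<theta>: "\<theta> > 0" and T: "\<forall>\<eta> H H'. \<eta> < \<theta> \<longrightarrow> (\<forall>t. (H has_vector_derivative H' t) (at t)) \<longrightarrow>
     (\<forall>t. norm (H t) \<le> \<eta> \<and> norm (H' t) \<le> \<eta>) \<longrightarrow>
     (\<forall>s t. \<bar>?rem H t\<bar> \<le> e / 8 * \<eta> \<and> \<bar>?rem H s - ?rem H t\<bar> \<le> e / 8 * \<eta> * \<bar>s - t\<bar>)"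
    using Taylor_remainder_along_curve[where \<phi>="vf", OF open_rhs_dom Ck_on_rhs z B' K rangeI e8] by (elim exE conjE)
  show ?thesis
  proof (intro exI[of _ "\<theta> / 2"] conjI ballI impI)
    show "\<theta> / 2 > 0" using \<theta> by simp
    fix h assume h: "h \<in> holder_per P 2 \<alpha>" and hn: "holder_norm 2 \<alpha> h < \<theta> / 2"
    note hD = holder2D[OF P_pos h]
    define n where "n = holder_norm 2 \<alpha> h"
    have n0: "n \<ge> 0" unfolding n_def by (rule holder_per_bounds(3)[OF P_pos h])
    define H' where "H' = (\<lambda>t. (0::real, h t, deriv h t, 0::real \<times> real))"
    define H'' where "H'' = (\<lambda>t. (0::real, deriv h t, deriv (deriv h) t, 0::real \<times> real))"
    have dH: "(H' has_vector_derivative H'' t) (at t)" for t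
      unfolding H'_def H''_def using hD(1,2)[of t]
      by (intro has_vector_derivative_Pair has_vector_derivative_const)
        (simp_all add: real_vector_derivative)
    have nt: "norm (0::real, u, v, 0::real \<times> real) \<le> \<bar>u\<bar> + \<bar>v\<bar>" for u v
      using norm_Pair_le[of "0::real" "(u, v, 0::real \<times> real)"] norm_Pair_le[of u "(v, 0::real \<times> real)"] norm_Pair_le[of v "0::real \<times> real"]
      by simp
    have nH: "norm (H' t) \<le> 2 * n \<and> norm (H'' t) \<le> 2 * n" for t
      using nt[of "h t" "deriv h t"] nt[of "deriv h t" "deriv (deriv h) t"] hD(7,8,9)[of t]
      unfolding H'_def H''_def n_def by linarith
    have n\<theta>: "2 * n < \<theta>" using hn by (simp add: n_def)
    define rem where "rem = ?rem H'"
    have r: "\<bar>rem t\<bar> \<le> e / 8 * (2 * n) \<and> \<bar>rem s - rem t\<bar> \<le> e / 8 * (2 * n) * \<bar>s - t\<bar>" for s t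
      using T[rule_format, OF n\<theta> dH nH] unfolding rem_def by blast
    have d1: "deriv (\<lambda>s. X L p s + h s) = (\<lambda>t. Y L p t + deriv h t)"
      by (intro ext DERIV_imp_deriv DERIV_add xf hD)
    have d2: "deriv (\<lambda>t. Y L p t + deriv h t) = (\<lambda>t. vf (jet p t) + deriv (deriv h) t)"
      by (intro ext DERIV_imp_deriv DERIV_add xf hD)
    have eq: "(\<lambda>t. magnitude_residual k1 k2 d1 L (fst p) (snd p) (\<lambda>s. X L p s + h s) t
         - magnitude_residual k1 k2 d1 L (fst p) (snd p) (X L p) t - lin p h t) = (\<lambda>t. - rem t)"
      unfolding residual_rhs d1 d2 deriv_X[OF p] lin_def rem_def H'_def rhs_derivative_split[OF p] by (simp add: fun_eq_iff)
    have per: "periodic P (\<lambda>t. - rem t)"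
      using hD(4,5) jet_per[OF p] by (simp add: periodic_def rem_def H'_def)
    have r1': "\<bar>- rem t\<bar> \<le> e / 8 * (2 * n)" for t using r[of t] by simp
    have r2': "\<bar>- rem s - - rem t\<bar> \<le> e / 8 * (2 * n) * \<bar>s - t\<bar>" for s t using r[of s t] by (simp add: abs_minus_commute)
    have "0 \<le> e / 8 * (2 * n)" using e n0 by simp
    from Lipschitz_holder0[OF \<alpha> per r1' r2' this]
    show "let rem = (\<lambda>t. magnitude_residual k1 k2 d1 L (fst p) (snd p) (\<lambda>s. X L p s + h s) t
                        - magnitude_residual k1 k2 d1 L (fst p) (snd p) (X L p) t - lin p h t) in
         rem \<in> holder_per P 0 \<alpha> \<and> holder_norm 0 \<alpha> rem \<le> e * holder_norm 2 \<alpha> h"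
      unfolding Let_def eq n_def by simp
  qed
qed

lemma linearization_invertible:
  assumes p: "p \<in> pars" and \<alpha>: "0 < \<alpha>" "\<alpha> < 1"
  shows "linearization_invertible k1 k2 d1 P \<alpha> L (fst p) (snd p) (X L p)"
proof -
  obtain K where K: "\<And>f h h1. f \<in> holder_per P 0 \<alpha> \<Longrightarrow> (\<And>t. (h has_real_derivative h1 t) (at t)) \<Longrightarrow>
    (\<And>t. (h1 has_real_derivative f t + (c0 p t * h t + c1 p t * h1 t)) (at t)) \<Longrightarrow> periodic P h \<Longrightarrow>
    h \<in> holder_per P 2 \<alpha> \<and> holder_norm 2 \<alpha> h \<le> K * holder_norm 0 \<alpha> f"
    by (rule lin_inverse_bound[OF p \<alpha>]) blast
  have maps: "lin p h \<in> holder_per P 0 \<alpha>" if "h \<in> holder_per P 2 \<alpha>" for h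
    using lin_holder[OF p \<alpha>] that by blast
  have "residual_derivative k1 k2 d1 P \<alpha> L (fst p) (snd p) (X L p) (lin p)"
    unfolding residual_derivative_def
    using maps lin_comb(1) lin_holder[OF p \<alpha>] lin_remainder[OF p \<alpha>] by blast
  moreover have "bij_betw (lin p) (holder_per P 2 \<alpha>) (holder_per P 0 \<alpha>)"
    unfolding bij_betw_def
  proof
    show "inj_on (lin p) (holder_per P 2 \<alpha>)"
    proof (rule inj_onI)
      fix h h' assume h: "h \<in> holder_per P 2 \<alpha>" "h' \<in> holder_per P 2 \<alpha>" and eq: "lin p h = lin p h'"
      note s = lin_solution(1)[OF h(1)] lin_solution(2)[OF h(1), of p] lin_solution(3)[OF h(1)]
        and s' = lin_solution(1)[OF h(2)] lin_solution(2)[OF h(2), of p] lin_solution(3)[OF h(2)]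
      have "\<bar>h t - h' t\<bar> \<le> M1 * (2 * 0)" for t
      proof (rule linear_apriori(1)[OF p, where f="\<lambda>_. 0" and h="\<lambda>t. h t - h' t" and ?h1.0="\<lambda>t. deriv h t - deriv h' t"])
        show "((\<lambda>t. h t - h' t) has_real_derivative deriv h t - deriv h' t) (at t)" for t
          by (rule DERIV_diff[OF s(1) s'(1)])
        show "((\<lambda>t. deriv h t - deriv h' t) has_real_derivative 0 + (c0 p t * (h t - h' t) + c1 p t * (deriv h t - deriv h' t))) (at t)" for t
          by (rule DERIV_cong[OF DERIV_diff[OF s(2) s'(2)]]) (simp add: eq algebra_simps)
        show "periodic P (\<lambda>t. h t - h' t)" using s(3) s'(3) by (simp add: periodic_def)
      qed (auto simp: contper_def periodic_def)
      then show "h = h'" by (auto simp: fun_eq_iff)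
    qed
    show "lin p ` holder_per P 2 \<alpha> = holder_per P 0 \<alpha>"
    proof (intro equalityI subsetI)
      fix f assume f: "f \<in> holder_per P 0 \<alpha>"
      obtain h h1 where h: "\<And>t. (h has_real_derivative h1 t) (at t)"
        "\<And>t. (h1 has_real_derivative f t + (c0 p t * h t + c1 p t * h1 t)) (at t)" "periodic P h"
        using linear_solvable[OF p holder_contper[OF f]] by blast
      have "deriv h = h1" "deriv h1 = (\<lambda>t. f t + (c0 p t * h t + c1 p t * h1 t))"
        using h(1,2) by (auto intro!: ext DERIV_imp_deriv)
      then have "lin p h = f" by (auto simp: lin_def)
      moreover have "h \<in> holder_per P 2 \<alpha>" using K[OF f h] by blast
      ultimately show "f \<in> lin p ` holder_per P 2 \<alpha>" by blast
    qed (use maps in auto)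
  qed
  moreover have "holder_norm 2 \<alpha> h \<le> K * holder_norm 0 \<alpha> (lin p h)" if "h \<in> holder_per P 2 \<alpha>" for h
    using K[OF maps[OF that] lin_solution[OF that]] by blast
  ultimately show ?thesis unfolding linearization_invertible_def by blast
qed

section \<open>From branch points to data, and closeness of branches\<close>

lemma pars_mu_pos: assumes "p \<in> pars" shows "fst p > 0"
proof -
  have "dist (fst p) \<mu>0 \<le> dist p (\<mu>0, 0)" using dist_fst_le[of p "(\<mu>0, 0)"] by simp
  then show ?thesis using assms \<mu>0 by (simp add: pars_iff dist_real_def)
qed

lemma branch_datum_solution:
  assumes "near l" "\<And>t. (l has_real_derivative l' t) (at t)" "p \<in> pars" "snd p > 0"
  shows "datum_solution k1 k2 d1 d2 P l l' (X l p) (Y l p) (fst p) (snd p)"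
  using k2_pos d2_pos P_pos pars_mu_pos[OF assms(3)] assms(4) assms(2) nearD(2)[OF assms(1)] X_facts[OF assms(1,3)]
  by unfold_locales (auto simp: contper_def)

lemma datum_return_ret:
  assumes "near l" "\<And>t. (l has_real_derivative l' t) (at t)" "p \<in> pars" "snd p > 0"
  shows "datum_return k2 d2 P (fst p) (snd p) (X l p) = ret l p"
  using datum_solution.datum_return_eq[OF branch_datum_solution[OF assms]] by (simp add: ret_def)

lemma sol_eq:
  assumes "near l" "p \<in> pars"
  shows "sol l p t = vf (l t, X l p t, Y l p t, p) + a t * X l p t"
  using sol_facts(2)[OF assms, of t] by (simp add: Nfun_def X_def Y_def)

text \<open>Closeness of l' is included because Hoelder norms of x'' are estimated through the
  derivative of the right-hand side along the jet, and that derivative contains l'.\<close>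

definition close_to :: "real \<Rightarrow> real \<times> real \<Rightarrow> (real \<Rightarrow> real) \<Rightarrow> (real \<Rightarrow> real) \<Rightarrow> real \<times> real \<Rightarrow> bool" where
  "close_to \<theta> p0 l l' p \<longleftrightarrow> near l \<and> p \<in> pars \<and> dist p p0 < \<theta> \<and>
     (\<forall>t. (l has_real_derivative l' t) (at t) \<and> \<bar>l t - L t\<bar> < \<theta> \<and> \<bar>l' t - deriv L t\<bar> < \<theta> \<and>
       \<bar>X l p t - X L p0 t\<bar> < \<theta> \<and> \<bar>Y l p t - Y L p0 t\<bar> < \<theta>)"

text \<open>The second derivatives are values of the same right-hand side along two nearby jets, so
  sup closeness of X and Y already controls them. For the Hoelder seminorm the difference is shown
  to be Lipschitz with a small constant.\<close>

lemma C2_close: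
  assumes p0: "p0 \<in> pars" and \<alpha>: "0 < \<alpha>" "\<alpha> < 1" and e: "e > 0"
  shows "\<exists>\<theta>>0. \<forall>l l' p. close_to \<theta> p0 l l' p \<longrightarrow>
      (\<lambda>t. X l p t - X L p0 t) \<in> holder_per P 2 \<alpha> \<and> holder_norm 2 \<alpha> (\<lambda>t. X l p t - X L p0 t) < e"
proof -
  note z = jet_curve(1)[OF p0] and K = jet_curve(2,3)[OF p0] rangeI[of "jet p0"]
  obtain B where B: "\<And>t. norm (djet p0 t) \<le> B" using jet_curve(4)[OF p0] by blast
  note x0f = X_facts[OF near_L p0]
  define e1 where "e1 = e / 8"
  have e1: "e1 > 0" using e by (simp add: e1_def)
  obtain \<theta>1 where \<theta>1: "\<theta>1 > 0"
    and val: "\<And>t v. norm v < \<theta>1 \<Longrightarrow> jet p0 t + v \<in> rhs_dom \<and> \<bar>vf (jet p0 t + v) - vf (jet p0 t)\<bar> \<le> e1"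
    and lip: "\<And>H H' s t. (\<And>t. (H has_vector_derivative H' t) (at t)) \<Longrightarrow> (\<And>t. norm (H t) < \<theta>1) \<Longrightarrow> (\<And>t. norm (H' t) < \<theta>1) \<Longrightarrow>
      \<bar>(vf (jet p0 s + H s) - vf (jet p0 s)) - (vf (jet p0 t + H t) - vf (jet p0 t))\<bar> \<le> e1 * \<bar>s - t\<bar>"
    using compose_close_along_curve[OF open_rhs_dom Ck_on_rhs z B K e1, unfolded real_norm_def] by blast
  \<comment> \<open>Two thresholds are needed: the derivative of the jet difference contains the
    difference of the right-hand sides, which must first be made small compared with
    \<open>\<theta>1\<close> before the Lipschitz estimate can be applied.\<close>
  define e2 where "e2 = \<theta>1 / 8"
  have e2: "e2 > 0" using \<theta>1 by (simp add: e2_def)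
  obtain \<theta>2 where \<theta>2: "\<theta>2 > 0"
    and val2: "\<And>t v. norm v < \<theta>2 \<Longrightarrow> jet p0 t + v \<in> rhs_dom \<and> \<bar>vf (jet p0 t + v) - vf (jet p0 t)\<bar> \<le> e2"
    and "\<And>H H' s t. (\<And>t. (H has_vector_derivative H' t) (at t)) \<Longrightarrow> (\<And>t. norm (H t) < \<theta>2) \<Longrightarrow> (\<And>t. norm (H' t) < \<theta>2) \<Longrightarrow>
      \<bar>(vf (jet p0 s + H s) - vf (jet p0 s)) - (vf (jet p0 t + H t) - vf (jet p0 t))\<bar> \<le> e2 * \<bar>s - t\<bar>"
    using compose_close_along_curve[OF open_rhs_dom Ck_on_rhs z B K e2, unfolded real_norm_def] by blast
  define \<theta> where "\<theta> = min e1 (min (\<theta>1 / 8) (\<theta>2 / 8))"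
  have \<theta>0: "\<theta> > 0" "\<theta> \<le> e1" "\<theta> \<le> \<theta>1 / 8" "\<theta> \<le> \<theta>2 / 8"
    using e1 \<theta>1 \<theta>2 by (simp_all add: \<theta>_def)
  then have \<theta>: "\<theta> > 0" "\<theta> \<le> e1" "4 * \<theta> < \<theta>1" "4 * \<theta> < \<theta>2" "3 * \<theta> + e2 < \<theta>1"
    unfolding e2_def using \<theta>1 \<theta>2 by linarith+
  show ?thesis
  proof (rule exI[of _ \<theta>], rule conjI[OF \<theta>(1)], intro allI impI)
    fix l l' p
    assume c: "close_to \<theta> p0 l l' p"
    have l: "near l" and p: "p \<in> pars" and cp: "dist p p0 < \<theta>" using c by (auto simp: close_to_def)
    have dl: "(l has_real_derivative l' t) (at t)" and cl: "\<bar>l t - L t\<bar> < \<theta>" "\<bar>l' t - deriv L t\<bar> < \<theta>"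
      and cX: "\<bar>X l p t - X L p0 t\<bar> < \<theta>" and cY: "\<bar>Y l p t - Y L p0 t\<bar> < \<theta>" for t
      using c by (auto simp: close_to_def)
    note xf = X_facts[OF l p]
    let ?zl = "\<lambda>t. (l t, X l p t, Y l p t, p)"
    define H' where "H' = (\<lambda>t. (l t - L t, X l p t - X L p0 t, Y l p t - Y L p0 t, p - p0))"
    define H'' where "H'' = (\<lambda>t. (l' t - deriv L t, Y l p t - Y L p0 t, vf (?zl t) - vf (jet p0 t), 0::real \<times> real))"
    have zH: "jet p0 t + H' t = ?zl t" for t by (simp add: H'_def)
    have nt: "norm (u, v, w, q) \<le> \<bar>u\<bar> + \<bar>v\<bar> + \<bar>w\<bar> + norm q" for u v w :: real and q :: "real \<times> real"
      using norm_Pair_le[of u "(v, w, q)"] norm_Pair_le[of v "(w, q)"] norm_Pair_le[of w q] by simp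
    have nH: "norm (H' t) < 4 * \<theta>" for t
      using nt[of "l t - L t" "X l p t - X L p0 t" "Y l p t - Y L p0 t" "p - p0"] cl(1)[of t] cX[of t] cY[of t] cp
      unfolding H'_def by (simp add: dist_norm)
    have r2: "\<bar>vf (?zl t) - vf (jet p0 t)\<bar> \<le> e2" for t
      using val2[of "H' t" t] nH[of t] \<theta>(4) unfolding zH by linarith
    have r1: "\<bar>vf (?zl t) - vf (jet p0 t)\<bar> \<le> e1" for t
      using val[of "H' t" t] nH[of t] \<theta>(3) unfolding zH by linarith
    have nH': "norm (H'' t) < \<theta>1" for t
      using nt[of "l' t - deriv L t" "Y l p t - Y L p0 t" "vf (?zl t) - vf (jet p0 t)" "0"]
        cl(2)[of t] cY[of t] r2[of t] \<theta>(1,5) unfolding H''_def by simp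
    have dH: "(H' has_vector_derivative H'' t) (at t)" for t
      unfolding H'_def H''_def using dl[of t] L_deriv[of t] xf(1,2)[of t] x0f(1,2)[of t]
      by (intro has_vector_derivative_Pair has_vector_derivative_const has_vector_derivative_diff)
        (simp_all add: real_vector_derivative)
    have nH1: "norm (H' t) < \<theta>1" for t using nH[of t] \<theta>(3) by linarith
    let ?f = "\<lambda>t. vf (?zl t) - vf (jet p0 t)"
    have q: "\<bar>?f s - ?f t\<bar> \<le> (2 * e1 + e1) * \<bar>s - t\<bar> powr \<alpha>" for s t
      by (rule Lipschitz_imp_holder[OF \<alpha> r1]) (use lip[OF dH nH1 nH', of s t] e1 in \<open>simp_all add: zH\<close>)
    have cf: "continuous_on UNIV ?f"
    proof -
      have "contper (\<lambda>t. vf (?zl t))" by (rule contper_rhs[OF l p xf(6,7,5)])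
      moreover have "contper (\<lambda>t. vf (jet p0 t))" by (rule contper_rhs[OF near_L p0 x0f(6,7,5)])
      ultimately show ?thesis by (intro continuous_on_diff) (auto simp: contper_def)
    qed
    have per: "periodic P (\<lambda>t. X l p t - X L p0 t)" using xf(3) x0f(3) by (simp add: periodic_def)
    note hI = holder2I[OF per DERIV_diff[OF xf(1) x0f(1)] DERIV_diff[OF xf(2) x0f(2)] cf less_imp_le[OF cX] less_imp_le[OF cY] r1 q]
    show "(\<lambda>t. X l p t - X L p0 t) \<in> holder_per P 2 \<alpha> \<and> holder_norm 2 \<alpha> (\<lambda>t. X l p t - X L p0 t) < e"
      using hI \<theta>(2) e by (simp add: e1_def)
  qed
qed
end

section \<open>Nondegeneracy and persistence\<close>

lemma deriv_funpow_lin: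
  fixes f g :: "real \<Rightarrow> real"
  assumes "Ck_on r f UNIV" "Ck_on r g UNIV" "j \<le> r"
  shows "(deriv ^^ j) (\<lambda>t. f t + c * g t) = (\<lambda>t. (deriv ^^ j) f t + c * (deriv ^^ j) g t)"
  using assms(3)
proof (induction j)
  case (Suc j)
  have C: "Ck_on (Suc (r - Suc j)) ((deriv ^^ j) f) UNIV" "Ck_on (Suc (r - Suc j)) ((deriv ^^ j) g) UNIV"
    using Ck_on_deriv_funpow[OF assms(1), of j] Ck_on_deriv_funpow[OF assms(2), of j] Suc.prems by (simp_all add: Suc_diff_Suc)
  have "deriv (\<lambda>t. (deriv ^^ j) f t + c * (deriv ^^ j) g t) = (\<lambda>t. deriv ((deriv ^^ j) f) t + c * deriv ((deriv ^^ j) g) t)"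
    using Ck_on_Suc_DERIV(1)[OF open_UNIV C(1)] Ck_on_Suc_DERIV(1)[OF open_UNIV C(2)]
    by (intro ext DERIV_imp_deriv DERIV_add DERIV_cmult) auto
  then show ?case using Suc by simp
qed simp

lemma holder_per_lin:
  assumes P: "P > 0" and f: "f \<in> holder_per P r \<alpha>" and g: "g \<in> holder_per P r \<alpha>"
  shows "(\<lambda>t. f t + c * g t) \<in> holder_per P r \<alpha>"
proof -
  have C: "Ck_on r f UNIV" "periodic P f" "Ck_on r g UNIV" "periodic P g" using f g by (auto simp: holder_per_def)
  let ?f = "(deriv ^^ r) f" and ?g = "(deriv ^^ r) g"
  have "\<bar>(?f s + c * ?g s) - (?f t + c * ?g t)\<bar> \<le> (holder_norm r \<alpha> f + \<bar>c\<bar> * holder_norm r \<alpha> g) * \<bar>s - t\<bar> powr \<alpha>" for s t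
  proof -
    have "\<bar>(?f s + c * ?g s) - (?f t + c * ?g t)\<bar> \<le> \<bar>?f s - ?f t\<bar> + \<bar>c\<bar> * \<bar>?g s - ?g t\<bar>"
      unfolding abs_mult[symmetric] using abs_triangle_ineq[of "?f s - ?f t" "c * (?g s - ?g t)"] by (simp add: algebra_simps)
    also have "\<dots> \<le> holder_norm r \<alpha> f * \<bar>s - t\<bar> powr \<alpha> + \<bar>c\<bar> * (holder_norm r \<alpha> g * \<bar>s - t\<bar> powr \<alpha>)"
      by (intro add_mono mult_left_mono holder_per_bounds(2)[OF P f] holder_per_bounds(2)[OF P g]) auto
    finally show ?thesis by (simp add: algebra_simps)
  qed
  then have "bdd_above (holder_quotients \<alpha> ((deriv ^^ r) (\<lambda>t. f t + c * g t)))"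
    unfolding deriv_funpow_lin[OF C(1,3) order_refl] by (rule Sup_holder_quotients_le(2))
  moreover have "Ck_on r (\<lambda>t. f t + c * g t) UNIV"
    by (intro Ck_on_add Ck_on_mult Ck_on_const open_UNIV C)
  ultimately show ?thesis using C by (simp add: holder_per_def periodic_def)
qed

lemma Ck_on_Suc_periodic_holder:
  assumes P: "P > 0" and \<alpha>: "0 < \<alpha>" "\<alpha> < 1" and f: "Ck_on (Suc r) f UNIV" "periodic P f"
  shows "f \<in> holder_per P r \<alpha>"
proof -
  have C: "Ck_on (Suc 0) ((deriv ^^ r) f) UNIV" using Ck_on_deriv_funpow[OF f(1), of r] by simp
  have p: "periodic P ((deriv ^^ r) f)" by (rule periodic_deriv_funpow[OF f]) simp
  note d = Ck_on_Suc_DERIV[OF open_UNIV C]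
  obtain B where B: "B > 0" "\<And>t. \<bar>deriv ((deriv ^^ r) f) t\<bar> \<le> B"
    using periodic_bounded[OF P periodic_deriv[OF p] Ck_on_continuous[OF d(2)]] d(1) by blast
  obtain A where A: "\<And>t. \<bar>(deriv ^^ r) f t\<bar> \<le> A"
    using periodic_bounded[OF P p Ck_on_continuous[OF C]] by blast
  have "\<bar>(deriv ^^ r) f s - (deriv ^^ r) f t\<bar> \<le> (2 * A + B) * \<bar>s - t\<bar> powr \<alpha>" for s t
    by (rule Lipschitz_imp_holder[OF \<alpha> A DERIV_bound_imp_Lipschitz[OF d(1) B(2)] less_imp_le[OF B(1)]]) simp
  from Sup_holder_quotients_le(2)[of "(deriv ^^ r) f", OF this] show ?thesis
    using f(2) Ck_on_Suc_imp[OF f(1)] by (simp add: holder_per_def)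
qed

section \<open>Local uniqueness, nondegeneracy and persistence\<close>

context magnitude_branch
begin

lemma uniform_in_param:
  fixes K :: "real \<times> real \<Rightarrow> real \<Rightarrow> real"
  assumes K: "continuous_on (pars \<times> UNIV) (\<lambda>z. K (fst z) (snd z))" "\<And>p. p \<in> pars \<Longrightarrow> periodic P (K p)"
    and p0: "p0 \<in> pars" and e: "e > 0"
  shows "\<exists>d>0. \<forall>p. dist p p0 < d \<longrightarrow> p \<in> pars \<and> (\<forall>t. \<bar>K p t - K p0 t\<bar> < e)"
proof -
  have "\<exists>d>0. \<forall>z\<in>{p0} \<times> {0..P}. \<forall>z'. dist z z' < d \<longrightarrow> z' \<in> pars \<times> UNIV \<and> dist (K (fst z') (snd z')) (K (fst z) (snd z)) < e"
    by (rule uniform_near_compact[OF open_Times[OF open_pars open_UNIV] K(1) compact_Times[OF _ compact_Icc] _ e]) (use p0 in auto)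
  then obtain d where d: "d > 0" "\<And>z z'. z \<in> {p0} \<times> {0..P} \<Longrightarrow> dist z z' < d \<Longrightarrow> z' \<in> pars \<times> UNIV \<and> dist (K (fst z') (snd z')) (K (fst z) (snd z)) < e"
    by metis
  show ?thesis
  proof (intro exI[of _ d] conjI d(1) allI impI)
    fix p assume p: "dist p p0 < d"
    have dd: "dist (p0, t) (p, t) < d" for t :: real using p by (simp add: dist_Pair_Pair dist_commute)
    show pp: "p \<in> pars" using d(2)[of "(p0, 0)" "(p, 0)"] dd[of 0] P_pos by simp
    fix t
    have per: "periodic P (\<lambda>t. K p t - K p0 t)" using K(2)[OF pp] K(2)[OF p0] by (simp add: periodic_def)
    show "\<bar>K p t - K p0 t\<bar> < e"
    proof (rule periodic_all[OF P_pos per, where A="\<lambda>v. \<bar>v\<bar> < e"])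
      fix t assume "t \<in> {0..P}"
      then show "\<bar>K p t - K p0 t\<bar> < e" using d(2)[of "(p0, t)" "(p, t)"] dd[of t] by (simp add: dist_real_def)
    qed
  qed
qed

lemma X_holder:
  assumes "p \<in> pars" "0 < \<alpha>" "\<alpha> < 1"
  shows "X L p \<in> holder_per P 2 \<alpha>"
proof -
  have "Ck_on n (X L p) UNIV" for n
    using Ck_on_compose[OF open_UNIV open_Times[OF open_pars open_UNIV] _ XY_Ck(1), of "\<lambda>t. (p, t)" n]
      assms(1) Ck_on_Pair[OF open_UNIV Ck_on_const Ck_on_ident[OF open_UNIV]] by auto
  then show ?thesis
    by (rule Ck_on_Suc_periodic_holder[OF P_pos assms(2,3)]) (rule X_facts(3)[OF near_L assms(1)])
qed

lemma XY_close:
  assumes "p0 \<in> pars" "e > 0"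
  shows "\<exists>d>0. \<forall>p. dist p p0 < d \<longrightarrow> p \<in> pars \<and> (\<forall>t. \<bar>X L p t - X L p0 t\<bar> < e \<and> \<bar>Y L p t - Y L p0 t\<bar> < e)"
proof -
  obtain d where d: "d > 0" "\<And>p. dist p p0 < d \<Longrightarrow> p \<in> pars \<and> (\<forall>t. \<bar>X L p t - X L p0 t\<bar> < e)"
    using uniform_in_param[OF XY_continuous(1)[OF near_L] X_facts(3)[OF near_L] assms] by blast
  obtain d' where d': "d' > 0" "\<And>p. dist p p0 < d' \<Longrightarrow> p \<in> pars \<and> (\<forall>t. \<bar>Y L p t - Y L p0 t\<bar> < e)"
    using uniform_in_param[OF XY_continuous(2)[OF near_L] X_facts(4)[OF near_L] assms] by blast
  show ?thesis using d d' by (intro exI[of _ "min d d'"]) auto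
qed

lemma branch_datum:
  assumes "p \<in> pars" "snd p > 0"
  shows "magnitude_datum k1 k2 d1 P L (fst p) (snd p) (X L p)"
  by (rule datum_solution.datum[OF branch_datum_solution[OF near_L L_deriv assms]])

text \<open>A datum close to the base solution in the second order norm has a source term close to
  \<open>sol L p0\<close>. As the latter is within \<open>3 * R / 4\<close> of \<open>ga\<close>,
  the datum stays in the ball of uniqueness, and this for every parameter of the disc.\<close>

lemma local_uniqueness:
  assumes p0: "p0 \<in> pars" and \<alpha>: "0 < \<alpha>" "\<alpha> < 1"
  shows "\<exists>\<eta>>0. \<forall>p\<in>pars. \<forall>y\<in>holder_per P 2 \<alpha>. holder_norm 2 \<alpha> (\<lambda>t. y t - X L p0 t) < \<eta> \<longrightarrow>
    magnitude_datum k1 k2 d1 P L (fst p) (snd p) y \<longrightarrow> y = X L p"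
proof -
  obtain am where am: "am > 0" "\<And>t. \<bar>a t\<bar> \<le> am"
    using periodic_bounded[OF P_pos periodic_a Ck_on_continuous[OF smooth_a[of 0]]] by blast
  \<comment> \<open>A change of at most \<eta> in x and x'' changes the source term by at most
    \<open>\<eta> * (1 + am) = R / 8\<close>, the gap between \<open>3 * R / 4\<close> and
    \<open>7 * R / 8\<close>.\<close>
  define \<eta> where "\<eta> = R / 8 / (1 + am)"
  have nz: "1 + am \<noteq> 0" using am(1) by simp
  have \<eta>: "\<eta> > 0" using R_pos am(1) by (simp add: \<eta>_def)
  have \<eta>_eq: "\<eta> * (1 + am) = R / 8" by (rule iffD1[OF nonzero_eq_divide_eq[OF nz] \<eta>_def])
  show ?thesis
  proof (intro exI[of _ \<eta>] conjI \<eta> ballI impI)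
    fix p y assume p: "p \<in> pars" and y: "y \<in> holder_per P 2 \<alpha>" and n: "holder_norm 2 \<alpha> (\<lambda>t. y t - X L p0 t) < \<eta>"
      and dat: "magnitude_datum k1 k2 d1 P L (fst p) (snd p) y"
    interpret D: datum_solution k1 k2 d1 d2 P L "deriv L" y "deriv y" "fst p" "snd p"
      by (rule magnitude_datum_solution[OF k2_pos d2_pos P_pos L_deriv L_periodic L_pos dat])
    have h: "(\<lambda>t. y t - X L p0 t) \<in> holder_per P 2 \<alpha>"
      using holder_per_lin[OF P_pos y X_holder[OF p0 \<alpha>], of "-1"] by simp
    note hD = holder2D[OF P_pos h]
    note xf = X_facts[OF near_L p0]
    have d1: "deriv (\<lambda>t. y t - X L p0 t) = (\<lambda>t. deriv y t - Y L p0 t)"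
      by (intro ext DERIV_imp_deriv DERIV_diff D.x_deriv xf)
    have d2: "deriv (\<lambda>t. deriv y t - Y L p0 t) = (\<lambda>t. vf (L t, y t, deriv y t, p) - vf (jet p0 t))"
      using D.y_deriv xf(2) by (intro ext DERIV_imp_deriv DERIV_diff) simp_all
    show "y = X L p"
    proof (rule X_unique(1)[OF near_L p D.x_deriv _ D.x_per])
      show "(deriv y has_real_derivative vf (L t, y t, deriv y t, p)) (at t)" for t
        using D.y_deriv[of t] by simp
      show "contper (\<lambda>t. vf (L t, y t, deriv y t, p))"
        using D.continuous_along[OF Ck_on_rhs] D.zz_per by (simp add: contper_def periodic_def)
      fix t
      have b1: "\<bar>y t - X L p0 t\<bar> \<le> \<eta>" using hD(7)[of t] n by linarith
      have b2: "\<bar>vf (L t, y t, deriv y t, p) - vf (jet p0 t)\<bar> \<le> \<eta>"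
        using hD(9)[of t] n unfolding d1 d2 by linarith
      have b3: "\<bar>a t * (y t - X L p0 t)\<bar> \<le> am * \<eta>"
        unfolding abs_mult using am b1 by (intro mult_mono) auto
      have b4: "\<bar>sol L p0 t - ga t\<bar> \<le> 3 * R / 4" by (rule sol_facts(3)[OF near_L p0])
      have "vf (L t, y t, deriv y t, p) + a t * y t - ga t
        = (vf (L t, y t, deriv y t, p) - vf (jet p0 t)) + a t * (y t - X L p0 t) + (sol L p0 t - ga t)"
        unfolding sol_eq[OF near_L p0] by (simp add: algebra_simps)
      moreover have "\<eta> + am * \<eta> = R / 8" using \<eta>_eq by (simp add: algebra_simps)
      ultimately show "\<bar>vf (L t, y t, deriv y t, p) + a t * y t - ga t\<bar> \<le> 7 * R / 8"
        using b2 b3 b4 by linarith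
    qed
  qed
qed

lemma branch_continuous:
  assumes p0: "p0 \<in> pars" and \<alpha>: "0 < \<alpha>" "\<alpha> < 1"
  shows "((\<lambda>p. holder_norm 2 \<alpha> (\<lambda>t. X L p t - X L p0 t)) \<longlongrightarrow> 0) (at p0)"
proof (rule tendstoI)
  fix e :: real assume e: "e > 0"
  obtain \<theta> where \<theta>: "\<theta> > 0" and close: "\<forall>l l' p. close_to \<theta> p0 l l' p \<longrightarrow>
      (\<lambda>t. X l p t - X L p0 t) \<in> holder_per P 2 \<alpha> \<and> holder_norm 2 \<alpha> (\<lambda>t. X l p t - X L p0 t) < e"
    using C2_close[OF p0 \<alpha> e] by (elim exE conjE)
  obtain d where d: "d > 0" "\<And>p. dist p p0 < d \<Longrightarrow> p \<in> pars \<and> (\<forall>t. \<bar>X L p t - X L p0 t\<bar> < \<theta> \<and> \<bar>Y L p t - Y L p0 t\<bar> < \<theta>)"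
    using XY_close[OF p0 \<theta>] by blast
  have "dist (holder_norm 2 \<alpha> (\<lambda>t. X L p t - X L p0 t)) 0 < e" if p: "dist p p0 < min d \<theta>" for p
  proof -
    have "close_to \<theta> p0 L (deriv L) p"
      using d(2)[of p] p near_L L_deriv \<theta> by (simp add: close_to_def)
    from close[rule_format, OF this]
    show ?thesis using holder_per_bounds(3)[OF P_pos] by (simp add: dist_real_def)
  qed
  moreover have "min d \<theta> > 0" using d(1) \<theta> by simp
  ultimately show "\<forall>\<^sub>F p in at p0. dist (holder_norm 2 \<alpha> (\<lambda>t. X L p t - X L p0 t)) 0 < e"
    unfolding eventually_at by blast
qed

lemma nondegenerate:
  assumes p: "p \<in> pars" "snd p > 0" "ret_det p \<noteq> 0" and \<alpha>: "0 < \<alpha>" "\<alpha> < 1"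
  shows "nondegenerate_datum k1 k2 d1 d2 P \<alpha> L (fst p) (snd p) (X L p)"
proof -
  \<comment> \<open>Data require \<open>\<delta> > 0\<close>, so on the rest of the disc the branch
    exists but the equivalence demanded by \<open>local_branch\<close> would fail.\<close>
  define U where "U = pars \<inter> {p. snd p > 0}"
  have U: "open U" "p \<in> U" unfolding U_def using p by (auto intro!: open_Int open_pars open_Collect_less continuous_intros)
  obtain \<eta> where \<eta>: "\<eta> > 0" and uniq: "\<And>q y. q \<in> pars \<Longrightarrow> y \<in> holder_per P 2 \<alpha> \<Longrightarrow> holder_norm 2 \<alpha> (\<lambda>t. y t - X L p t) < \<eta> \<Longrightarrow>
    magnitude_datum k1 k2 d1 P L (fst q) (snd q) y \<Longrightarrow> y = X L q"
    using local_uniqueness[OF p(1) \<alpha>] by blast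
  have "local_branch k1 k2 d1 P \<alpha> L (fst p) (snd p) (X L p) U (X L)"
    unfolding local_branch_def
  proof (intro conjI exI[of _ \<eta>] ballI impI)
    show "X L (fst p, snd p) = X L p" "(fst p, snd p) \<in> U" using U by simp_all
  qed (use U \<eta> uniq branch_datum branch_continuous \<alpha> X_holder in \<open>auto simp: U_def\<close>)
  moreover obtain D' where "bij (fderiv (ret L) p)"
    by (rule plane_map_inverse[OF has_derivative_linear[OF ret_derivative[OF p(1)]] p(3)[unfolded ret_det_def]])
  moreover have "((\<lambda>p. datum_return k2 d2 P (fst p) (snd p) (X L p)) has_derivative fderiv (ret L) p) (at (fst p, snd p))"
    using has_derivative_transform_within_open[OF ret_derivative[OF p(1)] U]
      datum_return_ret[OF near_L L_deriv] by (auto simp: U_def)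
  ultimately show ?thesis
    unfolding nondegenerate_datum_def
    using branch_datum[OF p(1,2)] X_holder[OF p(1) \<alpha>] linearization_invertible[OF p(1) \<alpha>] by blast
qed

lemma compact_jets:
  assumes "compact C" "C \<subseteq> pars"
  obtains K where "compact K" "K \<subseteq> rhs_dom" "\<And>p t. p \<in> C \<Longrightarrow> jet p t \<in> K"
proof
  let ?j = "\<lambda>z. jet (fst z) (snd z)"
  have c: "continuous_on (pars \<times> UNIV) ?j" using Ck_on_continuous[OF jet_Ck[of 0]] by simp
  show "compact (?j ` (C \<times> {0..P}))"
    by (intro compact_continuous_image continuous_on_subset[OF c] compact_Times assms(1) compact_Icc) (use assms(2) in auto)
  show "?j ` (C \<times> {0..P}) \<subseteq> rhs_dom" using X_facts(5)[OF near_L] assms(2) by auto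
  fix p t assume p: "p \<in> C"
  have "periodic P (jet p)" unfolding periodic_def using jet_per p assms(2) by blast
  from periodic_image[OF P_pos this] have "jet p t \<in> jet p ` {0..P}" by blast
  then show "jet p t \<in> ?j ` (C \<times> {0..P})" using p by force
qed

text \<open>Sup closeness of the warps suffices, since neither the magnitude equation nor the phase
  rates contain l'. The branch for L is an approximate fixed point for l, with a defect that is
  uniform over the compact set of parameters.\<close>

lemma near_close:
  assumes C: "compact C" "C \<subseteq> pars" and e: "e > 0"
  shows "\<exists>\<theta>>0. \<forall>l. near l \<longrightarrow> (\<forall>t. \<bar>l t - L t\<bar> < \<theta>) \<longrightarrow> (\<forall>p\<in>C. (\<forall>t. \<bar>X l p t - X L p t\<bar> < e \<and> \<bar>Y l p t - Y L p t\<bar> < e) \<and>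
      norm (ret l p - ret L p) \<le> e)"
proof -
  obtain K where K: "compact K" "K \<subseteq> rhs_dom" "\<And>p t. p \<in> C \<Longrightarrow> jet p t \<in> K" using compact_jets[OF C] by blast
  have unif: "\<exists>d>0. \<forall>z\<in>K. \<forall>z'. dist z z' < d \<longrightarrow> z' \<in> rhs_dom \<and> dist (F z') (F z) < e'"
    if "Ck_on 0 F rhs_dom" "e' > 0" for F :: "jet \<Rightarrow> real" and e'
    by (rule uniform_near_compact[OF open_rhs_dom Ck_on_continuous[OF that(1)] K(1,2) that(2)])
  define e' where "e' = e / (2 * P)"
  have e': "e' > 0" using e P_pos by (simp add: e'_def)
  obtain \<delta>1 where d1: "\<delta>1 > 0" "\<And>z z'. z \<in> K \<Longrightarrow> dist z z' < \<delta>1 \<Longrightarrow> z' \<in> rhs_dom \<and> dist (rate1 z') (rate1 z) < e'"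
    using unif[OF Ck_on_rate1 e'] by metis
  obtain \<delta>2 where d2: "\<delta>2 > 0" "\<And>z z'. z \<in> K \<Longrightarrow> dist z z' < \<delta>2 \<Longrightarrow> z' \<in> rhs_dom \<and> dist (rate2 z') (rate2 z) < e'"
    using unif[OF Ck_on_rate2 e'] by metis
  define \<delta>3 where "\<delta>3 = min e (min (\<delta>1 / 4) (\<delta>2 / 4))"
  have d3: "\<delta>3 > 0" "\<delta>3 \<le> e" "\<delta>3 \<le> \<delta>1 / 4" "\<delta>3 \<le> \<delta>2 / 4" using e d1 d2 by (simp_all add: \<delta>3_def)
  \<comment> \<open>Stability doubles the defect and the operators multiply it by M1 and M2; with
    this choice the deviations of X and Y together stay below \<open>\<delta>3\<close>.\<close>
  define e'' where "e'' = \<delta>3 / (4 * (M1 + M2))"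
  have M: "M1 + M2 > 0" using M_pos by simp
  have e'': "e'' > 0" using d3 M by (simp add: e''_def)
  have Me: "2 * e'' * (2 * (M1 + M2)) = \<delta>3" using M by (simp add: e''_def field_simps)
  obtain \<delta>4 where d4: "\<delta>4 > 0" "\<And>z z'. z \<in> K \<Longrightarrow> dist z z' < \<delta>4 \<Longrightarrow> z' \<in> rhs_dom \<and> dist (vf z') (vf z) < e''"
    using unif[OF Ck_on_rhs e''] by metis
  define \<theta> where "\<theta> = min \<delta>3 \<delta>4"
  have \<theta>: "\<theta> > 0" "\<theta> \<le> \<delta>3" "\<theta> \<le> \<delta>4" using d3 d4 by (simp_all add: \<theta>_def)
  have "(\<forall>t. \<bar>X l p t - X L p t\<bar> < e \<and> \<bar>Y l p t - Y L p t\<bar> < e) \<and> norm (ret l p - ret L p) \<le> e"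
    if l: "near l" "\<forall>t. \<bar>l t - L t\<bar> < \<theta>" and p: "p \<in> C" for l p
  proof -
    have pp: "p \<in> pars" using p C by blast
    have cl: "\<bar>vf (l t, X L p t, Y L p t, p) - vf (jet p t)\<bar> \<le> e''" for t
    proof -
      have "dist (jet p t) (l t, X L p t, Y L p t, p) < \<delta>4"
        using l(2)[rule_format, of t] \<theta>(3) by (simp add: dist_Pair_Pair dist_real_def abs_minus_commute)
      then show ?thesis using d4(2)[OF K(3)[OF p]] by (fastforce simp: dist_real_def)
    qed
    have s: "\<bar>sol l p t - sol L p t\<bar> \<le> 2 * e''" for t by (rule sol_close[OF l(1) pp cl])
    note cs = sol_facts(1)[OF l(1) pp] sol_facts(1)[OF near_L pp]
    have XY: "\<bar>X l p t - X L p t\<bar> \<le> M1 * (2 * e'')" "\<bar>Y l p t - Y L p t\<bar> \<le> M2 * (2 * e'')" for t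
      using GH_bound[OF contper_diff[OF cs] s] GH_diff[OF cs] by (simp_all add: X_def Y_def)
    have XY3: "\<bar>X l p t - X L p t\<bar> < \<delta>3" "\<bar>Y l p t - Y L p t\<bar> < \<delta>3" for t
    proof -
      have "M1 * (2 * e'') > 0" "M2 * (2 * e'') > 0" using M_pos e'' by auto
      moreover have "2 * (M1 * (2 * e'')) + 2 * (M2 * (2 * e'')) = \<delta>3" using Me by (simp add: algebra_simps)
      ultimately show "\<bar>X l p t - X L p t\<bar> < \<delta>3" "\<bar>Y l p t - Y L p t\<bar> < \<delta>3" using XY[of t] by linarith+
    qed
    let ?zl = "\<lambda>t. (l t, X l p t, Y l p t, p)"
    have dz: "dist (jet p t) (?zl t) < 4 * \<delta>3" for t
    proof -
      have "dist (jet p t) (?zl t) = norm (l t - L t, X l p t - X L p t, Y l p t - Y L p t, 0::real \<times> real)"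
        by (subst dist_commute) (simp add: dist_norm)
      also have "\<dots> \<le> \<bar>l t - L t\<bar> + \<bar>X l p t - X L p t\<bar> + \<bar>Y l p t - Y L p t\<bar>"
        using norm_Pair_le[of "l t - L t" "(X l p t - X L p t, Y l p t - Y L p t, 0::real \<times> real)"]
          norm_Pair_le[of "X l p t - X L p t" "(Y l p t - Y L p t, 0::real \<times> real)"] norm_Pair_le[of "Y l p t - Y L p t" "0::real \<times> real"] by simp
      also have "\<dots> < 4 * \<delta>3" using l(2)[rule_format, of t] \<theta>(2) XY3[of t] d3(1) by linarith
      finally show ?thesis .
    qed
    have int: "\<bar>integral {0..P} (\<lambda>t. F (?zl t)) - integral {0..P} (\<lambda>t. F (jet p t))\<bar> \<le> e / 2"
      if F: "Ck_on 0 F rhs_dom" and cF: "\<And>t. dist (F (?zl t)) (F (jet p t)) < e'" for F :: "jet \<Rightarrow> real"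
    proof -
      have c: "continuous_on UNIV (\<lambda>t. F (u t, X u p t, Y u p t, p))" if u: "near u" for u
        using contperD(1)[OF nearD(2)[OF u]] contperD(1)[OF X_facts(6)[OF u pp]] contperD(1)[OF X_facts(7)[OF u pp]] X_facts(5)[OF u pp]
        by (intro continuous_on_compose2[OF Ck_on_continuous[OF F]] continuous_on_Pair continuous_on_const) auto
      have i: "(\<lambda>t. F (?zl t)) integrable_on {0..P}" "(\<lambda>t. F (jet p t)) integrable_on {0..P}"
        by (rule integrable_continuous_real, rule continuous_on_subset[OF c[OF l(1)]], simp,
            rule integrable_continuous_real, rule continuous_on_subset[OF c[OF near_L]], simp)
      have "norm (integral {0..P} (\<lambda>t. F (?zl t) - F (jet p t))) \<le> e' * (P - 0)"
        by (rule integral_bound[OF less_imp_le[OF P_pos]])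
          (use cF in \<open>auto intro!: continuous_intros continuous_on_subset[OF c[OF l(1)]] continuous_on_subset[OF c[OF near_L]] simp: dist_real_def less_imp_le\<close>)
      then show ?thesis using P_pos by (simp add: Henstock_Kurzweil_Integration.integral_diff[OF i] e'_def)
    qed
    have r1: "\<bar>fst (ret l p) - fst (ret L p)\<bar> \<le> e / 2" unfolding ret_def fst_conv
      by (rule int[OF Ck_on_rate1]) (use d1(2)[OF K(3)[OF p] order_less_le_trans[OF dz]] d3(3) in auto)
    have r2: "\<bar>snd (ret l p) - snd (ret L p)\<bar> \<le> e / 2" unfolding ret_def snd_conv
      by (rule int[OF Ck_on_rate2]) (use d2(2)[OF K(3)[OF p] order_less_le_trans[OF dz]] d3(4) in auto)
    have "norm (ret l p - ret L p) \<le> \<bar>fst (ret l p - ret L p)\<bar> + \<bar>snd (ret l p - ret L p)\<bar>"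
      using norm_Pair_le[of "fst (ret l p - ret L p)" "snd (ret l p - ret L p)"] by (simp only: prod.collapse real_norm_def)
    also have "\<dots> \<le> e" using r1 r2 by simp
    finally show ?thesis using XY3 d3(2) by (meson order_less_le_trans)
  qed
  then show ?thesis using \<theta>(1) by blast
qed

text \<open>Brouwer's theorem for the Newton map at the unperturbed datum replaces the implicit function theorem:
  it needs the perturbed return map to be uniformly close, but not its derivative.\<close>

lemma near_ex_same_return:
  assumes p0: "p0 \<in> pars" "ret_det p0 \<noteq> 0" and e: "e > 0"
  shows "\<exists>\<theta>>0. \<forall>l. near l \<longrightarrow> (\<forall>t. \<bar>l t - L t\<bar> < \<theta>) \<longrightarrow> (\<exists>p\<in>pars. dist p p0 < e \<and> ret l p = ret L p0 \<and>
      (\<forall>t. \<bar>X l p t - X L p0 t\<bar> < e \<and> \<bar>Y l p t - Y L p0 t\<bar> < e))"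
proof -
  let ?J = "fderiv (ret L) p0"
  note dJ = ret_derivative[OF p0(1)]
  obtain D' where D': "bounded_linear D'" "\<And>v. ?J (D' v) = v" "\<And>v. D' (?J v) = v"
    by (rule plane_map_inverse[OF has_derivative_linear[OF dJ] p0(2)[unfolded ret_det_def]]) blast
  interpret D': bounded_linear D' by (rule D'(1))
  obtain B where B: "B > 0" "\<And>v. norm (D' v) \<le> norm v * B" using D'.pos_bounded by blast
  have "1 / (2 * B) > 0" using B by simp
  then obtain d1 where d1: "d1 > 0" "\<And>p. norm (p - p0) < d1 \<Longrightarrow> norm (ret L p - ret L p0 - ?J (p - p0)) \<le> 1 / (2 * B) * norm (p - p0)"
    using dJ unfolding has_derivative_at_alt by blast
  have e2: "e / 2 > 0" using e by simp
  obtain d2 where d2: "d2 > 0" "\<And>p. dist p p0 < d2 \<Longrightarrow> p \<in> pars \<and> (\<forall>t. \<bar>X L p t - X L p0 t\<bar> < e / 2 \<and> \<bar>Y L p t - Y L p0 t\<bar> < e / 2)"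
    using XY_close[OF p0(1) e2] by blast
  define \<rho> where "\<rho> = min (min d1 d2) e / 2"
  have \<rho>: "\<rho> > 0" "\<rho> < d1" "\<rho> < d2" "\<rho> < e" using d1 d2 e by (auto simp: \<rho>_def)
  have C: "compact (cball p0 \<rho>)" "cball p0 \<rho> \<subseteq> pars" using d2(2) \<rho>(3) by (auto simp: dist_commute)
  define e' where "e' = min (e / 2) (\<rho> / (2 * B))"
  have e': "e' > 0" "e' \<le> e / 2" "e' \<le> \<rho> / (2 * B)" using e \<rho> B by (simp_all add: e'_def)
  obtain \<theta> where \<theta>: "\<theta> > 0" and close: "\<And>l p. near l \<Longrightarrow> \<forall>t. \<bar>l t - L t\<bar> < \<theta> \<Longrightarrow> p \<in> cball p0 \<rho> \<Longrightarrow>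
      (\<forall>t. \<bar>X l p t - X L p t\<bar> < e' \<and> \<bar>Y l p t - Y L p t\<bar> < e') \<and> norm (ret l p - ret L p) \<le> e'"
    using near_close[OF C e'(1)] by metis
  have "\<exists>p\<in>pars. dist p p0 < e \<and> ret l p = ret L p0 \<and> (\<forall>t. \<bar>X l p t - X L p0 t\<bar> < e \<and> \<bar>Y l p t - Y L p0 t\<bar> < e)"
    if l: "near l" "\<forall>t. \<bar>l t - L t\<bar> < \<theta>" for l
  proof -
    \<comment> \<open>The Newton map with the derivative frozen at the unperturbed datum. On the
      ball of radius \<rho> the linearization error of \<open>ret L\<close> moves it by at most
      \<open>\<rho> / 2\<close> and the difference of the return maps by at most
      \<open>\<rho> / 2\<close>, so the ball is mapped into itself.\<close>
    let ?\<Psi> = "\<lambda>p. p - D' (ret l p - ret L p0)"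
    have "continuous_on (cball p0 \<rho>) (ret l)" using ret_continuous[OF l(1)] C(2) by (rule continuous_on_subset)
    then have "continuous_on (cball p0 \<rho>) ?\<Psi>" by (intro continuous_intros D'.continuous_on)
    moreover have "?\<Psi> p \<in> cball p0 \<rho>" if p: "p \<in> cball p0 \<rho>" for p
    proof -
      have np: "norm (p - p0) \<le> \<rho>" using p by (simp add: dist_norm norm_minus_commute)
      have "?\<Psi> p - p0 = - D' (ret L p - ret L p0 - ?J (p - p0)) - D' (ret l p - ret L p)"
        using D'(3)[of "p - p0"] by (simp add: D'.diff)
      then have "norm (?\<Psi> p - p0) \<le> norm (D' (ret L p - ret L p0 - ?J (p - p0))) + norm (D' (ret l p - ret L p))"
        using norm_triangle_ineq4[of "- D' (ret L p - ret L p0 - ?J (p - p0))" "D' (ret l p - ret L p)"] by simp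
      also have "\<dots> \<le> (1 / (2 * B) * norm (p - p0)) * B + e' * B"
        using d1(2)[of p] np \<rho>(2) close[OF l p] B
        by (intro add_mono order_trans[OF B(2)] mult_right_mono) auto
      also have "\<dots> \<le> \<rho> / 2 + \<rho> / 2"
      proof (rule add_mono)
        show "(1 / (2 * B) * norm (p - p0)) * B \<le> \<rho> / 2" using np B by simp
        have "e' * B \<le> \<rho> / (2 * B) * B" using e'(3) B by (intro mult_right_mono) auto
        then show "e' * B \<le> \<rho> / 2" using B by simp
      qed
      finally show ?thesis by (simp add: dist_norm norm_minus_commute)
    qed
    ultimately obtain p where p: "p \<in> cball p0 \<rho>" "?\<Psi> p = p"
      using brouwer_ball[OF \<rho>(1), of p0 ?\<Psi>] by blast
    have "D' (ret l p - ret L p0) = 0" using p(2) by simp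
    then have "ret l p - ret L p0 = ?J 0" using D'(2)[of "ret l p - ret L p0"] by simp
    then have "ret l p = ret L p0" using linear_0[OF has_derivative_linear[OF dJ]] by simp
    moreover have dp: "dist p p0 \<le> \<rho>" using p(1) by (simp add: dist_commute)
    moreover have "\<bar>X l p t - X L p0 t\<bar> < e \<and> \<bar>Y l p t - Y L p0 t\<bar> < e" for t
    proof -
      have 1: "\<bar>X l p t - X L p t\<bar> < e'" "\<bar>Y l p t - Y L p t\<bar> < e'" using close[OF l p(1)] by auto
      have 2: "\<bar>X L p t - X L p0 t\<bar> < e / 2" "\<bar>Y L p t - Y L p0 t\<bar> < e / 2" using d2(2)[of p] dp \<rho>(3) by auto
      show ?thesis using 1 2 e'(2) by linarith
    qed
    moreover have "dist p p0 < e" using dp \<rho>(4) by linarith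
    moreover have "p \<in> pars" using C(2) p(1) by blast
    ultimately show ?thesis by blast
  qed
  then show ?thesis using \<theta> by blast
qed

text \<open>The Hoelder norm controls both the warp and its first derivative. The former yields the
  parameters with the same return, the latter is what closeness of x in the second order Hoelder
  norm requires.\<close>

lemma persistence:
  assumes p0: "p0 \<in> pars" "snd p0 > 0" "ret_det p0 \<noteq> 0" and \<alpha>: "0 < \<alpha>" "\<alpha> < 1" and r: "r \<ge> 2" and \<eta>: "\<eta> > 0"
  shows "\<exists>\<theta>>0. \<forall>l\<in>holder_per P r \<alpha>. holder_norm r \<alpha> (\<lambda>t. l t - L t) < \<theta> \<longrightarrow>
    (\<exists>p\<in>pars. near l \<and> (\<forall>t. (l has_real_derivative deriv l t) (at t)) \<and> snd p > 0 \<and> dist p p0 < \<eta> \<and>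
      ret l p = ret L p0 \<and> X l p \<in> holder_per P 2 \<alpha> \<and> holder_norm 2 \<alpha> (\<lambda>t. X l p t - X L p0 t) < \<eta>)"
proof -
  obtain \<theta>1 where \<theta>1: "\<theta>1 > 0" and close: "\<forall>l l' p. close_to \<theta>1 p0 l l' p \<longrightarrow>
      (\<lambda>t. X l p t - X L p0 t) \<in> holder_per P 2 \<alpha> \<and> holder_norm 2 \<alpha> (\<lambda>t. X l p t - X L p0 t) < \<eta>"
    using C2_close[OF p0(1) \<alpha> \<eta>] by (elim exE conjE)
  \<comment> \<open>The entry \<open>snd p0\<close> keeps the new \<delta> positive, so the
    perturbed solution is a datum and not merely a point of the extended branch.\<close>
  define e where "e = min \<theta>1 (min \<eta> (snd p0))"
  have e: "e > 0" "e \<le> \<theta>1" "e \<le> \<eta>" "e \<le> snd p0" using \<theta>1 \<eta> p0(2) by (simp_all add: e_def)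
  obtain \<theta>2 where \<theta>2: "\<theta>2 > 0" and ex: "\<And>l. near l \<Longrightarrow> \<forall>t. \<bar>l t - L t\<bar> < \<theta>2 \<Longrightarrow> \<exists>p\<in>pars. dist p p0 < e \<and> ret l p = ret L p0 \<and>
      (\<forall>t. \<bar>X l p t - X L p0 t\<bar> < e \<and> \<bar>Y l p t - Y L p0 t\<bar> < e)"
    using near_ex_same_return[OF p0(1,3) e(1)] by metis
  define \<theta> where "\<theta> = min d0 (min \<theta>1 \<theta>2)"
  have \<theta>: "\<theta> > 0" "\<theta> \<le> d0" "\<theta> \<le> \<theta>1" "\<theta> \<le> \<theta>2" using d0_pos \<theta>1 \<theta>2 by (simp_all add: \<theta>_def)
  show ?thesis
  proof (intro exI[of _ \<theta>] conjI \<theta>(1) ballI impI)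
    fix l assume l: "l \<in> holder_per P r \<alpha>" and n: "holder_norm r \<alpha> (\<lambda>t. l t - L t) < \<theta>"
    have Cl: "Ck_on r l UNIV" "periodic P l" using l by (auto simp: holder_per_def)
    have Cl1: "Ck_on (Suc 0) l UNIV" by (rule Ck_on_mono[OF _ Cl(1)]) (use r in simp)
    have dl: "(l has_real_derivative deriv l t) (at t)" for t using Ck_on_Suc_DERIV(1)[OF open_UNIV Cl1] by simp
    have d: "(\<lambda>t. l t - L t) \<in> holder_per P r \<alpha>"
      using holder_per_lin[OF P_pos l Ck_on_Suc_periodic_holder[OF P_pos \<alpha> L_smooth L_periodic], of "-1"] by simp
    have "\<bar>l t - L t\<bar> \<le> holder_norm r \<alpha> (\<lambda>t. l t - L t)" for t
      using holder_per_bounds(1)[OF P_pos d, of 0 t] by simp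
    then have cl: "\<bar>l t - L t\<bar> < \<theta>" for t using n by (rule le_less_trans)
    have "deriv (\<lambda>t. l t - L t) = (\<lambda>t. deriv l t - deriv L t)"
      by (intro ext DERIV_imp_deriv DERIV_diff dl L_deriv)
    then have "\<bar>deriv l t - deriv L t\<bar> \<le> holder_norm r \<alpha> (\<lambda>t. l t - L t)" for t
      using holder_per_bounds(1)[OF P_pos d, of 1 t] r by simp
    then have cl': "\<bar>deriv l t - deriv L t\<bar> < \<theta>1" for t using n \<theta>(3) by (meson le_less_trans less_le_trans)
    have near: "near l"
      unfolding near_def contper_def using Cl(2) Ck_on_continuous[OF Cl1] cl \<theta>(2) by (meson less_le_trans)
    obtain p where p: "p \<in> pars" "dist p p0 < e" "ret l p = ret L p0"
      and XY: "\<And>t. \<bar>X l p t - X L p0 t\<bar> < e" "\<And>t. \<bar>Y l p t - Y L p0 t\<bar> < e"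
      using ex[OF near] cl \<theta>(4) by (meson less_le_trans)
    have "close_to \<theta>1 p0 l (deriv l) p"
      using near p(1) dl cl' less_le_trans[OF cl \<theta>(3)] less_le_trans[OF p(2) e(2)] less_le_trans[OF XY(1) e(2)]
        less_le_trans[OF XY(2) e(2)] by (simp add: close_to_def)
    note c = close[rule_format, OF this]
    have "X l p \<in> holder_per P 2 \<alpha>"
      using holder_per_lin[OF P_pos conjunct1[OF c] X_holder[OF p0(1) \<alpha>], of 1] by simp
    moreover have "snd p > 0"
      using dist_snd_le[of p p0] p(2) e(4) by (simp add: dist_real_def)
    ultimately show "\<exists>p\<in>pars. near l \<and> (\<forall>t. (l has_real_derivative deriv l t) (at t)) \<and> snd p > 0 \<and> dist p p0 < \<eta> \<and>
      ret l p = ret L p0 \<and> X l p \<in> holder_per P 2 \<alpha> \<and> holder_norm 2 \<alpha> (\<lambda>t. X l p t - X L p0 t) < \<eta>"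
      using p near dl c less_le_trans[OF p(2) e(3)] by blast
  qed
qed

section \<open>The reconstructions along the branch\<close>

definition member :: "real \<times> real \<Rightarrow> recon" where
  "member p = recon_of k1 k2 d2 L (X L p) (Y L p) p"

lemma member_solution:
  assumes "p \<in> pars" "snd p > 0"
  shows "datum_solution k1 k2 d1 d2 P L (deriv L) (X L p) (Y L p) (fst p) (snd p)"
  by (rule branch_datum_solution[OF near_L L_deriv assms])

lemma member_facts:
  assumes p: "p \<in> pars" "snd p > 0"
  shows "smooth_on (mag (member p)) UNIV" "warp1 (member p) = L" "P_periodic_data P (member p)"
    and "realizes_datum k2 d2 L (fst p) (snd p) (X L p) (member p)" "doubly_spiral (member p)"
proof -
  interpret datum_solution k1 k2 d1 d2 P L "deriv L" "X L p" "Y L p" "fst p" "snd p" by (rule member_solution[OF p])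
  have eq: "recon_of k1 k2 d2 L (X L p) (Y L p) (fst p, snd p) = member p" by (simp add: member_def)
  show "smooth_on (mag (member p)) UNIV"
    unfolding smooth_on_def using mag_Ck[OF L_smooth, unfolded eq] Ck_on_mono[OF le_add1] by blast
  show "warp1 (member p) = L" by (simp add: member_def recon_of_def)
  show "P_periodic_data P (member p)" using periodic_data unfolding eq .
  show "realizes_datum k2 d2 L (fst p) (snd p) (X L p) (member p)" using realizes unfolding eq .
  show "doubly_spiral (member p)" using p(2) by (simp add: doubly_spiral_def member_def recon_of_def)
qed

lemma member_closing:
  assumes p: "p \<in> pars" "snd p > 0" and ret: "ret L p = (2 * pi * \<rho>1, 2 * pi * \<rho>2)"
  shows "\<rho>1 \<in> \<rat> \<Longrightarrow> \<rho>2 \<in> \<rat> \<Longrightarrow> profile_closes P (member p)"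
    and "closing_multiplier P (member p) j \<Longrightarrow> j \<ge> 1 \<and> real j * \<rho>2 \<in> \<int>"
proof -
  interpret datum_solution k1 k2 d1 d2 P L "deriv L" "X L p" "Y L p" "fst p" "snd p" by (rule member_solution[OF p])
  have eq: "recon_of k1 k2 d2 L (X L p) (Y L p) (fst p, snd p) = member p" by (simp add: member_def)
  have D: "datum_return k2 d2 P (fst p) (snd p) (X L p) = (2 * pi * \<rho>1, 2 * pi * \<rho>2)"
    using datum_return_ret[OF near_L L_deriv p] ret by simp
  show "\<rho>1 \<in> \<rat> \<Longrightarrow> \<rho>2 \<in> \<rat> \<Longrightarrow> profile_closes P (member p)" using profile_closes[OF D] unfolding eq .
  show "closing_multiplier P (member p) j \<Longrightarrow> j \<ge> 1 \<and> real j * \<rho>2 \<in> \<int>"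
    using closing_multiplier_Ints[OF D, of j] unfolding eq by blast
qed

lemma member_harmonic:
  fixes A1 :: "('m1::{t2_space, second_countable_topology}, 'e1::euclidean_space) rchart set"
    and A2 :: "('m2::{t2_space, second_countable_topology}, 'e2::euclidean_space) rchart set"
    and f1 :: "'m1 \<Rightarrow> complex ^ 'n1" and f2 :: "'m2 \<Rightarrow> complex ^ 'n2"
  assumes "riemannian_atlas A1" "riemannian_atlas A2" "eigenmap A1 f1 d1" "eigenmap A2 f2 d2"
    and "k1 = DIM('e1)" "k2 = DIM('e2)" and p: "p \<in> pars" "snd p > 0"
  shows "harmonic_reconstruction A1 A2 f1 f2 d1 d2 (member p)"
  using datum_solution.harmonic[OF member_solution[OF p] assms(1-6)] by (simp add: member_def)

lemma ramp_Ck: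
  assumes U: "open U" "U \<subseteq> pars" and F: "Ck_on n F rhs_dom"
  shows "Ck_on n (\<lambda>z. ramp (\<lambda>s. F (jet (fst z) s)) (snd z)) (U \<times> UNIV)"
proof -
  have o: "open (U \<times> (UNIV :: real set))" "open ((U \<times> (UNIV :: real set)) \<times> (UNIV :: real set))"
    using U(1) by (simp_all add: open_Times)
  have c: "Ck_on n (\<lambda>w. (fst (fst w), snd (fst w) * snd w)) ((U \<times> (UNIV :: real set)) \<times> (UNIV :: real set))"
    by (intro Ck_on_Pair Ck_on_mult Ck_on_fst Ck_on_snd Ck_on_ident o)
  have img: "(\<lambda>w. (fst (fst w), snd (fst w) * snd w)) ` ((U \<times> (UNIV :: real set)) \<times> (UNIV :: real set)) \<subseteq> pars \<times> UNIV"
    using U(2) by auto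
  from Ck_on_compose[OF o(2) open_Times[OF open_pars open_UNIV] img compose_jet_Ck[OF F] c]
  have "Ck_on n (\<lambda>w. F (jet (fst (fst w)) (snd (fst w) * snd w))) ((U \<times> UNIV) \<times> UNIV)"
    by (simp only: fst_conv snd_conv)
  then have "Ck_on n (\<lambda>w. snd (fst w) * F (jet (fst (fst w)) (snd (fst w) * snd w))) ((U \<times> UNIV) \<times> UNIV)"
    by (intro Ck_on_mult Ck_on_fst Ck_on_snd Ck_on_ident o)
  from Ck_on_integral[OF o(1) this, of 0 1] show ?thesis by (simp add: ramp_def)
qed

lemma family_smooth:
  assumes U: "open U" "U \<subseteq> pars \<inter> {p. snd p > 0}"
  shows "smooth_on (\<lambda>p. par_c (member p)) U" "smooth_on (\<lambda>p. par_eps (member p)) U" "smooth_on (\<lambda>p. par_sig (member p)) U"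
    and "smooth_on (\<lambda>(p, t). mag (member p) t) (U \<times> UNIV)" "smooth_on (\<lambda>(p, t). warp2 (member p) t) (U \<times> UNIV)"
    and "smooth_on (\<lambda>(p, t). phase1 (member p) t) (U \<times> UNIV)" "smooth_on (\<lambda>(p, t). phase2 (member p) t) (U \<times> UNIV)"
proof -
  have oU: "open (U \<times> (UNIV :: real set))" using U(1) by (simp add: open_Times)
  have sub: "U \<times> UNIV \<subseteq> pars \<times> (UNIV :: real set)" using U(2) by auto
  have pos: "fst p > 0" "snd p > 0" if "p \<in> U" for p using pars_mu_pos[of p] that U(2) by auto
  note [simp] = member_def recon_of_def
  show "smooth_on (\<lambda>p. par_c (member p)) U" unfolding smooth_on_def
    by (simp, intro allI Ck_on_divide Ck_on_const Ck_on_snd Ck_on_ident U(1)) (auto dest: pos)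
  show "smooth_on (\<lambda>p. par_eps (member p)) U" unfolding smooth_on_def
    by (simp add: datum_eps_def, intro allI Ck_on_mult Ck_on_power Ck_on_divide Ck_on_const Ck_on_fst Ck_on_snd Ck_on_ident U(1))
      (auto dest: pos)
  show "smooth_on (\<lambda>p. par_sig (member p)) U" unfolding smooth_on_def by (simp add: Ck_on_const)
  show "smooth_on (\<lambda>(p, t). mag (member p) t) (U \<times> UNIV)"
    unfolding smooth_on_def
  proof
    fix n
    have "Ck_on n (\<lambda>z. sqrt (snd (fst z)) * X L (fst z) (snd z)) (U \<times> UNIV)"
      using pos by (intro Ck_on_mult Ck_on_sqrt Ck_on_fst Ck_on_snd Ck_on_ident oU Ck_on_subset[OF XY_Ck(1) sub]) auto
    then show "Ck_on n (\<lambda>(p, t). mag (member p) t) (U \<times> UNIV)" by (simp add: case_prod_unfold datum_mag_def)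
  qed
  show "smooth_on (\<lambda>(p, t). warp2 (member p) t) (U \<times> UNIV)"
    unfolding smooth_on_def
  proof
    fix n
    have "Ck_on n (\<lambda>z. warp2_fun k1 k2 d2 (jet (fst z) (snd z))) (U \<times> UNIV)"
      by (rule Ck_on_compose[OF oU open_rhs_dom_mu _ Ck_on_warp2_fun[OF d2_pos] Ck_on_subset[OF jet_Ck sub]])
        (use X_facts(5)[OF near_L] U(2) pos in auto)
    then show "Ck_on n (\<lambda>(p, t). warp2 (member p) t) (U \<times> UNIV)" by (simp add: case_prod_unfold)
  qed
  have UP: "U \<subseteq> pars" using U(2) by blast
  show "smooth_on (\<lambda>(p, t). phase1 (member p) t) (U \<times> UNIV)" "smooth_on (\<lambda>(p, t). phase2 (member p) t) (U \<times> UNIV)"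
    unfolding smooth_on_def using ramp_Ck[OF U(1) UP Ck_on_rate1] ramp_Ck[OF U(1) UP Ck_on_rate2]
    by (simp_all add: case_prod_unfold)
qed

text \<open>Shows that the family really has two parameters: c determines \<delta>, and then
  \<epsilon> determines \<mu>.\<close>

lemma member_inj: "inj_on (\<lambda>p. (par_c (member p), par_eps (member p))) (pars \<inter> {p. snd p > 0})"
proof (rule inj_onI)
  fix p q assume p: "p \<in> pars \<inter> {p. snd p > 0}" and q: "q \<in> pars \<inter> {p. snd p > 0}"
    and eq: "(par_c (member p), par_eps (member p)) = (par_c (member q), par_eps (member q))"
  have mu: "fst p > 0" "fst q > 0" using p q pars_mu_pos[of p] pars_mu_pos[of q] by auto
  have s: "snd p = snd q" using eq by (simp add: member_def recon_of_def)
  then have "(d2 / fst p) ^ k2 = (d2 / fst q) ^ k2"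
    using eq p by (simp add: member_def recon_of_def datum_eps_def)
  then have "d2 / fst p = d2 / fst q"
    by (rule power_eq_imp_eq_base) (use d2_pos mu k2_pos in auto)
  then have "fst p = fst q" using d2_pos mu by (simp add: field_simps)
  with s show "p = q" by (simp add: prod_eq_iff)
qed

lemma closing_dense:
  assumes U: "open U" "U \<subseteq> pars \<inter> {p. snd p > 0}" "\<And>p. p \<in> U \<Longrightarrow> ret_det p \<noteq> 0"
  shows "U \<subseteq> closure {p \<in> U. profile_closes P (member p)}"
proof
  fix p assume p: "p \<in> U"
  show "p \<in> closure {p \<in> U. profile_closes P (member p)}"
    unfolding closure_approachable
  proof (intro allI impI)
    fix e :: real assume e: "e > 0"
    have S: "open (U \<inter> ball p e)" "p \<in> U \<inter> ball p e" "U \<inter> ball p e \<subseteq> pars" using U p e by auto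
    have pp: "p \<in> pars" using p U by auto
    obtain p' \<rho>1 \<rho>2 where p': "p' \<in> U \<inter> ball p e" "\<rho>1 \<in> \<rat>" "\<rho>2 \<in> \<rat>" "ret L p' = (2 * pi * \<rho>1, 2 * pi * \<rho>2)"
      "\<And>j :: nat. j \<ge> 1 \<Longrightarrow> real j * \<rho>2 \<in> \<int> \<Longrightarrow> j > 0"
      by (rule ex_rational_return[OF pp U(3)[OF p] S]) blast
    have "profile_closes P (member p')" by (rule member_closing(1)[OF _ _ p'(4,2,3)]) (use p'(1) U(2) in auto)
    then show "\<exists>y\<in>{p \<in> U. profile_closes P (member p)}. dist y p < e" using p'(1) by (intro bexI[of _ p']) (simp_all add: dist_commute)
  qed
qed

text \<open>The parameters approach \<open>(\<mu>0, 0)\<close> inside a compact disc on which the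
  branch is regular up to \<open>\<delta> = 0\<close>. The jets stay in a compact part of the
  domain, so x is bounded above and the second warp is bounded below, while the factor
  \<open>sqrt \<delta>\<close> of the magnitude tends to 0.\<close>

lemma collapsing_sequence:
  assumes d: "d > 0" "d \<le> d0" "\<forall>p. dist p (\<mu>0, 0) < d \<longrightarrow> ret_det p \<noteq> 0"
  shows "\<exists>(q :: nat \<Rightarrow> real \<times> real) \<kappa>.
    (\<forall>j. q j \<in> pars \<and> snd (q j) > 0 \<and> profile_closes P (member (q j))) \<and>
    \<kappa> > 0 \<and> (\<forall>t. L t \<ge> \<kappa>) \<and> (\<forall>j t. warp2 (member (q j)) t \<ge> \<kappa>) \<and>
    uniform_limit UNIV (\<lambda>j. mag (member (q j))) (\<lambda>_. 0) sequentially \<and>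
    filterlim (\<lambda>j. least_closing_multiplier P (member (q j))) at_top sequentially"
proof -
  define C where "C = cball (\<mu>0, 0::real) (d / 2)"
  have C: "compact C" "C \<subseteq> pars" using d(1,2) by (auto simp: C_def pars_def)
  \<comment> \<open>The bound \<open>d / 2\<close> stays where \<open>ret_det\<close> does not
    vanish and inside C; the bound \<open>1 / real (Suc j)\<close> drives \<delta> to 0.\<close>
  define s where "s j = min (d / 2) (1 / real (Suc j))" for j
  have s: "s j > 0" "s j \<le> d / 2" "s j \<le> 1 / real (Suc j)" for j using d(1) by (simp_all add: s_def)
  have "\<exists>p \<rho>1 \<rho>2. dist p (\<mu>0, 0) < s j \<and> snd p > 0 \<and> \<rho>1 \<in> \<rat> \<and> \<rho>2 \<in> \<rat> \<and> ret L p = (2 * pi * \<rho>1, 2 * pi * \<rho>2) \<and>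
      (\<forall>m :: nat. m \<ge> 1 \<longrightarrow> real m * \<rho>2 \<in> \<int> \<longrightarrow> m > j)" for j
  proof -
    define S where "S = ball (\<mu>0, 0) (s j) \<inter> {p :: real \<times> real. snd p > 0}"
    have S: "open S" unfolding S_def by (intro open_Int open_ball open_Collect_less continuous_intros)
    have m: "(\<mu>0, s j / 2) \<in> S" using s(1)[of j] by (simp add: S_def dist_Pair_Pair dist_real_def)
    have sub: "S \<subseteq> pars" using s(2)[of j] d(1,2) by (auto simp: S_def pars_def)
    have dd: "dist (\<mu>0, s j / 2) (\<mu>0, 0) < d" using s(1,2)[of j] by (simp add: dist_Pair_Pair dist_real_def)
    obtain p \<rho>1 \<rho>2 where p: "p \<in> S" "\<rho>1 \<in> \<rat>" "\<rho>2 \<in> \<rat>" "ret L p = (2 * pi * \<rho>1, 2 * pi * \<rho>2)"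
      "\<And>m :: nat. m \<ge> 1 \<Longrightarrow> real m * \<rho>2 \<in> \<int> \<Longrightarrow> m > j"
      by (rule ex_rational_return[OF subsetD[OF sub m] d(3)[rule_format, OF dd] S m sub]) blast
    then show ?thesis by (intro exI[of _ p] exI[of _ \<rho>1] exI[of _ \<rho>2]) (auto simp: S_def dist_commute)
  qed
  then obtain q \<rho>1 \<rho>2 where q: "\<And>j. dist (q j) (\<mu>0, 0) < s j" "\<And>j. snd (q j) > 0" "\<And>j. \<rho>1 j \<in> \<rat>" "\<And>j. \<rho>2 j \<in> \<rat>"
    "\<And>j. ret L (q j) = (2 * pi * \<rho>1 j, 2 * pi * \<rho>2 j)" "\<And>j m :: nat. m \<ge> 1 \<Longrightarrow> real m * \<rho>2 j \<in> \<int> \<Longrightarrow> m > j"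
    by metis
  have qC: "q j \<in> C" for j using q(1)[of j] s(2)[of j] by (simp add: C_def dist_commute)
  have qp: "q j \<in> pars" for j using qC C(2) by blast
  have closes: "profile_closes P (member (q j))" for j by (rule member_closing(1)[OF qp q(2,5,3,4)])
  obtain K where K: "compact K" "K \<subseteq> rhs_dom" "\<And>p t. p \<in> C \<Longrightarrow> jet p t \<in> K" using compact_jets[OF C] by blast
  have jK: "jet (q j) t \<in> K" for j t by (rule K(3)[OF qC])
  obtain B where B: "B > 0" "\<And>z. z \<in> K \<Longrightarrow> norm z \<le> B" using compact_imp_bounded[OF K(1)] unfolding bounded_pos by blast
  have XB: "X L (q j) t \<le> B" for j t
  proof -
    have "norm (X L (q j) t) \<le> norm (jet (q j) t)"
      by (rule order_trans[OF norm_fst_le norm_snd_le])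
    then show ?thesis using B(2)[OF jK[where j=j and t=t]] by simp
  qed
  \<comment> \<open>The formula for the second warp divides by \<mu>, so its minimum is taken over
    jets whose \<mu> stays above a positive constant.\<close>
  define K' where "K' = K \<inter> {z. fst (snd (snd (snd z))) \<ge> \<mu>0 - d / 2}"
  have mu: "\<mu>0 - d / 2 > 0" using \<mu>0 d(1,2) by linarith
  have cK: "compact K'" unfolding K'_def
    by (intro compact_Int_closed K(1) closed_Collect_le continuous_intros)
  have subK: "K' \<subseteq> rhs_dom \<inter> {z. fst (snd (snd (snd z))) > 0}" using K(2) mu by (auto simp: K'_def)
  have jK': "jet (q j) t \<in> K'" for j t
  proof -
    have "\<bar>fst (q j) - \<mu>0\<bar> \<le> dist (q j) (\<mu>0, 0)" using dist_fst_le[of "q j" "(\<mu>0, 0)"] by (simp add: dist_real_def)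
    then have "fst (q j) \<ge> \<mu>0 - d / 2" using q(1)[of j] s(2)[of j] by linarith
    then show ?thesis using jK by (simp add: K'_def)
  qed
  have "continuous_on K' (warp2_fun k1 k2 d2)"
    by (rule continuous_on_subset[OF Ck_on_continuous[OF Ck_on_warp2_fun[OF d2_pos, of 0]] subK])
  moreover have "K' \<noteq> {}" using jK' by blast
  ultimately obtain z where z: "z \<in> K'" "\<And>y. y \<in> K' \<Longrightarrow> warp2_fun k1 k2 d2 z \<le> warp2_fun k1 k2 d2 y"
    using continuous_attains_inf[OF cK] by metis
  have zpos: "warp2_fun k1 k2 d2 z > 0"
    using warp2_fun_pos[OF subsetD[OF subK z(1)] d2_pos] by (simp add: warp2_fun_def)
  obtain b where b: "b > 0" "\<And>t. b \<le> L t"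
    using periodic_pos_lower[OF P_pos L_periodic Ck_on_continuous[OF L_smooth[of 0]] L_pos] by blast
  have "uniform_limit UNIV (\<lambda>j. mag (member (q j))) (\<lambda>_. 0) sequentially"
  proof (rule uniform_limitI)
    fix e :: real assume e: "e > 0"
    have "(\<lambda>j. sqrt (1 / real (Suc j)) * B) \<longlonglongrightarrow> sqrt 0 * B"
      by (intro tendsto_intros) (use LIMSEQ_inverse_real_of_nat in \<open>simp add: inverse_eq_divide\<close>)
    then have "\<forall>\<^sub>F j in sequentially. sqrt (1 / real (Suc j)) * B < e" using e by (auto dest: order_tendstoD(2))
    then show "\<forall>\<^sub>F j in sequentially. \<forall>t\<in>UNIV. dist (mag (member (q j)) t) 0 < e"
    proof eventually_elim
      fix j assume j: "sqrt (1 / real (Suc j)) * B < e"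
      show "\<forall>t\<in>UNIV. dist (mag (member (q j)) t) 0 < e"
      proof
        fix t
        have "\<bar>snd (q j)\<bar> \<le> dist (q j) (\<mu>0, 0)" using dist_snd_le[of "q j" "(\<mu>0, 0)"] by (simp add: dist_real_def)
        then have "snd (q j) \<le> 1 / real (Suc j)" using q(1)[of j] s(3)[of j] by linarith
        then have "sqrt (snd (q j)) * X L (q j) t \<le> sqrt (1 / real (Suc j)) * B"
          using XB[where j=j and t=t] X_pos[OF near_L qp[of j], of t] q(2)[of j] by (intro mult_mono real_sqrt_le_mono) auto
        moreover have "0 \<le> sqrt (snd (q j)) * X L (q j) t" using X_pos[OF near_L qp[of j], of t] q(2)[of j] by simp
        ultimately show "dist (mag (member (q j)) t) 0 < e"
          using j by (simp add: member_def recon_of_def datum_mag_def dist_real_def)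
      qed
    qed
  qed
  \<comment> \<open>The least multiplier is itself a closing multiplier because the profile closes;
    it makes \<open>m * \<rho>2\<close> an integer and therefore exceeds j by the choice of
    \<open>\<rho>2\<close>.\<close>
  moreover have "j \<le> least_closing_multiplier P (member (q j))" for j
  proof -
    have "closing_multiplier P (member (q j)) (least_closing_multiplier P (member (q j)))"
      using closes[of j] unfolding profile_closes_def least_closing_multiplier_def by (rule LeastI_ex)
    then have "least_closing_multiplier P (member (q j)) \<ge> 1 \<and> real (least_closing_multiplier P (member (q j))) * \<rho>2 j \<in> \<int>"
      by (rule member_closing(2)[OF qp q(2,5)])
    then show ?thesis using q(6) by (blast intro: less_imp_le)
  qed
  then have "filterlim (\<lambda>j. least_closing_multiplier P (member (q j))) at_top sequentially"
    by (intro filterlim_at_top_mono[OF filterlim_ident]) auto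
  moreover have "warp2 (member (q j)) t \<ge> min b (warp2_fun k1 k2 d2 z)" for j t
    using z(2)[OF jK'[where j=j and t=t]] by (simp add: member_def recon_of_def min.coboundedI2)
  moreover have "L t \<ge> min b (warp2_fun k1 k2 d2 z)" for t using b(2)[of t] by (rule min.coboundedI1)
  moreover have "min b (warp2_fun k1 k2 d2 z) > 0" using b(1) zpos by simp
  ultimately show ?thesis using qp q(2) closes by (intro exI[of _ q] exI[of _ "min b (warp2_fun k1 k2 d2 z)"]) simp
qed
end

theorem theoremC:
  fixes A1 :: "('m1::{t2_space, second_countable_topology}, 'e1::euclidean_space) rchart set"
    and A2 :: "('m2::{t2_space, second_countable_topology}, 'e2::euclidean_space) rchart set"
    and f1 :: "'m1 \<Rightarrow> complex ^ 'n1" and f2 :: "'m2 \<Rightarrow> complex ^ 'n2"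
    and d1 d2 P :: real and L :: "real \<Rightarrow> real"
  defines "k1 \<equiv> DIM('e1)" and "k2 \<equiv> DIM('e2)"
  assumes manifolds: "riemannian_atlas A1" "riemannian_atlas A2"
    and closed_manifolds: "compact (UNIV :: 'm1 set)" "compact (UNIV :: 'm2 set)"
    and eigenmaps: "eigenmap A1 f1 d1" "eigenmap A2 f2 d2"
    and warp: "P > 0" "smooth_on L UNIV" "periodic P L" "\<forall>t. L t > 0"
  shows
    "(\<exists>(U :: (real \<times> real) set) (\<Phi> :: real \<times> real \<Rightarrow> recon).
        open U \<and> U \<noteq> {} \<and>
        (\<forall>p\<in>U. harmonic_reconstruction A1 A2 f1 f2 d1 d2 (\<Phi> p) \<and>
               smooth_on (mag (\<Phi> p)) UNIV \<and> warp1 (\<Phi> p) = L \<and> P_periodic_data P (\<Phi> p)) \<and>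
        smooth_on (\<lambda>p. par_c (\<Phi> p)) U \<and>
        smooth_on (\<lambda>p. par_eps (\<Phi> p)) U \<and>
        smooth_on (\<lambda>p. par_sig (\<Phi> p)) U \<and>
        smooth_on (\<lambda>(p, t). mag (\<Phi> p) t) (U \<times> UNIV) \<and>
        smooth_on (\<lambda>(p, t). warp2 (\<Phi> p) t) (U \<times> UNIV) \<and>
        smooth_on (\<lambda>(p, t). phase1 (\<Phi> p) t) (U \<times> UNIV) \<and>
        smooth_on (\<lambda>(p, t). phase2 (\<Phi> p) t) (U \<times> UNIV) \<and>
        inj_on (\<lambda>p. (par_c (\<Phi> p), par_eps (\<Phi> p))) U \<and>
        U \<subseteq> closure {p \<in> U. profile_closes P (\<Phi> p)})
     \<and>
     (\<exists>D :: nat \<Rightarrow> recon.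
        (\<forall>j. harmonic_reconstruction A1 A2 f1 f2 d1 d2 (D j) \<and>
             smooth_on (mag (D j)) UNIV \<and> warp1 (D j) = L \<and> P_periodic_data P (D j) \<and>
             doubly_spiral (D j) \<and> profile_closes P (D j)) \<and>
        (\<exists>\<kappa>>0. \<forall>j t. warp1 (D j) t \<ge> \<kappa> \<and> warp2 (D j) t \<ge> \<kappa>) \<and>
        (uniform_limit UNIV (\<lambda>j. mag (D j)) (\<lambda>_. 0) sequentially \<or>
         uniform_limit UNIV (\<lambda>j. co_magnitude (mag (D j))) (\<lambda>_. 0) sequentially) \<and>
        filterlim (\<lambda>j. least_closing_multiplier P (D j)) at_top sequentially)
     \<and>
     (\<exists>\<mu>0 \<delta>0 x0 \<rho>1 \<rho>2.
        \<rho>1 \<in> \<rat> \<and> \<rho>2 \<in> \<rat> \<and>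
        (\<forall>\<alpha>. 0 < \<alpha> \<and> \<alpha> < 1 \<longrightarrow> nondegenerate_datum k1 k2 d1 d2 P \<alpha> L \<mu>0 \<delta>0 x0) \<and>
        has_phase_return k2 d2 P \<mu>0 \<delta>0 x0 \<rho>1 \<rho>2 \<and>
        (\<exists>D. realizes_datum k2 d2 L \<mu>0 \<delta>0 x0 D \<and> smooth_on (mag D) UNIV \<and>
             harmonic_reconstruction A1 A2 f1 f2 d1 d2 D \<and> P_periodic_data P D) \<and>
        (\<forall>r\<ge>2. \<forall>\<alpha>. 0 < \<alpha> \<and> \<alpha> < 1 \<longrightarrow> (\<forall>\<eta>>0. \<exists>\<theta>>0.
           \<forall>L'\<in>holder_per P r \<alpha>.
             (\<forall>t. L' t > 0) \<and> holder_norm r \<alpha> (\<lambda>t. L' t - L t) < \<theta> \<longrightarrow>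
             (\<exists>\<mu> \<delta> x.
                \<bar>\<mu> - \<mu>0\<bar> < \<eta> \<and> \<bar>\<delta> - \<delta>0\<bar> < \<eta> \<and>
                x \<in> holder_per P 2 \<alpha> \<and> holder_norm 2 \<alpha> (\<lambda>t. x t - x0 t) < \<eta> \<and>
                magnitude_datum k1 k2 d1 P L' \<mu> \<delta> x \<and>
                has_phase_return k2 d2 P \<mu> \<delta> x \<rho>1 \<rho>2 \<and>
                (\<exists>D. realizes_datum k2 d2 L' \<mu> \<delta> x D \<and>
                     (\<forall>n. Ck_on n L' UNIV \<longrightarrow> Ck_on (n + 2) (mag D) UNIV) \<and>
                     harmonic_reconstruction A1 A2 f1 f2 d1 d2 D \<and> P_periodic_data P D)))))"
proof -
  have k: "k1 > 0" "k2 > 0" by (simp_all add: k1_def k2_def)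
  have d: "d1 > 0" "d2 > 0" using eigenmaps by (auto simp: eigenmap_def)
  interpret warp_data k1 k2 d1 d2 P L
    using k d warp by unfold_locales (auto simp: smooth_on_def)
  obtain u1 u2 v1 v2 a m m' xa ya R \<mu>0 d0 \<alpha>0 \<beta>0 where
    "magnitude_branch k1 k2 d1 d2 P L u1 u2 v1 v2 a m m' xa ya R \<mu>0 d0 \<alpha>0 \<beta>0"
    using ex_magnitude_branch by blast
  then interpret magnitude_branch k1 k2 d1 d2 P L u1 u2 v1 v2 a m m' xa ya R \<mu>0 d0 \<alpha>0 \<beta>0 .
  note DIMS = k1_def[THEN meta_eq_to_obj_eq] k2_def[THEN meta_eq_to_obj_eq]
  note harm = member_harmonic[OF manifolds eigenmaps DIMS]
  obtain d' where d': "d' > 0" "d' \<le> d0" "\<forall>p. dist p (\<mu>0, 0) < d' \<longrightarrow> ret_det p \<noteq> 0"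
    by (rule ex_nondegenerate_radius) blast
  \<comment> \<open>Only the open half disc \<open>\<delta> > 0\<close> carries reconstructions,
    since \<open>c = 1 / \<delta>\<close>. The base point lies on its boundary, and the
    invertibility of the return map reaches the half disc by continuity.\<close>
  define U where "U = ball (\<mu>0, 0) d' \<inter> {p :: real \<times> real. snd p > 0}"
  have U: "open U" "U \<subseteq> pars \<inter> {p. snd p > 0}" "\<And>p. p \<in> U \<Longrightarrow> ret_det p \<noteq> 0"
    using d' by (auto simp: U_def pars_def dist_commute intro!: open_Int open_Collect_less continuous_intros)
  have mU: "(\<mu>0, d' / 2) \<in> U" using d'(1) by (simp add: U_def dist_Pair_Pair dist_real_def)
  have Up: "p \<in> pars" "snd p > 0" if "p \<in> U" for p using that U(2) by auto
  have UP: "U \<subseteq> pars" using U(2) by blast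
  obtain q \<kappa> where seq: "(\<forall>j :: nat. q j \<in> pars \<and> snd (q j) > 0 \<and> profile_closes P (member (q j))) \<and>
      \<kappa> > 0 \<and> (\<forall>t. L t \<ge> \<kappa>) \<and> (\<forall>j t. warp2 (member (q j)) t \<ge> \<kappa>) \<and>
      uniform_limit UNIV (\<lambda>j. mag (member (q j))) (\<lambda>_. 0) sequentially \<and>
      filterlim (\<lambda>j. least_closing_multiplier P (member (q j))) at_top sequentially"
    using collapsing_sequence[OF d'] by (elim exE)
  then have q: "q j \<in> pars" "snd (q j) > 0" "profile_closes P (member (q j))" for j by auto
  \<comment> \<open>For the persistent datum any rational return will do, so the bound on the
    denominator is taken to be 0. One choice of \<open>p0\<close> serves all Hoelder exponents,
    because the branch itself does not depend on them.\<close>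
  obtain p0 \<rho>1 \<rho>2 where p0: "p0 \<in> U" and \<rho>: "\<rho>1 \<in> \<rat>" "\<rho>2 \<in> \<rat>" "ret L p0 = (2 * pi * \<rho>1, 2 * pi * \<rho>2)"
    and "\<And>j :: nat. j \<ge> 1 \<Longrightarrow> real j * \<rho>2 \<in> \<int> \<Longrightarrow> j > 0"
    by (rule ex_rational_return[OF Up(1)[OF mU] U(3)[OF mU] U(1) mU UP]) blast
  note pp = Up[OF p0]
  have persist: "\<exists>\<theta>>0. \<forall>L'\<in>holder_per P r \<alpha>.
             (\<forall>t. L' t > 0) \<and> holder_norm r \<alpha> (\<lambda>t. L' t - L t) < \<theta> \<longrightarrow>
             (\<exists>\<mu> \<delta> x.
                \<bar>\<mu> - fst p0\<bar> < \<eta> \<and> \<bar>\<delta> - snd p0\<bar> < \<eta> \<and>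
                x \<in> holder_per P 2 \<alpha> \<and> holder_norm 2 \<alpha> (\<lambda>t. x t - X L p0 t) < \<eta> \<and>
                magnitude_datum k1 k2 d1 P L' \<mu> \<delta> x \<and>
                has_phase_return k2 d2 P \<mu> \<delta> x \<rho>1 \<rho>2 \<and>
                (\<exists>D. realizes_datum k2 d2 L' \<mu> \<delta> x D \<and>
                     (\<forall>n. Ck_on n L' UNIV \<longrightarrow> Ck_on (n + 2) (mag D) UNIV) \<and>
                     harmonic_reconstruction A1 A2 f1 f2 d1 d2 D \<and> P_periodic_data P D))"
    if r: "r \<ge> 2" and \<alpha>: "0 < \<alpha>" "\<alpha> < 1" and \<eta>: "\<eta> > 0" for r \<alpha> \<eta>
  proof -
    obtain \<theta> where \<theta>: "\<theta> > 0" and ex: "\<forall>l\<in>holder_per P r \<alpha>. holder_norm r \<alpha> (\<lambda>t. l t - L t) < \<theta> \<longrightarrow>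
      (\<exists>p\<in>pars. near l \<and> (\<forall>t. (l has_real_derivative deriv l t) (at t)) \<and> snd p > 0 \<and> dist p p0 < \<eta> \<and>
        ret l p = ret L p0 \<and> X l p \<in> holder_per P 2 \<alpha> \<and> holder_norm 2 \<alpha> (\<lambda>t. X l p t - X L p0 t) < \<eta>)"
      using persistence[OF pp U(3)[OF p0] \<alpha> r \<eta>] by (elim exE conjE)
    show ?thesis
    proof (rule exI[of _ \<theta>], intro conjI \<theta> ballI impI)
      fix l assume l: "l \<in> holder_per P r \<alpha>" and h: "(\<forall>t. l t > 0) \<and> holder_norm r \<alpha> (\<lambda>t. l t - L t) < \<theta>"
      obtain p where p: "p \<in> pars" "snd p > 0" and n: "near l" and dl': "\<forall>t. (l has_real_derivative deriv l t) (at t)"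
        and dist: "dist p p0 < \<eta>" and ret: "ret l p = ret L p0"
        and X: "X l p \<in> holder_per P 2 \<alpha>" "holder_norm 2 \<alpha> (\<lambda>t. X l p t - X L p0 t) < \<eta>"
        using ex[rule_format, OF l conjunct2[OF h]] by (elim bexE conjE)
      note dl = dl'[rule_format]
      interpret S: datum_solution k1 k2 d1 d2 P l "deriv l" "X l p" "Y l p" "fst p" "snd p"
        by (rule branch_datum_solution[OF n dl p])
      have "\<bar>fst p - fst p0\<bar> < \<eta>" "\<bar>snd p - snd p0\<bar> < \<eta>"
        using dist_fst_le[of p p0] dist_snd_le[of p p0] dist by (simp_all add: dist_real_def)
      moreover have "has_phase_return k2 d2 P (fst p) (snd p) (X l p) \<rho>1 \<rho>2"
        unfolding has_phase_return_def datum_return_ret[OF n dl p] ret by (rule \<rho>(3))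
      ultimately show "\<exists>\<mu> \<delta> x. \<bar>\<mu> - fst p0\<bar> < \<eta> \<and> \<bar>\<delta> - snd p0\<bar> < \<eta> \<and>
                x \<in> holder_per P 2 \<alpha> \<and> holder_norm 2 \<alpha> (\<lambda>t. x t - X L p0 t) < \<eta> \<and>
                magnitude_datum k1 k2 d1 P l \<mu> \<delta> x \<and>
                has_phase_return k2 d2 P \<mu> \<delta> x \<rho>1 \<rho>2 \<and>
                (\<exists>D. realizes_datum k2 d2 l \<mu> \<delta> x D \<and>
                     (\<forall>n. Ck_on n l UNIV \<longrightarrow> Ck_on (n + 2) (mag D) UNIV) \<and>
                     harmonic_reconstruction A1 A2 f1 f2 d1 d2 D \<and> P_periodic_data P D)"
        using X S.datum S.realizes S.mag_Ck S.harmonic[OF manifolds eigenmaps DIMS] S.periodic_data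
        by (intro exI[of _ "fst p"] exI[of _ "snd p"] exI[of _ "X l p"] exI[of _ S.DD] conjI allI impI)
    qed
  qed
  show ?thesis
  proof (intro conjI, goal_cases)
    case 1
    show ?case
      using U(1) mU harm[OF Up] member_facts(1-3)[OF Up] family_smooth[OF U(1,2)]
        inj_on_subset[OF member_inj U(2)] closing_dense[OF U]
      by (intro exI[of _ U] exI[of _ member] conjI ballI) blast+
  next
    case 2
    show ?case
      using harm[OF q(1,2)] member_facts[OF q(1,2)] q(3) seq
      by (intro exI[of _ "\<lambda>j. member (q j)"] conjI allI exI[of _ \<kappa>] disjI1) simp_all
  next
    case 3
    show ?case
    proof (rule exI[of _ "fst p0"], rule exI[of _ "snd p0"], rule exI[of _ "X L p0"], rule exI[of _ \<rho>1], rule exI[of _ \<rho>2],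
        intro conjI \<rho>(1,2) allI impI)
      show "nondegenerate_datum k1 k2 d1 d2 P \<alpha> L (fst p0) (snd p0) (X L p0)" if "0 < \<alpha> \<and> \<alpha> < 1" for \<alpha>
        by (rule nondegenerate[OF pp U(3)[OF p0]]) (use that in auto)
      show "has_phase_return k2 d2 P (fst p0) (snd p0) (X L p0) \<rho>1 \<rho>2"
        unfolding has_phase_return_def datum_return_ret[OF near_L L_deriv pp] by (rule \<rho>(3))
      show "\<exists>D. realizes_datum k2 d2 L (fst p0) (snd p0) (X L p0) D \<and> smooth_on (mag D) UNIV \<and>
               harmonic_reconstruction A1 A2 f1 f2 d1 d2 D \<and> P_periodic_data P D"
        using member_facts[OF pp] harm[OF pp] by blast
    qed (use persist in blast)
  qed
qed

end
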